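(* Let $0<\epsilon<1$, $\delta>0$, and let $(h,\phi)$ be the solution of $$\epsilon\delta\,\partial_t h+\epsilon v\,\partial_x h-\delta\,\partial_x\phi\,\partial_v h+\delta\,\tfrac v2\,\partial_x\phi\,h+\delta\, v\sqrt M\,\partial_x\phi=\mathcal L h,\qquad \partial_x^2\phi=-\sigma .$$ Then for any integer $m\ge1$ and any constant $a>0$, $$\frac12\partial_t\Big[E^m_h+\frac\delta\epsilon E^m_\phi\Big]+\frac{\lambda_0}{\delta\epsilon}D^m_h+\frac1{\delta\epsilon}D^m_u\le \frac{AC_1^2}{a\epsilon}\sqrt{E^m_h}\,\big(3D^m_u+2D^m_h\big)+\frac{2AC_1^2}{\epsilon}\sqrt{E^m_\phi}\,\Big(\big(4+\tfrac1a\big)D^m_u+4D^m_h\Big)+\frac{aAC_1^2}{\epsilon}\sqrt{E^m_h}\,D^m_\phi+\frac{aAC_1^2}{\epsilon}\sqrt{E^m_\phi}\,D^m_\sigma$$ and $$\partial_t\Big[\sum_{l=0}^{m}\langle\partial_z^l u,\partial_z^l\partial_x\phi\rangle+\sum_{l=0}^m\langle\partial_z^l\partial_x u,\partial_z^l\partial_x^2\phi\rangle+\frac1{2\epsilon}E^m_\phi\Big]+\frac1{2\delta}D^m_\sigma+\frac1\epsilon D^m_\phi\le\frac1\delta D^m_u+\frac1{2\delta}D^m_h+\frac{AC_1^2}{\epsilon}\sqrt{E^m_\phi}\,\big(3D^m_\sigma+2D^m_\phi\big),$$ where $A=2\sqrt{m+1}\binom{m}{[m/2]}+\sqrt{m+1}$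 and $[m/2]$ is the smallest integer larger than or equal to $m/2$.
   Context: Variables: $t\ge0$, $x,v\in\mathbb R$, and $z\in I_z\subseteq\mathbb R$ is a random variable with probability density $\pi(z)$. Put $d\mu(x,v,z)=\pi(z)\,dx\,dv\,dz$ and $d\mu(x,z)=\pi(z)\,dx\,dz$. $\langle\cdot,\cdot\rangle$ and $\|\cdot\|$ denote the $L^2$ inner product and norm with respect to $d\mu(x,v,z)$ (for functions of $x,v,z$) or $d\mu(x,z)$ (for functions of $x,z$). $M(v)=\frac1{\sqrt{2\pi}}e^{-v^2/2}$ and $\mathcal L h=\frac1{\sqrt M}\partial_v\big(M\partial_v(h/\sqrt M)\big)$. For $h(t,x,v,z)$ put $\sigma=\int_{\mathbb R} h\sqrt M\,dv$, $u=\int_{\mathbb R} h\,v\sqrt M\,dv$, and $\Pi h=\sigma\sqrt M+u\,v\sqrt M$. The unknown $\phi=\phi(t,x,z)$ is the self-consistent electric potential. (The system for $(h,\phi)$ is that of $h=(f-M)/\sqrt M$, where $\partial_t f+\frac1\delta v\partial_x f-\frac1\epsilon\partial_x\phi\,\partial_v f=\frac1{\delta\epsilon}\partial_v(M\partial_v(f/M))$, $-\partial_x^2\phi=\int f\,dv-1$; the regimes of interest are $\delta=1$ and $\delta=\epsilon$.) Solutions are understood to be sufficiently smooth and decaying that all quantities are finite and the usual integrations by parts are justified. Norms: $\|h\|_\nu^2=\int\big[(1+v^2)h^2+(\partial_v h)^2\big]d\mu(x,v,z)$, $\|g\|_{H^m_z}^2=\sum_{l=0}^m\|\partial_z^l g\|^2$,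 $\|g\|^2_{H^m_z(H^n_x)}=\sum_{i\le n}\|\partial_x^i g\|_{H^m_z}^2$. Energies and dissipations: $E^m_h=\sum_{i=0}^1\|\partial_x^i h\|^2_{H^m_z}$, $E^m_\phi=\sum_{i=0}^1\|\partial_x^i\partial_x\phi\|^2_{H^m_z}$, $D^m_h=\sum_{i=0}^1\sum_{l\le m}\|\partial_z^l\partial_x^i(1-\Pi)h\|_\nu^2$, $D^m_\phi=\sum_{i=0}^1\|\partial_x^i\partial_x\phi\|^2_{H^m_z}$, $D^m_u=\sum_{i=0}^1\|\partial_x^i u\|^2_{H^m_z}$, $D^m_\sigma=\sum_{i=0}^1\|\partial_x^i\sigma\|^2_{H^m_z}$. Constants: $\lambda_0=\frac17$ is the hypocoercivity constant in $-\langle\mathcal L h,h\rangle\ge\lambda_0\|(1-\Pi)h\|_\nu^2+\|u\|^2$. $C_1\ge1$ is a Sobolev embedding constant in one dimension: $\|g\|_{C^0_x}\le C_1^2\|g\|_{H^1_x}$, $\|g\|_{C^0_z}\le C_1\|g\|_{H^1_z}$, $\|g\|_{C^0_{x,z}}\le C_1\|g\|_{H^1_z(H^1_x)}$ for all $g\in H^1_z(H^1_x)$. *)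

theory Defs
  imports "HOL-Probability.Probability"
begin

definition pd :: "'a::real_vector \<Rightarrow> ('a \<Rightarrow> real) \<Rightarrow> 'a \<Rightarrow> real" where
  "pd e f p = deriv (\<lambda>s::real. f (p + s *\<^sub>R e)) 0"

definition pds :: "'a::real_vector list \<Rightarrow> ('a \<Rightarrow> real) \<Rightarrow> 'a \<Rightarrow> real" where
  "pds es f = foldr pd es f"

text \<open>Kinetic functions depend on \<open>(x, v, z)\<close>, macroscopic ones on \<open>(x, z)\<close>.\<close>

abbreviation ex3 :: "real \<times> real \<times> real" where "ex3 \<equiv> (1, 0, 0)"
abbreviation ev3 :: "real \<times> real \<times> real" where "ev3 \<equiv> (0, 1, 0)"
abbreviation ez3 :: "real \<times> real \<times> real" where "ez3 \<equiv> (0, 0, 1)"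
abbreviation ex2 :: "real \<times> real" where "ex2 \<equiv> (1, 0)"
abbreviation ez2 :: "real \<times> real" where "ez2 \<equiv> (0, 1)"

primrec Ck_on :: "nat \<Rightarrow> 'a::euclidean_space set \<Rightarrow> ('a \<Rightarrow> real) \<Rightarrow> bool" where
  "Ck_on 0 U f \<longleftrightarrow> continuous_on U f"
| "Ck_on (Suc k) U f \<longleftrightarrow> continuous_on U f \<and>
     (\<forall>e\<in>Basis. (\<forall>p\<in>U. (\<lambda>s::real. f (p + s *\<^sub>R e)) differentiable (at 0)) \<and> Ck_on k U (pd e f))"

definition Ck_near :: "nat \<Rightarrow> 'a::euclidean_space set \<Rightarrow> ('a \<Rightarrow> real) \<Rightarrow> bool" where
  "Ck_near k S f \<longleftrightarrow> (\<exists>U. open U \<and> S \<subseteq> U \<and> Ck_on k U f)"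

text \<open>
  ``Sufficiently smooth and decaying'': all partial derivatives (in \<open>t, x, v, z\<close>) of order at most
  \<open>m + 3\<close> of \<open>h\<close> and \<open>\<phi>\<close> exist and are continuous up to \<open>t = 0\<close> and on a neighbourhood \<open>J\<close> of
  \<open>I\<close>; those of \<open>h\<close>, and those of \<open>\<partial>\<^sub>x \<phi>\<close> of order at most \<open>m + 2\<close>, decay algebraically, uniformly on
  bounded time intervals. The potential \<open>\<phi>\<close> itself need not decay. The order \<open>m + 3\<close> is that of
  \<open>\<partial>\<^sub>z\<^sup>m \<partial>\<^sub>x \<partial>\<^sub>v\<^sup>2 h\<close>, which occurs when \<open>\<partial>\<^sub>z\<^sup>m \<partial>\<^sub>x\<close> is applied to the kinetic equation.
  The neighbourhood \<open>J\<close> makes \<open>z\<close>-derivatives of velocity moments meaningful at every point of \<open>I\<close>.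
\<close>

definition regular_pair ::
  "nat \<Rightarrow> real set \<Rightarrow> (real \<Rightarrow> real \<times> real \<times> real \<Rightarrow> real) \<Rightarrow> (real \<Rightarrow> real \<times> real \<Rightarrow> real) \<Rightarrow> bool" where
  "regular_pair m I h \<phi> \<longleftrightarrow> (\<exists>J. open J \<and> I \<subseteq> J \<and>
     Ck_near (m + 3) ({0..} \<times> UNIV \<times> UNIV \<times> J) (\<lambda>(t, p). h t p) \<and>
     Ck_near (m + 3) ({0..} \<times> UNIV \<times> J) (\<lambda>(t, p). \<phi> t p) \<and>
     (\<forall>es T. set es \<subseteq> Basis \<and> length es \<le> m + 3 \<longrightarrow>
        (\<exists>K. \<forall>t\<in>{0..T}. \<forall>x v. \<forall>z\<in>J.
           \<bar>pds es (\<lambda>(t, p). h t p) (t, x, v, z)\<bar> \<le> K / ((1 + x\<^sup>2) * (1 + v\<^sup>2)))) \<and>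
     (\<forall>es T. set es \<subseteq> Basis \<and> length es \<le> m + 2 \<longrightarrow>
        (\<exists>K. \<forall>t\<in>{0..T}. \<forall>x. \<forall>z\<in>J.
           \<bar>pds es (\<lambda>(t, p). pd ex2 (\<phi> t) p) (t, x, z)\<bar> \<le> K / (1 + x\<^sup>2))))"

text \<open>
  The law of \<open>z\<close> lives on the restricted space \<open>I\<close>, so that values of functions at \<open>z \<notin> I\<close>
  affect neither integrals nor measurability.
\<close>

definition zlaw :: "real set \<Rightarrow> (real \<Rightarrow> real) \<Rightarrow> real measure" where
  "zlaw I \<rho> = density (restrict_space lborel I) (\<lambda>z. ennreal (\<rho> z))"

definition is_prob_density_on :: "real set \<Rightarrow> (real \<Rightarrow> real) \<Rightarrow> bool" where
  "is_prob_density_on I \<rho> \<longleftrightarrow> I \<in> sets borel \<and> \<rho> \<in> borel_measurable (restrict_space borel I) \<and>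
     (\<forall>z\<in>I. 0 \<le> \<rho> z) \<and> prob_space (zlaw I \<rho>)"

definition mu3 :: "real measure \<Rightarrow> (real \<times> real \<times> real) measure" where
  "mu3 P = lborel \<Otimes>\<^sub>M (lborel \<Otimes>\<^sub>M P)"

definition mu2 :: "real measure \<Rightarrow> (real \<times> real) measure" where
  "mu2 P = lborel \<Otimes>\<^sub>M P"

definition l2_inner :: "'a measure \<Rightarrow> ('a \<Rightarrow> real) \<Rightarrow> ('a \<Rightarrow> real) \<Rightarrow> real" where
  "l2_inner M f g = (LINT p|M. f p * g p)"

definition l2_norm :: "'a measure \<Rightarrow> ('a \<Rightarrow> real) \<Rightarrow> real" where
  "l2_norm M f = sqrt (l2_inner M f f)"

definition in_L2 :: "'a measure \<Rightarrow> ('a \<Rightarrow> real) \<Rightarrow> bool" where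
  "in_L2 M f \<longleftrightarrow> f \<in> borel_measurable M \<and> integrable M (\<lambda>p. (f p)\<^sup>2)"

text \<open>The norm of \<open>H\<^sup>m\<close> in the direction \<open>e\<close> only, e.g. \<open>H\<^sup>m\<^sub>z\<close> for \<open>e = ez3\<close> or \<open>e = ez2\<close>.\<close>

definition sob_norm :: "'a::real_vector measure \<Rightarrow> 'a \<Rightarrow> nat \<Rightarrow> ('a \<Rightarrow> real) \<Rightarrow> real" where
  "sob_norm M e m g = sqrt (\<Sum>l\<le>m. (l2_norm M ((pd e ^^ l) g))\<^sup>2)"

definition HzHx_norm :: "real measure \<Rightarrow> nat \<Rightarrow> nat \<Rightarrow> (real \<times> real \<Rightarrow> real) \<Rightarrow> real" where
  "HzHx_norm P m n g = sqrt (\<Sum>i\<le>n. (sob_norm (mu2 P) ez2 m ((pd ex2 ^^ i) g))\<^sup>2)"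

definition nu_norm :: "real measure \<Rightarrow> (real \<times> real \<times> real \<Rightarrow> real) \<Rightarrow> real" where
  "nu_norm P g =
     sqrt (LINT p|mu3 P. (case p of (x, v, z) \<Rightarrow> (1 + v\<^sup>2) * (g (x, v, z))\<^sup>2 + (pd ev3 g (x, v, z))\<^sup>2))"

text \<open>
  \<open>C\<close> is an admissible constant in the three embeddings. The inequalities are required for
  continuously differentiable functions of finite norm only, which is a weaker requirement on \<open>C\<close>
  than demanding them for all Sobolev functions.
\<close>

definition sobolev_constant :: "real set \<Rightarrow> real measure \<Rightarrow> real \<Rightarrow> bool" where
  "sobolev_constant I P C \<longleftrightarrow>
     (\<forall>g::real \<Rightarrow> real. Ck_on 1 UNIV g \<and> (\<forall>i\<le>1. in_L2 lborel ((pd 1 ^^ i) g)) \<longrightarrow>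
        (\<forall>x. \<bar>g x\<bar> \<le> C\<^sup>2 * sob_norm lborel 1 1 g)) \<and>
     (\<forall>g::real \<Rightarrow> real. Ck_near 1 I g \<and> (\<forall>l\<le>1. in_L2 P ((pd 1 ^^ l) g)) \<longrightarrow>
        (\<forall>z\<in>I. \<bar>g z\<bar> \<le> C * sob_norm P 1 1 g)) \<and>
     (\<forall>g::real \<times> real \<Rightarrow> real. Ck_near 2 (UNIV \<times> I) g \<and>
          (\<forall>i\<le>1. \<forall>l\<le>1. in_L2 (mu2 P) ((pd ez2 ^^ l) ((pd ex2 ^^ i) g))) \<longrightarrow>
        (\<forall>x. \<forall>z\<in>I. \<bar>g (x, z)\<bar> \<le> C * HzHx_norm P 1 1 g))"

abbreviation Maxw :: "real \<Rightarrow> real" where "Maxw \<equiv> std_normal_density"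

definition FP_op :: "(real \<Rightarrow> real) \<Rightarrow> real \<Rightarrow> real" where
  "FP_op k v = 1 / sqrt (Maxw v) * deriv (\<lambda>w. Maxw w * deriv (\<lambda>r. k r / sqrt (Maxw r)) w) v"

definition sigma_of :: "(real \<times> real \<times> real \<Rightarrow> real) \<Rightarrow> real \<times> real \<Rightarrow> real" where
  "sigma_of g = (\<lambda>(x, z). LINT v|lborel. g (x, v, z) * sqrt (Maxw v))"

definition u_of :: "(real \<times> real \<times> real \<Rightarrow> real) \<Rightarrow> real \<times> real \<Rightarrow> real" where
  "u_of g = (\<lambda>(x, z). LINT v|lborel. g (x, v, z) * v * sqrt (Maxw v))"

definition fluid_proj :: "(real \<times> real \<times> real \<Rightarrow> real) \<Rightarrow> real \<times> real \<times> real \<Rightarrow> real" where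
  "fluid_proj g = (\<lambda>(x, v, z). sigma_of g (x, z) * sqrt (Maxw v) + u_of g (x, z) * v * sqrt (Maxw v))"

definition micro_part :: "(real \<times> real \<times> real \<Rightarrow> real) \<Rightarrow> real \<times> real \<times> real \<Rightarrow> real" where
  "micro_part g = (\<lambda>p. g p - fluid_proj g p)"

text \<open>
  Arguments are time slices; \<open>P\<close> is the law of \<open>z\<close>.
\<close>

definition E_h :: "real measure \<Rightarrow> nat \<Rightarrow> (real \<times> real \<times> real \<Rightarrow> real) \<Rightarrow> real" where
  "E_h P m g = (\<Sum>i\<le>1. (sob_norm (mu3 P) ez3 m ((pd ex3 ^^ i) g))\<^sup>2)"

definition E_phi :: "real measure \<Rightarrow> nat \<Rightarrow> (real \<times> real \<Rightarrow> real) \<Rightarrow> real" where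
  "E_phi P m \<psi> = (\<Sum>i\<le>1. (sob_norm (mu2 P) ez2 m ((pd ex2 ^^ i) (pd ex2 \<psi>)))\<^sup>2)"

definition D_h :: "real measure \<Rightarrow> nat \<Rightarrow> (real \<times> real \<times> real \<Rightarrow> real) \<Rightarrow> real" where
  "D_h P m g = (\<Sum>i\<le>1. \<Sum>l\<le>m. (nu_norm P ((pd ez3 ^^ l) ((pd ex3 ^^ i) (micro_part g))))\<^sup>2)"

definition D_phi :: "real measure \<Rightarrow> nat \<Rightarrow> (real \<times> real \<Rightarrow> real) \<Rightarrow> real" where
  "D_phi P m \<psi> = (\<Sum>i\<le>1. (sob_norm (mu2 P) ez2 m ((pd ex2 ^^ i) (pd ex2 \<psi>)))\<^sup>2)"

definition D_u :: "real measure \<Rightarrow> nat \<Rightarrow> (real \<times> real \<times> real \<Rightarrow> real) \<Rightarrow> real" where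
  "D_u P m g = (\<Sum>i\<le>1. (sob_norm (mu2 P) ez2 m ((pd ex2 ^^ i) (u_of g)))\<^sup>2)"

definition D_sigma :: "real measure \<Rightarrow> nat \<Rightarrow> (real \<times> real \<times> real \<Rightarrow> real) \<Rightarrow> real" where
  "D_sigma P m g = (\<Sum>i\<le>1. (sob_norm (mu2 P) ez2 m ((pd ex2 ^^ i) (sigma_of g)))\<^sup>2)"

definition lambda0 :: real where
  "lambda0 = 1 / 7"

definition A_const :: "nat \<Rightarrow> real" where
  "A_const m = 2 * sqrt (real (m + 1)) * real (m choose nat \<lceil>real m / 2\<rceil>) + sqrt (real (m + 1))"

end

theory Submission
  imports Defs
begin

text \<open>Applying \<open>\<partial>\<^sub>z\<^sup>l \<partial>\<^sub>x\<^sup>i\<close> to the kinetic equation and testing with the same derivative of \<open>h\<close> gives the first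
  inequality, because the Fokker--Planck operator is \<open>- A\<^sup>* A\<close> with \<open>A = \<partial>\<^sub>v + v/2\<close>, the Gaussian Poincare
  inequality bounds \<open>\<parallel>A q\<parallel>\<^sup>2\<close> from below, and the linear field term is a time derivative by
  \<open>\<delta> \<partial>\<^sub>t \<partial>\<^sub>x \<phi> = u\<close>. Integration by parts moves \<open>A\<close> onto the test function in the nonlinear term, which leaves
  \<open>\<langle>\<partial>(\<partial>\<^sub>x \<phi> h), A \<partial>h\<rangle>\<close>. In each term of its Leibniz expansion the supremum in \<open>x\<close> is put on a factor without
  \<open>x\<close>-derivative and the supremum in \<open>z\<close> on a factor with fewer than \<open>m\<close> derivatives in \<open>z\<close>; Cauchy--Schwarz
  for the discrete convolution then produces the constant \<open>A_const m\<close>. The second inequality comes in the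
  same way from the momentum equation
  \<open>\<epsilon> \<delta> \<partial>\<^sub>t u + \<epsilon> \<partial>\<^sub>x \<integral> v\<^sup>2 \<surd>M h dv + \<delta> (1 + \<sigma>) \<partial>\<^sub>x \<phi> + u = 0\<close> tested with \<open>\<partial>\<^sub>x \<phi>\<close>.\<close>

section \<open>Functions of algebraic decay\<close>

text \<open>Several obstacles shape the proof. The equations hold only for z in I, while derivatives
  in z need a neighbourhood J; an identity on I can be differentiated only at limit points of I, and
  the embedding itself shows that all points of I are such. The constant \<open>C\<^sub>1\<close> is
  known for scalar functions of z, but the nonlinear terms need the supremum in z of norms in
  L^2(dx) and L^2(dx dv); duality transfers it without loss. The operator A costs one power of v, so
  integrands are controlled as products of two factors that each decay like 1/|v|. The supremum in x
  comes from an elementary embedding with constant 1, hence the estimates are linear in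
  \<open>C\<^sub>1\<close>, and the square in the statement follows from
  \<open>1 \<le> C\<^sub>1\<close>. The coercivity constant 1/7 is the best that a convex
  combination of the Poincare inequality and the expansion of |A g|^2 can give. In the first
  inequality the nonlinearity is bounded by terms with the root of the energy of h; those with the
  root of the field energy are nonnegative and are added at the end.\<close>

lemma one_plus_square_pos [simp]: "0 < 1 + (s::real)\<^sup>2" "1 + (s::real)\<^sup>2 \<noteq> 0"
  by (auto simp: add_pos_nonneg add_nonneg_eq_0_iff)

lemma integrable_weight: "integrable lborel (\<lambda>s::real. K / (1 + s\<^sup>2))"
proof -
  have "set_integrable lborel (einterval (-\<infinity>) \<infinity>) (\<lambda>x::real. inverse (1 + x\<^sup>2))"
    by (rule integrable_inverse_1_plus_square)
  then have "integrable lborel (\<lambda>s::real. K * inverse (1 + s\<^sup>2))"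
    by (auto simp: set_integrable_def)
  then show ?thesis by (simp add: divide_inverse)
qed

lemma integrable_lborel_dominated:
  fixes f :: "real \<Rightarrow> real"
  assumes "f \<in> borel_measurable borel" "\<And>s. \<bar>f s\<bar> \<le> K / (1 + s\<^sup>2)"
  shows "integrable lborel f"
proof (rule Bochner_Integration.integrable_bound[OF integrable_weight[of K]])
  show "f \<in> borel_measurable lborel" using assms(1) by simp
  show "AE s in lborel. norm (f s) \<le> norm (K / (1 + s\<^sup>2))"
    using order_trans[OF assms(2) abs_ge_self] by (intro AE_I2) (simp only: real_norm_def)
qed

lemma weight_tendsto_0:
  fixes f :: "real \<Rightarrow> real"
  assumes "\<And>s. \<bar>f s\<bar> \<le> K / (1 + s\<^sup>2)"
  shows "(f \<longlongrightarrow> 0) at_top" "(f \<longlongrightarrow> 0) at_bot"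
proof -
  have l: "((\<lambda>s::real. K / (1 + s\<^sup>2)) \<longlongrightarrow> 0) at_top" "((\<lambda>s::real. K / (1 + s\<^sup>2)) \<longlongrightarrow> 0) at_bot"
    by real_asymp+
  show "(f \<longlongrightarrow> 0) at_top" "(f \<longlongrightarrow> 0) at_bot"
    by (rule Lim_null_comparison[OF _ l(1)], use assms in simp)
       (rule Lim_null_comparison[OF _ l(2)], use assms in simp)
qed

section \<open>Decay classes of functions on the line\<close>

definition decay :: "(real \<Rightarrow> real) \<Rightarrow> bool" where
  "decay f \<longleftrightarrow> continuous_on UNIV f \<and> (\<exists>K. \<forall>s. \<bar>f s\<bar> \<le> K / (1 + s\<^sup>2))"

text \<open>Multiplication by the variable costs one power, and this class is what results, for
  instance after applying A. Its members are in general only square integrable, but a product of two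
  of them lies in \<open>decay\<close> again by (1 + |s|)^2 <= 2 (1 + s^2).\<close>

definition decay1 :: "(real \<Rightarrow> real) \<Rightarrow> bool" where
  "decay1 f \<longleftrightarrow> continuous_on UNIV f \<and> (\<exists>K. \<forall>s. \<bar>f s\<bar> \<le> K * (1 + \<bar>s\<bar>) / (1 + s\<^sup>2))"

lemma decayI: "continuous_on UNIV f \<Longrightarrow> (\<And>s. \<bar>f s\<bar> \<le> K / (1 + s\<^sup>2)) \<Longrightarrow> decay f"
  by (auto simp: decay_def)

lemma decayE:
  assumes "decay f" obtains K where "0 \<le> K" "\<And>s. \<bar>f s\<bar> \<le> K / (1 + s\<^sup>2)"
proof -
  obtain K where K: "\<And>s. \<bar>f s\<bar> \<le> K / (1 + s\<^sup>2)" using assms by (auto simp: decay_def)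
  have "0 \<le> K" using K[of 0] by simp
  then show ?thesis using K that by blast
qed

lemma decay1E:
  assumes "decay1 f" obtains K where "0 \<le> K" "\<And>s. \<bar>f s\<bar> \<le> K * (1 + \<bar>s\<bar>) / (1 + s\<^sup>2)"
proof -
  obtain K where K: "\<And>s. \<bar>f s\<bar> \<le> K * (1 + \<bar>s\<bar>) / (1 + s\<^sup>2)" using assms by (auto simp: decay1_def)
  have "0 \<le> K" using K[of 0] by simp
  then show ?thesis using K that by blast
qed

lemma decay_continuous: "decay f \<Longrightarrow> continuous_on UNIV f"
  and decay1_continuous: "decay1 f \<Longrightarrow> continuous_on UNIV f"
  by (auto simp: decay_def decay1_def)

lemma decay_integrable:
  assumes "decay f" shows "integrable lborel f"
proof -
  obtain K where "\<And>s. \<bar>f s\<bar> \<le> K / (1 + s\<^sup>2)" using assms by (meson decayE)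
  then show ?thesis
    using assms by (intro integrable_lborel_dominated[of f K] borel_measurable_continuous_onI decay_continuous)
qed

lemma decay_zero: "decay (\<lambda>s. 0)"
  by (rule decayI[of _ 0]) auto

lemma decay_add:
  assumes "decay f" "decay g" shows "decay (\<lambda>s. f s + g s)"
proof -
  obtain K L where "\<And>s. \<bar>f s\<bar> \<le> K / (1 + s\<^sup>2)" "\<And>s. \<bar>g s\<bar> \<le> L / (1 + s\<^sup>2)"
    using assms by (meson decayE)
  then have "\<bar>f s + g s\<bar> \<le> (K + L) / (1 + s\<^sup>2)" for s
    unfolding add_divide_distrib by (intro order_trans[OF abs_triangle_ineq] add_mono)
  then show ?thesis using assms by (intro decayI) (auto intro: continuous_on_add decay_continuous)
qed

lemma decay1_add:
  assumes "decay1 f" "decay1 g" shows "decay1 (\<lambda>s. f s + g s)"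
proof -
  obtain K L where "\<And>s. \<bar>f s\<bar> \<le> K * (1 + \<bar>s\<bar>) / (1 + s\<^sup>2)" "\<And>s. \<bar>g s\<bar> \<le> L * (1 + \<bar>s\<bar>) / (1 + s\<^sup>2)"
    using assms by (meson decay1E)
  then have "\<bar>f s + g s\<bar> \<le> (K + L) * (1 + \<bar>s\<bar>) / (1 + s\<^sup>2)" for s
    unfolding distrib_right[of K L] add_divide_distrib by (intro order_trans[OF abs_triangle_ineq] add_mono)
  then show ?thesis using assms unfolding decay1_def by (blast intro: continuous_on_add)
qed

lemma decay_cmult:
  assumes "decay f" shows "decay (\<lambda>s. c * f s)"
proof -
  obtain K where K: "\<And>s. \<bar>f s\<bar> \<le> K / (1 + s\<^sup>2)" using assms by (meson decayE)
  then have "\<bar>c * f s\<bar> \<le> (\<bar>c\<bar> * K) / (1 + s\<^sup>2)" for s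
    using mult_left_mono[OF K[of s], of "\<bar>c\<bar>"] by (simp add: abs_mult)
  then show ?thesis using assms by (intro decayI) (auto intro: continuous_on_mult_left decay_continuous)
qed

lemma decay1_cmult:
  assumes "decay1 f" shows "decay1 (\<lambda>s. c * f s)"
proof -
  obtain K where K: "\<And>s. \<bar>f s\<bar> \<le> K * (1 + \<bar>s\<bar>) / (1 + s\<^sup>2)" using assms by (meson decay1E)
  then have "\<bar>c * f s\<bar> \<le> (\<bar>c\<bar> * K) * (1 + \<bar>s\<bar>) / (1 + s\<^sup>2)" for s
    using mult_left_mono[OF K[of s], of "\<bar>c\<bar>"] by (simp add: abs_mult mult.assoc)
  then show ?thesis using assms unfolding decay1_def by (blast intro: continuous_on_mult_left)
qed

lemma decay_minus: "decay f \<Longrightarrow> decay (\<lambda>s. - f s)"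
  and decay1_minus: "decay1 f \<Longrightarrow> decay1 (\<lambda>s. - f s)"
  using decay_cmult[of f "-1"] decay1_cmult[of f "-1"] by simp_all

lemma decay_diff: "decay f \<Longrightarrow> decay g \<Longrightarrow> decay (\<lambda>s. f s - g s)"
  and decay1_diff: "decay1 f \<Longrightarrow> decay1 g \<Longrightarrow> decay1 (\<lambda>s. f s - g s)"
  using decay_add[OF _ decay_minus, of f g] decay1_add[OF _ decay1_minus, of f g] by simp_all

lemma decay_imp_decay1:
  assumes "decay f" shows "decay1 f"
proof -
  obtain K where K: "0 \<le> K" "\<And>s. \<bar>f s\<bar> \<le> K / (1 + s\<^sup>2)" using assms by (meson decayE)
  have "\<bar>f s\<bar> \<le> K * (1 + \<bar>s\<bar>) / (1 + s\<^sup>2)" for s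
    by (rule order_trans[OF K(2)]) (use K(1) in \<open>auto intro!: divide_right_mono simp: algebra_simps\<close>)
  then show ?thesis using assms unfolding decay1_def decay_def by blast
qed

lemma decay1_ident_mult:
  assumes "decay f" shows "decay1 (\<lambda>s. s * f s)"
proof -
  obtain K where K: "0 \<le> K" "\<And>s. \<bar>f s\<bar> \<le> K / (1 + s\<^sup>2)" using assms by (meson decayE)
  have "\<bar>s * f s\<bar> \<le> K * (1 + \<bar>s\<bar>) / (1 + s\<^sup>2)" for s
  proof -
    have "\<bar>s * f s\<bar> \<le> (1 + \<bar>s\<bar>) * (K / (1 + s\<^sup>2))"
      unfolding abs_mult by (intro mult_mono K) auto
    then show ?thesis by (simp add: mult.commute)
  qed
  moreover have "continuous_on UNIV (\<lambda>s. s * f s)" using assms by (intro continuous_intros decay_continuous)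
  ultimately show ?thesis unfolding decay1_def by blast
qed

lemma decay1_mult:
  assumes "decay1 f" "decay1 g" shows "decay (\<lambda>s. f s * g s)"
proof -
  obtain K L where K: "0 \<le> K" "\<And>s. \<bar>f s\<bar> \<le> K * (1 + \<bar>s\<bar>) / (1 + s\<^sup>2)"
    and L: "0 \<le> L" "\<And>s. \<bar>g s\<bar> \<le> L * (1 + \<bar>s\<bar>) / (1 + s\<^sup>2)"
    using assms by (meson decay1E)
  have "\<bar>f s * g s\<bar> \<le> 2 * K * L / (1 + s\<^sup>2)" for s
  proof -
    have "\<bar>f s * g s\<bar> \<le> (K * (1 + \<bar>s\<bar>) / (1 + s\<^sup>2)) * (L * (1 + \<bar>s\<bar>) / (1 + s\<^sup>2))"
      unfolding abs_mult by (intro mult_mono K L) (use K(1) in auto)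
    also have "\<dots> = K * L * (1 + \<bar>s\<bar>)\<^sup>2 / (1 + s\<^sup>2)\<^sup>2" by (simp add: power2_eq_square)
    also have "\<dots> \<le> K * L * (2 * (1 + s\<^sup>2)) / (1 + s\<^sup>2)\<^sup>2"
    proof (intro divide_right_mono mult_left_mono)
      show "(1 + \<bar>s\<bar>)\<^sup>2 \<le> 2 * (1 + s\<^sup>2)"
        using sum_squares_bound[of 1 "\<bar>s\<bar>"] by (simp add: power2_eq_square algebra_simps)
    qed (use K L in auto)
    also have "\<dots> = 2 * K * L / (1 + s\<^sup>2)"
      using one_plus_square_pos(2)[of s] by (simp add: divide_simps power2_eq_square[of "1 + s\<^sup>2"])
    finally show ?thesis .
  qed
  then show ?thesis using assms by (intro decayI) (auto intro: continuous_on_mult decay1_continuous)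
qed

lemma decay1_power2: "decay1 f \<Longrightarrow> decay (\<lambda>s. (f s)\<^sup>2)"
  using decay1_mult[of f f] by (simp add: power2_eq_square)

lemma decay1_half_ident_mult: "decay f \<Longrightarrow> decay1 (\<lambda>s. s / 2 * f s)"
  using decay1_cmult[OF decay1_ident_mult, of f "1/2"] by simp

lemmas decay_intros = decay_zero decay_add decay_diff decay_cmult decay_minus decay1_power2 decay1_mult
  decay1_add decay1_diff decay1_cmult decay1_minus decay1_ident_mult decay1_half_ident_mult decay_imp_decay1

section \<open>Integrals of derivatives and the embedding in x\<close>

lemma lborel_FTC:
  fixes f f' :: "real \<Rightarrow> real"
  assumes D: "\<And>s. (f has_real_derivative f' s) (at s)" and f: "decay f" and f': "decay f'"
  shows "(LINT s|lborel. f' s) = 0"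
    and "(LINT s|lborel. indicator {..x} s * f' s) = f x"
proof -
  obtain K where b: "\<And>s. \<bar>f s\<bar> \<le> K / (1 + s\<^sup>2)" using f by (meson decayE)
  have i: "integrable lborel f'" using f' by (rule decay_integrable)
  have ic: "isCont f' s" for s using decay_continuous[OF f'] by (simp add: continuous_on_eq_continuous_at)
  have si: "set_integrable lborel S f'" if "S \<in> sets lborel" for S
    using integrable_mult_indicator[OF _ i, of S] that by (simp add: set_integrable_def)
  have t: "((f \<circ> real_of_ereal) \<longlongrightarrow> 0) (at_right (-\<infinity>))" "((f \<circ> real_of_ereal) \<longlongrightarrow> 0) (at_left \<infinity>)"
    using weight_tendsto_0[of f, OF b]
    by (auto simp: ereal_tendsto_simps)
  have tx: "((f \<circ> real_of_ereal) \<longlongrightarrow> f x) (at_left (ereal x))"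
    using DERIV_isCont[OF D[of x]] by (auto simp: ereal_tendsto_simps isCont_def filterlim_at_split)
  have 1: "(LBINT s=-\<infinity>..\<infinity>. f' s) = 0 - 0"
    by (rule interval_integral_FTC_integrable[of _ _ f])
       (auto simp: t ic si D has_real_derivative_iff_has_vector_derivative[symmetric])
  have 2: "(LBINT s=-\<infinity>..ereal x. f' s) = f x - 0"
    by (rule interval_integral_FTC_integrable[of _ _ f])
       (auto simp: t tx ic si D has_real_derivative_iff_has_vector_derivative[symmetric])
  show "(LINT s|lborel. f' s) = 0"
    using 1 by (simp add: interval_lebesgue_integral_def set_lebesgue_integral_def)
  \<comment> \<open>The interval integral runs over the open half line, which differs from
    \<open>{..x}\<close> by a null set.\<close>
  have "(LINT s|lborel. indicator {..x} s * f' s) = (LINT s|lborel. indicator {..<x} s * f' s)"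
    by (rule integral_cong_AE)
       (use i AE_lborel_singleton[of x] in \<open>auto elim!: eventually_mono simp: indicator_def\<close>)
  also have "\<dots> = f x"
    using 2 by (simp add: interval_lebesgue_integral_def set_lebesgue_integral_def einterval_def lessThan_def)
  finally show "(LINT s|lborel. indicator {..x} s * f' s) = f x" .
qed

text \<open>Integrating the derivative 2 f f' of f^2 up to x and using 2 f f' <= f^2 + f'^2 gives
  the embedding of H^1 in x with constant 1.\<close>

lemma sup_le_H1:
  fixes f f' :: "real \<Rightarrow> real"
  assumes D: "\<And>s. (f has_real_derivative f' s) (at s)" and f: "decay f" and f': "decay f'"
  shows "(f x)\<^sup>2 \<le> (LINT s|lborel. (f s)\<^sup>2) + (LINT s|lborel. (f' s)\<^sup>2)"
proof -
  have d: "decay (\<lambda>s. f s * f' s)" by (intro decay_intros f f')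
  have d2: "decay (\<lambda>s. 2 * f s * f' s)" using decay_cmult[OF d, of 2] by (simp add: mult.assoc)
  have "(f x)\<^sup>2 = (LINT s|lborel. indicator {..x} s * (2 * f s * f' s))"
    by (rule lborel_FTC(2)[symmetric]) (auto intro!: derivative_eq_intros D d2 decay1_power2 decay_imp_decay1 f)
  also have "\<dots> \<le> (LINT s|lborel. (f s)\<^sup>2 + (f' s)\<^sup>2)"
  proof (rule integral_mono)
    show "integrable lborel (\<lambda>s. indicator {..x} s * (2 * f s * f' s))"
      using integrable_mult_indicator[OF _ decay_integrable[OF d2], of "{..x}"] by simp
    show "integrable lborel (\<lambda>s. (f s)\<^sup>2 + (f' s)\<^sup>2)" by (intro decay_integrable decay_intros f f')
    show "indicator {..x} s * (2 * f s * f' s) \<le> (f s)\<^sup>2 + (f' s)\<^sup>2" for s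
      using sum_squares_bound[of "f s" "f' s"] by (auto simp: indicator_def)
  qed
  also have "\<dots> = (LINT s|lborel. (f s)\<^sup>2) + (LINT s|lborel. (f' s)\<^sup>2)"
    by (intro Bochner_Integration.integral_add decay_integrable decay_intros f f')
  finally show ?thesis .
qed

section \<open>Cauchy-Schwarz and differentiation under the integral\<close>

lemma integral_Cauchy_Schwarz:
  fixes f g :: "'a \<Rightarrow> real"
  assumes f: "integrable M (\<lambda>x. (f x)\<^sup>2)" and g: "integrable M (\<lambda>x. (g x)\<^sup>2)"
    and fg: "integrable M (\<lambda>x. f x * g x)"
  shows "(LINT x|M. f x * g x)\<^sup>2 \<le> (LINT x|M. (f x)\<^sup>2) * (LINT x|M. (g x)\<^sup>2)"
proof -
  define a b c where "a = (LINT x|M. (f x)\<^sup>2)" "b = (LINT x|M. f x * g x)" "c = (LINT x|M. (g x)\<^sup>2)"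
  have q: "0 \<le> a - 2 * r * b + r\<^sup>2 * c" for r
  proof -
    have "0 \<le> (LINT x|M. (f x - r * g x)\<^sup>2)" by simp
    also have "\<dots> = (LINT x|M. (f x)\<^sup>2 - 2 * r * (f x * g x) + r\<^sup>2 * (g x)\<^sup>2)"
      by (rule Bochner_Integration.integral_cong) (auto simp: power2_eq_square algebra_simps)
    also have "\<dots> = a - 2 * r * b + r\<^sup>2 * c"
      using f g fg by (simp add: a_b_c_def)
    finally show ?thesis .
  qed
  have "c \<ge> 0" by (simp add: a_b_c_def)
  have "b\<^sup>2 \<le> a * c"
  proof (cases "c = 0")
    case True
    have "b = 0"
    proof (rule ccontr)
      assume "b \<noteq> 0"
      \<comment> \<open>For c = 0 the quadratic in r is affine, and this r makes it equal to
        -1.\<close>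
      then show False using q[of "(a + 1) / (2 * b)"] True by (simp add: field_simps)
    qed
    then show ?thesis using True by simp
  next
    case False
    \<comment> \<open>b / c is the minimiser of the quadratic in r.\<close>
    then show ?thesis using q[of "b / c"] \<open>c \<ge> 0\<close> by (simp add: field_simps power2_eq_square)
  qed
  then show ?thesis by (simp add: a_b_c_def)
qed

lemma integral_le_sqrt_mult:
  fixes f g :: "'a \<Rightarrow> real"
  assumes "integrable M (\<lambda>x. (f x)\<^sup>2)" "integrable M (\<lambda>x. (g x)\<^sup>2)" "integrable M (\<lambda>x. f x * g x)"
  shows "\<bar>LINT x|M. f x * g x\<bar> \<le> sqrt (LINT x|M. (f x)\<^sup>2) * sqrt (LINT x|M. (g x)\<^sup>2)"
  using real_sqrt_le_mono[OF integral_Cauchy_Schwarz[OF assms]] by (simp add: real_sqrt_mult)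

text \<open>S may be a half line or a compact interval, as the one-sided time derivative at t = 0
  requires. Convexity lets the mean value inequality dominate the difference quotients by w, and
  along sequences dominated convergence applies.\<close>

lemma integral_has_real_derivative_within:
  fixes f f' :: "real \<Rightarrow> 'a \<Rightarrow> real"
  assumes S: "convex S" "s0 \<in> S"
    and D: "\<And>s y. s \<in> S \<Longrightarrow> y \<in> space M \<Longrightarrow> ((\<lambda>s. f s y) has_real_derivative f' s y) (at s within S)"
    and b: "\<And>s y. s \<in> S \<Longrightarrow> y \<in> space M \<Longrightarrow> \<bar>f' s y\<bar> \<le> w y" and w: "integrable M w"
    and f: "\<And>s. s \<in> S \<Longrightarrow> integrable M (f s)" and m: "f' s0 \<in> borel_measurable M"
  shows "((\<lambda>s. LINT y|M. f s y) has_real_derivative (LINT y|M. f' s0 y)) (at s0 within S)"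
proof -
  let ?q = "\<lambda>s y. (f s y - f s0 y) / (s - s0)"
  have "((\<lambda>s. LINT y|M. ?q s y) \<longlongrightarrow> (LINT y|M. f' s0 y)) (at s0 within S)"
    unfolding tendsto_at_iff_sequentially comp_def
  proof (intro allI impI)
    fix X :: "nat \<Rightarrow> real" assume X: "\<forall>i. X i \<in> S - {s0}" "X \<longlonglongrightarrow> s0"
    show "(\<lambda>i. LINT y|M. ?q (X i) y) \<longlonglongrightarrow> (LINT y|M. f' s0 y)"
    proof (rule integral_dominated_convergence[OF m _ w])
      show "?q (X i) \<in> borel_measurable M" for i
        using f[of "X i"] f[of s0] S X by (auto intro!: borel_measurable_diff borel_measurable_divide)
      show "AE y in M. (\<lambda>i. ?q (X i) y) \<longlonglongrightarrow> f' s0 y"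
      proof (rule AE_I2)
        fix y assume y: "y \<in> space M"
        have "((\<lambda>s. ?q s y) \<longlongrightarrow> f' s0 y) (at s0 within S)"
          using D[OF S(2) y] by (simp add: has_field_derivative_iff)
        then show "(\<lambda>i. ?q (X i) y) \<longlonglongrightarrow> f' s0 y"
          using X by (auto simp: tendsto_at_iff_sequentially comp_def)
      qed
      show "AE y in M. norm (?q (X i) y) \<le> w y" for i
      proof (rule AE_I2)
        fix y assume y: "y \<in> space M"
        have "norm (f (X i) y - f s0 y) \<le> w y * norm (X i - s0)"
          by (rule field_differentiable_bound[where S=S and f'="\<lambda>s. f' s y"])
             (use S X D[OF _ y] b[OF _ y] in auto)
        then show "norm (?q (X i) y) \<le> w y" using X by (auto simp: divide_simps)
      qed
    qed
  qed
  moreover have "\<forall>\<^sub>F s in at s0 within S. (LINT y|M. ?q s y) = ((LINT y|M. f s y) - (LINT y|M. f s0 y)) / (s - s0)"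
    unfolding eventually_at_filter
    using S(2) f by (intro always_eventually allI impI) (simp add: Bochner_Integration.integral_diff)
  ultimately show ?thesis
    unfolding has_field_derivative_iff by (simp only: tendsto_cong)
qed

section \<open>The Gaussian Poincare inequality and coercivity\<close>

definition sqrtM :: "real \<Rightarrow> real" where "sqrtM v = sqrt (Maxw v)"

lemma sqrtM_eq: "sqrtM v = sqrt (1 / sqrt (2 * pi)) * exp (- v\<^sup>2 / 4)"
proof -
  have "exp (- v\<^sup>2 / 2) = (exp (- v\<^sup>2 / 4))\<^sup>2" by (simp flip: exp_of_nat_mult add: power2_eq_square exp_add[symmetric])
  then show ?thesis by (simp add: sqrtM_def std_normal_density_def real_sqrt_mult real_sqrt_divide)
qed

lemma sqrtM_pos: "0 < sqrtM v"
  by (simp add: sqrtM_def normal_density_pos)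

lemma sqrtM_power2: "(sqrtM v)\<^sup>2 = Maxw v"
  by (simp add: sqrtM_def less_imp_le normal_density_pos)

lemma DERIV_sqrtM [derivative_intros]:
  "(g has_real_derivative g') (at v within S) \<Longrightarrow>
    ((\<lambda>v. sqrtM (g v)) has_real_derivative - (g v / 2) * sqrtM (g v) * g') (at v within S)"
  unfolding sqrtM_eq by (auto intro!: derivative_eq_intros)

lemma continuous_sqrtM: "continuous_on UNIV sqrtM"
  by (rule DERIV_continuous_on, rule DERIV_sqrtM, rule DERIV_ident)

text \<open>A single term of the power series of \<open>exp (v\<^sup>2 / 4)\<close> is at most the
  whole sum, and \<open>sqrtM\<close> carries exactly the reciprocal of that exponential.\<close>

lemma even_power_sqrtM_le: "v ^ (2 * k) * sqrtM v \<le> sqrtM 0 * (4 ^ k * fact k)"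
proof -
  have "(v\<^sup>2 / 4) ^ k / fact k \<le> exp (v\<^sup>2 / 4)"
  proof -
    have "(\<Sum>n\<in>{k}. (v\<^sup>2 / 4) ^ n /\<^sub>R fact n) \<le> (\<Sum>n. (v\<^sup>2 / 4) ^ n /\<^sub>R fact n)"
      by (rule sum_le_suminf[OF summable_exp_generic]) auto
    also have "\<dots> = exp (v\<^sup>2 / 4)" by (simp only: exp_def)
    finally have "(v\<^sup>2 / 4) ^ k /\<^sub>R fact k \<le> exp (v\<^sup>2 / 4)" by simp
    moreover have "a /\<^sub>R b = a / b" for a b :: real by (simp add: divide_inverse mult.commute)
    ultimately show ?thesis by (simp only:)
  qed
  then have "v ^ (2 * k) \<le> 4 ^ k * fact k * exp (v\<^sup>2 / 4)"
    unfolding power_mult[of v] by (simp add: power_divide field_simps)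
  then have "v ^ (2 * k) * exp (- v\<^sup>2 / 4) \<le> (4 ^ k * fact k * exp (v\<^sup>2 / 4)) * exp (- v\<^sup>2 / 4)"
    by (intro mult_right_mono) auto
  then have "v ^ (2 * k) * exp (- v\<^sup>2 / 4) \<le> 4 ^ k * fact k"
    by (simp add: mult.assoc flip: exp_add)
  then have "sqrt (1 / sqrt (2 * pi)) * (v ^ (2 * k) * exp (- v\<^sup>2 / 4)) \<le> sqrt (1 / sqrt (2 * pi)) * (4 ^ k * fact k)"
    by (intro mult_left_mono) auto
  then show ?thesis by (simp add: sqrtM_eq mult_ac)
qed

lemma decay_power_sqrtM: "decay (\<lambda>v. v ^ n * sqrtM v)"
proof (rule decayI)
  show "continuous_on UNIV (\<lambda>v. v ^ n * sqrtM v)" by (intro continuous_intros continuous_sqrtM)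
  define c where "c k = sqrtM 0 * (4 ^ k * fact k)" for k
  fix v :: real
  have "v ^ (2 * n) = \<bar>v ^ n\<bar>\<^sup>2" by (simp add: power_mult[symmetric] mult.commute flip: power_mult)
  \<comment> \<open>Odd powers are reduced to even ones. After multiplication by 1 + v^2 four even
    powers remain, each bounded by the series estimate.\<close>
  then have n: "\<bar>v ^ n\<bar> \<le> 1 + v ^ (2 * n)"
    using sum_squares_bound[of 1 "\<bar>v ^ n\<bar>"] abs_ge_zero[of "v ^ n"] by simp
  have "(1 + v\<^sup>2) * \<bar>v ^ n * sqrtM v\<bar> \<le> (1 + v\<^sup>2) * ((1 + v ^ (2 * n)) * sqrtM v)"
    unfolding abs_mult using sqrtM_pos[of v] n by (intro mult_left_mono mult_mono) auto
  also have "\<dots> = v ^ (2 * 0) * sqrtM v + v ^ (2 * 1) * sqrtM v + v ^ (2 * n) * sqrtM v + v ^ (2 * Suc n) * sqrtM v"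
    by (simp add: algebra_simps power2_eq_square)
  also have "\<dots> \<le> c 0 + c 1 + c n + c (Suc n)"
    unfolding c_def by (intro add_mono even_power_sqrtM_le)
  finally show "\<bar>v ^ n * sqrtM v\<bar> \<le> (c 0 + c 1 + c n + c (Suc n)) / (1 + v\<^sup>2)"
    by (simp add: field_simps)
qed

lemma decay_sqrtM: "decay sqrtM" and decay_v_sqrtM: "decay (\<lambda>v. v * sqrtM v)" and decay_v2_sqrtM: "decay (\<lambda>v. v\<^sup>2 * sqrtM v)"
  using decay_power_sqrtM[of 0] decay_power_sqrtM[of 1] decay_power_sqrtM[of 2] by simp_all

lemma sqrtM_moments:
  "(LINT v|lborel. (sqrtM v)\<^sup>2) = 1" "(LINT v|lborel. v * (sqrtM v)\<^sup>2) = 0"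
  "(LINT v|lborel. v\<^sup>2 * (sqrtM v)\<^sup>2) = 1" "(LINT v|lborel. v ^ 3 * (sqrtM v)\<^sup>2) = 0"
  using integral_std_normal_moment_even[of 0] integral_std_normal_moment_even[of 1]
    integral_std_normal_moment_odd[of 0] integral_std_normal_moment_odd[of 1]
  unfolding sqrtM_power2 by (simp_all add: mult.commute numeral_eq_Suc)

section \<open>Ladder operators and the Fokker-Planck operator\<close>

text \<open>The lowering operator \<open>\<partial>\<^sub>v + v/2\<close> annihilates \<open>sqrtM\<close>, and its adjoint is \<open>-\<partial>\<^sub>v + v/2\<close>.\<close>

lemma ladder_adjoint:
  assumes g: "\<And>v. (g has_real_derivative g' v) (at v)" "decay1 g" "decay1 g'"
    and k: "\<And>v. (k has_real_derivative k' v) (at v)" "decay k" "decay1 k'"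
  shows "(LINT v|lborel. (g' v - v / 2 * g v) * k v) = - (LINT v|lborel. g v * (k' v + v / 2 * k v))"
    and "integrable lborel (\<lambda>v. (g' v - v / 2 * g v) * k v)"
    and "integrable lborel (\<lambda>v. g v * (k' v + v / 2 * k v))"
proof -
  have 1: "decay (\<lambda>v. g' v * k v - g v * (v / 2 * k v))" and 2: "decay (\<lambda>v. g v * (k' v + v / 2 * k v))"
    by (intro decay_intros g k)+
  have e: "(\<lambda>v. (g' v - v / 2 * g v) * k v) = (\<lambda>v. g' v * k v - g v * (v / 2 * k v))"
    by (simp add: algebra_simps)
  show i: "integrable lborel (\<lambda>v. (g' v - v / 2 * g v) * k v)" "integrable lborel (\<lambda>v. g v * (k' v + v / 2 * k v))"
    unfolding e using 1 2 by (auto intro: decay_integrable)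
  have "(LINT v|lborel. g' v * k v + g v * k' v) = 0"
    by (rule lborel_FTC(1)[of "\<lambda>v. g v * k v"])
       (use g k in \<open>auto intro!: derivative_eq_intros decay_add decay1_mult intro: decay_imp_decay1\<close>)
  also have "(\<lambda>v. g' v * k v + g v * k' v) = (\<lambda>v. (g' v - v / 2 * g v) * k v + g v * (k' v + v / 2 * k v))"
    by (auto simp: algebra_simps)
  finally show "(LINT v|lborel. (g' v - v / 2 * g v) * k v) = - (LINT v|lborel. g v * (k' v + v / 2 * k v))"
    using i by simp
qed

text \<open>A annihilates \<open>sqrtM\<close> and maps \<open>v * sqrtM\<close> to
  \<open>sqrtM\<close>. Hence a term of the form \<open>(\<partial>\<^sub>v - v/2) g\<close> carries
  no mass, and its momentum is minus the mass of g.\<close>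

lemma ladder_sqrtM:
  assumes g: "\<And>v. (g has_real_derivative g' v) (at v)" "decay1 g" "decay1 g'"
  shows "(LINT v|lborel. (g' v - v / 2 * g v) * sqrtM v) = 0"
    and "(LINT v|lborel. (g' v - v / 2 * g v) * (v * sqrtM v)) = - (LINT v|lborel. g v * sqrtM v)"
proof -
  have d1: "decay (\<lambda>v. - (v / 2) * sqrtM v)" and d2: "decay (\<lambda>v. sqrtM v + - (v / 2) * (v * sqrtM v))"
    using decay_cmult[OF decay_v_sqrtM, of "-1/2"] decay_add[OF decay_sqrtM decay_cmult[OF decay_v2_sqrtM, of "-1/2"]]
    by (simp_all add: power2_eq_square mult.assoc)
  show "(LINT v|lborel. (g' v - v / 2 * g v) * sqrtM v) = 0"
    using ladder_adjoint(1)[OF g _ decay_sqrtM decay_imp_decay1[OF d1]] DERIV_sqrtM[OF DERIV_ident] by simp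
  have "(LINT v|lborel. (g' v - v / 2 * g v) * (v * sqrtM v)) =
      - (LINT v|lborel. g v * ((sqrtM v + - (v / 2) * (v * sqrtM v)) + v / 2 * (v * sqrtM v)))"
    by (rule ladder_adjoint(1)[OF g _ decay_v_sqrtM decay_imp_decay1[OF d2]])
       (auto intro!: derivative_eq_intros simp: algebra_simps)
  then show "(LINT v|lborel. (g' v - v / 2 * g v) * (v * sqrtM v)) = - (LINT v|lborel. g v * sqrtM v)"
    by simp
qed

text \<open>\<open>\<partial>\<^sub>v\<^sup>2 + 1/2 - v\<^sup>2/4 = (\<partial>\<^sub>v - v/2)(\<partial>\<^sub>v + v/2)\<close>, with \<open>q'\<close> and \<open>q''\<close> in place of the derivatives of \<open>q\<close>.\<close>

lemma FP_factor:
  fixes v :: real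
  shows "q'' + (1 / 2 - v\<^sup>2 / 4) * q = (q'' + (q / 2 + v / 2 * q')) - v / 2 * (q' + v / 2 * q)"
  by (simp add: power2_eq_square field_simps)

text \<open>By \<open>FP_factor\<close> the operator is -A* A. Pairing with q moves A* onto q;
  pairing with \<open>v * sqrtM\<close> moves first A* and then A, and A* A maps
  \<open>v * sqrtM\<close> to itself. So mass is conserved and momentum is damped at rate 1.\<close>

lemma FP_integrals:
  assumes q: "\<And>v. (q has_real_derivative q' v) (at v)" "\<And>v. (q' has_real_derivative q'' v) (at v)"
    and d: "decay q" "decay q'" "decay q''"
  shows "(LINT v|lborel. (q'' v + (1 / 2 - v\<^sup>2 / 4) * q v) * q v) = - (LINT v|lborel. (q' v + v / 2 * q v)\<^sup>2)"
    and "integrable lborel (\<lambda>v. (q'' v + (1 / 2 - v\<^sup>2 / 4) * q v) * q v)"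
    and "(LINT v|lborel. (q'' v + (1 / 2 - v\<^sup>2 / 4) * q v) * sqrtM v) = 0"
    and "(LINT v|lborel. (q'' v + (1 / 2 - v\<^sup>2 / 4) * q v) * (v * sqrtM v)) = - (LINT v|lborel. q v * (v * sqrtM v))"
proof -
  note e = FP_factor[of "q'' v" v "q v" "q' v" for v]
  have g: "((\<lambda>v. q' v + v / 2 * q v) has_real_derivative (q'' v + (q v / 2 + v / 2 * q' v))) (at v)" for v
    by (auto intro!: derivative_eq_intros q)
  have dq2: "decay (\<lambda>v. q v / 2)" using decay_cmult[OF d(1), of "1/2"] by simp
  have gd: "decay1 (\<lambda>v. q' v + v / 2 * q v)" "decay1 (\<lambda>v. q'' v + (q v / 2 + v / 2 * q' v))"
    by (intro decay_intros d dq2)+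
  show "(LINT v|lborel. (q'' v + (1 / 2 - v\<^sup>2 / 4) * q v) * q v) = - (LINT v|lborel. (q' v + v / 2 * q v)\<^sup>2)"
    "integrable lborel (\<lambda>v. (q'' v + (1 / 2 - v\<^sup>2 / 4) * q v) * q v)"
    using ladder_adjoint[OF g gd q(1) d(1) decay_imp_decay1[OF d(2)]] unfolding e by (auto simp: power2_eq_square)
  show "(LINT v|lborel. (q'' v + (1 / 2 - v\<^sup>2 / 4) * q v) * sqrtM v) = 0"
    using ladder_sqrtM(1)[OF g gd] unfolding e by auto
  have "(LINT v|lborel. (q'' v + (1 / 2 - v\<^sup>2 / 4) * q v) * (v * sqrtM v)) = - (LINT v|lborel. (q' v + v / 2 * q v) * sqrtM v)"
    using ladder_sqrtM(2)[OF g gd] unfolding e by auto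
  also have "(LINT v|lborel. (q' v + v / 2 * q v) * sqrtM v) = (LINT v|lborel. sqrtM v * (q' v + v / 2 * q v))"
    by (simp add: mult.commute)
  \<comment> \<open>The factor of q on the right is minus A* applied to \<open>sqrtM\<close>, that
    is \<open>- v * sqrtM v\<close>.\<close>
  also have "- \<dots> = (LINT v|lborel. (- (v / 2) * sqrtM v - v / 2 * sqrtM v) * q v)"
  proof (rule ladder_adjoint(1)[symmetric])
    have "decay (\<lambda>v. - (v / 2) * sqrtM v)" using decay_cmult[OF decay_v_sqrtM, of "-1/2"] by simp
    then show "decay1 (\<lambda>v. - (v / 2) * sqrtM v)" by (rule decay_imp_decay1)
  qed (use q d decay_sqrtM in \<open>auto intro!: derivative_eq_intros intro: decay_imp_decay1\<close>)
  also have "\<dots> = - (LINT v|lborel. q v * (v * sqrtM v))"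
    by (subst Bochner_Integration.integral_minus[symmetric]) (auto intro!: Bochner_Integration.integral_cong)
  finally show "(LINT v|lborel. (q'' v + (1 / 2 - v\<^sup>2 / 4) * q v) * (v * sqrtM v)) = - (LINT v|lborel. q v * (v * sqrtM v))" .
qed


section \<open>Half-line integrals, the raising operator and the Poincare inequality\<close>

lemma integral_indicator_diff:
  fixes f F :: "real \<Rightarrow> real"
  assumes f: "integrable lborel f" "continuous_on UNIV f"
    and F: "\<And>x. (F has_real_derivative f x) (at x)" and "y \<le> x"
  shows "(LINT s|lborel. indicator {..x} s * f s) - (LINT s|lborel. indicator {..y} s * f s) = F x - F y"
proof -
  have i: "integrable lborel (\<lambda>s. indicator {..z} s * f s)" for z
    using integrable_mult_indicator[OF _ f(1), of "{..z}"] by simp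
  have "(LINT s|lborel. indicator {..x} s * f s) - (LINT s|lborel. indicator {..y} s * f s)
      = (LINT s|lborel. indicator {..x} s * f s - indicator {..y} s * f s)"
    using i by simp
  also have "\<dots> = (LINT s|lborel. indicator {y..x} s *\<^sub>R f s)"
    by (rule integral_cong_AE)
       (use f(1) AE_lborel_singleton[of y] \<open>y \<le> x\<close> in \<open>auto elim!: eventually_mono simp: indicator_def\<close>)
  also have "\<dots> = F x - F y"
    by (rule integral_FTC_atLeastAtMost[OF \<open>y \<le> x\<close>])
       (use F f(2) in \<open>auto intro: continuous_on_subset has_vector_derivative_at_within
          simp: has_real_derivative_iff_has_vector_derivative\<close>)
  finally show ?thesis .
qed

text \<open>Any antiderivative F of f differs from the half-line integral by the constant read off
  at 0, so both have the same derivative.\<close>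

lemma DERIV_integral_indicator:
  fixes f :: "real \<Rightarrow> real"
  assumes f: "integrable lborel f" "continuous_on UNIV f"
  shows "((\<lambda>x. LINT s|lborel. indicator {..x} s * f s) has_real_derivative f x) (at x)"
proof -
  have "isCont f x" for x using f(2) by (simp add: continuous_on_eq_continuous_at)
  then obtain F where F: "\<And>x. (F has_real_derivative f x) (at x)"
    using einterval_antiderivative[of "-\<infinity>" "\<infinity>" f] by (auto simp: has_real_derivative_iff_has_vector_derivative)
  let ?G = "\<lambda>x. LINT s|lborel. indicator {..x} s * f s"
  have "?G y = F y + (?G 0 - F 0)" for y
    using integral_indicator_diff[OF f F, of 0 y] integral_indicator_diff[OF f F, of y 0] by linarith
  then have "?G = (\<lambda>y. F y + (?G 0 - F 0))" by blast
  then show ?thesis using DERIV_add[OF F[of x] DERIV_const[of "?G 0 - F 0"]] by simp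
qed

text \<open>\<open>- 2 * sqrtM\<close> is a decaying antiderivative of the integrand. The explicit
  Gaussian tail serves as majorant below.\<close>

lemma tail_sqrtM:
  "(LINT s|lborel. s * sqrtM s) = 0"
  "(LINT s|lborel. indicator {..x} s * (s * sqrtM s)) = - 2 * sqrtM x"
proof -
  have "((\<lambda>x. - 2 * sqrtM x) has_real_derivative s * sqrtM s) (at s)" for s
    by (auto intro!: derivative_eq_intros)
  note FTC = lborel_FTC[OF this decay_cmult[OF decay_sqrtM] decay_v_sqrtM]
  show "(LINT s|lborel. s * sqrtM s) = 0"
    "(LINT s|lborel. indicator {..x} s * (s * sqrtM s)) = - 2 * sqrtM x"
    by (rule FTC)+
qed

text \<open>With the integrating factor \<open>sqrtM\<close> the equation A* W = g becomes (sqrtM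
  W)' = - g sqrtM, so W is minus a primitive of \<open>g * sqrtM\<close> divided by
  \<open>sqrtM\<close>. Dividing by a Gaussian is harmless because this primitive has Gaussian tails
  on both sides, on the right owing to the orthogonality \<open>zero\<close>.\<close>

lemma raising_surj:
  assumes g: "decay g" and zero: "(LINT v|lborel. g v * sqrtM v) = 0"
  obtains W where "decay W" "\<And>v. (W has_real_derivative (v / 2 * W v - g v)) (at v)"
proof -
  define f where "f s = g s * sqrtM s" for s
  define \<Phi> where "\<Phi> x = (LINT s|lborel. indicator {..x} s * f s)" for x
  define W where "W x = - \<Phi> x / sqrtM x" for x
  have fd: "decay f" unfolding f_def by (intro decay_intros g decay_sqrtM)
  have fi: "integrable lborel f" by (rule decay_integrable[OF fd])
  have fin: "integrable lborel (\<lambda>s. indicator {..x} s * f s)" for x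
    using integrable_mult_indicator[OF _ fi, of "{..x}"] by simp
  have f0: "(LINT s|lborel. f s) = 0" using zero by (simp add: f_def[abs_def])
  have vi: "integrable lborel (\<lambda>s. s * sqrtM s)" by (rule decay_integrable[OF decay_v_sqrtM])
  have vin: "integrable lborel (\<lambda>s. indicator {..x} s * (s * sqrtM s))" for x
    using integrable_mult_indicator[OF _ vi, of "{..x}"] by simp
  have D: "(\<Phi> has_real_derivative f x) (at x)" for x
    unfolding \<Phi>_def[abs_def] by (rule DERIV_integral_indicator[OF fi decay_continuous[OF fd]])
  have DW: "(W has_real_derivative (v / 2 * W v - g v)) (at v)" for v
    unfolding W_def[abs_def] using sqrtM_pos[of v]
    by (auto intro!: derivative_eq_intros D simp: f_def field_simps power2_eq_square)
  obtain K where K: "0 \<le> K" "\<And>s. \<bar>g s\<bar> \<le> K / (1 + s\<^sup>2)" using g by (meson decayE)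
  \<comment> \<open>Since |s| is at least 1, a factor |s| may be inserted in the majorant; its
    integral over a tail is then known exactly from \<open>tail_sqrtM\<close>.\<close>
  have fle: "\<bar>f s\<bar> \<le> K / (1 + x\<^sup>2) * (\<bar>s\<bar> * sqrtM s)" if "1 \<le> \<bar>x\<bar>" "\<bar>x\<bar> \<le> \<bar>s\<bar>" for x s
  proof -
    have "x\<^sup>2 \<le> s\<^sup>2" using that by (simp add: abs_le_square_iff)
    then have "\<bar>g s\<bar> \<le> K / (1 + x\<^sup>2)"
      by (intro order_trans[OF K(2)] divide_left_mono) (use K in auto)
    then have "\<bar>g s\<bar> * sqrtM s \<le> K / (1 + x\<^sup>2) * (\<bar>s\<bar> * sqrtM s)"
      using that sqrtM_pos[of s] K(1) by (intro mult_mono) auto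
    then show ?thesis using sqrtM_pos[of s] by (simp add: f_def abs_mult)
  qed
  have \<Phi>le: "\<bar>\<Phi> x\<bar> \<le> K / (1 + x\<^sup>2) * (2 * sqrtM x)" if "1 \<le> \<bar>x\<bar>" for x
  proof (cases "x \<le> 0")
    case True
    have "\<bar>\<Phi> x\<bar> \<le> (LINT s|lborel. - (K / (1 + x\<^sup>2)) * (indicator {..x} s * (s * sqrtM s)))"
      unfolding \<Phi>_def
    proof (rule integral_abs_bound_integral[OF fin])
      show "integrable lborel (\<lambda>s. - (K / (1 + x\<^sup>2)) * (indicator {..x} s * (s * sqrtM s)))"
        by (intro integrable_mult_right vin)
      show "\<bar>indicator {..x} s * f s\<bar> \<le> - (K / (1 + x\<^sup>2)) * (indicator {..x} s * (s * sqrtM s))" for s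
        using fle[OF that, of s] True by (cases "s \<le> x") simp_all
    qed
    then show ?thesis by (simp add: tail_sqrtM)
  next
    case False
    have c: "(\<lambda>s. indicator (- {..x}) s * h s) = (\<lambda>s. h s - indicator {..x} s * h s)" for h :: "real \<Rightarrow> real"
      by (auto simp: indicator_def)
    \<comment> \<open>Orthogonality of g to \<open>sqrtM\<close> turns the integral up to x into
      minus the right tail, which is small for large x.\<close>
    have "\<Phi> x = - (LINT s|lborel. indicator (- {..x}) s * f s)"
      unfolding c \<Phi>_def using fin fi f0 by simp
    moreover have "\<bar>LINT s|lborel. indicator (- {..x}) s * f s\<bar> \<le>
        (LINT s|lborel. (K / (1 + x\<^sup>2)) * (indicator (- {..x}) s * (s * sqrtM s)))"
    proof (rule integral_abs_bound_integral)
      show "integrable lborel (\<lambda>s. indicator (- {..x}) s * f s)"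
        unfolding c by (intro Bochner_Integration.integrable_diff fi fin)
      have "integrable lborel (\<lambda>s. indicator (- {..x}) s * (s * sqrtM s))"
        unfolding c by (intro Bochner_Integration.integrable_diff vi vin)
      then show "integrable lborel (\<lambda>s. K / (1 + x\<^sup>2) * (indicator (- {..x}) s * (s * sqrtM s)))"
        by (rule integrable_mult_right)
      show "\<bar>indicator (- {..x}) s * f s\<bar> \<le> K / (1 + x\<^sup>2) * (indicator (- {..x}) s * (s * sqrtM s))" for s
        using fle[OF that, of s] False by (cases "s \<le> x") simp_all
    qed
    moreover have "(LINT s|lborel. indicator (- {..x}) s * (s * sqrtM s)) = 2 * sqrtM x"
      unfolding c using vi vin by (simp add: tail_sqrtM)
    ultimately show ?thesis by simp
  qed
  have cW: "continuous_on UNIV W" using DW by (rule DERIV_continuous_on)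
  \<comment> \<open>On the remaining compact interval continuity of W suffices.\<close>
  have "bounded (W ` {-1..1})"
    by (intro compact_imp_bounded compact_continuous_image continuous_on_subset[OF cW] compact_Icc) auto
  then obtain B where "\<forall>y\<in>W ` {-1..1}. norm y \<le> B"
    unfolding bounded_iff by blast
  then have B: "\<bar>W x\<bar> \<le> B" if "x \<in> {-1..1}" for x using that by simp
  have "\<bar>W x\<bar> \<le> (2 * K + 2 * B) / (1 + x\<^sup>2)" for x
  proof (cases "1 \<le> \<bar>x\<bar>")
    case True
    have "\<bar>W x\<bar> \<le> 2 * K / (1 + x\<^sup>2)"
      using \<Phi>le[OF True] sqrtM_pos[of x] by (simp add: W_def abs_divide divide_le_eq mult_ac)
    moreover have "0 \<le> B" using B[of 0] by simp
    ultimately show ?thesis by (simp add: add_divide_distrib add_increasing2)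
  next
    case False
    then have "\<bar>W x\<bar> \<le> B" by (intro B) auto
    moreover have "x\<^sup>2 \<le> 1" using False by (simp add: abs_square_le_1)
    ultimately have "\<bar>W x\<bar> * (1 + x\<^sup>2) \<le> B * 2" by (intro mult_mono) auto
    then show ?thesis using K(1) by (simp add: pos_le_divide_eq)
  qed
  then have "decay W" using cW by (intro decayI) auto
  then show ?thesis using DW that by blast
qed

text \<open>By duality: if \<open>g = (-\<partial>\<^sub>v + v/2) W\<close> then \<open>\<parallel>g\<parallel>\<^sup>2 = \<langle>W, (\<partial>\<^sub>v + v/2) g\<rangle>\<close>, and \<open>\<parallel>W\<parallel> \<le> \<parallel>g\<parallel>\<close>
  since the commutator of the two operators is the identity.\<close>

lemma Gaussian_Poincare:
  assumes g: "\<And>v. (g has_real_derivative g' v) (at v)" "decay g" "decay g'"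
    and zero: "(LINT v|lborel. g v * sqrtM v) = 0"
  shows "(LINT v|lborel. (g v)\<^sup>2) \<le> (LINT v|lborel. (g' v + v / 2 * g v)\<^sup>2)"
proof -
  obtain W where W: "decay W" and DW: "\<And>v. (W has_real_derivative (v / 2 * W v - g v)) (at v)"
    using raising_surj[OF g(2) zero] by blast
  define W' where "W' v = v / 2 * W v - g v" for v
  note DW = DW[folded W'_def]
  have W': "decay1 W'" unfolding W'_def by (intro decay_intros W g)
  have Ag: "decay1 (\<lambda>v. g' v + v / 2 * g v)" by (intro decay_intros g)
  have i: "integrable lborel (\<lambda>v. (g v)\<^sup>2)" "integrable lborel (\<lambda>v. (W v)\<^sup>2)"
    "integrable lborel (\<lambda>v. (g' v + v / 2 * g v)\<^sup>2)" "integrable lborel (\<lambda>v. W v * (g' v + v / 2 * g v))"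
    "integrable lborel (\<lambda>v. (W' v + v / 2 * W v)\<^sup>2)"
    by (intro decay_integrable decay_intros g W W' Ag)+
  have "(LINT v|lborel. (W' v - v / 2 * W v) * g v) = - (LINT v|lborel. W v * (g' v + v / 2 * g v))"
    by (rule ladder_adjoint(1)[OF DW decay_imp_decay1[OF W] W' g(1,2) decay_imp_decay1[OF g(3)]])
  then have 1: "(LINT v|lborel. (g v)\<^sup>2) = (LINT v|lborel. W v * (g' v + v / 2 * g v))"
    by (simp add: W'_def power2_eq_square)
  have d2: "decay (\<lambda>v. (v * W v) * W' v)" by (intro decay1_mult W' decay1_ident_mult W)
  have z: "decay (\<lambda>v. (W v)\<^sup>2 + 2 * ((v * W v) * W' v))" by (intro decay_add decay_cmult d2 decay1_power2 decay_imp_decay1 W)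
  \<comment> \<open>The integrand is the derivative of v W^2, and its second part is (A W)^2 - (A*
    W)^2. This yields |A* W|^2 = |A W|^2 + |W|^2, the integrated commutator relation.\<close>
  have 2: "(LINT v|lborel. (W v)\<^sup>2 + 2 * ((v * W v) * W' v)) = 0"
  proof (rule lborel_FTC(1)[OF _ _ z])
    show "((\<lambda>v. (v * W v) * W v) has_real_derivative (W v)\<^sup>2 + 2 * ((v * W v) * W' v)) (at v)" for v
      by (auto intro!: derivative_eq_intros DW simp: algebra_simps power2_eq_square)
    show "decay (\<lambda>v. (v * W v) * W v)" by (intro decay1_mult decay1_ident_mult decay_imp_decay1 W)
  qed
  have "(LINT v|lborel. (g v)\<^sup>2) = (LINT v|lborel. ((W' v + v / 2 * W v)\<^sup>2 + (W v)\<^sup>2) - ((W v)\<^sup>2 + 2 * ((v * W v) * W' v)))"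
    by (rule Bochner_Integration.integral_cong) (simp_all add: W'_def power2_eq_square algebra_simps)
  also have "\<dots> = (LINT v|lborel. (W' v + v / 2 * W v)\<^sup>2 + (W v)\<^sup>2) - (LINT v|lborel. (W v)\<^sup>2 + 2 * ((v * W v) * W' v))"
    by (intro Bochner_Integration.integral_diff Bochner_Integration.integrable_add i decay_integrable z)
  also have "\<dots> = (LINT v|lborel. (W' v + v / 2 * W v)\<^sup>2) + (LINT v|lborel. (W v)\<^sup>2)"
    unfolding 2 using Bochner_Integration.integral_add[OF i(5,2)] by linarith
  finally have 3: "(LINT v|lborel. (W v)\<^sup>2) \<le> (LINT v|lborel. (g v)\<^sup>2)" by simp
  let ?G = "LINT v|lborel. (g v)\<^sup>2" and ?A = "LINT v|lborel. (g' v + v / 2 * g v)\<^sup>2"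
  have "?G\<^sup>2 \<le> (LINT v|lborel. (W v)\<^sup>2) * ?A"
    unfolding 1 by (rule integral_Cauchy_Schwarz[OF i(2,3,4)])
  also have "\<dots> \<le> ?G * ?A" by (intro mult_right_mono 3) simp
  finally have "?G * ?G \<le> ?G * ?A" by (simp add: power2_eq_square)
  moreover have "0 \<le> ?G" "0 \<le> ?A" by simp_all
  moreover have "a \<le> b" if "a * a \<le> a * b" "0 \<le> a" "0 \<le> b" for a b :: real
    using that by (cases "a = 0") auto
  ultimately show ?thesis by blast
qed


text \<open>Coercivity of the Fokker--Planck operator with \<open>\<lambda>\<^sub>0 = 1/7\<close>. The Poincare inequality applies to the microscopic
  part because it is orthogonal to \<open>sqrtM\<close>.\<close>

lemma micro_bounds:
  fixes q q' :: "real \<Rightarrow> real"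
  assumes q: "\<And>v. (q has_real_derivative q' v) (at v)" "decay q" "decay q'"
  defines "\<sigma> \<equiv> LINT v|lborel. q v * sqrtM v" and "u \<equiv> LINT v|lborel. q v * (v * sqrtM v)"
  defines "g \<equiv> \<lambda>v. q v - \<sigma> * sqrtM v - u * (v * sqrtM v)"
    and "g' \<equiv> \<lambda>v. q' v + \<sigma> * (v / 2 * sqrtM v) - u * (sqrtM v - v\<^sup>2 / 2 * sqrtM v)"
  defines "G \<equiv> LINT v|lborel. (1 + v\<^sup>2) * (g v)\<^sup>2 + (g' v)\<^sup>2"
    and "B \<equiv> LINT v|lborel. (q' v + v / 2 * q v)\<^sup>2"
  shows "1 / 7 * G + u\<^sup>2 \<le> B" and "B \<le> 2 * G + u\<^sup>2"
    and "((LINT v|lborel. q v * (v\<^sup>2 * sqrtM v)) - \<sigma>)\<^sup>2 \<le> G"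
    and "\<And>v. (g has_real_derivative g' v) (at v)"
proof -
  have gd: "decay g" unfolding g_def by (intro decay_diff decay_cmult q decay_sqrtM decay_v_sqrtM)
  have dv2: "decay (\<lambda>v. v / 2 * sqrtM v)" "decay (\<lambda>v. v\<^sup>2 / 2 * sqrtM v)"
    using decay_cmult[OF decay_v_sqrtM, of "1/2"] decay_cmult[OF decay_v2_sqrtM, of "1/2"] by simp_all
  have g'd: "decay g'" unfolding g'_def by (intro decay_diff decay_add decay_cmult q decay_sqrtM dv2)
  show Dg: "(g has_real_derivative g' v) (at v)" for v
    unfolding g_def g'_def by (auto intro!: derivative_eq_intros q simp: field_simps power2_eq_square)
  define A where "A v = g' v + v / 2 * g v" for v
  have Ad: "decay1 A" unfolding A_def by (intro decay_intros gd g'd)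
  have vg: "decay1 (\<lambda>v. v * g v)" by (intro decay_intros gd)
  \<comment> \<open>A annihilates the density part of q and maps its velocity part to
    \<open>u * sqrtM v\<close>.\<close>
  have qA: "q' v + v / 2 * q v = A v + u * sqrtM v" for v
    by (simp add: A_def g_def g'_def field_simps power2_eq_square)
  have m: "integrable lborel (\<lambda>v. (sqrtM v)\<^sup>2)" "integrable lborel (\<lambda>v. v * (sqrtM v)\<^sup>2)"
    "integrable lborel (\<lambda>v. v\<^sup>2 * (sqrtM v)\<^sup>2)" "integrable lborel (\<lambda>v. v ^ 3 * (sqrtM v)\<^sup>2)"
    using decay_integrable[OF decay1_mult[OF decay_imp_decay1[OF decay_power_sqrtM] decay_imp_decay1[OF decay_sqrtM]], of 0]
      decay_integrable[OF decay1_mult[OF decay_imp_decay1[OF decay_power_sqrtM] decay_imp_decay1[OF decay_sqrtM]], of 1]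
      decay_integrable[OF decay1_mult[OF decay_imp_decay1[OF decay_power_sqrtM] decay_imp_decay1[OF decay_sqrtM]], of 2]
      decay_integrable[OF decay1_mult[OF decay_imp_decay1[OF decay_power_sqrtM] decay_imp_decay1[OF decay_sqrtM]], of 3]
    by (simp_all add: power2_eq_square mult.assoc)
  have iq: "integrable lborel (\<lambda>v. q v * sqrtM v)" "integrable lborel (\<lambda>v. q v * (v * sqrtM v))"
    "integrable lborel (\<lambda>v. q v * (v\<^sup>2 * sqrtM v))"
    by (intro decay_integrable decay1_mult decay_imp_decay1 q decay_sqrtM decay_v_sqrtM decay_v2_sqrtM)+
  have "(LINT v|lborel. g v * sqrtM v) =
      (LINT v|lborel. q v * sqrtM v - \<sigma> * (sqrtM v)\<^sup>2 - u * (v * (sqrtM v)\<^sup>2))"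
    by (rule Bochner_Integration.integral_cong) (simp_all add: g_def power2_eq_square algebra_simps)
  also have "\<dots> = 0" using iq m by (simp add: sqrtM_moments \<sigma>_def)
  finally have g0: "(LINT v|lborel. g v * sqrtM v) = 0" .
  have "(LINT v|lborel. g v * (v * sqrtM v)) =
      (LINT v|lborel. q v * (v * sqrtM v) - \<sigma> * (v * (sqrtM v)\<^sup>2) - u * (v\<^sup>2 * (sqrtM v)\<^sup>2))"
    by (rule Bochner_Integration.integral_cong) (simp_all add: g_def power2_eq_square algebra_simps)
  also have "\<dots> = 0" using iq m by (simp add: sqrtM_moments u_def)
  finally have g1: "(LINT v|lborel. g v * (v * sqrtM v)) = 0" .
  have "(LINT v|lborel. g v * (v\<^sup>2 * sqrtM v)) =
      (LINT v|lborel. q v * (v\<^sup>2 * sqrtM v) - \<sigma> * (v\<^sup>2 * (sqrtM v)\<^sup>2) - u * (v ^ 3 * (sqrtM v)\<^sup>2))"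
    by (rule Bochner_Integration.integral_cong) (simp_all add: g_def power2_eq_square power3_eq_cube algebra_simps)
  also have "\<dots> = (LINT v|lborel. q v * (v\<^sup>2 * sqrtM v)) - \<sigma>" using iq m by (simp add: sqrtM_moments)
  finally have g2: "(LINT v|lborel. q v * (v\<^sup>2 * sqrtM v)) - \<sigma> = (LINT v|lborel. (v * g v) * (v * sqrtM v))"
    by (simp add: power2_eq_square mult_ac)
  \<comment> \<open>A* maps \<open>sqrtM\<close> to \<open>v * sqrtM\<close>, to which g is
    orthogonal. So the two parts of A q are orthogonal and B splits into |A g|^2 and u^2.\<close>
  have A0: "(LINT v|lborel. sqrtM v * A v) = 0"
  proof -
    have "decay (\<lambda>v. - (v / 2) * sqrtM v)" using decay_cmult[OF decay_v_sqrtM, of "-1/2"] by simp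
    then have "(LINT v|lborel. (- (v / 2) * sqrtM v - v / 2 * sqrtM v) * g v) = - (LINT v|lborel. sqrtM v * A v)"
      unfolding A_def
      by (intro ladder_adjoint(1) Dg gd decay_imp_decay1 g'd decay_sqrtM) (auto intro!: derivative_eq_intros)
    moreover have "(LINT v|lborel. (- (v / 2) * sqrtM v - v / 2 * sqrtM v) * g v) = - (LINT v|lborel. g v * (v * sqrtM v))"
      by (subst Bochner_Integration.integral_minus[symmetric]) (auto intro!: Bochner_Integration.integral_cong)
    ultimately show ?thesis using g1 by simp
  qed
  have i: "integrable lborel (\<lambda>v. (A v)\<^sup>2)" "integrable lborel (\<lambda>v. sqrtM v * A v)"
    "integrable lborel (\<lambda>v. (g v)\<^sup>2)" "integrable lborel (\<lambda>v. (g' v)\<^sup>2)" "integrable lborel (\<lambda>v. (v * g v)\<^sup>2)"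
    "integrable lborel (\<lambda>v. (v * g v) * g' v)" "integrable lborel (\<lambda>v. (v * g v) * (v * sqrtM v))"
    "integrable lborel (\<lambda>v. (v * sqrtM v)\<^sup>2)"
    by (intro decay_integrable decay1_mult decay1_power2 decay1_ident_mult decay_imp_decay1 gd g'd Ad vg decay_sqrtM decay_v_sqrtM;
        intro decay_imp_decay1 gd g'd Ad vg decay_sqrtM decay_v_sqrtM)+
  have "B = (LINT v|lborel. (A v)\<^sup>2 + 2 * u * (sqrtM v * A v) + u\<^sup>2 * (sqrtM v)\<^sup>2)"
    unfolding B_def qA by (rule Bochner_Integration.integral_cong) (simp_all add: power2_eq_square algebra_simps)
  also have "\<dots> = (LINT v|lborel. (A v)\<^sup>2) + u\<^sup>2" using i m by (simp add: A0 sqrtM_moments)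
  finally have B: "B = (LINT v|lborel. (A v)\<^sup>2) + u\<^sup>2" .
  have "(LINT v|lborel. (1 + v\<^sup>2) * (g v)\<^sup>2 + (g' v)\<^sup>2) = (LINT v|lborel. (g v)\<^sup>2 + (v * g v)\<^sup>2 + (g' v)\<^sup>2)"
    by (rule Bochner_Integration.integral_cong) (simp_all add: power2_eq_square algebra_simps)
  then have G: "G = (LINT v|lborel. (g v)\<^sup>2) + (LINT v|lborel. (v * g v)\<^sup>2) + (LINT v|lborel. (g' v)\<^sup>2)"
    unfolding G_def using i by simp
  have P: "(LINT v|lborel. (g v)\<^sup>2) \<le> (LINT v|lborel. (A v)\<^sup>2)"
    using Gaussian_Poincare[OF Dg gd g'd g0] by (simp add: A_def)
  \<comment> \<open>The derivative of v g^2; its vanishing integral trades the cross term of |A g|^2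
    for -|g|^2 / 2.\<close>
  have z: "decay (\<lambda>v. (g v)\<^sup>2 + 2 * ((v * g v) * g' v))"
    by (intro decay_add decay_cmult decay1_mult vg decay1_power2 decay_imp_decay1 gd g'd)
  have z0: "(LINT v|lborel. (g v)\<^sup>2 + 2 * ((v * g v) * g' v)) = 0"
  proof (rule lborel_FTC(1)[OF _ _ z])
    show "((\<lambda>v. (v * g v) * g v) has_real_derivative (g v)\<^sup>2 + 2 * ((v * g v) * g' v)) (at v)" for v
      by (auto intro!: derivative_eq_intros Dg simp: algebra_simps power2_eq_square)
    show "decay (\<lambda>v. (v * g v) * g v)" by (intro decay1_mult vg decay_imp_decay1 gd)
  qed
  have z1: "2 * (LINT v|lborel. (v * g v) * g' v) = - (LINT v|lborel. (g v)\<^sup>2)"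
    using z0 i by simp
  have "(LINT v|lborel. (A v)\<^sup>2) = (LINT v|lborel. (g' v)\<^sup>2 + (v * g v) * g' v + 1 / 4 * (v * g v)\<^sup>2)"
    by (rule Bochner_Integration.integral_cong) (simp_all add: A_def power2_eq_square field_simps)
  also have "\<dots> = (LINT v|lborel. (g' v)\<^sup>2) + (LINT v|lborel. (v * g v) * g' v) + 1 / 4 * (LINT v|lborel. (v * g v)\<^sup>2)"
    using i by simp
  finally have A: "(LINT v|lborel. (A v)\<^sup>2) =
      (LINT v|lborel. (g' v)\<^sup>2) - 1 / 2 * (LINT v|lborel. (g v)\<^sup>2) + 1 / 4 * (LINT v|lborel. (v * g v)\<^sup>2)"
    using z1 by simp
  have nn: "0 \<le> (LINT v|lborel. (g' v)\<^sup>2)" "0 \<le> (LINT v|lborel. (g v)\<^sup>2)" "0 \<le> (LINT v|lborel. (v * g v)\<^sup>2)"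
    by simp_all
  \<comment> \<open>Origin of 1/7: here a, b, c, d are the squared norms of A g, g, g' and v g.
    Weight 4/7 on the expansion of a and weight 3/7 on the Poincare inequality b <= a give the lower
    bound 4/7 c + 1/7 b + 1/7 d; no other weights raise the smallest coefficient.\<close>
  have lin: "1 / 7 * (b + d + c) + e \<le> a + e \<and> a + e \<le> 2 * (b + d + c) + e"
    if "a = c - 1 / 2 * b + 1 / 4 * d" "b \<le> a" "0 \<le> c" "0 \<le> b" "0 \<le> d" for a b c d e :: real
    using that by auto
  show "1 / 7 * G + u\<^sup>2 \<le> B" "B \<le> 2 * G + u\<^sup>2"
    unfolding B G using lin[OF A P nn] by auto
  \<comment> \<open>\<open>v * sqrtM\<close> has norm 1, so the second moment of g is bounded by |v
    g|, which the weight 1 + v^2 in G contains.\<close>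
  have "(LINT v|lborel. (v * g v) * (v * sqrtM v))\<^sup>2 \<le> (LINT v|lborel. (v * g v)\<^sup>2) * (LINT v|lborel. (v * sqrtM v)\<^sup>2)"
    by (rule integral_Cauchy_Schwarz[OF i(5,8,7)])
  then have "((LINT v|lborel. q v * (v\<^sup>2 * sqrtM v)) - \<sigma>)\<^sup>2 \<le> (LINT v|lborel. (v * g v)\<^sup>2)"
    unfolding g2 by (simp add: power_mult_distrib sqrtM_moments)
  then show "((LINT v|lborel. q v * (v\<^sup>2 * sqrtM v)) - \<sigma>)\<^sup>2 \<le> G"
    unfolding G using nn by linarith
qed

section \<open>Embedding in the random variable\<close>

lemma integral_has_real_derivative_open:
  fixes f f' :: "real \<Rightarrow> 'a \<Rightarrow> real"
  assumes J: "open J" "z0 \<in> J"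
    and D: "\<And>s y. s \<in> J \<Longrightarrow> y \<in> space M \<Longrightarrow> ((\<lambda>s. f s y) has_real_derivative f' s y) (at s)"
    and b: "\<And>s y. s \<in> J \<Longrightarrow> y \<in> space M \<Longrightarrow> \<bar>f' s y\<bar> \<le> w y" and w: "integrable M w"
    and f: "\<And>s. s \<in> J \<Longrightarrow> integrable M (f s)" and m: "f' z0 \<in> borel_measurable M"
  shows "((\<lambda>s. LINT y|M. f s y) has_real_derivative (LINT y|M. f' z0 y)) (at z0)"
proof -
  obtain r where r: "0 < r" "ball z0 r \<subseteq> J" using J by (meson openE)
  have "((\<lambda>s. LINT y|M. f s y) has_real_derivative (LINT y|M. f' z0 y)) (at z0 within ball z0 r)"
    by (rule integral_has_real_derivative_within[where w=w])
       (use r(1) subsetD[OF r(2)] D b w f m in \<open>auto intro: has_field_derivative_at_within\<close>)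
  moreover have "at z0 within ball z0 r = at z0" using r by (intro at_within_open) auto
  ultimately show ?thesis by simp
qed

lemma space_zlaw [simp]: "space (zlaw I \<rho>) = I"
  and sets_zlaw [simp, measurable_cong]: "sets (zlaw I \<rho>) = sets (restrict_space borel I)"
  by (auto simp: zlaw_def space_restrict_space sets_restrict_space)

text \<open>The law has a density with respect to Lebesgue measure, for which points are null
  sets.\<close>

lemma AE_zlaw_neq:
  assumes "is_prob_density_on I \<rho>"
  shows "AE z in zlaw I \<rho>. z \<noteq> z0"
proof -
  have [measurable]: "I \<in> sets borel" "\<rho> \<in> borel_measurable (restrict_space borel I)"
    using assms by (auto simp: is_prob_density_on_def)
  have [simp]: "I \<inter> space lborel \<in> sets lborel" by simp
  have "AE z in restrict_space lborel I. z \<noteq> z0"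
    using AE_lborel_singleton[of z0] by (auto simp: AE_restrict_space_iff elim: eventually_mono)
  moreover have "(\<lambda>z. ennreal (\<rho> z)) \<in> borel_measurable (restrict_space lborel I)"
  proof -
    have "sets (restrict_space lborel I) = sets (restrict_space borel I)" by (simp add: sets_restrict_space)
    then show ?thesis by (simp cong: measurable_cong_sets)
  qed
  ultimately show ?thesis unfolding zlaw_def by (subst AE_density) auto
qed

text \<open>The conjunct of \<open>sobolev_constant\<close> that concerns functions of z alone.
  Through it \<open>C\<^sub>1\<close> enters all estimates, while the supremum in x is supplied by
  \<open>sup_le_H1\<close>.\<close>

definition z_embedding :: "real set \<Rightarrow> real measure \<Rightarrow> real \<Rightarrow> bool" where
  "z_embedding I P C \<longleftrightarrow> (\<forall>g::real \<Rightarrow> real. Ck_near 1 I g \<and> (\<forall>l\<le>1. in_L2 P ((pd 1 ^^ l) g)) \<longrightarrow>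
     (\<forall>z\<in>I. \<bar>g z\<bar> \<le> C * sob_norm P 1 1 g))"

lemma sobolev_constant_imp_z_embedding: "sobolev_constant I P C \<Longrightarrow> z_embedding I P C"
  by (simp add: sobolev_constant_def z_embedding_def)

text \<open>Replaces \<open>Ck_near\<close> and \<open>pd\<close> by an explicit derivative on an
  open set around I, the form in which derivatives of parameter integrals become available.\<close>

lemma z_embeddingD:
  fixes g g' :: "real \<Rightarrow> real"
  assumes emb: "z_embedding I P C" and sp: "space P = I" and J: "open J" "I \<subseteq> J"
    and D: "\<And>z. z \<in> J \<Longrightarrow> (g has_real_derivative g' z) (at z)" and c: "continuous_on J g'"
    and L2: "in_L2 P g" "in_L2 P g'" and z: "z \<in> I"
  shows "\<bar>g z\<bar> \<le> C * sqrt ((LINT z|P. (g z)\<^sup>2) + (LINT z|P. (g' z)\<^sup>2))"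
proof -
  have sh: "((\<lambda>s. g (z + s)) has_real_derivative g' z) (at 0)" if "z \<in> J" for z
    using D[OF that] DERIV_shift[of g "g' z" 0 z] by (simp add: add.commute)
  then have pd: "pd 1 g z = g' z" if "z \<in> J" for z
    using that by (simp add: pd_def DERIV_imp_deriv)
  have pdI: "pd 1 g z = g' z" if "z \<in> I" for z using that J pd by auto
  have cg: "continuous_on J g"
    using D by (meson DERIV_continuous_on has_field_derivative_at_within)
  have "Ck_on 1 J g"
    using cg c sh pd by (auto simp: real_differentiable_def cong: continuous_on_cong)
  then have "Ck_near 1 I g" using J by (auto simp: Ck_near_def)
  moreover have "in_L2 P ((pd 1 ^^ l) g)" if "l \<le> 1" for l
  proof -
    have "in_L2 P (pd 1 g)"
    proof -
      have "g' \<in> borel_measurable P \<longleftrightarrow> pd 1 g \<in> borel_measurable P"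
        by (rule measurable_cong) (simp add: pdI sp)
      moreover have "integrable P (\<lambda>z. (g' z)\<^sup>2) \<longleftrightarrow> integrable P (\<lambda>z. (pd 1 g z)\<^sup>2)"
        by (rule Bochner_Integration.integrable_cong) (simp_all add: pdI sp)
      ultimately show ?thesis using L2(2) by (simp add: in_L2_def)
    qed
    then show ?thesis using L2(1) that by (cases l) auto
  qed
  ultimately have "\<bar>g z\<bar> \<le> C * sob_norm P 1 1 g" using emb z by (auto simp: z_embedding_def)
  also have "sob_norm P 1 1 g = sqrt ((LINT z|P. (g z)\<^sup>2) + (LINT z|P. (g' z)\<^sup>2))"
  proof -
    have "(LINT z|P. (pd 1 g z)\<^sup>2) = (LINT z|P. (g' z)\<^sup>2)"
      by (rule Bochner_Integration.integral_cong) (auto simp: pdI sp)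
    then show ?thesis
      by (simp add: sob_norm_def l2_norm_def l2_inner_def power2_eq_square[symmetric])
  qed
  finally show ?thesis .
qed

text \<open>At an isolated point of \<open>I\<close> a locally constant bump would violate the embedding. Hence identities
  that hold on \<open>I\<close> may be differentiated in \<open>z\<close>.\<close>

lemma z_embedding_imp_islimpt:
  assumes emb: "z_embedding I P C" and dens: "is_prob_density_on I \<rho>" and P: "P = zlaw I \<rho>" and z: "z0 \<in> I"
  shows "z0 islimpt I"
proof (rule ccontr)
  assume "\<not> z0 islimpt I"
  then obtain r where r: "0 < r" "\<And>x. x \<in> I \<Longrightarrow> x \<noteq> z0 \<Longrightarrow> r \<le> dist x z0"
    by (auto simp: islimpt_approachable not_less)
  define B where "B = ball z0 (r / 2)"
  \<comment> \<open>The sphere of radius r / 2 is left out. The other points of I have distance at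
    least r from z0, so J still contains I, and the bump is constant on each of the two open
    pieces.\<close>
  define J where "J = B \<union> - cball z0 (r / 2)"
  have J: "open J" by (auto simp: J_def B_def open_Compl)
  have IJ: "I \<subseteq> J"
  proof
    fix x assume "x \<in> I"
    then show "x \<in> J" using r(1) r(2)[of x] by (cases "x = z0") (auto simp: J_def B_def dist_commute)
  qed
  have D: "((indicator B :: real \<Rightarrow> real) has_real_derivative 0) (at z)" if "z \<in> J" for z
  proof (cases "z \<in> B")
    case True
    have "((\<lambda>_. 1::real) has_real_derivative 0) (at z)" by simp
    then show ?thesis
      by (rule has_field_derivative_transform_within_open[where S=B]) (use True in \<open>auto simp: B_def\<close>)
  next
    case False
    have "((\<lambda>_. 0::real) has_real_derivative 0) (at z)" by simp
    then show ?thesis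
      by (rule has_field_derivative_transform_within_open[where S="- cball z0 (r / 2)"])
         (use False that in \<open>auto simp: B_def J_def\<close>)
  qed
  have [measurable]: "B \<in> sets borel" by (simp add: B_def)
  have mI: "(indicator B :: real \<Rightarrow> real) \<in> borel_measurable P"
  proof -
    have "(indicator B :: real \<Rightarrow> real) \<in> borel_measurable (restrict_space borel I)"
      by (intro measurable_restrict_space1) measurable
    then show ?thesis unfolding P by (simp cong: measurable_cong_sets)
  qed
  have ae: "AE z in P. (indicator B z :: real)\<^sup>2 = 0"
    using AE_zlaw_neq[OF dens, of z0] AE_space[of "zlaw I \<rho>"] unfolding P
  proof eventually_elim
    case (elim z)
    then show ?case using r(1) r(2)[of z] by (auto simp: B_def indicator_def dist_commute)
  qed
  have int: "integrable P (\<lambda>z. (indicator B z :: real)\<^sup>2)"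
    by (subst integrable_cong_AE[where g="\<lambda>_. 0"]) (use ae mI in auto)
  \<comment> \<open>The left-hand side is 1. On the right both integrals vanish, because B meets I
    in the null set {z0} only.\<close>
  have "\<bar>indicator B z0 :: real\<bar> \<le> C * sqrt ((LINT z|P. (indicator B z)\<^sup>2) + (LINT z|P. 0\<^sup>2))"
    by (rule z_embeddingD[OF emb _ J IJ D]) (use mI int z P in \<open>auto simp: in_L2_def\<close>)
  moreover have "(LINT z|P. (indicator B z :: real)\<^sup>2) = 0"
    by (subst integral_cong_AE[where g="\<lambda>_. 0"]) (use ae mI in auto)
  ultimately show False using r(1) by (simp add: B_def)
qed

text \<open>The embedding for functions with values in \<open>L\<^sup>2(M)\<close> follows from the scalar one by testing
  against the value at \<open>z0\<close>.\<close>

lemma z_embedding_L2: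
  fixes f f' f'' :: "'y \<Rightarrow> real \<Rightarrow> real" and w :: "'y \<Rightarrow> real"
  assumes emb: "z_embedding I P C" "0 \<le> C" and P: "finite_measure P" "space P = I" and M: "sigma_finite_measure M"
    and J: "open J" "I \<subseteq> J"
    and D: "\<And>y z. y \<in> space M \<Longrightarrow> z \<in> J \<Longrightarrow> (f y has_real_derivative f' y z) (at z)"
      "\<And>y z. y \<in> space M \<Longrightarrow> z \<in> J \<Longrightarrow> (f' y has_real_derivative f'' y z) (at z)"
    and b: "\<And>y z. y \<in> space M \<Longrightarrow> z \<in> J \<Longrightarrow> \<bar>f y z\<bar> \<le> w y"
      "\<And>y z. y \<in> space M \<Longrightarrow> z \<in> J \<Longrightarrow> \<bar>f' y z\<bar> \<le> w y"
      "\<And>y z. y \<in> space M \<Longrightarrow> z \<in> J \<Longrightarrow> \<bar>f'' y z\<bar> \<le> w y"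
    and w: "integrable M (\<lambda>y. (w y)\<^sup>2)"
    and m: "\<And>z. z \<in> J \<Longrightarrow> (\<lambda>y. f y z) \<in> borel_measurable M" "\<And>z. z \<in> J \<Longrightarrow> (\<lambda>y. f' y z) \<in> borel_measurable M"
      "\<And>z. z \<in> J \<Longrightarrow> (\<lambda>y. f'' y z) \<in> borel_measurable M"
    and jm: "(\<lambda>(z, y). f y z) \<in> borel_measurable (P \<Otimes>\<^sub>M M)" "(\<lambda>(z, y). f' y z) \<in> borel_measurable (P \<Otimes>\<^sub>M M)"
    and z0: "z0 \<in> I"
  shows "(LINT y|M. (f y z0)\<^sup>2) \<le> C\<^sup>2 * ((LINT z|P. LINT y|M. (f y z)\<^sup>2) + (LINT z|P. LINT y|M. (f' y z)\<^sup>2))"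
proof -
  interpret P: finite_measure P by fact
  interpret M: sigma_finite_measure M by fact
  have z0J: "z0 \<in> J" using J z0 by auto
  have w0: "0 \<le> w y" if "y \<in> space M" for y using order_trans[OF abs_ge_zero b(1)[OF that z0J]] .
  have prod: "integrable M (\<lambda>y. g y * k y)"
    if "g \<in> borel_measurable M" "k \<in> borel_measurable M" "\<And>y. y \<in> space M \<Longrightarrow> \<bar>g y\<bar> \<le> w y"
      "\<And>y. y \<in> space M \<Longrightarrow> \<bar>k y\<bar> \<le> w y" for g k :: "'y \<Rightarrow> real"
  proof (rule Bochner_Integration.integrable_bound[OF w])
    show "AE y in M. norm (g y * k y) \<le> norm ((w y)\<^sup>2)"
      using that w0 by (intro AE_I2) (auto simp: abs_mult power2_eq_square intro!: mult_mono)
  qed (use that in auto)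
  note prods = prod[OF m(1) m(1) b(1) b(1)] prod[OF m(2) m(1) b(2) b(1)] prod[OF m(3) m(1) b(3) b(1)]
    prod[OF m(2) m(2) b(2) b(2)]
  have sq: "integrable M (\<lambda>y. (f y z)\<^sup>2)" "integrable M (\<lambda>y. (f' y z)\<^sup>2)" if "z \<in> J" for z
    using prods(1)[OF that that _ that _ that] prods(4)[OF that that _ that _ that] by (simp_all add: power2_eq_square)
  \<comment> \<open>G pairs f with its value at z0. Then G z0 is the squared norm to be bounded, and
    Cauchy-Schwarz bounds G and G' by the norms of f and f' times the root of that same
    quantity.\<close>
  define G where "G z = (LINT y|M. f y z * f y z0)" for z
  define G' where "G' z = (LINT y|M. f' y z * f y z0)" for z
  define G'' where "G'' z = (LINT y|M. f'' y z * f y z0)" for z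
  have bb: "\<bar>a * f y z0\<bar> \<le> (w y)\<^sup>2" if "\<bar>a\<bar> \<le> w y" "y \<in> space M" for a y
    using that b(1)[OF that(2) z0J] w0 by (auto simp: abs_mult power2_eq_square intro!: mult_mono)
  have DG: "(G has_real_derivative G' z) (at z)" if "z \<in> J" for z
    unfolding G_def[abs_def] G'_def
    by (rule integral_has_real_derivative_open[OF J(1) that, where w="\<lambda>y. (w y)\<^sup>2"])
       (use bb b D w z0J that m prods in \<open>auto intro!: derivative_eq_intros\<close>)
  \<comment> \<open>The embedding asks for a continuous G'; its differentiability, by means of f'',
    supplies this.\<close>
  have DG': "(G' has_real_derivative G'' z) (at z)" if "z \<in> J" for z
    unfolding G'_def[abs_def] G''_def
    by (rule integral_has_real_derivative_open[OF J(1) that, where w="\<lambda>y. (w y)\<^sup>2"])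
       (use bb b D w z0J that m prods in \<open>auto intro!: derivative_eq_intros\<close>)
  have cG': "continuous_on J G'" using DG' by (meson DERIV_continuous_on has_field_derivative_at_within)
  define n0 where "n0 = (LINT y|M. (f y z0)\<^sup>2)"
  have m0: "(\<lambda>(z, y). f y z0) \<in> borel_measurable (P \<Otimes>\<^sub>M M)"
    using measurable_compose[of snd "P \<Otimes>\<^sub>M M" M, OF measurable_snd m(1)[OF z0J]] by (simp add: case_prod_beta)
  have mG: "G \<in> borel_measurable P" "G' \<in> borel_measurable P"
    unfolding G_def[abs_def] G'_def[abs_def]
    by (rule M.borel_measurable_lebesgue_integral; use borel_measurable_times[OF _ m0] jm in \<open>auto simp: case_prod_beta\<close>)+
  have mN: "(\<lambda>z. LINT y|M. (f y z)\<^sup>2) \<in> borel_measurable P" "(\<lambda>z. LINT y|M. (f' y z)\<^sup>2) \<in> borel_measurable P"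
    by (rule M.borel_measurable_lebesgue_integral; use jm in \<open>auto simp: case_prod_beta\<close>)+
  define W where "W = (LINT y|M. (w y)\<^sup>2)"
  have Nb: "(LINT y|M. (f y z)\<^sup>2) \<le> W" "(LINT y|M. (f' y z)\<^sup>2) \<le> W" if "z \<in> J" for z
    unfolding W_def using b(1,2)[OF _ that] w0 by (auto intro!: integral_mono sq w that power2_le_iff_abs_le[THEN iffD2])
  have iN: "integrable P (\<lambda>z. LINT y|M. (f y z)\<^sup>2)" "integrable P (\<lambda>z. LINT y|M. (f' y z)\<^sup>2)"
    using Nb J P by (auto intro!: P.integrable_const_bound[where B=W] mN AE_I2)
  have Gle: "(G z)\<^sup>2 \<le> n0 * (LINT y|M. (f y z)\<^sup>2)" "(G' z)\<^sup>2 \<le> n0 * (LINT y|M. (f' y z)\<^sup>2)" if "z \<in> J" for z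
    using integral_Cauchy_Schwarz[OF sq(1)[OF that] sq(1)[OF z0J] prods(1)[OF that z0J _ that _ z0J]]
      integral_Cauchy_Schwarz[OF sq(2)[OF that] sq(1)[OF z0J] prods(2)[OF that z0J _ that _ z0J]]
    by (simp_all add: G_def G'_def n0_def mult.commute)
  have iG: "integrable P (\<lambda>z. (G z)\<^sup>2)" "integrable P (\<lambda>z. (G' z)\<^sup>2)"
  proof -
    show "integrable P (\<lambda>z. (G z)\<^sup>2)"
      by (rule Bochner_Integration.integrable_bound[OF integrable_mult_right[OF iN(1), of n0]])
         (use Gle(1) J P mG in \<open>auto intro!: AE_I2 intro: order_trans[OF _ abs_ge_self]\<close>)
    show "integrable P (\<lambda>z. (G' z)\<^sup>2)"
      by (rule Bochner_Integration.integrable_bound[OF integrable_mult_right[OF iN(2), of n0]])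
         (use Gle(2) J P mG in \<open>auto intro!: AE_I2 intro: order_trans[OF _ abs_ge_self]\<close>)
  qed
  let ?X = "(LINT z|P. LINT y|M. (f y z)\<^sup>2) + (LINT z|P. LINT y|M. (f' y z)\<^sup>2)"
  have "\<bar>G z0\<bar> \<le> C * sqrt ((LINT z|P. (G z)\<^sup>2) + (LINT z|P. (G' z)\<^sup>2))"
    by (rule z_embeddingD[OF emb(1) P(2) J DG cG' _ _ z0]) (use mG iG in \<open>auto simp: in_L2_def\<close>)
  also have "(LINT z|P. (G z)\<^sup>2) + (LINT z|P. (G' z)\<^sup>2) \<le> n0 * ?X"
    unfolding distrib_left
    using J P Gle
    by (intro add_mono; subst Bochner_Integration.integral_mult_right_zero[symmetric]; intro integral_mono iG integrable_mult_right iN) auto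
  finally have "\<bar>n0\<bar> \<le> C * sqrt (n0 * ?X)" using emb(2) by (simp add: mult_left_mono G_def n0_def power2_eq_square)
  moreover have nX: "0 \<le> n0" "0 \<le> ?X" by (simp_all add: n0_def)
  ultimately have "n0\<^sup>2 \<le> (C * sqrt (n0 * ?X))\<^sup>2" by (intro power_mono) auto
  also have "\<dots> = C\<^sup>2 * (n0 * ?X)" using nX by (simp add: power_mult_distrib)
  \<comment> \<open>One factor n0 cancels, so the vector-valued embedding has the scalar
    constant.\<close>
  finally have "n0 * n0 \<le> n0 * (C\<^sup>2 * ?X)" by (simp add: power2_eq_square mult_ac)
  moreover have "a \<le> b" if "a * a \<le> a * b" "0 \<le> a" "0 \<le> b" for a b :: real
    using that by (cases "a = 0") auto
  moreover have "0 \<le> C\<^sup>2 * ?X" using nX by simp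
  ultimately have "n0 \<le> C\<^sup>2 * ?X" using nX(1) by blast
  then show ?thesis unfolding n0_def .
qed

section \<open>The trilinear estimate\<close>

text \<open>Measurability takes the place of continuity, because the factors below are x-slices of
  functions such as roots of velocity integrals, of which only this is known.\<close>

definition mdecay :: "(real \<Rightarrow> real) \<Rightarrow> bool" where
  "mdecay f \<longleftrightarrow> f \<in> borel_measurable borel \<and> (\<exists>K. \<forall>s. \<bar>f s\<bar> \<le> K / (1 + s\<^sup>2))"

lemma mdecay_integrable: "mdecay f \<Longrightarrow> integrable lborel f"
  by (auto simp: mdecay_def intro: integrable_lborel_dominated)

lemma mdecay_mult:
  assumes "mdecay f" "mdecay g" shows "mdecay (\<lambda>s. f s * g s)"
proof -
  obtain K where K: "\<And>s. \<bar>f s\<bar> \<le> K / (1 + s\<^sup>2)" using assms by (auto simp: mdecay_def)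
  obtain L where L: "\<And>s. \<bar>g s\<bar> \<le> L / (1 + s\<^sup>2)" using assms by (auto simp: mdecay_def)
  have "0 \<le> K" "0 \<le> L" using K[of 0] L[of 0] by simp_all
  have "\<bar>f s * g s\<bar> \<le> K * L / (1 + s\<^sup>2)" for s
  proof -
    have "\<bar>f s * g s\<bar> \<le> (K / (1 + s\<^sup>2)) * L"
      unfolding abs_mult
    proof (intro mult_mono K order_trans[OF L])
      show "L / (1 + s\<^sup>2) \<le> L" using \<open>0 \<le> L\<close> by (simp add: divide_le_eq mult_le_cancel_left1 algebra_simps)
      show "0 \<le> K / (1 + s\<^sup>2)" using \<open>0 \<le> K\<close> by simp
    qed auto
    then show ?thesis by simp
  qed
  then show ?thesis using assms unfolding mdecay_def by (blast intro: borel_measurable_times)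
qed

lemma mdecay_power2: "mdecay f \<Longrightarrow> mdecay (\<lambda>s. (f s)\<^sup>2)"
  using mdecay_mult[of f f] by (simp add: power2_eq_square)

lemma mdecay_integral_mult_le:
  assumes "mdecay f" "mdecay g"
  shows "(LINT x|lborel. f x * g x) \<le> sqrt (LINT x|lborel. (f x)\<^sup>2) * sqrt (LINT x|lborel. (g x)\<^sup>2)"
  using integral_le_sqrt_mult[of lborel f g] assms
  by (auto intro: mdecay_integrable mdecay_power2 mdecay_mult order_trans[OF abs_ge_self])

text \<open>The three integrals are the Leibniz terms for at most one x-derivative of a product. The
  supremum goes on the factor without derivative: on f0 in the first two, which together cost F K B
  by Cauchy-Schwarz in the plane, and on k0 in the third, which costs F K B once more. Hence the
  factor 2.\<close>

lemma x_trilinear: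
  fixes f0 f1 k0 k1 b0 b1 :: "real \<Rightarrow> real"
  assumes m: "mdecay f0" "mdecay f1" "mdecay k0" "mdecay k1" "mdecay b0" "mdecay b1"
    and nn: "\<And>x. 0 \<le> f0 x" "\<And>x. 0 \<le> f1 x" "\<And>x. 0 \<le> k0 x" "\<And>x. 0 \<le> k1 x" "\<And>x. 0 \<le> b0 x" "\<And>x. 0 \<le> b1 x"
    and f: "\<And>x. (f0 x)\<^sup>2 \<le> (LINT x|lborel. (f0 x)\<^sup>2) + (LINT x|lborel. (f1 x)\<^sup>2)"
    and k: "\<And>x. (k0 x)\<^sup>2 \<le> (LINT x|lborel. (k0 x)\<^sup>2) + (LINT x|lborel. (k1 x)\<^sup>2)"
  shows "(LINT x|lborel. f0 x * k0 x * b0 x) + (LINT x|lborel. f0 x * k1 x * b1 x) + (LINT x|lborel. f1 x * k0 x * b1 x)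
    \<le> 2 * sqrt ((LINT x|lborel. (f0 x)\<^sup>2) + (LINT x|lborel. (f1 x)\<^sup>2))
        * sqrt ((LINT x|lborel. (k0 x)\<^sup>2) + (LINT x|lborel. (k1 x)\<^sup>2))
        * sqrt ((LINT x|lborel. (b0 x)\<^sup>2) + (LINT x|lborel. (b1 x)\<^sup>2))"
proof -
  define F K B where FKB: "F = sqrt ((LINT x|lborel. (f0 x)\<^sup>2) + (LINT x|lborel. (f1 x)\<^sup>2))"
    "K = sqrt ((LINT x|lborel. (k0 x)\<^sup>2) + (LINT x|lborel. (k1 x)\<^sup>2))"
    "B = sqrt ((LINT x|lborel. (b0 x)\<^sup>2) + (LINT x|lborel. (b1 x)\<^sup>2))"
  have F: "f0 x \<le> F" for x using real_sqrt_le_mono[OF f[of x]] nn by (simp add: FKB)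
  have K: "k0 x \<le> K" for x using real_sqrt_le_mono[OF k[of x]] nn by (simp add: FKB)
  have F0: "0 \<le> F" "0 \<le> K" by (simp_all add: FKB)
  have pull: "(LINT x|lborel. p x * q x * r x) \<le> c * (sqrt (LINT x|lborel. (q x)\<^sup>2) * sqrt (LINT x|lborel. (r x)\<^sup>2))"
    if "mdecay p" "mdecay q" "mdecay r" "\<And>x. p x \<le> c" "\<And>x. 0 \<le> q x" "\<And>x. 0 \<le> r x" "0 \<le> c" for p q r :: "real \<Rightarrow> real" and c
  proof -
    have "(LINT x|lborel. p x * q x * r x) \<le> (LINT x|lborel. c * (q x * r x))"
      using that
      by (intro integral_mono integrable_mult_right mdecay_integrable mdecay_mult)
         (auto simp: mult.assoc intro!: mult_right_mono)
    also have "\<dots> = c * (LINT x|lborel. q x * r x)" by simp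
    also have "\<dots> \<le> c * (sqrt (LINT x|lborel. (q x)\<^sup>2) * sqrt (LINT x|lborel. (r x)\<^sup>2))"
      using that by (intro mult_left_mono mdecay_integral_mult_le) auto
    finally show ?thesis .
  qed
  have com: "(LINT x|lborel. f1 x * k0 x * b1 x) = (LINT x|lborel. k0 x * f1 x * b1 x)"
    by (simp add: mult_ac)
  have cs: "a * b + c * d \<le> sqrt (a\<^sup>2 + c\<^sup>2) * sqrt (b\<^sup>2 + d\<^sup>2)" for a b c d :: real
    using Cauchy_Schwarz_ineq2[of "(a, c)" "(b, d)"] by (simp add: norm_Pair)
  have le: "c \<le> sqrt (a\<^sup>2 + c\<^sup>2)" for a c :: real by (rule real_le_rsqrt) simp
  let ?n = "\<lambda>g :: real \<Rightarrow> real. sqrt (LINT x|lborel. (g x)\<^sup>2)"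
  have "(LINT x|lborel. f0 x * k0 x * b0 x) + (LINT x|lborel. f0 x * k1 x * b1 x) + (LINT x|lborel. f1 x * k0 x * b1 x)
      \<le> F * (?n k0 * ?n b0) + F * (?n k1 * ?n b1) + K * (?n f1 * ?n b1)"
    unfolding com by (intro add_mono pull m nn F K F0)
  also have "\<dots> = F * (?n k0 * ?n b0 + ?n k1 * ?n b1) + K * (?n f1 * ?n b1)" by (simp add: algebra_simps)
  also have "\<dots> \<le> F * (K * B) + K * (F * B)"
  proof (intro add_mono mult_left_mono F0)
    show "?n k0 * ?n b0 + ?n k1 * ?n b1 \<le> K * B" using cs[of "?n k0" "?n b0" "?n k1" "?n b1"] by (simp add: FKB)
    show "?n f1 * ?n b1 \<le> F * B"
      using le[of "?n f1" "?n f0"] le[of "?n b1" "?n b0"] by (intro mult_mono) (simp_all add: FKB)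
  qed
  finally show ?thesis by (simp add: FKB mult_ac)
qed

text \<open>Binomial coefficients grow with the upper index and are largest in the middle of their
  row. By symmetry the index rounded up gives the same value as \<open>m div 2\<close>.\<close>

lemma A_const_ge:
  assumes "k \<le> l" "l \<le> m"
  shows "real (l choose k) \<le> real (m choose nat \<lceil>real m / 2\<rceil>)"
proof -
  have c: "nat \<lceil>real m / 2\<rceil> = m - m div 2"
  proof -
    have "\<lceil>real m / 2\<rceil> = int (m - m div 2)"
      by (intro ceiling_unique; cases "even m") (auto elim!: evenE oddE)
    then show ?thesis by simp
  qed
  have "m choose (m - m div 2) = m choose (m div 2)" by (rule binomial_symmetric[symmetric]) simp
  then show ?thesis
    unfolding c using order_trans[OF binomial_right_mono[OF assms(2)] binomial_maximum, of k] by simp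
qed

text \<open>The supremum in z goes on F whenever j < m. The single term with j = m also has l = m,
  and there K 0 takes the supremum, which is possible by \<open>1 \<le> m\<close>. In
  \<open>A_const\<close> the binomial bounds all Leibniz coefficients, the factor
  \<open>sqrt (real (m + 1))\<close> is the cost of summing over l, and the added summand covers the
  exceptional term.\<close>

lemma z_trilinear:
  fixes F K b :: "nat \<Rightarrow> 'z \<Rightarrow> real"
  assumes m: "1 \<le> m" and C: "0 \<le> C" and P: "finite_measure P"
    and meas: "\<And>l. l \<le> m \<Longrightarrow> F l \<in> borel_measurable P" "\<And>l. l \<le> m \<Longrightarrow> K l \<in> borel_measurable P"
      "\<And>l. l \<le> m \<Longrightarrow> b l \<in> borel_measurable P"
    and nn: "\<And>l z. 0 \<le> F l z" "\<And>l z. 0 \<le> K l z" "\<And>l z. 0 \<le> b l z"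
    and bd: "\<And>l z. l \<le> m \<Longrightarrow> z \<in> space P \<Longrightarrow> F l z \<le> W" "\<And>l z. l \<le> m \<Longrightarrow> z \<in> space P \<Longrightarrow> K l z \<le> W"
      "\<And>l z. l \<le> m \<Longrightarrow> z \<in> space P \<Longrightarrow> b l z \<le> W"
    and sup: "\<And>l z. l < m \<Longrightarrow> z \<in> space P \<Longrightarrow> (F l z)\<^sup>2 \<le> C\<^sup>2 * ((LINT z|P. (F l z)\<^sup>2) + (LINT z|P. (F (Suc l) z)\<^sup>2))"
      "\<And>l z. l < m \<Longrightarrow> z \<in> space P \<Longrightarrow> (K l z)\<^sup>2 \<le> C\<^sup>2 * ((LINT z|P. (K l z)\<^sup>2) + (LINT z|P. (K (Suc l) z)\<^sup>2))"
  shows "(\<Sum>l\<le>m. \<Sum>j\<le>l. real (l choose j) * (LINT z|P. F j z * K (l - j) z * b l z))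
    \<le> A_const m * C * sqrt (\<Sum>l\<le>m. LINT z|P. (F l z)\<^sup>2) * sqrt (\<Sum>l\<le>m. LINT z|P. (K l z)\<^sup>2)
        * sqrt (\<Sum>l\<le>m. LINT z|P. (b l z)\<^sup>2)"
proof -
  interpret finite_measure P by fact
  define a c d where acd: "a l = (LINT z|P. (F l z)\<^sup>2)" "c l = (LINT z|P. (K l z)\<^sup>2)" "d l = (LINT z|P. (b l z)\<^sup>2)" for l
  define Ea Ec Ed where E: "Ea = (\<Sum>l\<le>m. a l)" "Ec = (\<Sum>l\<le>m. c l)" "Ed = (\<Sum>l\<le>m. d l)"
  have acd0: "0 \<le> a l" "0 \<le> c l" "0 \<le> d l" for l by (simp_all add: acd)
  have E0: "0 \<le> Ea" "0 \<le> Ec" "0 \<le> Ed" by (auto simp: E intro!: sum_nonneg acd0)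
  define N where "N = real (m choose nat \<lceil>real m / 2\<rceil>)"
  have int1: "integrable P g" if "g \<in> borel_measurable P" "\<And>z. z \<in> space P \<Longrightarrow> 0 \<le> g z \<and> g z \<le> V" for g :: "'z \<Rightarrow> real" and V
    by (rule integrable_const_bound[where B=V]) (use that in \<open>auto intro!: AE_I2\<close>)
  have pull: "(LINT z|P. p z * q z * r z) \<le> e * (sqrt (LINT z|P. (q z)\<^sup>2) * sqrt (LINT z|P. (r z)\<^sup>2))"
    if p: "p \<in> borel_measurable P" "\<And>z. z \<in> space P \<Longrightarrow> 0 \<le> p z \<and> p z \<le> e"
      and q: "q \<in> borel_measurable P" "\<And>z. z \<in> space P \<Longrightarrow> 0 \<le> q z \<and> q z \<le> W"
      and r: "r \<in> borel_measurable P" "\<And>z. z \<in> space P \<Longrightarrow> 0 \<le> r z \<and> r z \<le> W" and e: "0 \<le> e"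
    for p q r :: "'z \<Rightarrow> real" and e
  proof -
    have iqr: "integrable P (\<lambda>z. q z * r z)"
      by (rule int1[of _ "W * W"]) (use q r in \<open>auto intro!: mult_mono order_trans[of 0 "q _" W]\<close>)
    have iq: "integrable P (\<lambda>z. (q z)\<^sup>2)" "integrable P (\<lambda>z. (r z)\<^sup>2)"
      by (rule int1[of _ "W\<^sup>2"]; use q r in \<open>auto intro!: power_mono\<close>)+
    have ipqr: "integrable P (\<lambda>z. p z * q z * r z)"
      unfolding mult.assoc
      by (rule int1[of _ "e * (W * W)"]) (use p q r e in \<open>auto intro!: mult_mono order_trans[of 0 "q _" W]\<close>)
    have "(LINT z|P. p z * q z * r z) \<le> (LINT z|P. e * (q z * r z))"
      using p q r by (intro integral_mono ipqr integrable_mult_right iqr) (auto simp: mult.assoc intro!: mult_right_mono)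
    also have "\<dots> = e * (LINT z|P. q z * r z)" by simp
    also have "\<dots> \<le> e * (sqrt (LINT z|P. (q z)\<^sup>2) * sqrt (LINT z|P. (r z)\<^sup>2))"
      using integral_le_sqrt_mult[OF iq iqr] by (intro mult_left_mono e) (rule order_trans[OF abs_ge_self])
    finally show ?thesis .
  qed
  have FC: "F l z \<le> C * sqrt (a l + a (Suc l))" if "l < m" "z \<in> space P" for l z
    using real_sqrt_le_mono[OF sup(1)[OF that]] nn(1)[of l z] C by (simp add: acd real_sqrt_mult)
  have KC: "K l z \<le> C * sqrt (c l + c (Suc l))" if "l < m" "z \<in> space P" for l z
    using real_sqrt_le_mono[OF sup(2)[OF that]] nn(2)[of l z] C by (simp add: acd real_sqrt_mult)
  have term1: "(LINT z|P. F j z * K (l - j) z * b l z) \<le> C * sqrt (a j + a (Suc j)) * (sqrt (c (l - j)) * sqrt (d l))"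
    if "j < m" "l \<le> m" for j l
    unfolding acd(2,3) by (rule pull) (use that meas nn bd FC C acd0 in auto)
  have term2: "(LINT z|P. F m z * K 0 z * b m z) \<le> C * sqrt (c 0 + c 1) * (sqrt (a m) * sqrt (d m))"
  proof -
    have "(LINT z|P. F m z * K 0 z * b m z) = (LINT z|P. K 0 z * F m z * b m z)" by (simp add: mult_ac)
    also have "\<dots> \<le> C * sqrt (c 0 + c 1) * (sqrt (a m) * sqrt (d m))"
      unfolding acd(1,3) by (rule pull) (use meas nn bd KC[of 0] C acd0 m in auto)
    finally show ?thesis .
  qed
  \<comment> \<open>A supremum of order j involves the norms of orders j and j + 1, so every norm is
    counted at most twice.\<close>
  have sa: "(\<Sum>j<m. a j + a (Suc j)) \<le> 2 * Ea"
  proof -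
    have "(\<Sum>j<m. a j) \<le> Ea" unfolding E by (intro sum_mono2) (auto simp: acd0)
    moreover have "(\<Sum>j<m. a (Suc j)) \<le> Ea"
      unfolding E lessThan_Suc_atMost[symmetric] sum.lessThan_Suc_shift[of a m] by (simp add: acd0)
    ultimately show ?thesis by (simp add: sum.distrib)
  qed
  have conv: "(\<Sum>j\<in>{..l} - {m}. sqrt (a j + a (Suc j)) * sqrt (c (l - j))) \<le> sqrt (2 * Ea) * sqrt Ec" if "l \<le> m" for l
  proof -
    have "(\<Sum>j\<in>{..l} - {m}. sqrt (a j + a (Suc j)) * sqrt (c (l - j)))\<^sup>2 \<le>
        (\<Sum>j\<in>{..l} - {m}. (sqrt (a j + a (Suc j)))\<^sup>2) * (\<Sum>j\<in>{..l} - {m}. (sqrt (c (l - j)))\<^sup>2)"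
      by (rule Cauchy_Schwarz_ineq_sum)
    also have "\<dots> \<le> (2 * Ea) * Ec"
    proof (rule mult_mono)
      have "(\<Sum>j\<in>{..l} - {m}. (sqrt (a j + a (Suc j)))\<^sup>2) = (\<Sum>j\<in>{..l} - {m}. a j + a (Suc j))"
        by (simp add: acd0)
      also have "\<dots> \<le> (\<Sum>j<m. a j + a (Suc j))" using that by (intro sum_mono2) (auto simp: acd0)
      finally show "(\<Sum>j\<in>{..l} - {m}. (sqrt (a j + a (Suc j)))\<^sup>2) \<le> 2 * Ea" using sa by simp
      have "(\<Sum>j\<in>{..l} - {m}. (sqrt (c (l - j)))\<^sup>2) \<le> (\<Sum>j\<le>l. c (l - j))"
        by (simp add: acd0) (intro sum_mono2, auto simp: acd0)
      also have "\<dots> = (\<Sum>j\<le>l. c j)" by (rule sum.nat_diff_reindex[of c "Suc l", unfolded lessThan_Suc_atMost, simplified])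
      also have "\<dots> \<le> Ec" unfolding E using that by (intro sum_mono2) (auto simp: acd0)
      finally show "(\<Sum>j\<in>{..l} - {m}. (sqrt (c (l - j)))\<^sup>2) \<le> Ec" .
    qed (auto intro!: sum_nonneg E0)
    finally have "(\<Sum>j\<in>{..l} - {m}. sqrt (a j + a (Suc j)) * sqrt (c (l - j)))\<^sup>2 \<le> (sqrt (2 * Ea) * sqrt Ec)\<^sup>2"
      using E0 by (simp add: power_mult_distrib)
    then show ?thesis by (rule power2_le_imp_le) (simp add: E0)
  qed
  have row: "(\<Sum>j\<in>{..l} - {m}. real (l choose j) * (LINT z|P. F j z * K (l - j) z * b l z))
      \<le> N * C * (sqrt (2 * Ea) * sqrt Ec) * sqrt (d l)" if l: "l \<le> m" for l
  proof -
    have "(\<Sum>j\<in>{..l} - {m}. real (l choose j) * (LINT z|P. F j z * K (l - j) z * b l z))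
        \<le> (\<Sum>j\<in>{..l} - {m}. N * (C * sqrt (a j + a (Suc j)) * (sqrt (c (l - j)) * sqrt (d l))))"
    proof (intro sum_mono mult_mono)
      fix j assume "j \<in> {..l} - {m}"
      then show "real (l choose j) \<le> N" "(LINT z|P. F j z * K (l - j) z * b l z) \<le> C * sqrt (a j + a (Suc j)) * (sqrt (c (l - j)) * sqrt (d l))"
        using l A_const_ge[of j l m] term1[of j l] by (auto simp: N_def)
      show "0 \<le> (LINT z|P. F j z * K (l - j) z * b l z)"
        by (intro Bochner_Integration.integral_nonneg) (simp add: nn)
    qed (simp add: N_def)
    also have "\<dots> = N * C * (\<Sum>j\<in>{..l} - {m}. sqrt (a j + a (Suc j)) * sqrt (c (l - j))) * sqrt (d l)"
      unfolding sum_distrib_left sum_distrib_right by (simp add: mult_ac)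
    also have "\<dots> \<le> N * C * (sqrt (2 * Ea) * sqrt Ec) * sqrt (d l)"
      by (intro mult_right_mono mult_left_mono conv l) (use C acd0 in \<open>auto simp: N_def\<close>)
    finally show ?thesis .
  qed
  let ?T = "\<lambda>l j. real (l choose j) * (LINT z|P. F j z * K (l - j) z * b l z)"
  have "(\<Sum>l\<le>m. \<Sum>j\<le>l. ?T l j) = (\<Sum>l\<le>m. (\<Sum>j\<in>{..l} - {m}. ?T l j) + (if l = m then ?T m m else 0))"
  proof (rule sum.cong[OF refl])
    fix l assume "l \<in> {..m}"
    then show "(\<Sum>j\<le>l. ?T l j) = (\<Sum>j\<in>{..l} - {m}. ?T l j) + (if l = m then ?T m m else 0)"
      by (cases "l = m") (auto simp: sum.remove[of "{..m}" m])
  qed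
  also have "\<dots> = (\<Sum>l\<le>m. \<Sum>j\<in>{..l} - {m}. ?T l j) + ?T m m"
    by (simp add: sum.distrib)
  also have "\<dots> \<le> (\<Sum>l\<le>m. N * C * (sqrt (2 * Ea) * sqrt Ec) * sqrt (d l)) + C * (sqrt Ec * (sqrt Ea * sqrt Ed))"
  proof (intro add_mono sum_mono row)
    have "c 0 + c 1 \<le> Ec"
      unfolding E using m acd0 sum_mono2[of "{..m}" "{0, 1}" c] by simp
    moreover have "a m \<le> Ea" "d m \<le> Ed" unfolding E by (auto intro!: member_le_sum acd0)
    ultimately have "C * sqrt (c 0 + c 1) * (sqrt (a m) * sqrt (d m)) \<le> C * sqrt Ec * (sqrt Ea * sqrt Ed)"
      by (intro mult_mono) (auto simp: C E0 acd0)
    then show "?T m m \<le> C * (sqrt Ec * (sqrt Ea * sqrt Ed))" using term2 by (simp add: mult.assoc)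
  qed auto
  also have "(\<Sum>l\<le>m. N * C * (sqrt (2 * Ea) * sqrt Ec) * sqrt (d l)) = N * C * (sqrt (2 * Ea) * sqrt Ec) * (\<Sum>l\<le>m. 1 * sqrt (d l))"
    by (simp add: sum_distrib_left)
  also have "\<dots> \<le> N * C * (2 * sqrt Ea * sqrt Ec) * (sqrt (real (m + 1)) * sqrt Ed)"
  proof (intro mult_mono mult_left_mono)
    have "(\<Sum>l\<le>m. 1 * sqrt (d l))\<^sup>2 \<le> (\<Sum>l\<le>m. 1\<^sup>2) * (\<Sum>l\<le>m. (sqrt (d l))\<^sup>2)" by (rule Cauchy_Schwarz_ineq_sum)
    also have "\<dots> = (sqrt (real (m + 1)) * sqrt Ed)\<^sup>2" using E0 by (simp add: power_mult_distrib acd0 E(3))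
    finally show "(\<Sum>l\<le>m. 1 * sqrt (d l)) \<le> sqrt (real (m + 1)) * sqrt Ed"
      by (rule power2_le_imp_le) (simp add: E0)
    \<comment> \<open>Rounding up produces the leading factor 2 of \<open>A_const\<close>.\<close>
    have "sqrt 2 \<le> 2" using real_sqrt_le_mono[of 2 4] by simp
    then show "sqrt (2 * Ea) \<le> 2 * sqrt Ea" unfolding real_sqrt_mult by (intro mult_right_mono) (auto simp: E0)
  qed (use C E0 in \<open>auto simp: N_def acd0 intro!: sum_nonneg\<close>)
  also have "N * C * (2 * sqrt Ea * sqrt Ec) * (sqrt (real (m + 1)) * sqrt Ed) + C * (sqrt Ec * (sqrt Ea * sqrt Ed))
      = (2 * sqrt (real (m + 1)) * N + 1) * (C * sqrt Ea * sqrt Ec * sqrt Ed)" by (simp add: algebra_simps)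
  \<comment> \<open>The summand 1 from the exceptional term is at most
    \<open>sqrt (real (m + 1))\<close>.\<close>
  also have "\<dots> \<le> A_const m * (C * sqrt Ea * sqrt Ec * sqrt Ed)"
    by (intro mult_right_mono) (use C E0 in \<open>auto simp: A_const_def N_def\<close>)
  finally show ?thesis by (simp add: E acd mult_ac)
qed

section \<open>Partial derivatives\<close>

lemma open_line:
  fixes e :: "'a::real_normed_vector"
  assumes "open U" "p \<in> U"
  shows "\<forall>\<^sub>F s in nhds 0. p + s *\<^sub>R e \<in> U"
proof -
  have "isCont (\<lambda>s. p + s *\<^sub>R e) 0" by (intro continuous_intros)
  then have "((\<lambda>s. p + s *\<^sub>R e) \<longlongrightarrow> p) (nhds 0)"
    using assms by (simp add: isCont_def tendsto_nhds_iff)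
  then show ?thesis using assms by (auto simp: tendsto_def)
qed

lemma pd_cong_open:
  fixes e :: "'a::real_normed_vector"
  assumes "open U" "\<And>q. q \<in> U \<Longrightarrow> f q = g q" "p \<in> U"
  shows "pd e f p = pd e g p"
  unfolding pd_def
  by (rule deriv_cong_ev[OF _ refl]) (use open_line[OF assms(1,3), of e] assms(2) in \<open>auto elim: eventually_mono\<close>)

text \<open>\<open>pd\<close> looks at values along a short segment, so each induction step needs
  the identity on an open set and not only at p.\<close>

lemma pd_iterate:
  fixes e :: "'a::real_normed_vector"
  assumes "open U"
    and "\<And>n p. n < N \<Longrightarrow> p \<in> U \<Longrightarrow> ((\<lambda>s. G n (p + s *\<^sub>R e)) has_real_derivative G (Suc n) p) (at 0)"
    and "\<And>p. p \<in> U \<Longrightarrow> f p = G 0 p"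
  shows "n \<le> N \<Longrightarrow> p \<in> U \<Longrightarrow> (pd e ^^ n) f p = G n p"
proof (induction n arbitrary: p)
  case (Suc n)
  have "pd e ((pd e ^^ n) f) p = pd e (G n) p"
    using Suc by (intro pd_cong_open[OF assms(1)]) auto
  also have "\<dots> = G (Suc n) p"
    unfolding pd_def using assms(2)[of n p] Suc.prems by (intro DERIV_imp_deriv) auto
  finally show ?case by simp
qed (use assms(3) in auto)

section \<open>Regularity classes and commuting partial derivatives\<close>

lemma Ck_on_DERIV:
  assumes "Ck_on (Suc k) U f" "e \<in> Basis" "p + s0 *\<^sub>R e \<in> U"
  shows "((\<lambda>s. f (p + s *\<^sub>R e)) has_real_derivative pd e f (p + s0 *\<^sub>R e)) (at s0)"
proof -
  have "(\<lambda>s::real. f ((p + s0 *\<^sub>R e) + s *\<^sub>R e)) differentiable (at 0)" using assms by auto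
  then have "((\<lambda>s::real. f ((p + s0 *\<^sub>R e) + s *\<^sub>R e)) has_real_derivative pd e f (p + s0 *\<^sub>R e)) (at 0)"
    unfolding pd_def by (simp add: DERIV_deriv_iff_real_differentiable)
  moreover have "(p + s0 *\<^sub>R e) + s *\<^sub>R e = p + (s + s0) *\<^sub>R e" for s by (simp add: algebra_simps)
  ultimately show ?thesis using DERIV_shift[of "\<lambda>s. f (p + s *\<^sub>R e)" _ 0 s0] by simp
qed

lemma Ck_on_Suc_imp: "Ck_on (Suc k) U f \<Longrightarrow> Ck_on k U f"
  by (induction k arbitrary: f) auto

lemma Ck_on_mono: "Ck_on n U f \<Longrightarrow> k \<le> n \<Longrightarrow> Ck_on k U f"
proof (induction n)
  case (Suc n)
  then show ?case using Ck_on_Suc_imp[of n U f] by (cases "k = Suc n") auto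
qed simp

lemma Ck_on_imp_continuous: "Ck_on k U f \<Longrightarrow> continuous_on U f"
  by (cases k) auto

lemma pds_Cons: "pds (e # es) f = pd e (pds es f)"
  by (simp add: pds_def)

lemma pds_Nil [simp]: "pds [] f = f"
  by (simp add: pds_def)

lemma Ck_on_pds:
  "Ck_on n U f \<Longrightarrow> set es \<subseteq> Basis \<Longrightarrow> length es + k \<le> n \<Longrightarrow> Ck_on k U (pds es f)"
proof (induction es arbitrary: k)
  case Nil
  then show ?case by (auto intro: Ck_on_mono)
next
  case (Cons e es)
  have "Ck_on (Suc k) U (pds es f)" using Cons.prems by (intro Cons.IH) auto
  then show ?case using Cons.prems by (simp add: pds_Cons)
qed

text \<open>Schwarz's theorem by second differences: the mean value theorem, applied to \<Delta> in
  both orders, shows that r^2 times either mixed derivative, each at some point of a small square,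
  equals \<Delta>. Continuity at p then excludes a gap of size 2 \<eta>.\<close>

lemma pd_commute:
  fixes f :: "'a::euclidean_space \<Rightarrow> real"
  assumes U: "open U" and f: "Ck_on (Suc (Suc 0)) U f" and ab: "a \<in> Basis" "b \<in> Basis" and p: "p \<in> U"
  shows "pd a (pd b f) p = pd b (pd a f) p"
proof (rule ccontr)
  let ?ab = "pd a (pd b f)" and ?ba = "pd b (pd a f)"
  assume ne: "?ab p \<noteq> ?ba p"
  define \<eta> where "\<eta> = \<bar>?ab p - ?ba p\<bar> / 2"
  have \<eta>: "0 < \<eta>" using ne by (simp add: \<eta>_def)
  have c: "continuous_on U ?ab" "continuous_on U ?ba" using f ab by auto
  obtain d1 where d1: "0 < d1" "\<And>q. q \<in> U \<Longrightarrow> dist q p < d1 \<Longrightarrow> dist (?ab q) (?ab p) < \<eta>"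
    using c(1) p \<eta> unfolding continuous_on_iff by meson
  obtain d2 where d2: "0 < d2" "\<And>q. q \<in> U \<Longrightarrow> dist q p < d2 \<Longrightarrow> dist (?ba q) (?ba p) < \<eta>"
    using c(2) p \<eta> unfolding continuous_on_iff by meson
  obtain d3 where d3: "0 < d3" "ball p d3 \<subseteq> U" using U p by (meson openE)
  define d where "d = min d1 (min d2 d3)"
  \<comment> \<open>All points of the square of side r lie within 2 r < d of p.\<close>
  define r where "r = d / 3"
  have r: "0 < r" using d1(1) d2(1) d3(1) by (simp add: r_def d_def)
  have near: "dist (p + s *\<^sub>R a + s' *\<^sub>R b) p < d" if "0 \<le> s" "s \<le> r" "0 \<le> s'" "s' \<le> r" for s s'
  proof -
    have "dist (p + s *\<^sub>R a + s' *\<^sub>R b) p \<le> norm (s *\<^sub>R a) + norm (s' *\<^sub>R b)"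
      using norm_triangle_ineq[of "s *\<^sub>R a" "s' *\<^sub>R b"] by (simp add: dist_norm add.assoc)
    also have "\<dots> \<le> 2 * r" using that ab by simp
    finally show ?thesis using r by (simp add: r_def)
  qed
  have inU: "p + s *\<^sub>R a + s' *\<^sub>R b \<in> U" if "0 \<le> s" "s \<le> r" "0 \<le> s'" "s' \<le> r" for s s'
    using near[OF that] d3(2) by (auto simp: d_def dist_commute)
  note Ca = Ck_on_DERIV[OF f ab(1)] and Cb = Ck_on_DERIV[OF f ab(2)]
  have f': "Ck_on (Suc 0) U (pd a f)" "Ck_on (Suc 0) U (pd b f)" using f ab by auto
  define \<Delta> where "\<Delta> = f (p + r *\<^sub>R a + r *\<^sub>R b) - f (p + r *\<^sub>R a) - f (p + r *\<^sub>R b) + f p"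
  obtain s where s: "0 < s" "s < r" and \<Delta>s: "\<Delta> = r * (pd a f (p + s *\<^sub>R a + r *\<^sub>R b) - pd a f (p + s *\<^sub>R a))"
  proof -
    have "((\<lambda>s. f ((p + r *\<^sub>R b) + s *\<^sub>R a) - f (p + s *\<^sub>R a)) has_real_derivative
        pd a f ((p + r *\<^sub>R b) + s *\<^sub>R a) - pd a f (p + s *\<^sub>R a)) (at s)" if "0 \<le> s" "s \<le> r" for s
      using inU[of s r] inU[of s 0] that r by (intro DERIV_diff Ca) (auto simp: add_ac)
    from MVT2[OF r this] show ?thesis using that by (auto simp: \<Delta>_def add_ac)
  qed
  obtain s' where s': "0 < s'" "s' < r" and \<Delta>1: "\<Delta> = r * (r * ?ba (p + s *\<^sub>R a + s' *\<^sub>R b))"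
  proof -
    have "((\<lambda>s'. pd a f ((p + s *\<^sub>R a) + s' *\<^sub>R b)) has_real_derivative
        ?ba ((p + s *\<^sub>R a) + s' *\<^sub>R b)) (at s')" if "0 \<le> s'" "s' \<le> r" for s'
      using inU[of s s'] that s r by (intro Ck_on_DERIV[OF f'(1) ab(2)]) auto
    from MVT2[OF r this] show ?thesis using that by (auto simp: \<Delta>s)
  qed
  obtain q where q: "0 < q" "q < r" and \<Delta>q: "\<Delta> = r * (pd b f (p + r *\<^sub>R a + q *\<^sub>R b) - pd b f (p + q *\<^sub>R b))"
  proof -
    have "((\<lambda>s. f ((p + r *\<^sub>R a) + s *\<^sub>R b) - f (p + s *\<^sub>R b)) has_real_derivative
        pd b f ((p + r *\<^sub>R a) + s *\<^sub>R b) - pd b f (p + s *\<^sub>R b)) (at s)" if "0 \<le> s" "s \<le> r" for s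
      using inU[of r s] inU[of 0 s] that r by (intro DERIV_diff Cb) (auto simp: add_ac)
    from MVT2[OF r this] show ?thesis using that by (auto simp: \<Delta>_def add_ac)
  qed
  obtain q' where q': "0 < q'" "q' < r" and \<Delta>2: "\<Delta> = r * (r * ?ab (p + q' *\<^sub>R a + q *\<^sub>R b))"
  proof -
    have "((\<lambda>s'. pd b f ((p + q *\<^sub>R b) + s' *\<^sub>R a)) has_real_derivative
        ?ab ((p + q *\<^sub>R b) + s' *\<^sub>R a)) (at s')" if "0 \<le> s'" "s' \<le> r" for s'
      using inU[of s' q] that q r by (intro Ck_on_DERIV[OF f'(2) ab(1)]) (auto simp: add_ac)
    from MVT2[OF r this] show ?thesis using that by (auto simp: \<Delta>q add_ac)
  qed
  have "?ba (p + s *\<^sub>R a + s' *\<^sub>R b) = ?ab (p + q' *\<^sub>R a + q *\<^sub>R b)"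
    using \<Delta>1 \<Delta>2 r by simp
  moreover have "dist (?ba (p + s *\<^sub>R a + s' *\<^sub>R b)) (?ba p) < \<eta>"
    using near[of s s'] s s' by (intro d2 inU) (auto simp: d_def)
  moreover have "dist (?ab (p + q' *\<^sub>R a + q *\<^sub>R b)) (?ab p) < \<eta>"
    using near[of q' q] q q' by (intro d1 inU) (auto simp: d_def)
  ultimately have "\<bar>?ab p - ?ba p\<bar> < 2 * \<eta>" by (simp add: dist_real_def)
  then show False by (simp add: \<eta>_def)
qed

text \<open>A derivative taken last is moved inwards past es1, so that lists of directions can be
  kept in one fixed order.\<close>

lemma pd_pds_commute:
  assumes U: "open U" and f: "Ck_on n U f" and e: "e \<in> Basis"
  shows "set (es1 @ es2) \<subseteq> Basis \<Longrightarrow> length (es1 @ es2) < n \<Longrightarrow> p \<in> U \<Longrightarrow>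
    pd e (pds (es1 @ es2) f) p = pds (es1 @ e # es2) f p"
proof (induction es1 arbitrary: p)
  case (Cons a es1)
  have C: "Ck_on (Suc (Suc 0)) U (pds (es1 @ es2) f)" using Cons.prems by (intro Ck_on_pds[OF f]) auto
  have "pd e (pd a (pds (es1 @ es2) f)) p = pd a (pd e (pds (es1 @ es2) f)) p"
    using Cons.prems by (intro pd_commute[OF U C e]) auto
  also have "\<dots> = pd a (pds (es1 @ e # es2) f) p"
    using Cons by (intro pd_cong_open[OF U]) auto
  finally show ?case by (simp add: pds_Cons)
qed (simp add: pds_Cons)

text \<open>The product rule together with Pascal's rule. It advances by one derivative at a time,
  as needed in an induction on the order in z whose hypothesis is an identity on I.\<close>

lemma Leibniz_step:
  fixes a b :: "nat \<Rightarrow> real \<Rightarrow> real"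
  assumes "\<And>k. k \<le> n \<Longrightarrow> (a k has_real_derivative a (Suc k) z) (at z)"
    and "\<And>k. k \<le> n \<Longrightarrow> (b k has_real_derivative b (Suc k) z) (at z)"
  shows "((\<lambda>z. \<Sum>k\<le>n. real (n choose k) * (a k z * b (n - k) z)) has_real_derivative
    (\<Sum>k\<le>Suc n. real (Suc n choose k) * (a k z * b (Suc n - k) z))) (at z)"
proof -
  have 1: "((\<lambda>z. \<Sum>k\<le>n. real (n choose k) * (a k z * b (n - k) z)) has_real_derivative
    (\<Sum>k\<le>n. real (n choose k) * (a (Suc k) z * b (n - k) z + a k z * b (Suc n - k) z))) (at z)"
  proof (rule DERIV_sum)
    fix k assume "k \<in> {..n}"
    then have "k \<le> n" "Suc (n - k) = Suc n - k" by auto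
    then show "((\<lambda>z. real (n choose k) * (a k z * b (n - k) z)) has_real_derivative
        real (n choose k) * (a (Suc k) z * b (n - k) z + a k z * b (Suc n - k) z)) (at z)"
      using assms(1)[of k] assms(2)[of "n - k"] by (auto intro!: derivative_eq_intros)
  qed
  define g where "g k = a k z * b (Suc n - k) z" for k
  have "(\<Sum>k\<le>Suc n. real (Suc n choose k) * g k) = g 0 + (\<Sum>k\<le>n. real (Suc n choose Suc k) * g (Suc k))"
    by (simp add: sum.atMost_Suc_shift del: binomial_Suc_Suc sum.atMost_Suc)
  also have "\<dots> = (\<Sum>k\<le>n. real (n choose k) * g (Suc k)) + (g 0 + (\<Sum>k\<le>n. real (n choose Suc k) * g (Suc k)))"
    by (simp add: algebra_simps sum.distrib)
  also have "g 0 + (\<Sum>k\<le>n. real (n choose Suc k) * g (Suc k)) = (\<Sum>k\<le>Suc n. real (n choose k) * g k)"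
    by (simp add: sum.atMost_Suc_shift del: sum.atMost_Suc)
  also have "\<dots> = (\<Sum>k\<le>n. real (n choose k) * g k)" by simp
  finally have "(\<Sum>k\<le>Suc n. real (Suc n choose k) * g k) = (\<Sum>k\<le>n. real (n choose k) * (g (Suc k) + g k))"
    by (simp add: algebra_simps sum.distrib)
  then show ?thesis using 1 by (simp add: g_def del: sum.atMost_Suc)
qed

text \<open>All difference quotients of R along I are 0, and z is approached within I.\<close>

lemma DERIV_zero_islimpt:
  fixes R :: "real \<Rightarrow> real"
  assumes D: "(R has_real_derivative R') (at z)" and "z islimpt I" and "z \<in> I" and 0: "\<And>y. y \<in> I \<Longrightarrow> R y = 0"
  shows "R' = 0"
proof -
  have ne: "at z within I \<noteq> bot" using assms(2) by (simp add: trivial_limit_within)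
  have "((\<lambda>y. (R y - R z) / (y - z)) \<longlongrightarrow> R') (at z within I)"
    using D has_field_derivative_at_within[of R R' z I] by (simp add: has_field_derivative_iff)
  moreover have "((\<lambda>y. (R y - R z) / (y - z)) \<longlongrightarrow> 0) (at z within I)"
    by (rule tendsto_eventually) (use 0 \<open>z \<in> I\<close> in \<open>auto simp: eventually_at_filter\<close>)
  ultimately show ?thesis using tendsto_unique[OF ne] by blast
qed

lemma DERIV_eq_islimpt:
  fixes f g :: "real \<Rightarrow> real"
  assumes "(f has_real_derivative f') (at z)" "(g has_real_derivative g') (at z)"
    and "z islimpt I" "z \<in> I" "\<And>y. y \<in> I \<Longrightarrow> f y = g y"
  shows "f' = g'"
  using DERIV_zero_islimpt[OF DERIV_diff[OF assms(1,2)] assms(3,4)] assms(5) by auto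

text \<open>\<open>sqrtM\<close> has the logarithmic derivative -v/2, so dividing by it before
  differentiating turns the inner derivative into A, and the outer one becomes -A* in the same
  way.\<close>

lemma FP_op_eq:
  assumes k: "\<And>v. (k has_real_derivative k' v) (at v)" "\<And>v. (k' has_real_derivative k'' v) (at v)"
  shows "FP_op k v = k'' v + (1 / 2 - v\<^sup>2 / 4) * k v"
proof -
  have M: "Maxw w = sqrtM w * sqrtM w" for w using sqrtM_power2[of w] by (simp add: power2_eq_square)
  have s0: "sqrtM w \<noteq> 0" for w using sqrtM_pos[of w] by simp
  have "((\<lambda>r. k r / sqrt (Maxw r)) has_real_derivative (k' w + w / 2 * k w) / sqrtM w) (at w)" for w
    unfolding sqrtM_def[symmetric]
    by (auto intro!: derivative_eq_intros k simp: s0 field_simps)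
  then have d1: "deriv (\<lambda>r. k r / sqrt (Maxw r)) w = (k' w + w / 2 * k w) / sqrtM w" for w
    by (rule DERIV_imp_deriv)
  have e: "(\<lambda>w. Maxw w * deriv (\<lambda>r. k r / sqrt (Maxw r)) w) = (\<lambda>w. sqrtM w * (k' w + w / 2 * k w))"
    unfolding d1 unfolding M using s0 by auto
  have "((\<lambda>w. sqrtM w * (k' w + w / 2 * k w)) has_real_derivative
      sqrtM v * (k'' v + (1 / 2 - v\<^sup>2 / 4) * k v)) (at v)"
    by (auto intro!: derivative_eq_intros k simp: field_simps power2_eq_square)
  then show ?thesis
    unfolding FP_op_def e unfolding sqrtM_def[symmetric] using s0[of v] by (simp add: DERIV_imp_deriv)
qed

section \<open>Families of derivatives\<close>

text \<open>Families indexed by the orders of the derivatives: \<open>H k j l i\<close> stands for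
  \<open>\<partial>\<^sub>t\<^sup>k \<partial>\<^sub>v\<^sup>j \<partial>\<^sub>z\<^sup>l \<partial>\<^sub>x\<^sup>i h\<close> and \<open>F k l i\<close> for \<open>\<partial>\<^sub>t\<^sup>k \<partial>\<^sub>z\<^sup>l \<partial>\<^sub>x\<^sup>i f\<close>.\<close>

definition kin_family ::
  "nat \<Rightarrow> real set \<Rightarrow> (nat \<Rightarrow> nat \<Rightarrow> nat \<Rightarrow> nat \<Rightarrow> real \<Rightarrow> real \<Rightarrow> real \<Rightarrow> real \<Rightarrow> real) \<Rightarrow> bool" where
  "kin_family N J H \<longleftrightarrow>
    (\<forall>k j l i t x v z. k + j + l + i < N \<and> 0 \<le> t \<and> z \<in> J \<longrightarrow>
      ((\<lambda>s. H k j l i s x v z) has_real_derivative H (Suc k) j l i t x v z) (at t within {0..}) \<and>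
      ((\<lambda>s. H k j l i t x s z) has_real_derivative H k (Suc j) l i t x v z) (at v) \<and>
      ((\<lambda>s. H k j l i t x v s) has_real_derivative H k j (Suc l) i t x v z) (at z) \<and>
      ((\<lambda>s. H k j l i t s v z) has_real_derivative H k j l (Suc i) t x v z) (at x)) \<and>
    (\<forall>k j l i t. k + j + l + i \<le> N \<and> 0 \<le> t \<longrightarrow>
      continuous_on (UNIV \<times> UNIV \<times> J) (\<lambda>(x, v, z). H k j l i t x v z)) \<and>
    (\<forall>T. \<exists>K. \<forall>k j l i t x v z. k + j + l + i \<le> N \<and> 0 \<le> t \<and> t \<le> T \<and> z \<in> J \<longrightarrow>
      \<bar>H k j l i t x v z\<bar> \<le> K / ((1 + x\<^sup>2) * (1 + v\<^sup>2)))"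

definition mac_family ::
  "nat \<Rightarrow> real set \<Rightarrow> (nat \<Rightarrow> nat \<Rightarrow> nat \<Rightarrow> real \<Rightarrow> real \<Rightarrow> real \<Rightarrow> real) \<Rightarrow> bool" where
  "mac_family N J F \<longleftrightarrow>
    (\<forall>k l i t x z. k + l + i < N \<and> 0 \<le> t \<and> z \<in> J \<longrightarrow>
      ((\<lambda>s. F k l i s x z) has_real_derivative F (Suc k) l i t x z) (at t within {0..}) \<and>
      ((\<lambda>s. F k l i t x s) has_real_derivative F k (Suc l) i t x z) (at z) \<and>
      ((\<lambda>s. F k l i t s z) has_real_derivative F k l (Suc i) t x z) (at x)) \<and>
    (\<forall>k l i t. k + l + i \<le> N \<and> 0 \<le> t \<longrightarrow> continuous_on (UNIV \<times> J) (\<lambda>(x, z). F k l i t x z)) \<and>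
    (\<forall>T. \<exists>K. \<forall>k l i t x z. k + l + i \<le> N \<and> 0 \<le> t \<and> t \<le> T \<and> z \<in> J \<longrightarrow>
      \<bar>F k l i t x z\<bar> \<le> K / (1 + x\<^sup>2))"

text \<open>Time is the outermost and x the innermost direction. This is the order of
  \<open>(pd ez3 ^^ l) ((pd ex3 ^^ i) g)\<close> in the energies, so that their terms are members of
  the family as they stand.\<close>

definition kin_derivs ::
  "(real \<Rightarrow> real \<times> real \<times> real \<Rightarrow> real) \<Rightarrow> nat \<Rightarrow> nat \<Rightarrow> nat \<Rightarrow> nat \<Rightarrow> real \<Rightarrow> real \<Rightarrow> real \<Rightarrow> real \<Rightarrow> real" where
  "kin_derivs h k j l i t x v z =
    pds (replicate k (1, 0) @ replicate j (0, ev3) @ replicate l (0, ez3) @ replicate i (0, ex3))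
      (\<lambda>(t, p). h t p) (t, x, v, z)"

definition mac_derivs ::
  "(real \<Rightarrow> real \<times> real \<Rightarrow> real) \<Rightarrow> nat \<Rightarrow> nat \<Rightarrow> nat \<Rightarrow> real \<Rightarrow> real \<Rightarrow> real \<Rightarrow> real" where
  "mac_derivs f k l i t x z =
    pds (replicate k (1, 0) @ replicate l (0, ez2) @ replicate i (0, ex2)) (\<lambda>(t, p). f t p) (t, x, z)"

text \<open>Turns one constant per multi-index into a common one, the sum of their absolute
  values.\<close>

lemma finite_uniform_bound:
  fixes f :: "'i \<Rightarrow> 'p \<Rightarrow> real" and w :: "'p \<Rightarrow> real"
  assumes "finite A" "\<And>i. i \<in> A \<Longrightarrow> \<exists>K. \<forall>p\<in>S. \<bar>f i p\<bar> \<le> K / w p" "\<And>p. p \<in> S \<Longrightarrow> 0 < w p"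
  shows "\<exists>K. \<forall>i\<in>A. \<forall>p\<in>S. \<bar>f i p\<bar> \<le> K / w p"
proof -
  obtain K where K: "\<And>i p. i \<in> A \<Longrightarrow> p \<in> S \<Longrightarrow> \<bar>f i p\<bar> \<le> K i / w p"
    using assms(2) by metis
  have "\<bar>f i p\<bar> \<le> (\<Sum>i\<in>A. \<bar>K i\<bar>) / w p" if "i \<in> A" "p \<in> S" for i p
  proof (rule order_trans[OF K[OF that]])
    have "K i \<le> \<bar>K i\<bar>" by simp
    also have "\<dots> \<le> (\<Sum>i\<in>A. \<bar>K i\<bar>)" using that assms(1) by (intro member_le_sum) auto
    finally show "K i / w p \<le> (\<Sum>i\<in>A. \<bar>K i\<bar>) / w p" using assms(3)[OF that(2)] by (intro divide_right_mono) auto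
  qed
  then show ?thesis by blast
qed

lemma Basis_kinetic: "(1, 0) \<in> (Basis :: (real \<times> real \<times> real \<times> real) set)" "(0, ev3) \<in> (Basis :: (real \<times> real \<times> real \<times> real) set)"
    "(0, ez3) \<in> (Basis :: (real \<times> real \<times> real \<times> real) set)" "(0, ex3) \<in> (Basis :: (real \<times> real \<times> real \<times> real) set)"
  and Basis_macroscopic: "(1, 0) \<in> (Basis :: (real \<times> real \<times> real) set)"
    "(0, ez2) \<in> (Basis :: (real \<times> real \<times> real) set)" "(0, ex2) \<in> (Basis :: (real \<times> real \<times> real) set)"
  by (auto simp: Basis_prod_def zero_prod_def)

lemma kin_family_derivs:
  assumes U: "open U" "{0..} \<times> UNIV \<times> UNIV \<times> J \<subseteq> U" and C: "Ck_on N U (\<lambda>(t, p). h t p)"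
    and b: "\<And>es T. set es \<subseteq> Basis \<Longrightarrow> length es \<le> N \<Longrightarrow>
        \<exists>K. \<forall>t\<in>{0..T}. \<forall>x v. \<forall>z\<in>J. \<bar>pds es (\<lambda>(t, p). h t p) (t, x, v, z)\<bar> \<le> K / ((1 + x\<^sup>2) * (1 + v\<^sup>2))"
  shows "kin_family N J (kin_derivs h)"
  unfolding kin_family_def
proof (intro conjI allI impI)
  let ?f = "\<lambda>(t, p). h t p"
  let ?es = "\<lambda>k j l i. replicate k (1, 0) @ replicate j (0, ev3) @ replicate l (0, ez3) @ replicate i (0, ex3)
    :: (real \<times> real \<times> real \<times> real) list"
  have B: "set (?es k j l i) \<subseteq> Basis" for k j l i
    using Basis_kinetic by auto
  {
    fix k j l i :: nat and t x v z :: real assume *: "k + j + l + i < N \<and> 0 \<le> t \<and> z \<in> J"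
    then have p: "(t, x, v, z) \<in> U" using U by auto
    have C1: "Ck_on (Suc 0) U (pds (?es k j l i) ?f)"
      using * B by (intro Ck_on_pds[OF C]) auto
    note D = Ck_on_DERIV[OF C1]
    have len: "length (?es k j l i) < N" using * by simp
    have "pd (1, 0) (pds (?es k j l i) ?f) (t, x, v, z) = kin_derivs h (Suc k) j l i t x v z"
      by (simp add: kin_derivs_def pds_Cons)
    then show "((\<lambda>s. kin_derivs h k j l i s x v z) has_real_derivative kin_derivs h (Suc k) j l i t x v z) (at t within {0..})"
      using D[of "(1, 0)" "(0, x, v, z)" t] p Basis_kinetic by (auto simp: kin_derivs_def zero_prod_def intro: has_field_derivative_at_within)
    have "pd (0, ev3) (pds (?es k j l i) ?f) (t, x, v, z) = kin_derivs h k (Suc j) l i t x v z"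
      using pd_pds_commute[OF U(1) C Basis_kinetic(2), of "replicate k (1, 0)" "?es 0 j l i"] B[of k j l i] len p
      by (simp add: kin_derivs_def)
    then show "((\<lambda>s. kin_derivs h k j l i t x s z) has_real_derivative kin_derivs h k (Suc j) l i t x v z) (at v)"
      using D[of "(0, ev3)" "(t, x, 0, z)" v] p Basis_kinetic by (simp add: kin_derivs_def)
    have "pd (0, ez3) (pds (?es k j l i) ?f) (t, x, v, z) = kin_derivs h k j (Suc l) i t x v z"
      using pd_pds_commute[OF U(1) C Basis_kinetic(3), of "?es k j 0 0" "?es 0 0 l i"] B[of k j l i] len p
      by (simp add: kin_derivs_def)
    then show "((\<lambda>s. kin_derivs h k j l i t x v s) has_real_derivative kin_derivs h k j (Suc l) i t x v z) (at z)"
      using D[of "(0, ez3)" "(t, x, v, 0)" z] p Basis_kinetic by (simp add: kin_derivs_def)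
    have "pd (0, ex3) (pds (?es k j l i) ?f) (t, x, v, z) = kin_derivs h k j l (Suc i) t x v z"
      using pd_pds_commute[OF U(1) C Basis_kinetic(4), of "?es k j l 0" "?es 0 0 0 i"] B[of k j l i] len p
      by (simp add: kin_derivs_def)
    then show "((\<lambda>s. kin_derivs h k j l i t s v z) has_real_derivative kin_derivs h k j l (Suc i) t x v z) (at x)"
      using D[of "(0, ex3)" "(t, 0, v, z)" x] p Basis_kinetic by (simp add: kin_derivs_def)
  }
  {
    fix k j l i :: nat and t :: real assume *: "k + j + l + i \<le> N \<and> 0 \<le> (t::real)"
    have "continuous_on U (pds (?es k j l i) ?f)"
      using * B by (intro Ck_on_imp_continuous[of 0] Ck_on_pds[OF C]) auto
    then have "continuous_on (UNIV \<times> UNIV \<times> J) (\<lambda>p. pds (?es k j l i) ?f (t, p))"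
      by (rule continuous_on_compose2) (use U * in \<open>auto intro!: continuous_intros\<close>)
    then show "continuous_on (UNIV \<times> UNIV \<times> J) (\<lambda>(x, v, z). kin_derivs h k j l i t x v z)"
      by (simp add: kin_derivs_def case_prod_beta)
  }
  fix T :: real
  let ?A = "{(k, j, l, i). k + j + l + i \<le> N}"
  let ?S = "{(t, x, v, z). 0 \<le> t \<and> t \<le> T \<and> z \<in> J}"
  have "finite ?A"
    by (rule finite_subset[of _ "{..N} \<times> {..N} \<times> {..N} \<times> {..N}"]) auto
  moreover have "\<exists>K. \<forall>p\<in>?S. \<bar>(case q of (k, j, l, i) \<Rightarrow> case p of (t, x, v, z) \<Rightarrow> kin_derivs h k j l i t x v z)\<bar>
      \<le> K / (case p of (t, x, v, z) \<Rightarrow> (1 + x\<^sup>2) * (1 + v\<^sup>2))" if "q \<in> ?A" for q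
  proof -
    obtain k j l i where q: "q = (k, j, l, i)" by (cases q) auto
    have "length (?es k j l i) \<le> N" using that q by simp
    from b[OF B this, of T] obtain K where
      "\<forall>t\<in>{0..T}. \<forall>x v. \<forall>z\<in>J. \<bar>kin_derivs h k j l i t x v z\<bar> \<le> K / ((1 + x\<^sup>2) * (1 + v\<^sup>2))"
      unfolding kin_derivs_def by blast
    then show ?thesis unfolding q by (intro exI[of _ K]) auto
  qed
  ultimately have "\<exists>K. \<forall>q\<in>?A. \<forall>p\<in>?S. \<bar>(case q of (k, j, l, i) \<Rightarrow> case p of (t, x, v, z) \<Rightarrow> kin_derivs h k j l i t x v z)\<bar>
      \<le> K / (case p of (t, x, v, z) \<Rightarrow> (1 + x\<^sup>2) * (1 + v\<^sup>2))"
    by (intro finite_uniform_bound) (auto intro!: mult_pos_pos)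
  then show "\<exists>K. \<forall>k j l i t x v z. k + j + l + i \<le> N \<and> 0 \<le> t \<and> t \<le> T \<and> z \<in> J \<longrightarrow>
      \<bar>kin_derivs h k j l i t x v z\<bar> \<le> K / ((1 + x\<^sup>2) * (1 + v\<^sup>2))"
    by (elim ex_forward) auto
qed

lemma mac_family_derivs:
  assumes U: "open U" "{0..} \<times> UNIV \<times> J \<subseteq> U" and C: "Ck_on N U (\<lambda>(t, p). f t p)"
    and b: "\<And>es T. set es \<subseteq> Basis \<Longrightarrow> length es \<le> N \<Longrightarrow>
        \<exists>K. \<forall>t\<in>{0..T}. \<forall>x. \<forall>z\<in>J. \<bar>pds es (\<lambda>(t, p). f t p) (t, x, z)\<bar> \<le> K / (1 + x\<^sup>2)"
  shows "mac_family N J (mac_derivs f)"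
  unfolding mac_family_def
proof (intro conjI allI impI)
  let ?f = "\<lambda>(t, p). f t p"
  let ?es = "\<lambda>k l i. replicate k (1, 0) @ replicate l (0, ez2) @ replicate i (0, ex2)
    :: (real \<times> real \<times> real) list"
  have B: "set (?es k l i) \<subseteq> Basis" for k l i
    using Basis_macroscopic by auto
  {
    fix k l i :: nat and t x z :: real assume *: "k + l + i < N \<and> 0 \<le> t \<and> z \<in> J"
    then have p: "(t, x, z) \<in> U" using U by auto
    have C1: "Ck_on (Suc 0) U (pds (?es k l i) ?f)"
      using * B by (intro Ck_on_pds[OF C]) auto
    note D = Ck_on_DERIV[OF C1]
    have len: "length (?es k l i) < N" using * by simp
    have "pd (1, 0) (pds (?es k l i) ?f) (t, x, z) = mac_derivs f (Suc k) l i t x z"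
      by (simp add: mac_derivs_def pds_Cons)
    then show "((\<lambda>s. mac_derivs f k l i s x z) has_real_derivative mac_derivs f (Suc k) l i t x z) (at t within {0..})"
      using D[of "(1, 0)" "(0, x, z)" t] p Basis_macroscopic by (auto simp: mac_derivs_def zero_prod_def intro: has_field_derivative_at_within)
    have "pd (0, ez2) (pds (?es k l i) ?f) (t, x, z) = mac_derivs f k (Suc l) i t x z"
      using pd_pds_commute[OF U(1) C Basis_macroscopic(2), of "?es k 0 0" "?es 0 l i"] B[of k l i] len p
      by (simp add: mac_derivs_def)
    then show "((\<lambda>s. mac_derivs f k l i t x s) has_real_derivative mac_derivs f k (Suc l) i t x z) (at z)"
      using D[of "(0, ez2)" "(t, x, 0)" z] p Basis_macroscopic by (simp add: mac_derivs_def)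
    have "pd (0, ex2) (pds (?es k l i) ?f) (t, x, z) = mac_derivs f k l (Suc i) t x z"
      using pd_pds_commute[OF U(1) C Basis_macroscopic(3), of "?es k l 0" "?es 0 0 i"] B[of k l i] len p
      by (simp add: mac_derivs_def)
    then show "((\<lambda>s. mac_derivs f k l i t s z) has_real_derivative mac_derivs f k l (Suc i) t x z) (at x)"
      using D[of "(0, ex2)" "(t, 0, z)" x] p Basis_macroscopic by (simp add: mac_derivs_def)
  }
  {
    fix k l i :: nat and t :: real assume *: "k + l + i \<le> N \<and> 0 \<le> (t::real)"
    have "continuous_on U (pds (?es k l i) ?f)"
      using * B by (intro Ck_on_imp_continuous[of 0] Ck_on_pds[OF C]) auto
    then have "continuous_on (UNIV \<times> J) (\<lambda>p. pds (?es k l i) ?f (t, p))"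
      by (rule continuous_on_compose2) (use U * in \<open>auto intro!: continuous_intros\<close>)
    then show "continuous_on (UNIV \<times> J) (\<lambda>(x, z). mac_derivs f k l i t x z)"
      by (simp add: mac_derivs_def case_prod_beta)
  }
  fix T :: real
  let ?A = "{(k, l, i). k + l + i \<le> N}"
  let ?S = "{(t, x, z). 0 \<le> t \<and> t \<le> T \<and> z \<in> J}"
  have "finite ?A"
    by (rule finite_subset[of _ "{..N} \<times> {..N} \<times> {..N}"]) auto
  moreover have "\<exists>K. \<forall>p\<in>?S. \<bar>(case q of (k, l, i) \<Rightarrow> case p of (t, x, z) \<Rightarrow> mac_derivs f k l i t x z)\<bar>
      \<le> K / (case p of (t, x, z) \<Rightarrow> 1 + x\<^sup>2)" if "q \<in> ?A" for q
  proof -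
    obtain k l i where q: "q = (k, l, i)" by (cases q) auto
    have "length (?es k l i) \<le> N" using that q by simp
    from b[OF B this, of T] obtain K where
      "\<forall>t\<in>{0..T}. \<forall>x. \<forall>z\<in>J. \<bar>mac_derivs f k l i t x z\<bar> \<le> K / (1 + x\<^sup>2)"
      unfolding mac_derivs_def by blast
    then show ?thesis unfolding q by (intro exI[of _ K]) auto
  qed
  ultimately have "\<exists>K. \<forall>q\<in>?A. \<forall>p\<in>?S. \<bar>(case q of (k, l, i) \<Rightarrow> case p of (t, x, z) \<Rightarrow> mac_derivs f k l i t x z)\<bar>
      \<le> K / (case p of (t, x, z) \<Rightarrow> 1 + x\<^sup>2)"
    by (intro finite_uniform_bound) (auto intro!: mult_pos_pos)
  then show "\<exists>K. \<forall>k l i t x z. k + l + i \<le> N \<and> 0 \<le> t \<and> t \<le> T \<and> z \<in> J \<longrightarrow>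
      \<bar>mac_derivs f k l i t x z\<bar> \<le> K / (1 + x\<^sup>2)"
    by (elim ex_forward) auto
qed

lemma regular_pair_families:
  assumes "regular_pair m I h \<phi>"
  obtains J where "open J" "I \<subseteq> J" "kin_family (m + 3) J (kin_derivs h)"
    "mac_family (m + 2) J (mac_derivs (\<lambda>t. pd ex2 (\<phi> t)))"
proof -
  obtain J where J: "open J" "I \<subseteq> J"
    and h: "Ck_near (m + 3) ({0..} \<times> UNIV \<times> UNIV \<times> J) (\<lambda>(t, p). h t p)"
    and \<phi>: "Ck_near (m + 3) ({0..} \<times> UNIV \<times> J) (\<lambda>(t, p). \<phi> t p)"
    and hb: "\<forall>es T. set es \<subseteq> Basis \<and> length es \<le> m + 3 \<longrightarrow>
        (\<exists>K. \<forall>t\<in>{0..T}. \<forall>x v. \<forall>z\<in>J. \<bar>pds es (\<lambda>(t, p). h t p) (t, x, v, z)\<bar> \<le> K / ((1 + x\<^sup>2) * (1 + v\<^sup>2)))"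
    and \<phi>b: "\<forall>es T. set es \<subseteq> Basis \<and> length es \<le> m + 2 \<longrightarrow>
        (\<exists>K. \<forall>t\<in>{0..T}. \<forall>x. \<forall>z\<in>J. \<bar>pds es (\<lambda>(t, p). pd ex2 (\<phi> t) p) (t, x, z)\<bar> \<le> K / (1 + x\<^sup>2))"
    using assms unfolding regular_pair_def by (elim exE conjE) (rule that)
  obtain U where U: "open U" "{0..} \<times> UNIV \<times> UNIV \<times> J \<subseteq> U" "Ck_on (m + 3) U (\<lambda>(t, p). h t p)"
    using h by (auto simp: Ck_near_def)
  obtain V where V: "open V" "{0..} \<times> UNIV \<times> J \<subseteq> V" "Ck_on (m + 3) V (\<lambda>(t, p). \<phi> t p)"
    using \<phi> by (auto simp: Ck_near_def)
  \<comment> \<open>The x-derivative of a time slice is a partial derivative in (t, x, z), so it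
    inherits all but one of the m + 3 derivatives of \<phi>.\<close>
  have e: "pd (0, ex2) (\<lambda>(t, p). \<phi> t p) = (\<lambda>(t, p). pd ex2 (\<phi> t) p)"
    by (rule ext) (auto simp: pd_def)
  have "Ck_on (m + 2) V (\<lambda>(t, p). pd ex2 (\<phi> t) p)"
    using V(3) Basis_macroscopic(3) unfolding e[symmetric] by (simp add: numeral_3_eq_3 numeral_2_eq_2)
  then have "mac_family (m + 2) J (mac_derivs (\<lambda>t. pd ex2 (\<phi> t)))"
    by (rule mac_family_derivs[OF V(1,2)]) (rule \<phi>b[rule_format], intro conjI)
  moreover have "kin_family (m + 3) J (kin_derivs h)"
    by (rule kin_family_derivs[OF U]) (rule hb[rule_format], intro conjI)
  ultimately show ?thesis using that J by blast
qed

section \<open>Decay in several variables\<close>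

lemma integral_continuous_on:
  fixes f :: "'a::metric_space \<Rightarrow> 'y \<Rightarrow> real"
  assumes c: "\<And>y. y \<in> space M \<Longrightarrow> continuous_on S (\<lambda>p. f p y)"
    and m: "\<And>p. p \<in> S \<Longrightarrow> f p \<in> borel_measurable M"
    and b: "\<And>p y. p \<in> S \<Longrightarrow> y \<in> space M \<Longrightarrow> \<bar>f p y\<bar> \<le> w y" and w: "integrable M w"
  shows "continuous_on S (\<lambda>p. LINT y|M. f p y)"
  unfolding continuous_on_sequentially comp_def
proof (intro allI ballI impI)
  fix X :: "nat \<Rightarrow> 'a" and a assume a: "a \<in> S" and X: "(\<forall>n. X n \<in> S) \<and> X \<longlonglongrightarrow> a"
  show "(\<lambda>n. LINT y|M. f (X n) y) \<longlonglongrightarrow> (LINT y|M. f a y)"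
  proof (rule integral_dominated_convergence[OF m[OF a] _ w])
    show "f (X n) \<in> borel_measurable M" for n using X m by auto
    show "AE y in M. (\<lambda>n. f (X n) y) \<longlonglongrightarrow> f a y"
      using c a X by (intro AE_I2) (auto simp: continuous_on_sequentially comp_def)
    show "AE y in M. norm (f (X n) y) \<le> w y" for n using b X by (intro AE_I2) auto
  qed
qed

lemma (in pair_sigma_finite) integrable_mult_pair:
  fixes f :: "'a \<Rightarrow> real" and g :: "'b \<Rightarrow> real"
  assumes f: "integrable M1 f" and g: "integrable M2 g"
  shows "integrable (M1 \<Otimes>\<^sub>M M2) (\<lambda>(x, y). f x * g y)"
proof (rule Fubini_integrable)
  have [measurable]: "f \<in> borel_measurable M1" "g \<in> borel_measurable M2" using f g by auto
  show "(\<lambda>(x, y). f x * g y) \<in> borel_measurable (M1 \<Otimes>\<^sub>M M2)" by measurable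
  have "(\<lambda>x. LINT y|M2. norm (case (x, y) of (x, y) \<Rightarrow> f x * g y)) = (\<lambda>x. \<bar>f x\<bar> * (LINT y|M2. \<bar>g y\<bar>))"
    by (auto simp: abs_mult)
  then show "integrable M1 (\<lambda>x. LINT y|M2. norm (case (x, y) of (x, y) \<Rightarrow> f x * g y))"
    using f by auto
  show "AE x in M1. integrable M2 (\<lambda>y. case (x, y) of (x, y) \<Rightarrow> f x * g y)" using g by auto
qed

section \<open>Integration against the law of the random variable\<close>

locale zspace = prob_space P for P :: "real measure" +
  fixes I :: "real set"
  assumes space_P [simp]: "space P = I" and sets_P [measurable_cong]: "sets P = sets (restrict_space borel I)"
begin

lemma zlaw_borel [measurable]: "(\<lambda>z. z) \<in> measurable P borel"
proof -
  have "(\<lambda>z. z) \<in> measurable (restrict_space borel I) borel" by (rule measurable_restrict_space1) simp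
  then show ?thesis by (simp add: measurable_cong_sets[OF sets_P refl])
qed

sublocale xz: pair_sigma_finite "lborel :: real measure" P ..
sublocale vxz: pair_sigma_finite "lborel :: real measure" "lborel \<Otimes>\<^sub>M P"
  by (intro pair_sigma_finite.intro sigma_finite_pair_measure sigma_finite_lborel) unfold_locales

lemma fst_borel_measurable_lborel: "fst \<in> borel_measurable ((lborel :: real measure) \<Otimes>\<^sub>M N)"
  using measurable_fst[of "lborel :: real measure" N] by simp

text \<open>Continuity is given only around I, so the function is cut off by the indicator of the
  open set \<open>UNIV \<times> J\<close>, which changes nothing on the space of the
  measure.\<close>

lemma borel_measurable_mu2:
  fixes f :: "real \<Rightarrow> real \<Rightarrow> real"
  assumes "open J" "I \<subseteq> J" "continuous_on (UNIV \<times> J) (\<lambda>(x, z). f x z)"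
  shows "(\<lambda>(x, z). f x z) \<in> borel_measurable (lborel \<Otimes>\<^sub>M P)"
proof -
  let ?g = "\<lambda>p :: real \<times> real. indicator (UNIV \<times> J) p *\<^sub>R (case p of (x, z) \<Rightarrow> f x z)"
  have g: "?g \<in> borel_measurable borel"
    by (rule borel_measurable_continuous_on_indicator[OF _ assms(3)]) (auto intro!: borel_open open_Times assms)
  note fst = fst_borel_measurable_lborel
  have "(\<lambda>p :: real \<times> real. (fst p, snd p)) \<in> measurable (lborel \<Otimes>\<^sub>M P) (borel \<Otimes>\<^sub>M borel)"
    by (intro measurable_Pair fst measurable_compose[OF measurable_snd zlaw_borel])
  with g have "(\<lambda>p. ?g (fst p, snd p)) \<in> borel_measurable (lborel \<Otimes>\<^sub>M P)"
    unfolding borel_prod by (rule measurable_compose[rotated])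
  then show ?thesis
    by (rule measurable_cong[THEN iffD1, rotated]) (use assms in \<open>auto simp: space_pair_measure\<close>)
qed

lemma borel_measurable_mu3:
  fixes f :: "real \<Rightarrow> real \<Rightarrow> real \<Rightarrow> real"
  assumes "open J" "I \<subseteq> J" "continuous_on (UNIV \<times> UNIV \<times> J) (\<lambda>(x, v, z). f x v z)"
  shows "(\<lambda>(x, v, z). f x v z) \<in> borel_measurable (lborel \<Otimes>\<^sub>M (lborel \<Otimes>\<^sub>M P))"
proof -
  let ?g = "\<lambda>p :: real \<times> real \<times> real. indicator (UNIV \<times> UNIV \<times> J) p *\<^sub>R (case p of (x, v, z) \<Rightarrow> f x v z)"
  have g: "?g \<in> borel_measurable borel"
    by (rule borel_measurable_continuous_on_indicator[OF _ assms(3)]) (auto intro!: borel_open open_Times assms)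
  note fst = fst_borel_measurable_lborel
  have "(\<lambda>p :: real \<times> real \<times> real. (fst p, fst (snd p), snd (snd p))) \<in> measurable (lborel \<Otimes>\<^sub>M (lborel \<Otimes>\<^sub>M P)) (borel \<Otimes>\<^sub>M (borel \<Otimes>\<^sub>M borel))"
    by (intro measurable_Pair fst
        measurable_compose[OF measurable_snd fst[of P]]
        measurable_compose[OF measurable_snd measurable_compose[OF measurable_snd zlaw_borel]])
  with g have "(\<lambda>p. ?g (fst p, fst (snd p), snd (snd p))) \<in> borel_measurable (lborel \<Otimes>\<^sub>M (lborel \<Otimes>\<^sub>M P))"
    unfolding borel_prod by (rule measurable_compose[rotated])
  then show ?thesis
    by (rule measurable_cong[THEN iffD1, rotated]) (use assms in \<open>auto simp: space_pair_measure\<close>)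
qed

definition decay_xz :: "(real \<Rightarrow> real \<Rightarrow> real) \<Rightarrow> bool" where
  "decay_xz f \<longleftrightarrow> (\<lambda>(x, z). f x z) \<in> borel_measurable (lborel \<Otimes>\<^sub>M P) \<and>
    (\<exists>K. \<forall>x. \<forall>z\<in>I. \<bar>f x z\<bar> \<le> K / (1 + x\<^sup>2))"

definition decay_xvz :: "(real \<Rightarrow> real \<Rightarrow> real \<Rightarrow> real) \<Rightarrow> bool" where
  "decay_xvz f \<longleftrightarrow> (\<lambda>(x, v, z). f x v z) \<in> borel_measurable (lborel \<Otimes>\<^sub>M (lborel \<Otimes>\<^sub>M P)) \<and>
    (\<exists>K. \<forall>x v. \<forall>z\<in>I. \<bar>f x v z\<bar> \<le> K * (1 / (1 + x\<^sup>2)) * (1 / (1 + v\<^sup>2)))"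

definition decay1_xvz :: "(real \<Rightarrow> real \<Rightarrow> real \<Rightarrow> real) \<Rightarrow> bool" where
  "decay1_xvz f \<longleftrightarrow> (\<lambda>(x, v, z). f x v z) \<in> borel_measurable (lborel \<Otimes>\<^sub>M (lborel \<Otimes>\<^sub>M P)) \<and>
    (\<exists>K. \<forall>x v. \<forall>z\<in>I. \<bar>f x v z\<bar> \<le> K * (1 / (1 + x\<^sup>2)) * ((1 + \<bar>v\<bar>) / (1 + v\<^sup>2)))"

lemma decay_xzE:
  assumes "decay_xz f" obtains K where "0 \<le> K" "\<And>x z. z \<in> I \<Longrightarrow> \<bar>f x z\<bar> \<le> K / (1 + x\<^sup>2)"
proof -
  obtain K where K: "\<And>x z. z \<in> I \<Longrightarrow> \<bar>f x z\<bar> \<le> K / (1 + x\<^sup>2)" using assms by (auto simp: decay_xz_def)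
  obtain z where "z \<in> I" using not_empty by auto
  then have "0 \<le> K" using K[of z 0] by simp
  then show ?thesis using that K by blast
qed

lemma decay1_xvzE:
  assumes "decay1_xvz f"
  obtains K where "0 \<le> K" "\<And>x v z. z \<in> I \<Longrightarrow> \<bar>f x v z\<bar> \<le> K * (1 / (1 + x\<^sup>2)) * ((1 + \<bar>v\<bar>) / (1 + v\<^sup>2))"
proof -
  obtain K where K: "\<And>x v z. z \<in> I \<Longrightarrow> \<bar>f x v z\<bar> \<le> K * (1 / (1 + x\<^sup>2)) * ((1 + \<bar>v\<bar>) / (1 + v\<^sup>2))"
    using assms unfolding decay1_xvz_def by blast
  obtain z where "z \<in> I" using not_empty by auto
  then have "0 \<le> K" using K[of z 0 0] by simp
  then show ?thesis using that K by blast
qed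

lemma decay_xvzE:
  assumes "decay_xvz f"
  obtains K where "0 \<le> K" "\<And>x v z. z \<in> I \<Longrightarrow> \<bar>f x v z\<bar> \<le> K * (1 / (1 + x\<^sup>2)) * (1 / (1 + v\<^sup>2))"
proof -
  obtain K where K: "\<And>x v z. z \<in> I \<Longrightarrow> \<bar>f x v z\<bar> \<le> K * (1 / (1 + x\<^sup>2)) * (1 / (1 + v\<^sup>2))"
    using assms unfolding decay_xvz_def by blast
  obtain z where "z \<in> I" using not_empty by auto
  then have "0 \<le> K" using K[of z 0 0] by simp
  then show ?thesis using that K by blast
qed

lemma decay_xvz_imp_decay1_xvz:
  assumes "decay_xvz f" shows "decay1_xvz f"
proof -
  obtain K where K: "0 \<le> K" "\<And>x v z. z \<in> I \<Longrightarrow> \<bar>f x v z\<bar> \<le> K * (1 / (1 + x\<^sup>2)) * (1 / (1 + v\<^sup>2))"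
    by (rule decay_xvzE[OF assms]) (rule that)
  have "\<bar>f x v z\<bar> \<le> K * (1 / (1 + x\<^sup>2)) * ((1 + \<bar>v\<bar>) / (1 + v\<^sup>2))" if "z \<in> I" for x v z
    by (rule order_trans[OF K(2)[OF that]]) (use K(1) in \<open>intro mult_left_mono divide_right_mono, auto\<close>)
  then show ?thesis using assms unfolding decay_xvz_def decay1_xvz_def by blast
qed

lemma decay_xz_add: assumes "decay_xz f" "decay_xz g" shows "decay_xz (\<lambda>x z. f x z + g x z)"
proof -
  obtain K where K: "0 \<le> K" "\<And>x z. z \<in> I \<Longrightarrow> \<bar>f x z\<bar> \<le> K / (1 + x\<^sup>2)" by (rule decay_xzE[OF assms(1)]) (rule that)
  obtain L where L: "0 \<le> L" "\<And>x z. z \<in> I \<Longrightarrow> \<bar>g x z\<bar> \<le> L / (1 + x\<^sup>2)" by (rule decay_xzE[OF assms(2)]) (rule that)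
  have "\<bar>f x z + g x z\<bar> \<le> (K + L) / (1 + x\<^sup>2)" if "z \<in> I" for x z
    unfolding add_divide_distrib using that by (intro order_trans[OF abs_triangle_ineq] add_mono K L)
  moreover have "(\<lambda>(x, z). f x z + g x z) \<in> borel_measurable (lborel \<Otimes>\<^sub>M P)"
    using assms by (auto simp: decay_xz_def case_prod_beta' intro!: borel_measurable_add)
  ultimately show ?thesis unfolding decay_xz_def by blast
qed

lemma decay_xz_cmult: assumes "decay_xz f" shows "decay_xz (\<lambda>x z. c * f x z)"
proof -
  obtain K where K: "0 \<le> K" "\<And>x z. z \<in> I \<Longrightarrow> \<bar>f x z\<bar> \<le> K / (1 + x\<^sup>2)" by (rule decay_xzE[OF assms]) (rule that)
  have "\<bar>c * f x z\<bar> \<le> (\<bar>c\<bar> * K) / (1 + x\<^sup>2)" if "z \<in> I" for x z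
    using mult_left_mono[OF K(2)[OF that, of x], of "\<bar>c\<bar>"] by (simp add: abs_mult)
  moreover have "(\<lambda>(x, z). c * f x z) \<in> borel_measurable (lborel \<Otimes>\<^sub>M P)"
    using assms by (auto simp: decay_xz_def case_prod_beta' intro!: borel_measurable_times)
  ultimately show ?thesis unfolding decay_xz_def by blast
qed

lemma decay_xz_minus: "decay_xz f \<Longrightarrow> decay_xz (\<lambda>x z. - f x z)"
  using decay_xz_cmult[of f "-1"] by simp

lemma decay_xz_diff: "decay_xz f \<Longrightarrow> decay_xz g \<Longrightarrow> decay_xz (\<lambda>x z. f x z - g x z)"
  using decay_xz_add[OF _ decay_xz_minus, of f g] by simp

lemma decay_xz_zero: "decay_xz (\<lambda>x z. 0)"
  unfolding decay_xz_def by (intro conjI exI[of _ 0]) auto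

lemma decay_xz_sum: "(\<And>k. k \<in> A \<Longrightarrow> decay_xz (f k)) \<Longrightarrow> decay_xz (\<lambda>x z. \<Sum>k\<in>A. f k x z)"
  by (induction A rule: infinite_finite_induct) (auto intro: decay_xz_zero decay_xz_add)

lemma decay_xz_mult: assumes "decay_xz f" "decay_xz g" shows "decay_xz (\<lambda>x z. f x z * g x z)"
proof -
  obtain K where K: "0 \<le> K" "\<And>x z. z \<in> I \<Longrightarrow> \<bar>f x z\<bar> \<le> K / (1 + x\<^sup>2)" by (rule decay_xzE[OF assms(1)]) (rule that)
  obtain L where L: "0 \<le> L" "\<And>x z. z \<in> I \<Longrightarrow> \<bar>g x z\<bar> \<le> L / (1 + x\<^sup>2)" by (rule decay_xzE[OF assms(2)]) (rule that)
  have "\<bar>f x z * g x z\<bar> \<le> K * L / (1 + x\<^sup>2)" if "z \<in> I" for x z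
  proof -
    have "\<bar>f x z * g x z\<bar> \<le> (K / (1 + x\<^sup>2)) * L"
      unfolding abs_mult
    proof (intro mult_mono K order_trans[OF L(2)] that)
      show "L / (1 + x\<^sup>2) \<le> L" using \<open>0 \<le> L\<close> by (simp add: divide_le_eq mult_le_cancel_left1 algebra_simps)
      show "0 \<le> K / (1 + x\<^sup>2)" using \<open>0 \<le> K\<close> by simp
    qed auto
    then show ?thesis by simp
  qed
  moreover have "(\<lambda>(x, z). f x z * g x z) \<in> borel_measurable (lborel \<Otimes>\<^sub>M P)"
    using assms by (auto simp: decay_xz_def case_prod_beta' intro!: borel_measurable_times)
  ultimately show ?thesis unfolding decay_xz_def by blast
qed

lemma decay_xz_power2: "decay_xz f \<Longrightarrow> decay_xz (\<lambda>x z. (f x z)\<^sup>2)"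
  using decay_xz_mult[of f f] by (simp add: power2_eq_square)

lemma decay_xz_abs: "decay_xz f \<Longrightarrow> decay_xz (\<lambda>x z. \<bar>f x z\<bar>)"
  by (auto simp: decay_xz_def case_prod_beta')

lemma decay_xz_mdecay: assumes "decay_xz f" "z \<in> I" shows "mdecay (\<lambda>x. f x z)"
proof -
  have "(\<lambda>x. (\<lambda>(x, z). f x z) (x, z)) \<in> borel_measurable lborel"
    using assms by (intro measurable_compose[OF measurable_Pair2']) (auto simp: decay_xz_def)
  then show ?thesis using assms by (auto simp: decay_xz_def mdecay_def)
qed

lemma mu2_integral:
  assumes "decay_xz f"
  shows "integrable (mu2 P) (\<lambda>(x, z). f x z)"
    and "(LINT p|mu2 P. (case p of (x, z) \<Rightarrow> f x z)) = (LINT z|P. LINT x|lborel. f x z)"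
    and "integrable P (\<lambda>z. LINT x|lborel. f x z)"
proof -
  obtain K where K: "0 \<le> K" "\<And>x z. z \<in> I \<Longrightarrow> \<bar>f x z\<bar> \<le> K / (1 + x\<^sup>2)" by (rule decay_xzE[OF assms]) (rule that)
  have "integrable (lborel \<Otimes>\<^sub>M P) (\<lambda>(x, z). K / (1 + x\<^sup>2) * 1)"
    by (rule xz.integrable_mult_pair) (auto intro: integrable_weight)
  then have i: "integrable (lborel \<Otimes>\<^sub>M P) (\<lambda>(x, z). f x z)"
    by (rule Bochner_Integration.integrable_bound)
       (use assms order_trans[OF K(2) abs_ge_self] in \<open>auto simp: decay_xz_def space_pair_measure simp del: abs_divide intro!: AE_I2\<close>)
  then show "integrable (mu2 P) (\<lambda>(x, z). f x z)" by (simp add: mu2_def)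
  show "(LINT p|mu2 P. (case p of (x, z) \<Rightarrow> f x z)) = (LINT z|P. LINT x|lborel. f x z)"
    using xz.integral_snd[of f] i by (simp add: mu2_def)
  show "integrable P (\<lambda>z. LINT x|lborel. f x z)" using xz.integrable_snd[of f] i by simp
qed

end

section \<open>Derivatives, continuity and bounds of the families\<close>

lemma kin_family_DERIV:
  assumes "kin_family N J H" "k + j + l + i < N" "0 \<le> t" "z \<in> J"
  shows "((\<lambda>s. H k j l i s x v z) has_real_derivative H (Suc k) j l i t x v z) (at t within {0..})"
    "((\<lambda>s. H k j l i t x s z) has_real_derivative H k (Suc j) l i t x v z) (at v)"
    "((\<lambda>s. H k j l i t x v s) has_real_derivative H k j (Suc l) i t x v z) (at z)"
    "((\<lambda>s. H k j l i t s v z) has_real_derivative H k j l (Suc i) t x v z) (at x)"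
  using assms(1)[unfolded kin_family_def, THEN conjunct1, rule_format, OF conjI[OF assms(2) conjI[OF assms(3,4)]]]
  by blast+

lemma mac_family_DERIV:
  assumes "mac_family N J F" "k + l + i < N" "0 \<le> t" "z \<in> J"
  shows "((\<lambda>s. F k l i s x z) has_real_derivative F (Suc k) l i t x z) (at t within {0..})"
    "((\<lambda>s. F k l i t x s) has_real_derivative F k (Suc l) i t x z) (at z)"
    "((\<lambda>s. F k l i t s z) has_real_derivative F k l (Suc i) t x z) (at x)"
  using assms(1)[unfolded mac_family_def, THEN conjunct1, rule_format, OF conjI[OF assms(2) conjI[OF assms(3,4)]]]
  by blast+

lemma kin_family_continuous:
  assumes "kin_family N J H" "k + j + l + i \<le> N" "0 \<le> t"
  shows "continuous_on (UNIV \<times> UNIV \<times> J) (\<lambda>(x, v, z). H k j l i t x v z)"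
  using assms(1)[unfolded kin_family_def, THEN conjunct2, THEN conjunct1] assms(2,3) by blast

lemma mac_family_continuous:
  assumes "mac_family N J F" "k + l + i \<le> N" "0 \<le> t"
  shows "continuous_on (UNIV \<times> J) (\<lambda>(x, z). F k l i t x z)"
  using assms(1)[unfolded mac_family_def, THEN conjunct2, THEN conjunct1] assms(2,3) by blast

lemma kin_family_bound:
  assumes "kin_family N J H"
  obtains K where "0 \<le> K" "\<And>k j l i t x v z. k + j + l + i \<le> N \<Longrightarrow> 0 \<le> t \<Longrightarrow> t \<le> T \<Longrightarrow> z \<in> J \<Longrightarrow>
      \<bar>H k j l i t x v z\<bar> \<le> K * (1 / (1 + x\<^sup>2)) * (1 / (1 + v\<^sup>2))"
proof -
  obtain K where K: "\<forall>k j l i t x v z. k + j + l + i \<le> N \<and> 0 \<le> t \<and> t \<le> T \<and> z \<in> J \<longrightarrow>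
      \<bar>H k j l i t x v z\<bar> \<le> K / ((1 + x\<^sup>2) * (1 + v\<^sup>2))"
    using assms[unfolded kin_family_def, THEN conjunct2, THEN conjunct2, THEN spec[of _ T]] by (rule exE)
  have "\<bar>H k j l i t x v z\<bar> \<le> \<bar>K\<bar> * (1 / (1 + x\<^sup>2)) * (1 / (1 + v\<^sup>2))"
    if "k + j + l + i \<le> N" "0 \<le> t" "t \<le> T" "z \<in> J" for k j l i t x v z
  proof -
    have "K / ((1 + x\<^sup>2) * (1 + v\<^sup>2)) \<le> \<bar>K\<bar> / ((1 + x\<^sup>2) * (1 + v\<^sup>2))"
      by (intro divide_right_mono) auto
    then show ?thesis using K[rule_format, of k j l i t z x v] that by simp
  qed
  then show ?thesis by (intro that[of "\<bar>K\<bar>"]) auto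
qed

lemma mac_family_bound:
  assumes "mac_family N J F"
  obtains K where "0 \<le> K" "\<And>k l i t x z. k + l + i \<le> N \<Longrightarrow> 0 \<le> t \<Longrightarrow> t \<le> T \<Longrightarrow> z \<in> J \<Longrightarrow>
      \<bar>F k l i t x z\<bar> \<le> K / (1 + x\<^sup>2)"
proof -
  obtain K where K: "\<forall>k l i t x z. k + l + i \<le> N \<and> 0 \<le> t \<and> t \<le> T \<and> z \<in> J \<longrightarrow>
      \<bar>F k l i t x z\<bar> \<le> K / (1 + x\<^sup>2)"
    using assms[unfolded mac_family_def, THEN conjunct2, THEN conjunct2, THEN spec[of _ T]] by (rule exE)
  have "\<bar>F k l i t x z\<bar> \<le> \<bar>K\<bar> / (1 + x\<^sup>2)"
    if "k + l + i \<le> N" "0 \<le> t" "t \<le> T" "z \<in> J" for k l i t x z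
  proof -
    have "K / (1 + x\<^sup>2) \<le> \<bar>K\<bar> / (1 + x\<^sup>2)" by (intro divide_right_mono) auto
    then show ?thesis using K[rule_format, of k l i t z x] that by simp
  qed
  then show ?thesis by (intro that[of "\<bar>K\<bar>"]) auto
qed

lemma kin_family_decay_v:
  assumes H: "kin_family N J H" and "k + j + l + i \<le> N" "0 \<le> t" "z \<in> J"
  shows "decay (\<lambda>v. H k j l i t x v z)"
proof -
  obtain K where K: "0 \<le> K" "\<And>k j l i t' x v z. k + j + l + i \<le> N \<Longrightarrow> 0 \<le> t' \<Longrightarrow> t' \<le> t \<Longrightarrow> z \<in> J \<Longrightarrow>
      \<bar>H k j l i t' x v z\<bar> \<le> K * (1 / (1 + x\<^sup>2)) * (1 / (1 + v\<^sup>2))"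
    by (rule kin_family_bound[OF H, where T=t]) (rule that)
  have "continuous_on UNIV (\<lambda>v. (\<lambda>(x, v, z). H k j l i t x v z) (x, v, z))"
    by (rule continuous_on_compose2[OF kin_family_continuous[OF assms(1-3)]])
       (use assms in \<open>auto intro!: continuous_intros\<close>)
  then have "continuous_on UNIV (\<lambda>v. H k j l i t x v z)" by simp
  moreover have "\<bar>H k j l i t x v z\<bar> \<le> (K * (1 / (1 + x\<^sup>2))) / (1 + v\<^sup>2)" for v
    using K(2)[of k j l i t z x v] assms by simp
  ultimately show ?thesis by (rule decayI)
qed

lemma mac_family_decay_x:
  assumes F: "mac_family N J F" and "k + l + i \<le> N" "0 \<le> t" "z \<in> J"
  shows "decay (\<lambda>x. F k l i t x z)"
proof -
  obtain K where K: "0 \<le> K" "\<And>k l i t' x z. k + l + i \<le> N \<Longrightarrow> 0 \<le> t' \<Longrightarrow> t' \<le> t \<Longrightarrow> z \<in> J \<Longrightarrow>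
      \<bar>F k l i t' x z\<bar> \<le> K / (1 + x\<^sup>2)"
    by (rule mac_family_bound[OF F, where T=t]) (rule that)
  have "continuous_on UNIV (\<lambda>x. (\<lambda>(x, z). F k l i t x z) (x, z))"
    by (rule continuous_on_compose2[OF mac_family_continuous[OF assms(1-3)]])
       (use assms in \<open>auto intro!: continuous_intros\<close>)
  then have "continuous_on UNIV (\<lambda>x. F k l i t x z)" by simp
  then show ?thesis using K(2)[of k l i t z] assms by (intro decayI) auto
qed

lemma kin_family_decay_x:
  assumes H: "kin_family N J H" and "k + j + l + i \<le> N" "0 \<le> t" "z \<in> J"
  shows "decay (\<lambda>x. H k j l i t x v z)"
proof -
  obtain K where K: "0 \<le> K" "\<And>k j l i t' x v z. k + j + l + i \<le> N \<Longrightarrow> 0 \<le> t' \<Longrightarrow> t' \<le> t \<Longrightarrow> z \<in> J \<Longrightarrow>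
      \<bar>H k j l i t' x v z\<bar> \<le> K * (1 / (1 + x\<^sup>2)) * (1 / (1 + v\<^sup>2))"
    by (rule kin_family_bound[OF H, where T=t]) (rule that)
  have "continuous_on UNIV (\<lambda>x. (\<lambda>(x, v, z). H k j l i t x v z) (x, v, z))"
    by (rule continuous_on_compose2[OF kin_family_continuous[OF assms(1-3)]])
       (use assms in \<open>auto intro!: continuous_intros\<close>)
  then have "continuous_on UNIV (\<lambda>x. H k j l i t x v z)" by simp
  moreover have "\<bar>H k j l i t x v z\<bar> \<le> (K * (1 / (1 + v\<^sup>2))) / (1 + x\<^sup>2)" for x
    using K(2)[of k j l i t z x v] assms by (simp add: mult.commute)
  ultimately show ?thesis by (rule decayI)
qed

text \<open>The decay bounds are uniform on bounded time intervals only. Restriction to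
  \<open>{0..t + 1}\<close> leaves the filter at t unchanged and makes a single majorant
  suffice.\<close>

lemma integral_has_time_derivative:
  fixes f f' :: "real \<Rightarrow> 'a \<Rightarrow> real"
  assumes t: "0 \<le> t"
    and D: "\<And>s y. 0 \<le> s \<Longrightarrow> y \<in> space M \<Longrightarrow> ((\<lambda>s. f s y) has_real_derivative f' s y) (at s within {0..})"
    and b: "\<And>s y. 0 \<le> s \<Longrightarrow> s \<le> t + 1 \<Longrightarrow> y \<in> space M \<Longrightarrow> \<bar>f' s y\<bar> \<le> w y" and w: "integrable M w"
    and f: "\<And>s. 0 \<le> s \<Longrightarrow> integrable M (f s)" and m: "f' t \<in> borel_measurable M"
  shows "((\<lambda>s. LINT y|M. f s y) has_real_derivative (LINT y|M. f' t y)) (at t within {0..})"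
proof -
  have "((\<lambda>s. LINT y|M. f s y) has_real_derivative (LINT y|M. f' t y)) (at t within {0..t + 1})"
    by (rule integral_has_real_derivative_within[where w=w])
       (use t b w f m in \<open>auto intro!: DERIV_subset[OF D]\<close>)
  moreover have "at t within {0..t + 1} = at t within {0..}"
    by (rule at_within_nhd[of t "{..<t + 1}"]) auto
  ultimately show ?thesis by simp
qed

section \<open>Velocity moments\<close>

definition moment ::
  "(real \<Rightarrow> real) \<Rightarrow> (nat \<Rightarrow> nat \<Rightarrow> nat \<Rightarrow> nat \<Rightarrow> real \<Rightarrow> real \<Rightarrow> real \<Rightarrow> real \<Rightarrow> real) \<Rightarrow>
    nat \<Rightarrow> nat \<Rightarrow> nat \<Rightarrow> real \<Rightarrow> real \<Rightarrow> real \<Rightarrow> real" where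
  "moment \<psi> H k l i t x z = (LINT v|lborel. H k 0 l i t x v z * \<psi> v)"

text \<open>\<psi> is bounded, so the decay of H in v provides a majorant and all derivatives pass
  under the integral, while the decay in x survives. Moments thereby obey the same calculus as the
  field.\<close>

lemma mac_family_moment:
  assumes H: "kin_family N J H" and \<psi>: "decay \<psi>" and J: "open J"
  shows "mac_family N J (moment \<psi> H)"
proof -
  obtain c where c: "0 \<le> c" "\<And>v. \<bar>\<psi> v\<bar> \<le> c"
  proof -
    obtain K where K: "0 \<le> K" "\<And>s. \<bar>\<psi> s\<bar> \<le> K / (1 + s\<^sup>2)" by (rule decayE[OF \<psi>]) (rule that)
    have "\<bar>\<psi> v\<bar> \<le> K" for v
      by (rule order_trans[OF K(2)]) (use K(1) in \<open>simp add: divide_le_eq mult_le_cancel_left1 algebra_simps\<close>)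
    then show ?thesis using that K(1) by blast
  qed
  have d: "decay (\<lambda>v. H k j l i t x v z * \<psi> v)" if "k + j + l + i \<le> N" "0 \<le> t" "z \<in> J" for k j l i t x z
    by (intro decay1_mult decay_imp_decay1 kin_family_decay_v[OF H] that \<psi>)
  have m: "(\<lambda>v. H k j l i t x v z * \<psi> v) \<in> borel_measurable lborel" if "k + j + l + i \<le> N" "0 \<le> t" "z \<in> J" for k j l i t x z
    using decay_integrable[OF d[OF that]] by auto
  have bd: "\<exists>K\<ge>0. \<forall>k l i t x v z. k + l + i \<le> N \<and> 0 \<le> t \<and> t \<le> T \<and> z \<in> J \<longrightarrow>
      \<bar>H k 0 l i t x v z * \<psi> v\<bar> \<le> K * (1 / (1 + x\<^sup>2)) * (1 / (1 + v\<^sup>2))" for T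
  proof -
    obtain K where K: "0 \<le> K" "\<And>k j l i t x v z. k + j + l + i \<le> N \<Longrightarrow> 0 \<le> t \<Longrightarrow> t \<le> T \<Longrightarrow> z \<in> J \<Longrightarrow>
        \<bar>H k j l i t x v z\<bar> \<le> K * (1 / (1 + x\<^sup>2)) * (1 / (1 + v\<^sup>2))"
      by (rule kin_family_bound[OF H, where T=T]) (rule that)
    have "\<bar>H k 0 l i t x v z * \<psi> v\<bar> \<le> (K * c) * (1 / (1 + x\<^sup>2)) * (1 / (1 + v\<^sup>2))"
      if "k + l + i \<le> N" "0 \<le> t" "t \<le> T" "z \<in> J" for k l i t x v z
    proof -
      have "\<bar>H k 0 l i t x v z * \<psi> v\<bar> \<le> (K * (1 / (1 + x\<^sup>2)) * (1 / (1 + v\<^sup>2))) * c"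
        unfolding abs_mult using K(1) that by (intro mult_mono K(2) c) auto
      then show ?thesis by (simp add: mult_ac)
    qed
    then show ?thesis using K(1) c(1) by (intro exI[of _ "K * c"]) auto
  qed
  have le1: "a * (1 / (1 + x\<^sup>2)) * b \<le> a * b" if "0 \<le> a" "0 \<le> b" for a b x :: real
  proof -
    have "a * (1 / (1 + x\<^sup>2)) \<le> a * 1" using that by (intro mult_left_mono) auto
    then show ?thesis using that by (intro mult_right_mono) auto
  qed
  have bw: "\<exists>w. integrable lborel w \<and> (\<forall>k l i t x v z. k + l + i \<le> N \<and> 0 \<le> t \<and> t \<le> T \<and> z \<in> J \<longrightarrow>
      \<bar>H k 0 l i t x v z * \<psi> v\<bar> \<le> w v)" for T
  proof -
    obtain K where K: "0 \<le> K" "\<forall>k l i t x v z. k + l + i \<le> N \<and> 0 \<le> t \<and> t \<le> T \<and> z \<in> J \<longrightarrow>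
      \<bar>H k 0 l i t x v z * \<psi> v\<bar> \<le> K * (1 / (1 + x\<^sup>2)) * (1 / (1 + v\<^sup>2))" using bd[of T] by blast
    have "\<bar>H k 0 l i t x v z * \<psi> v\<bar> \<le> K / (1 + v\<^sup>2)" if "k + l + i \<le> N \<and> 0 \<le> t \<and> t \<le> T \<and> z \<in> J" for k l i t x v z
      using order_trans[OF K(2)[rule_format, OF that, of x v] le1[OF K(1), of "1 / (1 + v\<^sup>2)" x]] by simp
    then show ?thesis using integrable_weight[of K] by blast
  qed
  show ?thesis
    unfolding mac_family_def
  proof (intro conjI allI impI)
    fix k l i :: nat and t x z :: real assume *: "k + l + i < N \<and> 0 \<le> t \<and> z \<in> J"
    obtain w where w: "integrable lborel w" "\<And>k l i t' x v z. k + l + i \<le> N \<and> 0 \<le> t' \<and> t' \<le> t + 1 \<and> z \<in> J \<Longrightarrow>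
      \<bar>H k 0 l i t' x v z * \<psi> v\<bar> \<le> w v" using bw[of "t + 1"] by blast
    have D: "((\<lambda>s. H k 0 l i s x v z * \<psi> v) has_real_derivative H (Suc k) 0 l i s x v z * \<psi> v) (at s within {0..})"
      "((\<lambda>z. H k 0 l i s x v z * \<psi> v) has_real_derivative H k 0 (Suc l) i s x v z * \<psi> v) (at z)"
      "((\<lambda>x. H k 0 l i s x v z * \<psi> v) has_real_derivative H k 0 l (Suc i) s x v z * \<psi> v) (at x)"
      if "0 \<le> s" "z \<in> J" for s v z x
      using * that by (auto intro!: DERIV_cmult_right kin_family_DERIV[OF H])
    show "((\<lambda>s. moment \<psi> H k l i s x z) has_real_derivative moment \<psi> H (Suc k) l i t x z) (at t within {0..})"
      unfolding moment_def
      by (rule integral_has_time_derivative[where w=w])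
         (use * w D m[of k 0 l i] m[of "Suc k" 0 l i] d[of k 0 l i] in \<open>auto intro: decay_integrable\<close>)
    show "((\<lambda>s. moment \<psi> H k l i t x s) has_real_derivative moment \<psi> H k (Suc l) i t x z) (at z)"
      unfolding moment_def
      by (rule integral_has_real_derivative_open[where w=w and J=J])
         (use * w D J m[of k 0 "Suc l" i] d[of k 0 l i] in \<open>auto intro: decay_integrable\<close>)
    show "((\<lambda>s. moment \<psi> H k l i t s z) has_real_derivative moment \<psi> H k l (Suc i) t x z) (at x)"
      unfolding moment_def
      by (rule integral_has_real_derivative_open[where w=w and J=UNIV])
         (use * w D m[of k 0 l "Suc i"] d[of k 0 l i] in \<open>auto intro: decay_integrable\<close>)
  next
    fix k l i :: nat and t :: real assume *: "k + l + i \<le> N \<and> 0 \<le> t"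
    obtain w where w: "integrable lborel w" "\<And>k l i t' x v z. k + l + i \<le> N \<and> 0 \<le> t' \<and> t' \<le> t \<and> z \<in> J \<Longrightarrow>
      \<bar>H k 0 l i t' x v z * \<psi> v\<bar> \<le> w v" using bw[of t] by blast
    have "continuous_on (UNIV \<times> J) (\<lambda>p. LINT v|lborel. H k 0 l i t (fst p) v (snd p) * \<psi> v)"
    proof (rule integral_continuous_on[where w=w])
      fix v :: real
      have "continuous_on (UNIV \<times> J) (\<lambda>p. (\<lambda>(x, v, z). H k 0 l i t x v z) (fst p, v, snd p))"
        by (rule continuous_on_compose2[OF kin_family_continuous[OF H, of k 0 l i t]])
           (use * in \<open>auto intro!: continuous_intros\<close>)
      then show "continuous_on (UNIV \<times> J) (\<lambda>p. H k 0 l i t (fst p) v (snd p) * \<psi> v)"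
        by (intro continuous_on_mult_right) simp
    qed (use * w m[of k 0 l i t] in auto)
    then show "continuous_on (UNIV \<times> J) (\<lambda>(x, z). moment \<psi> H k l i t x z)"
      by (simp add: moment_def case_prod_beta')
  next
    fix T :: real
    obtain K where K: "0 \<le> K" "\<And>k l i t x v z. k + l + i \<le> N \<and> 0 \<le> t \<and> t \<le> T \<and> z \<in> J \<Longrightarrow>
      \<bar>H k 0 l i t x v z * \<psi> v\<bar> \<le> K * (1 / (1 + x\<^sup>2)) * (1 / (1 + v\<^sup>2))" using bd[of T] by blast
    show "\<exists>K. \<forall>k l i t x z. k + l + i \<le> N \<and> 0 \<le> t \<and> t \<le> T \<and> z \<in> J \<longrightarrow>
        \<bar>moment \<psi> H k l i t x z\<bar> \<le> K / (1 + x\<^sup>2)"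
    proof (intro exI allI impI)
      fix k l i :: nat and t x z :: real assume *: "k + l + i \<le> N \<and> 0 \<le> t \<and> t \<le> T \<and> z \<in> J"
      have "\<bar>moment \<psi> H k l i t x z\<bar> \<le> (LINT v|lborel. K * (1 / (1 + x\<^sup>2)) * (1 / (1 + v\<^sup>2)))"
        unfolding moment_def
        by (intro integral_abs_bound_integral decay_integrable[OF d] integrable_mult_right integrable_weight K(2)[rule_format, OF *])
           (use * in auto)
      also have "\<dots> = K * (1 / (1 + x\<^sup>2)) * (LINT v|lborel. 1 / (1 + v\<^sup>2))" by (rule integral_mult_right_zero)
      also have "\<dots> = (K * (LINT v|lborel. 1 / (1 + v\<^sup>2))) / (1 + x\<^sup>2)" by simp
      finally show "\<bar>moment \<psi> H k l i t x z\<bar> \<le> (K * (LINT v|lborel. 1 / (1 + v\<^sup>2))) / (1 + x\<^sup>2)" .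
    qed
  qed
qed

section \<open>Functions of position, velocity and the random variable\<close>

context zspace begin

lemma kin_family_decay_xvz:
  assumes "kin_family N J H" "open J" "I \<subseteq> J" "k + j + l + i \<le> N" "0 \<le> t"
  shows "decay_xvz (\<lambda>x v z. H k j l i t x v z)"
proof -
  obtain K where K: "0 \<le> K" "\<And>k j l i t' x v z. k + j + l + i \<le> N \<Longrightarrow> 0 \<le> t' \<Longrightarrow> t' \<le> t \<Longrightarrow> z \<in> J \<Longrightarrow>
      \<bar>H k j l i t' x v z\<bar> \<le> K * (1 / (1 + x\<^sup>2)) * (1 / (1 + v\<^sup>2))"
    by (rule kin_family_bound[OF assms(1), where T=t]) (rule that)
  show ?thesis
    unfolding decay_xvz_def
    using borel_measurable_mu3[OF assms(2,3) kin_family_continuous[OF assms(1,4,5)]] K(2)[OF assms(4,5) order_refl] assms(3)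
    by blast
qed

lemma mac_family_decay_xz:
  assumes "mac_family N J F" "open J" "I \<subseteq> J" "k + l + i \<le> N" "0 \<le> t"
  shows "decay_xz (\<lambda>x z. F k l i t x z)"
proof -
  obtain K where K: "0 \<le> K" "\<And>k l i t' x z. k + l + i \<le> N \<Longrightarrow> 0 \<le> t' \<Longrightarrow> t' \<le> t \<Longrightarrow> z \<in> J \<Longrightarrow>
      \<bar>F k l i t' x z\<bar> \<le> K / (1 + x\<^sup>2)"
    by (rule mac_family_bound[OF assms(1), where T=t]) (rule that)
  show ?thesis
    unfolding decay_xz_def
    using borel_measurable_mu2[OF assms(2,3) mac_family_continuous[OF assms(1,4,5)]] K(2)[OF assms(4,5) order_refl] assms(3)
    by blast
qed

lemma decay_xvz_imp_v_decay1_xvz: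
  assumes "decay_xvz f" shows "decay1_xvz (\<lambda>x v z. v * f x v z)"
proof -
  obtain K where K: "0 \<le> K" "\<And>x v z. z \<in> I \<Longrightarrow> \<bar>f x v z\<bar> \<le> K * (1 / (1 + x\<^sup>2)) * (1 / (1 + v\<^sup>2))"
    by (rule decay_xvzE[OF assms]) (rule that)
  have "\<bar>v * f x v z\<bar> \<le> K * (1 / (1 + x\<^sup>2)) * ((1 + \<bar>v\<bar>) / (1 + v\<^sup>2))" if "z \<in> I" for x v z
  proof -
    have "\<bar>v * f x v z\<bar> \<le> (1 + \<bar>v\<bar>) * (K * (1 / (1 + x\<^sup>2)) * (1 / (1 + v\<^sup>2)))"
      unfolding abs_mult using that by (intro mult_mono K) auto
    then show ?thesis by (simp add: mult_ac)
  qed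
  moreover have "(\<lambda>(x, v, z). v * f x v z) \<in> borel_measurable (lborel \<Otimes>\<^sub>M (lborel \<Otimes>\<^sub>M P))"
  proof -
    have "(\<lambda>p. fst (snd p)) \<in> borel_measurable ((lborel :: real measure) \<Otimes>\<^sub>M ((lborel :: real measure) \<Otimes>\<^sub>M P))"
      by (rule measurable_compose[OF measurable_snd fst_borel_measurable_lborel])
    then show ?thesis using assms by (auto simp: decay_xvz_def case_prod_beta' intro!: borel_measurable_times)
  qed
  ultimately show ?thesis unfolding decay1_xvz_def by blast
qed

lemma decay1_xvz_add: assumes "decay1_xvz f" "decay1_xvz g" shows "decay1_xvz (\<lambda>x v z. f x v z + g x v z)"
proof -
  obtain K where K: "0 \<le> K" "\<And>x v z. z \<in> I \<Longrightarrow> \<bar>f x v z\<bar> \<le> K * (1 / (1 + x\<^sup>2)) * ((1 + \<bar>v\<bar>) / (1 + v\<^sup>2))"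
    by (rule decay1_xvzE[OF assms(1)]) (rule that)
  obtain L where L: "0 \<le> L" "\<And>x v z. z \<in> I \<Longrightarrow> \<bar>g x v z\<bar> \<le> L * (1 / (1 + x\<^sup>2)) * ((1 + \<bar>v\<bar>) / (1 + v\<^sup>2))"
    by (rule decay1_xvzE[OF assms(2)]) (rule that)
  have "\<bar>f x v z + g x v z\<bar> \<le> (K + L) * (1 / (1 + x\<^sup>2)) * ((1 + \<bar>v\<bar>) / (1 + v\<^sup>2))" if "z \<in> I" for x v z
    unfolding distrib_right using that by (intro order_trans[OF abs_triangle_ineq] add_mono K L)
  moreover have "(\<lambda>(x, v, z). f x v z + g x v z) \<in> borel_measurable (lborel \<Otimes>\<^sub>M (lborel \<Otimes>\<^sub>M P))"
    using assms by (auto simp: decay1_xvz_def case_prod_beta' intro!: borel_measurable_add)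
  ultimately show ?thesis unfolding decay1_xvz_def by blast
qed

lemma decay1_xvz_cmult: assumes "decay1_xvz f" shows "decay1_xvz (\<lambda>x v z. c * f x v z)"
proof -
  obtain K where K: "0 \<le> K" "\<And>x v z. z \<in> I \<Longrightarrow> \<bar>f x v z\<bar> \<le> K * (1 / (1 + x\<^sup>2)) * ((1 + \<bar>v\<bar>) / (1 + v\<^sup>2))"
    by (rule decay1_xvzE[OF assms(1)]) (rule that)
  have "\<bar>c * f x v z\<bar> \<le> (\<bar>c\<bar> * K) * (1 / (1 + x\<^sup>2)) * ((1 + \<bar>v\<bar>) / (1 + v\<^sup>2))" if "z \<in> I" for x v z
    using mult_left_mono[OF K(2)[OF that, of x v], of "\<bar>c\<bar>"] by (simp add: abs_mult mult.assoc)
  moreover have "(\<lambda>(x, v, z). c * f x v z) \<in> borel_measurable (lborel \<Otimes>\<^sub>M (lborel \<Otimes>\<^sub>M P))"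
    using assms by (auto simp: decay1_xvz_def case_prod_beta' intro!: borel_measurable_times)
  ultimately show ?thesis unfolding decay1_xvz_def by blast
qed

lemma decay1_xvz_mult: assumes "decay1_xvz f" "decay1_xvz g" shows "decay_xvz (\<lambda>x v z. f x v z * g x v z)"
proof -
  obtain K where K: "0 \<le> K" "\<And>x v z. z \<in> I \<Longrightarrow> \<bar>f x v z\<bar> \<le> K * (1 / (1 + x\<^sup>2)) * ((1 + \<bar>v\<bar>) / (1 + v\<^sup>2))"
    by (rule decay1_xvzE[OF assms(1)]) (rule that)
  obtain L where L: "0 \<le> L" "\<And>x v z. z \<in> I \<Longrightarrow> \<bar>g x v z\<bar> \<le> L * (1 / (1 + x\<^sup>2)) * ((1 + \<bar>v\<bar>) / (1 + v\<^sup>2))"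
    by (rule decay1_xvzE[OF assms(2)]) (rule that)
  have "\<bar>f x v z * g x v z\<bar> \<le> (2 * K * L) * (1 / (1 + x\<^sup>2)) * (1 / (1 + v\<^sup>2))" if "z \<in> I" for x v z
  proof -
    have X: "1 / (1 + x\<^sup>2) * (1 / (1 + x\<^sup>2)) \<le> 1 / (1 + x\<^sup>2)"
      using mult_left_mono[of "1 / (1 + x\<^sup>2)" 1 "1 / (1 + x\<^sup>2)"] by simp
    have V: "(1 + \<bar>v\<bar>) / (1 + v\<^sup>2) * ((1 + \<bar>v\<bar>) / (1 + v\<^sup>2)) \<le> 2 * (1 / (1 + v\<^sup>2))"
    proof -
      have "(1 + \<bar>v\<bar>) * (1 + \<bar>v\<bar>) \<le> 2 * (1 + v\<^sup>2)"
        using sum_squares_bound[of 1 "\<bar>v\<bar>"] by (simp add: power2_eq_square algebra_simps)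
      then have "(1 + \<bar>v\<bar>) * (1 + \<bar>v\<bar>) / ((1 + v\<^sup>2) * (1 + v\<^sup>2)) \<le> 2 * (1 + v\<^sup>2) / ((1 + v\<^sup>2) * (1 + v\<^sup>2))"
        by (intro divide_right_mono) auto
      also have "\<dots> = 2 * (1 / (1 + v\<^sup>2))" using one_plus_square_pos(2)[of v] by (simp add: divide_simps)
      finally show ?thesis by simp
    qed
    have "\<bar>f x v z * g x v z\<bar> \<le> (K * (1 / (1 + x\<^sup>2)) * ((1 + \<bar>v\<bar>) / (1 + v\<^sup>2))) * (L * (1 / (1 + x\<^sup>2)) * ((1 + \<bar>v\<bar>) / (1 + v\<^sup>2)))"
      unfolding abs_mult using that K(1) by (intro mult_mono K L) auto
    also have "\<dots> = (K * L) * ((1 / (1 + x\<^sup>2) * (1 / (1 + x\<^sup>2))) * ((1 + \<bar>v\<bar>) / (1 + v\<^sup>2) * ((1 + \<bar>v\<bar>) / (1 + v\<^sup>2))))"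
      by (simp only: mult_ac)
    also have "\<dots> \<le> (K * L) * ((1 / (1 + x\<^sup>2)) * (2 * (1 / (1 + v\<^sup>2))))"
      using K(1) L(1) by (intro mult_left_mono mult_mono X V) auto
    finally show ?thesis by (simp add: mult_ac)
  qed
  moreover have "(\<lambda>(x, v, z). f x v z * g x v z) \<in> borel_measurable (lborel \<Otimes>\<^sub>M (lborel \<Otimes>\<^sub>M P))"
    using assms by (auto simp: decay1_xvz_def case_prod_beta' intro!: borel_measurable_times)
  ultimately show ?thesis unfolding decay_xvz_def by blast
qed

lemma decay1_xvz_power2: "decay1_xvz f \<Longrightarrow> decay_xvz (\<lambda>x v z. (f x v z)\<^sup>2)"
  using decay1_xvz_mult[of f f] by (simp add: power2_eq_square)

lemma decay_xvz_v_integrable: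
  assumes "decay_xvz f" "z \<in> I" shows "integrable lborel (\<lambda>v. f x v z)"
proof -
  obtain K where K: "0 \<le> K" "\<And>x v z. z \<in> I \<Longrightarrow> \<bar>f x v z\<bar> \<le> K * (1 / (1 + x\<^sup>2)) * (1 / (1 + v\<^sup>2))"
    by (rule decay_xvzE[OF assms(1)]) (rule that)
  have "(\<lambda>v. (\<lambda>(x, v, z). f x v z) (x, v, z)) \<in> borel_measurable lborel"
    using assms by (intro measurable_compose[OF _ conjunct1[OF assms(1)[unfolded decay_xvz_def]]] measurable_Pair) auto
  then show ?thesis
    using K(2)[OF assms(2), of x] by (intro integrable_lborel_dominated[where K="K * (1 / (1 + x\<^sup>2))"]) auto
qed

lemma decay_xz_integral_v:
  assumes "decay_xvz f" shows "decay_xz (\<lambda>x z. LINT v|lborel. f x v z)"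
proof -
  obtain K where K: "0 \<le> K" "\<And>x v z. z \<in> I \<Longrightarrow> \<bar>f x v z\<bar> \<le> K * (1 / (1 + x\<^sup>2)) * (1 / (1 + v\<^sup>2))"
    by (rule decay_xvzE[OF assms]) (rule that)
  have "\<bar>LINT v|lborel. f x v z\<bar> \<le> (K * (LINT v|lborel. 1 / (1 + v\<^sup>2))) / (1 + x\<^sup>2)" if "z \<in> I" for x z
  proof -
    have "\<bar>LINT v|lborel. f x v z\<bar> \<le> (LINT v|lborel. K * (1 / (1 + x\<^sup>2)) * (1 / (1 + v\<^sup>2)))"
      by (intro integral_abs_bound_integral decay_xvz_v_integrable[OF assms that] integrable_mult_right integrable_weight K(2)[OF that])
    also have "\<dots> = K * (1 / (1 + x\<^sup>2)) * (LINT v|lborel. 1 / (1 + v\<^sup>2))" by (rule integral_mult_right_zero)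
    finally show ?thesis by simp
  qed
  moreover have "(\<lambda>(x, z). LINT v|lborel. f x v z) \<in> borel_measurable (lborel \<Otimes>\<^sub>M P)"
  proof -
    have "(\<lambda>q. (fst (fst q), snd q, snd (fst q))) \<in> measurable (((lborel :: real measure) \<Otimes>\<^sub>M P) \<Otimes>\<^sub>M (lborel :: real measure))
        (lborel \<Otimes>\<^sub>M (lborel \<Otimes>\<^sub>M P))"
      by (intro measurable_Pair measurable_compose[OF measurable_fst measurable_fst]
          measurable_compose[OF measurable_fst measurable_snd] measurable_snd)
    from measurable_compose[OF this, of "\<lambda>(x, v, z). f x v z" borel]
    have "case_prod (\<lambda>p v. f (fst p) v (snd p)) \<in> borel_measurable ((lborel \<Otimes>\<^sub>M P) \<Otimes>\<^sub>M lborel)"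
      using assms by (simp add: decay_xvz_def case_prod_beta')
    from lborel.borel_measurable_lebesgue_integral[OF this] show ?thesis by (simp add: case_prod_beta')
  qed
  ultimately show ?thesis unfolding decay_xz_def by blast
qed

text \<open>The norm in L^2(dv) is the form in which kinetic functions enter the trilinear estimate.
  Squaring the bound makes the v-dependence integrable, and the root restores the decay in
  x.\<close>

lemma decay_xz_sqrt_integral_v:
  assumes "decay1_xvz f" shows "decay_xz (\<lambda>x z. sqrt (LINT v|lborel. (f x v z)\<^sup>2))"
proof -
  obtain K where K: "0 \<le> K" "\<And>x v z. z \<in> I \<Longrightarrow> \<bar>f x v z\<bar> \<le> K * (1 / (1 + x\<^sup>2)) * ((1 + \<bar>v\<bar>) / (1 + v\<^sup>2))"
    by (rule decay1_xvzE[OF assms]) (rule that)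
  let ?c = "LINT v|lborel. ((1 + \<bar>v\<bar>) / (1 + v\<^sup>2))\<^sup>2 :: real"
  have ic: "integrable lborel (\<lambda>v::real. ((1 + \<bar>v\<bar>) / (1 + v\<^sup>2))\<^sup>2)"
  proof -
    have "continuous_on UNIV (\<lambda>v::real. (1 + \<bar>v\<bar>) / (1 + v\<^sup>2))" by (intro continuous_intros) auto
    then have "decay1 (\<lambda>v::real. (1 + \<bar>v\<bar>) / (1 + v\<^sup>2))" unfolding decay1_def by (auto intro!: exI[of _ 1])
    then show ?thesis by (intro decay_integrable decay1_power2)
  qed
  have "\<bar>sqrt (LINT v|lborel. (f x v z)\<^sup>2)\<bar> \<le> (K * sqrt ?c) / (1 + x\<^sup>2)" if "z \<in> I" for x z
  proof -
    have "(LINT v|lborel. (f x v z)\<^sup>2) \<le> (LINT v|lborel. (K * (1 / (1 + x\<^sup>2)))\<^sup>2 * ((1 + \<bar>v\<bar>) / (1 + v\<^sup>2))\<^sup>2)"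
    proof (rule integral_mono)
      show "(f x v z)\<^sup>2 \<le> (K * (1 / (1 + x\<^sup>2)))\<^sup>2 * ((1 + \<bar>v\<bar>) / (1 + v\<^sup>2))\<^sup>2" for v
        unfolding power_mult_distrib[symmetric] using power_mono[OF K(2)[OF that, of x v], of 2] by simp
    qed (use decay_xvz_v_integrable[OF decay1_xvz_power2[OF assms] that] ic in \<open>auto intro: integrable_mult_right\<close>)
    also have "\<dots> = (K * (1 / (1 + x\<^sup>2)))\<^sup>2 * ?c" by simp
    finally have "sqrt (LINT v|lborel. (f x v z)\<^sup>2) \<le> sqrt ((K * (1 / (1 + x\<^sup>2)))\<^sup>2 * ?c)" by (rule real_sqrt_le_mono)
    also have "\<dots> = K * (1 / (1 + x\<^sup>2)) * sqrt ?c" using K(1) by (simp add: real_sqrt_mult real_sqrt_divide)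
    finally show ?thesis by simp
  qed
  moreover have "(\<lambda>(x, z). sqrt (LINT v|lborel. (f x v z)\<^sup>2)) \<in> borel_measurable (lborel \<Otimes>\<^sub>M P)"
    using decay_xz_integral_v[OF decay1_xvz_power2[OF assms]] by (auto simp: decay_xz_def case_prod_beta' intro!: borel_measurable_sqrt)
  ultimately show ?thesis unfolding decay_xz_def by blast
qed

lemma decay_xvz_xv_integrable:
  assumes "decay_xvz f" "z \<in> I"
  shows "integrable (lborel \<Otimes>\<^sub>M lborel) (\<lambda>(x, v). f x v z)"
proof -
  obtain K where K: "0 \<le> K" "\<And>x v z. z \<in> I \<Longrightarrow> \<bar>f x v z\<bar> \<le> K * (1 / (1 + x\<^sup>2)) * (1 / (1 + v\<^sup>2))"
    by (rule decay_xvzE[OF assms(1)]) (rule that)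
  have "integrable (lborel \<Otimes>\<^sub>M lborel) (\<lambda>(x::real, v::real). (K / (1 + x\<^sup>2)) * (1 / (1 + v\<^sup>2)))"
    by (intro lborel_pair.integrable_mult_pair integrable_weight)
  moreover have "(\<lambda>(x, v). f x v z) \<in> borel_measurable (lborel \<Otimes>\<^sub>M lborel)"
  proof -
    have "(\<lambda>q. (fst q, snd q, z)) \<in> measurable ((lborel :: real measure) \<Otimes>\<^sub>M (lborel :: real measure)) (lborel \<Otimes>\<^sub>M (lborel \<Otimes>\<^sub>M P))"
      using assms(2) by (intro measurable_Pair measurable_fst measurable_snd measurable_const) auto
    from measurable_compose[OF this conjunct1[OF assms(1)[unfolded decay_xvz_def]]] show ?thesis by (simp add: case_prod_beta')
  qed
  ultimately show ?thesis
    by (rule Bochner_Integration.integrable_bound)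
       (use order_trans[OF K(2)[OF assms(2)] abs_ge_self] in \<open>auto intro!: AE_I2\<close>)
qed

lemma decay_xvz_integral_swap:
  assumes "decay_xvz f" "z \<in> I"
  shows "(LINT v|lborel. LINT x|lborel. f x v z) = (LINT x|lborel. LINT v|lborel. f x v z)"
  using decay_xvz_xv_integrable[OF assms] by (rule lborel_pair.Fubini_integral)

text \<open>The product measure has the order x, v, z. Exchanging integrals puts velocity innermost,
  so that further work concerns functions of (x, z).\<close>

lemma mu3_integral:
  assumes "decay_xvz f"
  shows "integrable (mu3 P) (\<lambda>(x, v, z). f x v z)"
    and "(LINT p|mu3 P. (case p of (x, v, z) \<Rightarrow> f x v z)) = (LINT z|P. LINT x|lborel. LINT v|lborel. f x v z)"
proof -
  obtain K where K: "0 \<le> K" "\<And>x v z. z \<in> I \<Longrightarrow> \<bar>f x v z\<bar> \<le> K * (1 / (1 + x\<^sup>2)) * (1 / (1 + v\<^sup>2))"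
    by (rule decay_xvzE[OF assms]) (rule that)
  have m: "(\<lambda>(x, v, z). f x v z) \<in> borel_measurable (lborel \<Otimes>\<^sub>M (lborel \<Otimes>\<^sub>M P))" using assms by (simp add: decay_xvz_def)
  have "integrable (lborel \<Otimes>\<^sub>M P) (\<lambda>(v :: real, z). 1 / (1 + v\<^sup>2) * 1)"
    by (rule xz.integrable_mult_pair[of "\<lambda>v. 1 / (1 + v\<^sup>2)" "\<lambda>_. 1"]) (auto intro: integrable_weight)
  then have "integrable (lborel \<Otimes>\<^sub>M (lborel \<Otimes>\<^sub>M P)) (\<lambda>(x, q). (K / (1 + x\<^sup>2)) * (case q of (v, z) \<Rightarrow> 1 / (1 + v\<^sup>2) * 1))"
    by (intro vxz.integrable_mult_pair integrable_weight)
  then have i: "integrable (lborel \<Otimes>\<^sub>M (lborel \<Otimes>\<^sub>M P)) (\<lambda>(x, v, z). f x v z)"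
  proof (rule Bochner_Integration.integrable_bound[OF _ m], intro AE_I2)
    fix p assume "p \<in> space ((lborel :: real measure) \<Otimes>\<^sub>M ((lborel :: real measure) \<Otimes>\<^sub>M P))"
    then obtain x v z where p: "p = (x, v, z)" "z \<in> I" by (auto simp: space_pair_measure)
    show "norm (case p of (x, v, z) \<Rightarrow> f x v z) \<le> norm (case p of (x, q) \<Rightarrow> (K / (1 + x\<^sup>2)) * (case q of (v, z) \<Rightarrow> 1 / (1 + v\<^sup>2) * 1))"
      using order_trans[OF K(2)[OF p(2), of x v] abs_ge_self] by (simp add: p mult.commute)
  qed
  then show "integrable (mu3 P) (\<lambda>(x, v, z). f x v z)" by (simp add: mu3_def)
  have "(LINT p|mu3 P. (case p of (x, v, z) \<Rightarrow> f x v z)) = (LINT q|(lborel \<Otimes>\<^sub>M P). LINT x|lborel. (case q of (v, z) \<Rightarrow> f x v z))"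
    using vxz.integral_snd[of "\<lambda>x (v, z). f x v z"] i by (simp add: mu3_def)
  also have "\<dots> = (LINT q|(lborel \<Otimes>\<^sub>M P). (case q of (v, z) \<Rightarrow> LINT x|lborel. f x v z))"
    by (rule Bochner_Integration.integral_cong) auto
  also have "\<dots> = (LINT z|P. LINT v|lborel. LINT x|lborel. f x v z)"
    using xz.integral_snd[of "\<lambda>v z. LINT x|lborel. f x v z"] vxz.integrable_snd[of "\<lambda>x (v, z). f x v z"] i
    by (simp add: case_prod_beta')
  also have "\<dots> = (LINT z|P. LINT x|lborel. LINT v|lborel. f x v z)"
    by (rule Bochner_Integration.integral_cong[OF refl]) (simp add: decay_xvz_integral_swap[OF assms])
  finally show "(LINT p|mu3 P. (case p of (x, v, z) \<Rightarrow> f x v z)) = (LINT z|P. LINT x|lborel. LINT v|lborel. f x v z)" .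
qed

end

section \<open>Integrals over position and the random variable\<close>

context zspace begin

definition I2 :: "(real \<Rightarrow> real \<Rightarrow> real) \<Rightarrow> real" where
  "I2 f = (LINT p|mu2 P. (case p of (x, z) \<Rightarrow> f x z))"

lemma I2_iterated: "decay_xz f \<Longrightarrow> I2 f = (LINT z|P. LINT x|lborel. f x z)"
  by (simp add: I2_def mu2_integral)

lemma I2_add: "decay_xz f \<Longrightarrow> decay_xz g \<Longrightarrow> I2 (\<lambda>x z. f x z + g x z) = I2 f + I2 g"
  using mu2_integral(1)[of f] mu2_integral(1)[of g] by (simp add: I2_def case_prod_beta')

lemma I2_diff: "decay_xz f \<Longrightarrow> decay_xz g \<Longrightarrow> I2 (\<lambda>x z. f x z - g x z) = I2 f - I2 g"
  using mu2_integral(1)[of f] mu2_integral(1)[of g] by (simp add: I2_def case_prod_beta')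

lemma I2_cmult: "I2 (\<lambda>x z. c * f x z) = c * I2 f"
  by (simp add: I2_def case_prod_beta')

lemma I2_minus: "I2 (\<lambda>x z. - f x z) = - I2 f"
  using I2_cmult[of "-1"] by simp

lemma I2_zero: "I2 (\<lambda>x z. 0) = 0"
  by (simp add: I2_def)

lemma I2_sum: "(\<And>k. k \<in> A \<Longrightarrow> decay_xz (f k)) \<Longrightarrow> I2 (\<lambda>x z. \<Sum>k\<in>A. f k x z) = (\<Sum>k\<in>A. I2 (f k))"
  by (induction A rule: infinite_finite_induct) (auto simp: I2_zero I2_add decay_xz_sum)

lemma I2_cong: "(\<And>x z. z \<in> I \<Longrightarrow> f x z = g x z) \<Longrightarrow> I2 f = I2 g"
  unfolding I2_def by (rule Bochner_Integration.integral_cong) (auto simp: mu2_def space_pair_measure)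

lemma I2_mono: "decay_xz f \<Longrightarrow> decay_xz g \<Longrightarrow> (\<And>x z. z \<in> I \<Longrightarrow> f x z \<le> g x z) \<Longrightarrow> I2 f \<le> I2 g"
  using mu2_integral(1)[of f] mu2_integral(1)[of g]
  unfolding I2_def by (intro integral_mono) (auto simp: mu2_def space_pair_measure)

lemma I2_nonneg: "(\<And>x z. z \<in> I \<Longrightarrow> 0 \<le> f x z) \<Longrightarrow> 0 \<le> I2 f"
  unfolding I2_def by (rule Bochner_Integration.integral_nonneg) (auto simp: mu2_def space_pair_measure)

lemma I2_abs_le: "decay_xz f \<Longrightarrow> \<bar>I2 f\<bar> \<le> I2 (\<lambda>x z. \<bar>f x z\<bar>)"
proof -
  assume f: "decay_xz f"
  have "I2 f \<le> I2 (\<lambda>x z. \<bar>f x z\<bar>)" "I2 (\<lambda>x z. - f x z) \<le> I2 (\<lambda>x z. \<bar>f x z\<bar>)"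
    by (intro I2_mono decay_xz_abs decay_xz_minus f; simp)+
  then show ?thesis by (simp add: I2_minus)
qed

lemma integral_x_bounded:
  assumes "decay_xz f"
  shows "\<exists>W\<ge>0. \<forall>z\<in>I. \<bar>LINT x|lborel. f x z\<bar> \<le> W"
proof -
  obtain K where K: "0 \<le> K" "\<And>x z. z \<in> I \<Longrightarrow> \<bar>f x z\<bar> \<le> K / (1 + x\<^sup>2)" by (rule decay_xzE[OF assms]) (rule that)
  have "\<bar>LINT x|lborel. f x z\<bar> \<le> (LINT x|lborel. K / (1 + x\<^sup>2))" if "z \<in> I" for z
    by (intro integral_abs_bound_integral mdecay_integrable decay_xz_mdecay[OF assms that] integrable_weight K(2)[OF that])
  moreover have "0 \<le> (LINT x|lborel. K / (1 + x\<^sup>2))"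
    by (rule Bochner_Integration.integral_nonneg) (simp add: K(1))
  ultimately show ?thesis by blast
qed

text \<open>For fixed z the estimate in x applies and leaves a product of three H^1 norms in x with
  a factor 2. These norms, as functions of z, satisfy the hypotheses of \<open>z_trilinear\<close>:
  adding \<open>zsup\<close> for i = 0 and i = 1 gives their suprema.\<close>

lemma xz_trilinear:
  fixes f k b :: "nat \<Rightarrow> nat \<Rightarrow> real \<Rightarrow> real \<Rightarrow> real"
  assumes m: "1 \<le> m" and C: "0 \<le> C"
    and decay_xz: "\<And>l i. l \<le> m \<Longrightarrow> i \<le> 1 \<Longrightarrow> decay_xz (f l i)" "\<And>l i. l \<le> m \<Longrightarrow> i \<le> 1 \<Longrightarrow> decay_xz (k l i)"
      "\<And>l i. l \<le> m \<Longrightarrow> i \<le> 1 \<Longrightarrow> decay_xz (b l i)"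
    and nn: "\<And>l i x z. 0 \<le> f l i x z" "\<And>l i x z. 0 \<le> k l i x z" "\<And>l i x z. 0 \<le> b l i x z"
    and xsup: "\<And>l x z. l \<le> m \<Longrightarrow> z \<in> I \<Longrightarrow> (f l 0 x z)\<^sup>2 \<le> (LINT x|lborel. (f l 0 x z)\<^sup>2) + (LINT x|lborel. (f l 1 x z)\<^sup>2)"
      "\<And>l x z. l \<le> m \<Longrightarrow> z \<in> I \<Longrightarrow> (k l 0 x z)\<^sup>2 \<le> (LINT x|lborel. (k l 0 x z)\<^sup>2) + (LINT x|lborel. (k l 1 x z)\<^sup>2)"
    and zsup: "\<And>l i z. l < m \<Longrightarrow> i \<le> 1 \<Longrightarrow> z \<in> I \<Longrightarrow>
        (LINT x|lborel. (f l i x z)\<^sup>2) \<le> C\<^sup>2 * (I2 (\<lambda>x z. (f l i x z)\<^sup>2) + I2 (\<lambda>x z. (f (Suc l) i x z)\<^sup>2))"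
      "\<And>l i z. l < m \<Longrightarrow> i \<le> 1 \<Longrightarrow> z \<in> I \<Longrightarrow>
        (LINT x|lborel. (k l i x z)\<^sup>2) \<le> C\<^sup>2 * (I2 (\<lambda>x z. (k l i x z)\<^sup>2) + I2 (\<lambda>x z. (k (Suc l) i x z)\<^sup>2))"
  shows "(\<Sum>l\<le>m. \<Sum>i\<le>1. \<Sum>r\<le>i. real (i choose r) *
      (\<Sum>j\<le>l. real (l choose j) * I2 (\<lambda>x z. f j r x z * k (l - j) (i - r) x z * b l i x z)))
    \<le> 2 * A_const m * C * sqrt (\<Sum>l\<le>m. \<Sum>i\<le>1. I2 (\<lambda>x z. (f l i x z)\<^sup>2))
        * sqrt (\<Sum>l\<le>m. \<Sum>i\<le>1. I2 (\<lambda>x z. (k l i x z)\<^sup>2)) * sqrt (\<Sum>l\<le>m. \<Sum>i\<le>1. I2 (\<lambda>x z. (b l i x z)\<^sup>2))"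
proof -
  define n where "n g l z = sqrt ((LINT x|lborel. (g l 0 x z)\<^sup>2) + (LINT x|lborel. (g l 1 x z)\<^sup>2))"
    for g :: "nat \<Rightarrow> nat \<Rightarrow> real \<Rightarrow> real \<Rightarrow> real" and l z
  have n2: "(n g l z)\<^sup>2 = (LINT x|lborel. (g l 0 x z)\<^sup>2) + (LINT x|lborel. (g l 1 x z)\<^sup>2)" for g l z
    by (simp add: n_def)
  have n0: "0 \<le> n g l z" for g l z by (simp add: n_def)
  note I2i = mu2_integral(3)
  have nI: "(LINT z|P. (n g l z)\<^sup>2) = (\<Sum>i\<le>1. I2 (\<lambda>x z. (g l i x z)\<^sup>2))"
    if "\<And>i. i \<le> 1 \<Longrightarrow> decay_xz (g l i)" for g l
    unfolding n2 using I2i[OF decay_xz_power2[OF that[of 0]]] I2i[OF decay_xz_power2[OF that[of 1]]]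
    by (simp add: I2_iterated decay_xz_power2 that)
  have nm: "n g l \<in> borel_measurable P" if "\<And>i. i \<le> 1 \<Longrightarrow> decay_xz (g l i)" for g l
    unfolding n_def[abs_def] using I2i[OF decay_xz_power2[OF that[of 0]]] I2i[OF decay_xz_power2[OF that[of 1]]] by simp
  have nW1: "\<exists>W. \<forall>z\<in>I. n g l z \<le> W" if g: "\<And>i. i \<le> 1 \<Longrightarrow> decay_xz (g l i)" for g l
  proof -
    obtain W0 W1 where W: "\<forall>z\<in>I. \<bar>LINT x|lborel. (g l 0 x z)\<^sup>2\<bar> \<le> W0" "\<forall>z\<in>I. \<bar>LINT x|lborel. (g l 1 x z)\<^sup>2\<bar> \<le> W1"
      using integral_x_bounded[OF decay_xz_power2[OF g[of 0]]] integral_x_bounded[OF decay_xz_power2[OF g[of 1]]] by auto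
    have "n g l z \<le> sqrt (W0 + W1)" if "z \<in> I" for z
      unfolding n_def using W that by (intro real_sqrt_le_mono add_mono) (auto intro: order_trans[OF abs_ge_self])
    then show ?thesis by blast
  qed
  have nW: "\<exists>W. \<forall>l\<le>m. \<forall>z\<in>I. n g l z \<le> W" if g: "\<And>l i. l \<le> m \<Longrightarrow> i \<le> 1 \<Longrightarrow> decay_xz (g l i)" for g
  proof -
    have "\<exists>K. \<forall>l\<in>{..m}. \<forall>z\<in>I. \<bar>n g l z\<bar> \<le> K / 1"
    proof (rule finite_uniform_bound)
      fix l assume "l \<in> {..m}"
      then show "\<exists>K. \<forall>z\<in>I. \<bar>n g l z\<bar> \<le> K / 1" using nW1[of g l, OF g] n0 by simp
    qed auto
    then obtain K where "\<forall>l\<in>{..m}. \<forall>z\<in>I. \<bar>n g l z\<bar> \<le> K / 1" by (rule exE)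
    then show ?thesis using n0 by (intro exI[of _ K]) simp
  qed
  obtain Wf where Wf: "\<forall>l\<le>m. \<forall>z\<in>I. n f l z \<le> Wf" using nW[of f, OF decay_xz(1)] by blast
  obtain Wk where Wk: "\<forall>l\<le>m. \<forall>z\<in>I. n k l z \<le> Wk" using nW[of k, OF decay_xz(2)] by blast
  obtain Wb where Wb: "\<forall>l\<le>m. \<forall>z\<in>I. n b l z \<le> Wb" using nW[of b, OF decay_xz(3)] by blast
  define W where "W = max Wf (max Wk Wb)"
  have W3: "n f l z \<le> W" "n k l z \<le> W" "n b l z \<le> W" if "l \<le> m" "z \<in> I" for l z
    using Wf[rule_format, OF that] Wk[rule_format, OF that] Wb[rule_format, OF that]
    unfolding W_def by (simp_all add: le_max_iff_disj)
  have sup: "(n g l z)\<^sup>2 \<le> C\<^sup>2 * ((LINT z|P. (n g l z)\<^sup>2) + (LINT z|P. (n g (Suc l) z)\<^sup>2))"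
    if "l < m" "z \<in> I" and g: "\<And>l i. l \<le> m \<Longrightarrow> i \<le> 1 \<Longrightarrow> decay_xz (g l i)"
      and zs: "\<And>l i z. l < m \<Longrightarrow> i \<le> 1 \<Longrightarrow> z \<in> I \<Longrightarrow>
        (LINT x|lborel. (g l i x z)\<^sup>2) \<le> C\<^sup>2 * (I2 (\<lambda>x z. (g l i x z)\<^sup>2) + I2 (\<lambda>x z. (g (Suc l) i x z)\<^sup>2))" for g l z
  proof -
    have e: "(LINT z|P. (n g l z)\<^sup>2) = (\<Sum>i\<le>1. I2 (\<lambda>x z. (g l i x z)\<^sup>2))"
      "(LINT z|P. (n g (Suc l) z)\<^sup>2) = (\<Sum>i\<le>1. I2 (\<lambda>x z. (g (Suc l) i x z)\<^sup>2))"
      using that(1) by (intro nI g; simp)+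
    show ?thesis
      unfolding e unfolding n2 using zs[OF that(1) _ that(2), of 0] zs[OF that(1) _ that(2), of 1]
      by (simp add: algebra_simps)
  qed
  have Z: "(\<Sum>l\<le>m. \<Sum>j\<le>l. real (l choose j) * (LINT z|P. n f j z * n k (l - j) z * n b l z))
    \<le> A_const m * C * sqrt (\<Sum>l\<le>m. LINT z|P. (n f l z)\<^sup>2) * sqrt (\<Sum>l\<le>m. LINT z|P. (n k l z)\<^sup>2)
        * sqrt (\<Sum>l\<le>m. LINT z|P. (n b l z)\<^sup>2)"
  proof (rule z_trilinear[OF m C, where W=W])
    show "finite_measure P" by unfold_locales
    show "n f l z \<le> W" "n k l z \<le> W" "n b l z \<le> W" if "l \<le> m" "z \<in> space P" for l z
      using W3 that by simp_all
    show "(n f l z)\<^sup>2 \<le> C\<^sup>2 * ((LINT z|P. (n f l z)\<^sup>2) + (LINT z|P. (n f (Suc l) z)\<^sup>2))"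
      "(n k l z)\<^sup>2 \<le> C\<^sup>2 * ((LINT z|P. (n k l z)\<^sup>2) + (LINT z|P. (n k (Suc l) z)\<^sup>2))" if "l < m" "z \<in> space P" for l z
      using that by (intro sup decay_xz zsup; simp)+
  qed (auto intro!: nm decay_xz simp: n0)
  have int: "integrable P (\<lambda>z. n f j z * n k (l - j) z * n b l z)" if "j \<le> l" "l \<le> m" for j l
  proof (rule integrable_const_bound[where B="W * W * W"])
    show "AE z in P. norm (n f j z * n k (l - j) z * n b l z) \<le> W * W * W"
    proof (rule AE_I2)
      fix z assume "z \<in> space P"
      then have "n f j z \<le> W" "n k (l - j) z \<le> W" "n b l z \<le> W" using W3 that by simp_all
      then have "n f j z * n k (l - j) z * n b l z \<le> W * W * W"
        using n0 by (intro mult_mono mult_nonneg_nonneg) (auto intro: order_trans[OF n0])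
      then show "norm (n f j z * n k (l - j) z * n b l z) \<le> W * W * W" using n0 by (simp add: abs_mult)
    qed
    show "(\<lambda>z. n f j z * n k (l - j) z * n b l z) \<in> borel_measurable P"
      using that by (intro borel_measurable_times nm decay_xz) auto
  qed
  let ?p = "\<lambda>j l x z. f j 0 x z * k (l - j) 0 x z * b l 0 x z"
    and ?q = "\<lambda>j l x z. f j 0 x z * k (l - j) 1 x z * b l 1 x z"
    and ?r = "\<lambda>j l x z. f j 1 x z * k (l - j) 0 x z * b l 1 x z"
  have T: "I2 (?p j l) + I2 (?q j l)
      + I2 (?r j l) \<le> 2 * (LINT z|P. n f j z * n k (l - j) z * n b l z)"
    if "j \<le> l" "l \<le> m" for j l
  proof -
    have d: "decay_xz (?p j l)" "decay_xz (?q j l)"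
      "decay_xz (?r j l)"
      using that by (auto intro!: decay_xz_mult decay_xz)
    have "I2 (?p j l) + I2 (?q j l)
      + I2 (?r j l)
      = (LINT z|P. (LINT x|lborel. ?p j l x z)
         + (LINT x|lborel. ?q j l x z) + (LINT x|lborel. ?r j l x z))"
      unfolding I2_iterated[OF d(1)] I2_iterated[OF d(2)] I2_iterated[OF d(3)]
      using I2i[OF d(1)] I2i[OF d(2)] I2i[OF d(3)] by simp
    also have "\<dots> \<le> (LINT z|P. 2 * (n f j z * n k (l - j) z * n b l z))"
    proof (rule integral_mono)
      fix z assume "z \<in> space P"
      then have z: "z \<in> I" by simp
      have "(LINT x|lborel. ?p j l x z)
         + (LINT x|lborel. ?q j l x z) + (LINT x|lborel. ?r j l x z)
         \<le> 2 * n f j z * n k (l - j) z * n b l z"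
        unfolding n_def
        by (intro x_trilinear decay_xz_mdecay decay_xz nn xsup z) (use that in auto)
      then show "(LINT x|lborel. ?p j l x z)
         + (LINT x|lborel. ?q j l x z) + (LINT x|lborel. ?r j l x z)
         \<le> 2 * (n f j z * n k (l - j) z * n b l z)" by (simp add: mult_ac)
    qed (use int[OF that] I2i[OF d(1)] I2i[OF d(2)] I2i[OF d(3)] in auto)
    finally show ?thesis by simp
  qed
  have "(\<Sum>l\<le>m. \<Sum>i\<le>1. \<Sum>r\<le>i. real (i choose r) *
      (\<Sum>j\<le>l. real (l choose j) * I2 (\<lambda>x z. f j r x z * k (l - j) (i - r) x z * b l i x z)))
    = (\<Sum>l\<le>m. \<Sum>j\<le>l. real (l choose j) * (I2 (?p j l)
      + I2 (?q j l) + I2 (?r j l)))"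
    by (simp add: sum.distrib distrib_left)
  also have "\<dots> \<le> (\<Sum>l\<le>m. \<Sum>j\<le>l. real (l choose j) * (2 * (LINT z|P. n f j z * n k (l - j) z * n b l z)))"
    by (intro sum_mono mult_left_mono T) auto
  also have "\<dots> = 2 * (\<Sum>l\<le>m. \<Sum>j\<le>l. real (l choose j) * (LINT z|P. n f j z * n k (l - j) z * n b l z))"
    by (simp add: sum_distrib_left mult_ac)
  also have "\<dots> \<le> 2 * (A_const m * C * sqrt (\<Sum>l\<le>m. LINT z|P. (n f l z)\<^sup>2) * sqrt (\<Sum>l\<le>m. LINT z|P. (n k l z)\<^sup>2)
        * sqrt (\<Sum>l\<le>m. LINT z|P. (n b l z)\<^sup>2))"
    using Z by simp
  also have "(\<Sum>l\<le>m. LINT z|P. (n f l z)\<^sup>2) = (\<Sum>l\<le>m. \<Sum>i\<le>1. I2 (\<lambda>x z. (f l i x z)\<^sup>2))"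
    by (rule sum.cong[OF refl], rule nI, rule decay_xz(1)) auto
  also have "(\<Sum>l\<le>m. LINT z|P. (n k l z)\<^sup>2) = (\<Sum>l\<le>m. \<Sum>i\<le>1. I2 (\<lambda>x z. (k l i x z)\<^sup>2))"
    by (rule sum.cong[OF refl], rule nI, rule decay_xz(2)) auto
  also have "(\<Sum>l\<le>m. LINT z|P. (n b l z)\<^sup>2) = (\<Sum>l\<le>m. \<Sum>i\<le>1. I2 (\<lambda>x z. (b l i x z)\<^sup>2))"
    by (rule sum.cong[OF refl], rule nI, rule decay_xz(3)) auto
  finally show ?thesis by (simp only: mult_ac)
qed

section \<open>Suprema of the derivative families in z and x\<close>

lemma decay_xz_swap_measurable: "decay_xz f \<Longrightarrow> (\<lambda>(z, x). f x z) \<in> borel_measurable (P \<Otimes>\<^sub>M lborel)"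
  using measurable_pair_swap[of "\<lambda>(x, z). f x z" lborel P borel] by (simp add: decay_xz_def)

text \<open>The two extra orders in \<open>N\<close> come from the second z-derivative in
  \<open>z_embedding_L2\<close>. With l < m and i at most 1 they amount to m + 2, the regularity
  granted to the field.\<close>

lemma mac_family_z_sup:
  assumes F: "mac_family N J F" and J: "open J" "I \<subseteq> J" and emb: "z_embedding I P C" "0 \<le> C"
    and N: "l + i + 2 \<le> N" and t: "0 \<le> t" and z: "z \<in> I"
  shows "(LINT x|lborel. (F 0 l i t x z)\<^sup>2) \<le>
    C\<^sup>2 * (I2 (\<lambda>x z. (F 0 l i t x z)\<^sup>2) + I2 (\<lambda>x z. (F 0 (Suc l) i t x z)\<^sup>2))"
proof -
  have d: "decay_xz (\<lambda>x z. F 0 l' i t x z)" if "l' \<le> Suc l" for l'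
    using that N by (intro mac_family_decay_xz[OF F J _ t]) auto
  obtain K where K: "0 \<le> K" "\<And>k l i t' x z. k + l + i \<le> N \<Longrightarrow> 0 \<le> t' \<Longrightarrow> t' \<le> t \<Longrightarrow> z \<in> J \<Longrightarrow>
      \<bar>F k l i t' x z\<bar> \<le> K / (1 + x\<^sup>2)"
    by (rule mac_family_bound[OF F, where T=t]) (rule that)
  have decay: "decay (\<lambda>x. F 0 l' i t x z)" if "l' \<le> l + 2" "z \<in> J" for l' z
    using that N t by (intro mac_family_decay_x[OF F]) auto
  have "(LINT x|lborel. (F 0 l i t x z)\<^sup>2) \<le> C\<^sup>2 * ((LINT z|P. LINT x|lborel. (F 0 l i t x z)\<^sup>2)
      + (LINT z|P. LINT x|lborel. (F 0 (Suc l) i t x z)\<^sup>2))"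
  proof (rule z_embedding_L2[OF emb _ space_P sigma_finite_lborel J, where f''="F 0 (Suc (Suc l)) i t" and w="\<lambda>x. K / (1 + x\<^sup>2)"])
    show "finite_measure P" by unfold_locales
    show "(F 0 l i t y has_real_derivative F 0 (Suc l) i t y z) (at z)"
      "(F 0 (Suc l) i t y has_real_derivative F 0 (Suc (Suc l)) i t y z) (at z)" if "z \<in> J" for y z
      using mac_family_DERIV(2)[OF F _ t that, of 0 l i y] mac_family_DERIV(2)[OF F _ t that, of 0 "Suc l" i y] N by auto
    show "\<bar>F 0 l i t y z\<bar> \<le> K / (1 + y\<^sup>2)" "\<bar>F 0 (Suc l) i t y z\<bar> \<le> K / (1 + y\<^sup>2)"
      "\<bar>F 0 (Suc (Suc l)) i t y z\<bar> \<le> K / (1 + y\<^sup>2)" if "z \<in> J" for y z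
      using N t that by (auto intro!: K(2))
    show "integrable lborel (\<lambda>y. (K / (1 + y\<^sup>2))\<^sup>2)"
    proof -
      have "decay (\<lambda>y::real. K / (1 + y\<^sup>2))" using K(1) by (intro decayI[where K=K] continuous_intros) auto
      then show ?thesis by (intro decay_integrable decay1_power2 decay_imp_decay1)
    qed
    show "(\<lambda>y. F 0 l i t y z) \<in> borel_measurable lborel" "(\<lambda>y. F 0 (Suc l) i t y z) \<in> borel_measurable lborel"
      "(\<lambda>y. F 0 (Suc (Suc l)) i t y z) \<in> borel_measurable lborel" if "z \<in> J" for z
      by (rule borel_measurable_integrable[OF decay_integrable[OF decay]], simp, rule that)+
    show "(\<lambda>(z, y). F 0 l i t y z) \<in> borel_measurable (P \<Otimes>\<^sub>M lborel)"
      "(\<lambda>(z, y). F 0 (Suc l) i t y z) \<in> borel_measurable (P \<Otimes>\<^sub>M lborel)"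
      by (rule decay_xz_swap_measurable, rule d, simp)+
  qed (use z in auto)
  then show ?thesis by (simp add: I2_iterated d decay_xz_power2)
qed

text \<open>The embedding is applied to h with values in L^2(dx dv) and not to the root of its
  velocity integral, which need not be differentiable where it vanishes.\<close>

lemma kin_family_z_sup:
  assumes H: "kin_family N J H" and J: "open J" "I \<subseteq> J" and emb: "z_embedding I P C" "0 \<le> C"
    and N: "l + i + 2 \<le> N" and t: "0 \<le> t" and z: "z \<in> I"
  shows "(LINT x|lborel. LINT v|lborel. (H 0 0 l i t x v z)\<^sup>2) \<le>
    C\<^sup>2 * (I2 (\<lambda>x z. LINT v|lborel. (H 0 0 l i t x v z)\<^sup>2) + I2 (\<lambda>x z. LINT v|lborel. (H 0 0 (Suc l) i t x v z)\<^sup>2))"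
proof -
  have d: "decay_xvz (\<lambda>x v z. H 0 0 l' i t x v z)" if "l' \<le> Suc l" for l'
    using that N by (intro kin_family_decay_xvz[OF H J _ t]) auto
  have d2: "decay_xvz (\<lambda>x v z. (H 0 0 l' i t x v z)\<^sup>2)" if "l' \<le> Suc l" for l'
    using that by (intro decay1_xvz_power2 decay_xvz_imp_decay1_xvz d)
  obtain K where K: "0 \<le> K" "\<And>k j l i t' x v z. k + j + l + i \<le> N \<Longrightarrow> 0 \<le> t' \<Longrightarrow> t' \<le> t \<Longrightarrow> z \<in> J \<Longrightarrow>
      \<bar>H k j l i t' x v z\<bar> \<le> K * (1 / (1 + x\<^sup>2)) * (1 / (1 + v\<^sup>2))"
    by (rule kin_family_bound[OF H, where T=t]) (rule that)
  let ?M = "(lborel :: real measure) \<Otimes>\<^sub>M (lborel :: real measure)"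
  have m: "(\<lambda>y. H 0 0 l' i t (fst y) (snd y) z) \<in> borel_measurable ?M" if "l' \<le> l + 2" "z \<in> J" for l' z
  proof -
    have "continuous_on UNIV (\<lambda>y. (\<lambda>(x, v, z). H 0 0 l' i t x v z) (fst y, snd y, z))"
      by (rule continuous_on_compose2[OF kin_family_continuous[OF H, of 0 0 l' i t]])
         (use that N t in \<open>auto intro!: continuous_intros\<close>)
    then have "(\<lambda>y. H 0 0 l' i t (fst y) (snd y) z) \<in> borel_measurable borel"
      by (intro borel_measurable_continuous_onI) simp
    then show ?thesis by (simp add: lborel_prod)
  qed
  have it: "(LINT y|?M. (H 0 0 l' i t (fst y) (snd y) z)\<^sup>2) = (LINT x|lborel. LINT v|lborel. (H 0 0 l' i t x v z)\<^sup>2)"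
    if "l' \<le> Suc l" "z \<in> I" for l' z
    using lborel_pair.integral_fst[of "\<lambda>x v. (H 0 0 l' i t x v z)\<^sup>2"] decay_xvz_xv_integrable[OF d2[OF that(1)] that(2)]
    by (simp add: case_prod_beta')
  have jm: "(\<lambda>(z, y). H 0 0 l' i t (fst y) (snd y) z) \<in> borel_measurable (P \<Otimes>\<^sub>M ?M)" if "l' \<le> Suc l" for l'
  proof -
    have "(\<lambda>q. (fst (snd q), snd (snd q), fst q)) \<in> measurable (P \<Otimes>\<^sub>M ?M) (lborel \<Otimes>\<^sub>M (lborel \<Otimes>\<^sub>M P))"
      by (intro measurable_Pair measurable_compose[OF measurable_snd measurable_fst]
          measurable_compose[OF measurable_snd measurable_snd] measurable_fst)
    from measurable_compose[OF this conjunct1[OF d[OF that, unfolded decay_xvz_def]]]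
    show ?thesis by (simp add: case_prod_beta')
  qed
  have "(LINT y|?M. (H 0 0 l i t (fst y) (snd y) z)\<^sup>2) \<le>
      C\<^sup>2 * ((LINT z|P. LINT y|?M. (H 0 0 l i t (fst y) (snd y) z)\<^sup>2)
        + (LINT z|P. LINT y|?M. (H 0 0 (Suc l) i t (fst y) (snd y) z)\<^sup>2))"
  proof (rule z_embedding_L2[OF emb _ space_P _ J, where f="\<lambda>y. H 0 0 l i t (fst y) (snd y)"
        and f'="\<lambda>y. H 0 0 (Suc l) i t (fst y) (snd y)" and f''="\<lambda>y. H 0 0 (Suc (Suc l)) i t (fst y) (snd y)"
        and w="\<lambda>y. K * (1 / (1 + (fst y)\<^sup>2)) * (1 / (1 + (snd y)\<^sup>2))"])
    show "finite_measure P" by unfold_locales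
    show "sigma_finite_measure ?M" by (intro sigma_finite_pair_measure sigma_finite_lborel)
    show "(H 0 0 l i t (fst y) (snd y) has_real_derivative H 0 0 (Suc l) i t (fst y) (snd y) z) (at z)"
      "(H 0 0 (Suc l) i t (fst y) (snd y) has_real_derivative H 0 0 (Suc (Suc l)) i t (fst y) (snd y) z) (at z)" if "z \<in> J" for y z
      using kin_family_DERIV(3)[OF H _ t that, of 0 0 l i "fst y" "snd y"] kin_family_DERIV(3)[OF H _ t that, of 0 0 "Suc l" i "fst y" "snd y"] N by auto
    show "\<bar>H 0 0 l i t (fst y) (snd y) z\<bar> \<le> K * (1 / (1 + (fst y)\<^sup>2)) * (1 / (1 + (snd y)\<^sup>2))"
      "\<bar>H 0 0 (Suc l) i t (fst y) (snd y) z\<bar> \<le> K * (1 / (1 + (fst y)\<^sup>2)) * (1 / (1 + (snd y)\<^sup>2))"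
      "\<bar>H 0 0 (Suc (Suc l)) i t (fst y) (snd y) z\<bar> \<le> K * (1 / (1 + (fst y)\<^sup>2)) * (1 / (1 + (snd y)\<^sup>2))" if "z \<in> J" for y z
      by (rule K(2); use N t that in simp)+
    have dw: "decay (\<lambda>x::real. 1 / (1 + x\<^sup>2))" by (intro decayI[where K=1] continuous_intros) auto
    have "integrable ?M (\<lambda>(x, v). (K * (1 / (1 + x\<^sup>2)))\<^sup>2 * (1 / (1 + v\<^sup>2))\<^sup>2)"
      by (intro lborel_pair.integrable_mult_pair decay_integrable decay1_power2 decay_imp_decay1 decay_cmult dw)
    then show "integrable ?M (\<lambda>y. (K * (1 / (1 + (fst y)\<^sup>2)) * (1 / (1 + (snd y)\<^sup>2)))\<^sup>2)"
      by (simp only: case_prod_beta' power_mult_distrib)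
  qed (use z m jm in auto)
  also have "(LINT y|?M. (H 0 0 l i t (fst y) (snd y) z)\<^sup>2) = (LINT x|lborel. LINT v|lborel. (H 0 0 l i t x v z)\<^sup>2)"
    by (rule it) (use z in auto)
  also have "(LINT z|P. LINT y|?M. (H 0 0 l i t (fst y) (snd y) z)\<^sup>2) = (LINT z|P. LINT x|lborel. LINT v|lborel. (H 0 0 l i t x v z)\<^sup>2)"
    by (rule Bochner_Integration.integral_cong[OF refl], rule it) auto
  also have "(LINT z|P. LINT y|?M. (H 0 0 (Suc l) i t (fst y) (snd y) z)\<^sup>2) = (LINT z|P. LINT x|lborel. LINT v|lborel. (H 0 0 (Suc l) i t x v z)\<^sup>2)"
    by (rule Bochner_Integration.integral_cong[OF refl], rule it) auto
  finally show ?thesis by (simp add: I2_iterated d2 decay_xz_integral_v)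
qed

text \<open>\<open>sup_le_H1\<close> is used at each fixed velocity and then integrated in v, so
  that again no root of a velocity integral is differentiated.\<close>

lemma kin_family_x_sup:
  assumes H: "kin_family N J H" and J: "open J" "I \<subseteq> J" and N: "Suc l \<le> N" and t: "0 \<le> t" and z: "z \<in> I"
  shows "(LINT v|lborel. (H 0 0 l 0 t x v z)\<^sup>2) \<le>
    (LINT x|lborel. LINT v|lborel. (H 0 0 l 0 t x v z)\<^sup>2) + (LINT x|lborel. LINT v|lborel. (H 0 0 l 1 t x v z)\<^sup>2)"
proof -
  have zJ: "z \<in> J" using J z by auto
  have d2: "decay_xvz (\<lambda>x v z. (H 0 0 l i t x v z)\<^sup>2)" if "i \<le> 1" for i
    using that N by (intro decay1_xvz_power2 decay_xvz_imp_decay1_xvz kin_family_decay_xvz[OF H J _ t]) auto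
  have i: "integrable lborel (\<lambda>v. LINT x|lborel. (H 0 0 l i t x v z)\<^sup>2)" if "i \<le> 1" for i
    using lborel_pair.integrable_snd[of "\<lambda>x v. (H 0 0 l i t x v z)\<^sup>2"] decay_xvz_xv_integrable[OF d2[OF that] z] by simp
  have dx: "decay (\<lambda>x. H 0 0 l i t x v z)" if "i \<le> 1" for i v
    using that N t zJ by (intro kin_family_decay_x[OF H]) auto
  have "(LINT v|lborel. (H 0 0 l 0 t x v z)\<^sup>2) \<le>
      (LINT v|lborel. (LINT x|lborel. (H 0 0 l 0 t x v z)\<^sup>2) + (LINT x|lborel. (H 0 0 l 1 t x v z)\<^sup>2))"
  proof (rule integral_mono)
    show "(H 0 0 l 0 t x v z)\<^sup>2 \<le> (LINT x|lborel. (H 0 0 l 0 t x v z)\<^sup>2) + (LINT x|lborel. (H 0 0 l 1 t x v z)\<^sup>2)" for v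
      using kin_family_DERIV(4)[OF H _ t zJ, of 0 0 l 0 v] N by (intro sup_le_H1 dx) auto
  qed (use decay_xvz_v_integrable[OF d2 z, of 0] i in auto)
  also have "\<dots> = (LINT v|lborel. LINT x|lborel. (H 0 0 l 0 t x v z)\<^sup>2) + (LINT v|lborel. LINT x|lborel. (H 0 0 l 1 t x v z)\<^sup>2)"
    using i by (intro Bochner_Integration.integral_add) auto
  finally show ?thesis using decay_xvz_integral_swap[OF d2 z, of 0] decay_xvz_integral_swap[OF d2 z, of 1] by simp
qed

end

section \<open>Energy identities\<close>

text \<open>The equations are required on I, the derivative families on its neighbourhood J. The two
  nonlinear field terms are merged into \<open>(\<partial>\<^sub>v - v/2) h\<close>, so that the
  adjoint of A becomes visible, and the collision operator appears in expanded form.\<close>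

locale vfp = zspace P I for P :: "real measure" and I :: "real set" +
  fixes J :: "real set" and H :: "nat \<Rightarrow> nat \<Rightarrow> nat \<Rightarrow> nat \<Rightarrow> real \<Rightarrow> real \<Rightarrow> real \<Rightarrow> real \<Rightarrow> real"
    and F :: "nat \<Rightarrow> nat \<Rightarrow> nat \<Rightarrow> real \<Rightarrow> real \<Rightarrow> real \<Rightarrow> real" and \<epsilon> \<delta> C :: real and m :: nat
  assumes J: "open J" "I \<subseteq> J" and I_lim: "\<And>z. z \<in> I \<Longrightarrow> z islimpt I"
    and H: "kin_family (m + 3) J H" and F: "mac_family (m + 2) J F"
    and emb: "z_embedding I P C" "1 \<le> C" and m: "1 \<le> m"
    and eps: "0 < \<epsilon>" and del: "0 < \<delta>"
    and kinetic: "\<And>t x v z. 0 \<le> t \<Longrightarrow> z \<in> I \<Longrightarrow>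
      \<epsilon> * \<delta> * H 1 0 0 0 t x v z + \<epsilon> * v * H 0 0 0 1 t x v z
        - \<delta> * F 0 0 0 t x z * (H 0 1 0 0 t x v z - v / 2 * H 0 0 0 0 t x v z)
        + \<delta> * v * sqrtM v * F 0 0 0 t x z
      = H 0 2 0 0 t x v z + (1 / 2 - v\<^sup>2 / 4) * H 0 0 0 0 t x v z"
    and poisson: "\<And>t x z. 0 \<le> t \<Longrightarrow> z \<in> I \<Longrightarrow> F 0 0 1 t x z = - moment sqrtM H 0 0 0 t x z"
begin

abbreviation "S \<equiv> moment sqrtM H"
abbreviation "U \<equiv> moment (\<lambda>v. v * sqrtM v) H"
abbreviation "V \<equiv> moment (\<lambda>v. v\<^sup>2 * sqrtM v) H"

lemma S: "mac_family (m + 3) J S" and U: "mac_family (m + 3) J U" and V: "mac_family (m + 3) J V"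
  by (intro mac_family_moment H decay_sqrtM decay_v_sqrtM decay_v2_sqrtM J)+

text \<open>Applied to derivatives of h, A is the lowering operator and Q is minus its
  adjoint.\<close>

definition Q where "Q l i t x v z = H 0 1 l i t x v z - v / 2 * H 0 0 l i t x v z"
definition A where "A l i t x v z = H 0 1 l i t x v z + v / 2 * H 0 0 l i t x v z"

lemma inJ: "z \<in> I \<Longrightarrow> z \<in> J" using J by auto

text \<open>At fixed z the equation holds on the whole x-axis, so the x-derivative is taken
  directly. In z it holds on I alone; each z-derivative is taken at a limit point of I, from the
  identity already known throughout I.\<close>

lemma kinetic_derivs:
  assumes "l \<le> m" "i \<le> 1" "0 \<le> t" "z \<in> I"
  shows "\<epsilon> * \<delta> * H 1 0 l i t x v z + \<epsilon> * v * H 0 0 l (Suc i) t x v z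
        - \<delta> * (\<Sum>r\<le>i. real (i choose r) * (\<Sum>j\<le>l. real (l choose j) * (F 0 j r t x z * Q (l - j) (i - r) t x v z)))
        + \<delta> * v * sqrtM v * F 0 l i t x z
      = H 0 2 l i t x v z + (1 / 2 - v\<^sup>2 / 4) * H 0 0 l i t x v z"
  using assms
proof (induction l arbitrary: z)
  case 0
  then have zJ: "z \<in> J" using inJ by simp
  have D: "((\<lambda>s. H k j 0 0 t s v z) has_real_derivative H k j 0 1 t x v z) (at x)" if "k + j < 3" for k j x
    using kin_family_DERIV(4)[OF H _ \<open>0 \<le> t\<close> zJ, of k j 0 0] that by simp
  have D1: "((\<lambda>s. H k j 0 1 t s v z) has_real_derivative H k j 0 (Suc 1) t x v z) (at x)" if "k + j < 2" for k j x
    using kin_family_DERIV(4)[OF H _ \<open>0 \<le> t\<close> zJ, of k j 0 1] that by simp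
  have DF: "((\<lambda>s. F 0 0 0 t s z) has_real_derivative F 0 0 1 t x z) (at x)" for x
    using mac_family_DERIV(3)[OF F _ \<open>0 \<le> t\<close> zJ, of 0 0 0] by simp
  consider "i = 0" | "i = 1" using 0 by linarith
  then show ?case
  proof cases
    case 1
    then show ?thesis using kinetic[OF \<open>0 \<le> t\<close> \<open>z \<in> I\<close>, of x v] by (simp add: Q_def)
  next
    case 2
    have d1: "((\<lambda>x. \<epsilon> * \<delta> * H 1 0 0 0 t x v z + \<epsilon> * v * H 0 0 0 1 t x v z
        - \<delta> * F 0 0 0 t x z * (H 0 1 0 0 t x v z - v / 2 * H 0 0 0 0 t x v z)
        + \<delta> * v * sqrtM v * F 0 0 0 t x z) has_real_derivative
        \<epsilon> * \<delta> * H 1 0 0 1 t x v z + \<epsilon> * v * H 0 0 0 (Suc 1) t x v z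
        - (\<delta> * F 0 0 0 t x z * (H 0 1 0 1 t x v z - v / 2 * H 0 0 0 1 t x v z)
           + \<delta> * F 0 0 1 t x z * (H 0 1 0 0 t x v z - v / 2 * H 0 0 0 0 t x v z))
        + \<delta> * v * sqrtM v * F 0 0 1 t x z) (at x)"
      by (rule DERIV_add DERIV_diff DERIV_cmult DERIV_mult' DF D D1 | simp)+
    have d2: "((\<lambda>x. H 0 2 0 0 t x v z + (1 / 2 - v\<^sup>2 / 4) * H 0 0 0 0 t x v z) has_real_derivative
        H 0 2 0 1 t x v z + (1 / 2 - v\<^sup>2 / 4) * H 0 0 0 1 t x v z) (at x)"
      by (rule DERIV_add DERIV_cmult D | simp)+
    have e: "(\<lambda>x. \<epsilon> * \<delta> * H 1 0 0 0 t x v z + \<epsilon> * v * H 0 0 0 1 t x v z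
        - \<delta> * F 0 0 0 t x z * (H 0 1 0 0 t x v z - v / 2 * H 0 0 0 0 t x v z)
        + \<delta> * v * sqrtM v * F 0 0 0 t x z) = (\<lambda>x. H 0 2 0 0 t x v z + (1 / 2 - v\<^sup>2 / 4) * H 0 0 0 0 t x v z)"
      using kinetic[OF \<open>0 \<le> t\<close> \<open>z \<in> I\<close>] by blast
    have "\<epsilon> * \<delta> * H 1 0 0 1 t x v z + \<epsilon> * v * H 0 0 0 (Suc 1) t x v z
        - (\<delta> * F 0 0 0 t x z * (H 0 1 0 1 t x v z - v / 2 * H 0 0 0 1 t x v z)
           + \<delta> * F 0 0 1 t x z * (H 0 1 0 0 t x v z - v / 2 * H 0 0 0 0 t x v z))
        + \<delta> * v * sqrtM v * F 0 0 1 t x z = H 0 2 0 1 t x v z + (1 / 2 - v\<^sup>2 / 4) * H 0 0 0 1 t x v z"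
      using d1 d2 unfolding e by (rule DERIV_unique)
    then show ?thesis using 2 by (simp add: Q_def algebra_simps)
  qed
next
  case (Suc l)
  have zJ: "z \<in> J" using inJ Suc.prems by simp
  have D: "((\<lambda>z. H k j l i' t x v z) has_real_derivative H k j (Suc l) i' t x v z) (at z)" if "k + j + i' < 4" for k j i'
    using kin_family_DERIV(3)[OF H _ \<open>0 \<le> t\<close> zJ, of k j l i' x v] that Suc.prems by simp
  have DF: "((\<lambda>z. F 0 j r t x z) has_real_derivative F 0 (Suc j) r t x z) (at z)" if "j \<le> l" "r \<le> 1" for j r
    using mac_family_DERIV(2)[OF F _ \<open>0 \<le> t\<close> zJ, of 0 j r x] that Suc.prems by simp
  have DQ: "((\<lambda>z. Q j i' t x v z) has_real_derivative Q (Suc j) i' t x v z) (at z)" if "j \<le> l" "i' \<le> 1" for j i'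
    unfolding Q_def
    using kin_family_DERIV(3)[OF H _ \<open>0 \<le> t\<close> zJ, of 0 1 j i' x v] kin_family_DERIV(3)[OF H _ \<open>0 \<le> t\<close> zJ, of 0 0 j i' x v] that Suc.prems
    by (intro DERIV_diff DERIV_cmult) auto
  have L: "((\<lambda>z. \<Sum>j\<le>l. real (l choose j) * (F 0 j r t x z * Q (l - j) (i - r) t x v z)) has_real_derivative
      (\<Sum>j\<le>Suc l. real (Suc l choose j) * (F 0 j r t x z * Q (Suc l - j) (i - r) t x v z))) (at z)" if "r \<le> i" for r
    using Suc.prems that by (intro Leibniz_step DF DQ) auto
  show ?case
  proof (rule DERIV_eq_islimpt[OF _ _ I_lim[OF Suc.prems(4)] Suc.prems(4)])
    show "((\<lambda>z. \<epsilon> * \<delta> * H 1 0 l i t x v z + \<epsilon> * v * H 0 0 l (Suc i) t x v z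
        - \<delta> * (\<Sum>r\<le>i. real (i choose r) * (\<Sum>j\<le>l. real (l choose j) * (F 0 j r t x z * Q (l - j) (i - r) t x v z)))
        + \<delta> * v * sqrtM v * F 0 l i t x z) has_real_derivative
        \<epsilon> * \<delta> * H 1 0 (Suc l) i t x v z + \<epsilon> * v * H 0 0 (Suc l) (Suc i) t x v z
        - \<delta> * (\<Sum>r\<le>i. real (i choose r) * (\<Sum>j\<le>Suc l. real (Suc l choose j) * (F 0 j r t x z * Q (Suc l - j) (i - r) t x v z)))
        + \<delta> * v * sqrtM v * F 0 (Suc l) i t x z) (at z)"
      using Suc.prems(2) by (intro DERIV_add DERIV_diff DERIV_cmult DERIV_sum L D DF) auto
    show "((\<lambda>z. H 0 2 l i t x v z + (1 / 2 - v\<^sup>2 / 4) * H 0 0 l i t x v z) has_real_derivative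
        H 0 2 (Suc l) i t x v z + (1 / 2 - v\<^sup>2 / 4) * H 0 0 (Suc l) i t x v z) (at z)"
      using Suc.prems(2) by (intro DERIV_add DERIV_cmult D) auto
  qed (use Suc in auto)
qed

lemma decay_H:
  assumes "k + j + l + i \<le> m + 3" "0 \<le> t" "z \<in> I"
  shows "decay (\<lambda>v. H k j l i t x v z)"
  using assms by (intro kin_family_decay_v[OF H] inJ)

lemma decay1_Q: "l \<le> m \<Longrightarrow> i \<le> 1 \<Longrightarrow> 0 \<le> t \<Longrightarrow> z \<in> I \<Longrightarrow> decay1 (\<lambda>v. Q l i t x v z)"
  unfolding Q_def by (intro decay1_diff decay1_half_ident_mult decay_imp_decay1 decay_H) auto

text \<open>The test functions will be \<open>sqrtM\<close>, \<open>v * sqrtM\<close> and the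
  differentiated h itself; they give the continuity equation, the momentum equation and the energy
  identity.\<close>

lemma kinetic_tested:
  assumes li: "l \<le> m" "i \<le> 1" and t: "0 \<le> t" and z: "z \<in> I" and \<psi>: "decay \<psi>"
  shows "\<epsilon> * \<delta> * (LINT v|lborel. H 1 0 l i t x v z * \<psi> v) + \<epsilon> * (LINT v|lborel. (v * H 0 0 l (Suc i) t x v z) * \<psi> v)
        - \<delta> * (\<Sum>r\<le>i. real (i choose r) * (\<Sum>j\<le>l. real (l choose j) *
            (F 0 j r t x z * (LINT v|lborel. Q (l - j) (i - r) t x v z * \<psi> v))))
        + \<delta> * F 0 l i t x z * (LINT v|lborel. (v * sqrtM v) * \<psi> v)
      = (LINT v|lborel. (H 0 2 l i t x v z + (1 / 2 - v\<^sup>2 / 4) * H 0 0 l i t x v z) * \<psi> v)"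
proof -
  have i1: "integrable lborel (\<lambda>v. H 1 0 l i t x v z * \<psi> v)"
    by (intro decay_integrable decay1_mult decay_imp_decay1 decay_H \<psi>) (use li t z in auto)
  have i2: "integrable lborel (\<lambda>v. (v * H 0 0 l (Suc i) t x v z) * \<psi> v)"
    by (intro decay_integrable decay1_mult decay1_ident_mult decay_imp_decay1 \<psi>; intro decay_imp_decay1 decay_H \<psi>) (use li t z in auto)
  have i3: "integrable lborel (\<lambda>v. Q (l - j) (i - r) t x v z * \<psi> v)" for j r
    by (intro decay_integrable decay1_mult decay1_Q decay_imp_decay1 \<psi>) (use li t z in auto)
  have i4: "integrable lborel (\<lambda>v. (v * sqrtM v) * \<psi> v)"
    by (intro decay_integrable decay1_mult decay_imp_decay1 decay_v_sqrtM \<psi>)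
  define w where "w v = (\<Sum>r\<le>i. real (i choose r) * (\<Sum>j\<le>l. real (l choose j) *
      (F 0 j r t x z * (Q (l - j) (i - r) t x v z * \<psi> v))))" for v
  have w: "integrable lborel w"
    unfolding w_def[abs_def] by (intro Bochner_Integration.integrable_sum integrable_mult_right i3)
  have iw: "(LINT v|lborel. w v) = (\<Sum>r\<le>i. real (i choose r) * (\<Sum>j\<le>l. real (l choose j) *
      (F 0 j r t x z * (LINT v|lborel. Q (l - j) (i - r) t x v z * \<psi> v))))"
    unfolding w_def using i3 by (simp add: Bochner_Integration.integral_sum)
  have "(LINT v|lborel. (H 0 2 l i t x v z + (1 / 2 - v\<^sup>2 / 4) * H 0 0 l i t x v z) * \<psi> v)
      = (LINT v|lborel. \<epsilon> * \<delta> * (H 1 0 l i t x v z * \<psi> v) + \<epsilon> * ((v * H 0 0 l (Suc i) t x v z) * \<psi> v)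
        - \<delta> * w v + \<delta> * F 0 l i t x z * ((v * sqrtM v) * \<psi> v))"
    unfolding kinetic_derivs[OF li t z, symmetric] w_def
    by (rule Bochner_Integration.integral_cong[OF refl])
       (simp add: algebra_simps sum_distrib_left sum_distrib_right)
  also have "\<dots> = \<epsilon> * \<delta> * (LINT v|lborel. H 1 0 l i t x v z * \<psi> v) + \<epsilon> * (LINT v|lborel. (v * H 0 0 l (Suc i) t x v z) * \<psi> v)
        - \<delta> * (LINT v|lborel. w v) + \<delta> * F 0 l i t x z * (LINT v|lborel. (v * sqrtM v) * \<psi> v)"
    using i1 i2 i4 w by simp
  finally show ?thesis unfolding iw by simp
qed

section \<open>Conservation laws and the Poisson equation\<close>

lemma FP_H:
  assumes "l \<le> m" "i \<le> 1" "0 \<le> t" "z \<in> I"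
  shows "(LINT v|lborel. (H 0 2 l i t x v z + (1 / 2 - v\<^sup>2 / 4) * H 0 0 l i t x v z) * H 0 0 l i t x v z) = - (LINT v|lborel. (A l i t x v z)\<^sup>2)"
    and "(LINT v|lborel. (H 0 2 l i t x v z + (1 / 2 - v\<^sup>2 / 4) * H 0 0 l i t x v z) * sqrtM v) = 0"
    and "(LINT v|lborel. (H 0 2 l i t x v z + (1 / 2 - v\<^sup>2 / 4) * H 0 0 l i t x v z) * (v * sqrtM v)) = - U 0 l i t x z"
proof -
  have D: "((\<lambda>v. H 0 0 l i t x v z) has_real_derivative H 0 1 l i t x v z) (at v)"
    "((\<lambda>v. H 0 1 l i t x v z) has_real_derivative H 0 2 l i t x v z) (at v)" for v
    using kin_family_DERIV(2)[OF H _ assms(3) inJ[OF assms(4)], of 0 0 l i x v] kin_family_DERIV(2)[OF H _ assms(3) inJ[OF assms(4)], of 0 1 l i x v] assms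
    by (simp_all add: numeral_2_eq_2)
  have d: "decay (\<lambda>v. H 0 0 l i t x v z)" "decay (\<lambda>v. H 0 1 l i t x v z)" "decay (\<lambda>v. H 0 2 l i t x v z)"
    by (intro decay_H; use assms in simp)+
  note * = FP_integrals[OF D d]
  show "(LINT v|lborel. (H 0 2 l i t x v z + (1 / 2 - v\<^sup>2 / 4) * H 0 0 l i t x v z) * H 0 0 l i t x v z) = - (LINT v|lborel. (A l i t x v z)\<^sup>2)"
    unfolding A_def by (rule *(1))
  show "(LINT v|lborel. (H 0 2 l i t x v z + (1 / 2 - v\<^sup>2 / 4) * H 0 0 l i t x v z) * sqrtM v) = 0" by (rule *(3))
  show "(LINT v|lborel. (H 0 2 l i t x v z + (1 / 2 - v\<^sup>2 / 4) * H 0 0 l i t x v z) * (v * sqrtM v)) = - U 0 l i t x z"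
    unfolding moment_def by (rule *(4))
qed

lemma Q_integrals:
  assumes "l \<le> m" "i \<le> 1" "0 \<le> t" "z \<in> I"
  shows "(LINT v|lborel. Q l i t x v z * sqrtM v) = 0"
    and "(LINT v|lborel. Q l i t x v z * (v * sqrtM v)) = - S 0 l i t x z"
    and "l' \<le> m \<Longrightarrow> i' \<le> 1 \<Longrightarrow>
      (LINT v|lborel. Q l i t x v z * H 0 0 l' i' t x v z) = - (LINT v|lborel. H 0 0 l i t x v z * A l' i' t x v z)"
proof -
  have D: "((\<lambda>v. H 0 0 l i t x v z) has_real_derivative H 0 1 l i t x v z) (at v)" if "l \<le> m" "i \<le> 1" for v l i
    using kin_family_DERIV(2)[OF H _ assms(3) inJ[OF assms(4)], of 0 0 l i x v] that by simp
  have d: "decay (\<lambda>v. H 0 0 l i t x v z)" "decay (\<lambda>v. H 0 1 l i t x v z)" if "l \<le> m" "i \<le> 1" for l i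
    by (intro decay_H; use assms that in simp)+
  note * = ladder_sqrtM[OF D[OF assms(1,2)] decay_imp_decay1[OF d(1)[OF assms(1,2)]] decay_imp_decay1[OF d(2)[OF assms(1,2)]]]
  show "(LINT v|lborel. Q l i t x v z * sqrtM v) = 0" unfolding Q_def by (rule *(1))
  show "(LINT v|lborel. Q l i t x v z * (v * sqrtM v)) = - S 0 l i t x z" unfolding Q_def moment_def by (rule *(2))
  assume l': "l' \<le> m" "i' \<le> 1"
  show "(LINT v|lborel. Q l i t x v z * H 0 0 l' i' t x v z) = - (LINT v|lborel. H 0 0 l i t x v z * A l' i' t x v z)"
    unfolding Q_def A_def
    by (rule ladder_adjoint(1)[OF D[OF assms(1,2)] decay_imp_decay1[OF d(1)[OF assms(1,2)]] decay_imp_decay1[OF d(2)[OF assms(1,2)]]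
          D[OF l'] d(1)[OF l'] decay_imp_decay1[OF d(2)[OF l']]])
qed

text \<open>Collisions and both field terms carry no mass, so only transport balances the time
  derivative.\<close>

lemma continuity:
  assumes "l \<le> m" "i \<le> 1" "0 \<le> t" "z \<in> I"
  shows "\<delta> * S 1 l i t x z + U 0 l (Suc i) t x z = 0"
proof -
  have e: "(LINT v|lborel. (v * H 0 0 l (Suc i) t x v z) * sqrtM v) = U 0 l (Suc i) t x z"
    unfolding moment_def by (rule Bochner_Integration.integral_cong) simp_all
  have e1: "(LINT v|lborel. (v * sqrtM v) * sqrtM v) = 0"
    using sqrtM_moments(2) by (simp add: power2_eq_square mult_ac)
  have q: "(LINT v|lborel. Q (l - j) (i - r) t x v z * sqrtM v) = 0" for j r
    by (rule Q_integrals(1)) (use assms in auto)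
  have "\<epsilon> * \<delta> * S 1 l i t x z + \<epsilon> * U 0 l (Suc i) t x z = 0"
    using kinetic_tested[OF assms decay_sqrtM, of x]
    unfolding e e1 q FP_H(2)[OF assms] by (simp add: moment_def)
  then have "\<epsilon> * (\<delta> * S 1 l i t x z + U 0 l (Suc i) t x z) = 0" by (simp add: algebra_simps)
  then show ?thesis using eps by simp
qed

text \<open>In the nonlinear term A maps \<open>v * sqrtM\<close> to \<open>sqrtM\<close> and leaves
  the density; the linear field term gets the second moment 1 of the Maxwellian; collisions leave
  the friction term.\<close>

lemma momentum:
  assumes "l \<le> m" "i \<le> 1" "0 \<le> t" "z \<in> I"
  shows "\<epsilon> * \<delta> * U 1 l i t x z + \<epsilon> * V 0 l (Suc i) t x z
      + \<delta> * (\<Sum>r\<le>i. real (i choose r) * (\<Sum>j\<le>l. real (l choose j) * (F 0 j r t x z * S 0 (l - j) (i - r) t x z)))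
      + \<delta> * F 0 l i t x z + U 0 l i t x z = 0"
proof -
  have e: "(LINT v|lborel. (v * H 0 0 l (Suc i) t x v z) * (v * sqrtM v)) = V 0 l (Suc i) t x z"
    unfolding moment_def by (rule Bochner_Integration.integral_cong) (simp_all add: power2_eq_square)
  have e1: "(LINT v|lborel. (v * sqrtM v) * (v * sqrtM v)) = 1"
    using sqrtM_moments(3) by (simp add: power2_eq_square mult_ac)
  have q: "(LINT v|lborel. Q (l - j) (i - r) t x v z * (v * sqrtM v)) = - S 0 (l - j) (i - r) t x z" for j r
    by (rule Q_integrals(2)) (use assms in auto)
  show ?thesis
    using kinetic_tested[OF assms decay_v_sqrtM, of x]
    unfolding e e1 q FP_H(3)[OF assms] by (simp add: moment_def sum_negf)
qed

lemma poisson_derivs: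
  assumes "l \<le> m" "i \<le> 1" "0 \<le> t" "z \<in> I"
  shows "F 0 l (Suc i) t x z = - S 0 l i t x z"
  using assms
proof (induction l arbitrary: z)
  case 0
  note zJ = inJ[OF 0(4)]
  consider "i = 0" | "i = 1" using 0 by linarith
  then show ?case
  proof cases
    case 1
    then show ?thesis using poisson[OF 0(3,4)] by simp
  next
    case 2
    have d1: "((\<lambda>x. F 0 0 1 t x z) has_real_derivative F 0 0 (Suc 1) t x z) (at x)"
      using mac_family_DERIV(3)[OF F _ 0(3) zJ, of 0 0 1] m by simp
    have d2: "((\<lambda>x. - S 0 0 0 t x z) has_real_derivative - S 0 0 1 t x z) (at x)"
      using mac_family_DERIV(3)[OF S _ 0(3) zJ, of 0 0 0] by (intro DERIV_minus) simp
    have e: "(\<lambda>x. F 0 0 1 t x z) = (\<lambda>x. - S 0 0 0 t x z)" using poisson[OF 0(3,4)] by simp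
    have "F 0 0 (Suc 1) t x z = - S 0 0 1 t x z" using d1 d2 unfolding e by (rule DERIV_unique)
    then show ?thesis using 2 by simp
  qed
next
  case (Suc l)
  note zJ = inJ[OF Suc.prems(4)]
  show ?case
  proof (rule DERIV_eq_islimpt[OF _ _ I_lim[OF Suc.prems(4)] Suc.prems(4)])
    show "((\<lambda>z. F 0 l (Suc i) t x z) has_real_derivative F 0 (Suc l) (Suc i) t x z) (at z)"
      using mac_family_DERIV(2)[OF F _ Suc.prems(3) zJ, of 0 l "Suc i"] Suc.prems by simp
    show "((\<lambda>z. - S 0 l i t x z) has_real_derivative - S 0 (Suc l) i t x z) (at z)"
      using mac_family_DERIV(2)[OF S _ Suc.prems(3) zJ, of 0 l i] Suc.prems by (intro DERIV_minus) simp
  qed (use Suc in auto)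
qed

text \<open>Differentiating the Poisson equation in time and integrating in \<open>x\<close> gives \<open>\<delta> \<partial>\<^sub>t \<partial>\<^sub>x \<phi> = u\<close>.\<close>

lemma dt_field:
  assumes "l \<le> m" "i \<le> 1" "0 \<le> t" "z \<in> I"
  shows "\<delta> * F 1 l i t x z = U 0 l i t x z"
  using assms
proof (induction l arbitrary: z)
  case 0
  note zJ = inJ[OF 0(4)]
  have F11: "\<delta> * F 1 0 1 t x z = U 0 0 1 t x z" for x
  proof -
    have "((\<lambda>s. F 0 0 1 s x z) has_real_derivative F 1 0 1 t x z) (at t within {0..})"
      using mac_family_DERIV(1)[OF F _ 0(3) zJ, of 0 0 1] m by simp
    moreover have "((\<lambda>s. F 0 0 1 s x z) has_real_derivative - S 1 0 0 t x z) (at t within {0..})"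
    proof (rule has_field_derivative_transform_within[where f="\<lambda>s. - S 0 0 0 s x z" and d=1])
      show "((\<lambda>s. - S 0 0 0 s x z) has_real_derivative - S 1 0 0 t x z) (at t within {0..})"
        using mac_family_DERIV(1)[OF S _ 0(3) zJ, of 0 0 0] by (intro DERIV_minus) simp
    qed (use poisson 0 in auto)
    \<comment> \<open>At t = 0 the derivatives are one-sided, and uniqueness of the limit needs a
      nontrivial filter within \<open>{0..}\<close>.\<close>
    moreover have "t islimpt {0..}"
      by (rule islimpt_subset[OF islimpt_greaterThanLessThan1[of t "t + 1"]]) (use 0(3) in auto)
    ultimately have "F 1 0 1 t x z = - S 1 0 0 t x z"
      unfolding has_field_derivative_iff trivial_limit_within[symmetric]
      by (intro tendsto_unique[of "at t within {0..}"]) (simp_all add: trivial_limit_within)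
    then show ?thesis using continuity[of 0 0 t z x] 0 by simp
  qed
  consider "i = 0" | "i = 1" using 0 by linarith
  then show ?case
  proof cases
    case 1
    let ?g = "\<lambda>x. \<delta> * F 1 0 0 t x z - U 0 0 0 t x z"
    have "(?g has_real_derivative 0) (at x)" for x
    proof -
      have "(?g has_real_derivative \<delta> * F 1 0 1 t x z - U 0 0 1 t x z) (at x)"
        using mac_family_DERIV(3)[OF F _ 0(3) zJ, of 1 0 0] mac_family_DERIV(3)[OF U _ 0(3) zJ, of 0 0 0] m
        by (intro DERIV_diff DERIV_cmult) auto
      then show ?thesis unfolding F11 by simp
    qed
    moreover have "decay ?g"
      using 0(3) zJ by (intro decay_diff decay_cmult mac_family_decay_x[OF F] mac_family_decay_x[OF U]) auto
    \<comment> \<open>A decaying function is the integral of its derivative over the half line to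
      the left, here of 0.\<close>
    ultimately have "?g x = 0" using lborel_FTC(2)[of ?g "\<lambda>_. 0" x] decay_zero by simp
    then show ?thesis using 1 by simp
  qed (use F11 in simp)
next
  case (Suc l)
  note zJ = inJ[OF Suc.prems(4)]
  show ?case
  proof (rule DERIV_eq_islimpt[OF _ _ I_lim[OF Suc.prems(4)] Suc.prems(4)])
    show "((\<lambda>z. \<delta> * F 1 l i t x z) has_real_derivative \<delta> * F 1 (Suc l) i t x z) (at z)"
      using mac_family_DERIV(2)[OF F _ Suc.prems(3) zJ, of 1 l i] Suc.prems by (intro DERIV_cmult) simp
    show "((\<lambda>z. U 0 l i t x z) has_real_derivative U 0 (Suc l) i t x z) (at z)"
      using mac_family_DERIV(2)[OF U _ Suc.prems(3) zJ, of 0 l i] Suc.prems by simp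
  qed (use Suc in auto)
qed

end

section \<open>Velocity integrals and the energy identity\<close>

context vfp begin

lemma decay_xvz_H: "k + j + l + i \<le> m + 3 \<Longrightarrow> 0 \<le> t \<Longrightarrow> decay_xvz (\<lambda>x v z. H k j l i t x v z)"
  by (rule kin_family_decay_xvz[OF H J])

lemma decay_xz_F: "k + l + i \<le> m + 2 \<Longrightarrow> 0 \<le> t \<Longrightarrow> decay_xz (\<lambda>x z. F k l i t x z)"
  by (rule mac_family_decay_xz[OF F J])

lemma decay_xz_S: "k + l + i \<le> m + 3 \<Longrightarrow> 0 \<le> t \<Longrightarrow> decay_xz (\<lambda>x z. S k l i t x z)"
  and decay_xz_U: "k + l + i \<le> m + 3 \<Longrightarrow> 0 \<le> t \<Longrightarrow> decay_xz (\<lambda>x z. U k l i t x z)"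
  and decay_xz_V: "k + l + i \<le> m + 3 \<Longrightarrow> 0 \<le> t \<Longrightarrow> decay_xz (\<lambda>x z. V k l i t x z)"
  by (rule mac_family_decay_xz[OF S J] mac_family_decay_xz[OF U J] mac_family_decay_xz[OF V J]; assumption)+

lemma decay1_xvz_A:
  assumes "l \<le> m" "i \<le> 1" "0 \<le> t" shows "decay1_xvz (\<lambda>x v z. A l i t x v z)"
proof -
  have "decay1_xvz (\<lambda>x v z. H 0 1 l i t x v z + 1 / 2 * (v * H 0 0 l i t x v z))"
    by (intro decay1_xvz_add decay1_xvz_cmult decay_xvz_imp_v_decay1_xvz decay_xvz_imp_decay1_xvz decay_xvz_H) (use assms in auto)
  then show ?thesis by (simp add: A_def[abs_def])
qed

text \<open>With \<open>q = \<partial>\<^sub>z\<^sup>l \<partial>\<^sub>x\<^sup>i h\<close>, \<open>B\<close> is the velocity integral of \<open>- q \<L> q\<close> and \<open>G\<close> that of the density of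
  \<open>\<parallel>(1 - \<Pi>) q\<parallel>\<^sub>\<nu>\<^sup>2\<close>; \<open>T\<close> is what remains of a Leibniz term \<open>\<partial>\<^sub>z\<^sup>j \<partial>\<^sub>x\<^sup>r h\<close> of the nonlinearity tested with \<open>q\<close>.\<close>

definition B where "B l i t x z = (LINT v|lborel. (A l i t x v z)\<^sup>2)"
definition E where "E l i t x z = (LINT v|lborel. (H 0 0 l i t x v z)\<^sup>2)"
definition E' where "E' l i t x z = (LINT v|lborel. H 1 0 l i t x v z * H 0 0 l i t x v z)"
definition T where "T j r l i t x z = (LINT v|lborel. H 0 0 j r t x v z * A l i t x v z)"
definition X where "X l i t x z = (LINT v|lborel. (v * H 0 0 l (Suc i) t x v z) * H 0 0 l i t x v z)"
definition G where "G l i t x z = (LINT v|lborel.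
    (1 + v\<^sup>2) * (H 0 0 l i t x v z - S 0 l i t x z * sqrtM v - U 0 l i t x z * (v * sqrtM v))\<^sup>2 +
    (H 0 1 l i t x v z + S 0 l i t x z * (v / 2 * sqrtM v) - U 0 l i t x z * (sqrtM v - v\<^sup>2 / 2 * sqrtM v))\<^sup>2)"

lemma decay_xz_B: "l \<le> m \<Longrightarrow> i \<le> 1 \<Longrightarrow> 0 \<le> t \<Longrightarrow> decay_xz (B l i t)"
  unfolding B_def[abs_def] by (intro decay_xz_integral_v decay1_xvz_power2 decay1_xvz_A)

lemma decay_xz_E: "l \<le> m \<Longrightarrow> i \<le> 1 \<Longrightarrow> 0 \<le> t \<Longrightarrow> decay_xz (E l i t)"
  unfolding E_def[abs_def] by (intro decay_xz_integral_v decay1_xvz_power2 decay_xvz_imp_decay1_xvz decay_xvz_H) auto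

lemma decay_xz_E': "l \<le> m \<Longrightarrow> i \<le> 1 \<Longrightarrow> 0 \<le> t \<Longrightarrow> decay_xz (E' l i t)"
  unfolding E'_def[abs_def] by (intro decay_xz_integral_v decay1_xvz_mult decay_xvz_imp_decay1_xvz decay_xvz_H) auto

lemma decay_xz_T: "j \<le> m \<Longrightarrow> r \<le> 1 \<Longrightarrow> l \<le> m \<Longrightarrow> i \<le> 1 \<Longrightarrow> 0 \<le> t \<Longrightarrow> decay_xz (T j r l i t)"
  unfolding T_def[abs_def] by (intro decay_xz_integral_v decay1_xvz_mult decay1_xvz_A decay_xvz_imp_decay1_xvz decay_xvz_H) auto

lemma decay_xvz_X: "l \<le> m \<Longrightarrow> i \<le> 1 \<Longrightarrow> 0 \<le> t \<Longrightarrow> decay_xvz (\<lambda>x v z. (v * H 0 0 l (Suc i) t x v z) * H 0 0 l i t x v z)"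
  by (intro decay1_xvz_mult decay_xvz_imp_v_decay1_xvz decay_xvz_imp_decay1_xvz decay_xvz_H) auto

lemma decay_xz_X: "l \<le> m \<Longrightarrow> i \<le> 1 \<Longrightarrow> 0 \<le> t \<Longrightarrow> decay_xz (X l i t)"
  unfolding X_def[abs_def] by (intro decay_xz_integral_v decay_xvz_X)

lemma B_nonneg: "0 \<le> B l i t x z" and E_nonneg: "0 \<le> E l i t x z"
  by (simp_all add: B_def E_def)

text \<open>v q times the x-derivative of q is half the x-derivative of v q^2. The integral in x
  must be taken first, hence the exchange.\<close>

lemma I2_X:
  assumes "l \<le> m" "i \<le> 1" "0 \<le> t"
  shows "I2 (X l i t) = 0"
proof -
  have "(LINT x|lborel. X l i t x z) = 0" if z: "z \<in> I" for z
  proof -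
    have "(LINT x|lborel. H 0 0 l (Suc i) t x v z * H 0 0 l i t x v z) = 0" for v
    proof -
      have D: "((\<lambda>x. H 0 0 l i t x v z) has_real_derivative H 0 0 l (Suc i) t x v z) (at x)" for x
        using kin_family_DERIV(4)[OF H _ assms(3) inJ[OF z], of 0 0 l i v] assms by simp
      have d: "decay (\<lambda>x. H 0 0 l i t x v z)" "decay (\<lambda>x. H 0 0 l (Suc i) t x v z)"
        by (intro kin_family_decay_x[OF H] inJ z; use assms in simp)+
      have "(LINT x|lborel. 2 * (H 0 0 l (Suc i) t x v z * H 0 0 l i t x v z)) = 0"
        by (rule lborel_FTC(1)[of "\<lambda>x. (H 0 0 l i t x v z)\<^sup>2"])
           (use D d in \<open>auto intro!: derivative_eq_intros decay1_power2 decay_cmult decay1_mult decay_imp_decay1\<close>)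
      then show ?thesis by simp
    qed
    then have "(LINT v|lborel. LINT x|lborel. (v * H 0 0 l (Suc i) t x v z) * H 0 0 l i t x v z) = 0"
      by (simp add: mult.assoc)
    then show ?thesis unfolding X_def using decay_xvz_integral_swap[OF decay_xvz_X[OF assms] z] by simp
  qed
  then have "(LINT z|P. LINT x|lborel. X l i t x z) = (LINT z|P. 0)"
    by (intro Bochner_Integration.integral_cong) auto
  then show ?thesis using I2_iterated[OF decay_xz_X[OF assms]] by simp
qed

text \<open>Leibniz expansion of the derivative of order l in z and i in x of a product f g.\<close>

definition nl where "nl f g l i x z = (\<Sum>r\<le>i. real (i choose r) * (\<Sum>j\<le>l. real (l choose j) * (f j r x z * g (l - j) (i - r) x z)))"
  for f g :: "nat \<Rightarrow> nat \<Rightarrow> real \<Rightarrow> real \<Rightarrow> real" and l i :: nat and x z :: real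

lemma decay_xz_nl:
  assumes "\<And>j r. j \<le> l \<Longrightarrow> r \<le> i \<Longrightarrow> decay_xz (f j r)" "\<And>j r. j \<le> l \<Longrightarrow> r \<le> i \<Longrightarrow> decay_xz (g j r)"
  shows "decay_xz (nl f g l i)"
  unfolding nl_def[abs_def] by (intro decay_xz_sum decay_xz_cmult decay_xz_mult assms) auto

lemma I2_nl_mult:
  assumes "\<And>j r. j \<le> l \<Longrightarrow> r \<le> i \<Longrightarrow> decay_xz (f j r)" "\<And>j r. j \<le> l \<Longrightarrow> r \<le> i \<Longrightarrow> decay_xz (g j r)" "decay_xz b"
  shows "I2 (\<lambda>x z. nl f g l i x z * b x z) = (\<Sum>r\<le>i. real (i choose r) * (\<Sum>j\<le>l. real (l choose j) *
      I2 (\<lambda>x z. f j r x z * g (l - j) (i - r) x z * b x z)))"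
proof -
  have e: "nl f g l i x z * b x z = (\<Sum>r\<le>i. real (i choose r) * (\<Sum>j\<le>l. real (l choose j) * (f j r x z * g (l - j) (i - r) x z * b x z)))" for x z
    by (simp add: nl_def sum_distrib_right mult.assoc)
  have d: "decay_xz (\<lambda>x z. f j r x z * g (l - j) (i - r) x z * b x z)" if "r \<le> i" "j \<le> l" for r j
    using that by (intro decay_xz_mult assms) auto
  have "I2 (\<lambda>x z. nl f g l i x z * b x z) = (\<Sum>r\<le>i. I2 (\<lambda>x z. real (i choose r) * (\<Sum>j\<le>l. real (l choose j) * (f j r x z * g (l - j) (i - r) x z * b x z))))"
    unfolding e by (intro I2_sum decay_xz_cmult decay_xz_sum d) auto
  also have "\<dots> = (\<Sum>r\<le>i. real (i choose r) * (\<Sum>j\<le>l. real (l choose j) *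
      I2 (\<lambda>x z. f j r x z * g (l - j) (i - r) x z * b x z)))"
  proof (rule sum.cong[OF refl])
    fix r assume "r \<in> {..i}"
    then have "I2 (\<lambda>x z. \<Sum>j\<le>l. real (l choose j) * (f j r x z * g (l - j) (i - r) x z * b x z))
        = (\<Sum>j\<le>l. I2 (\<lambda>x z. real (l choose j) * (f j r x z * g (l - j) (i - r) x z * b x z)))"
      by (intro I2_sum decay_xz_cmult d) auto
    then show "I2 (\<lambda>x z. real (i choose r) * (\<Sum>j\<le>l. real (l choose j) * (f j r x z * g (l - j) (i - r) x z * b x z)))
      = real (i choose r) * (\<Sum>j\<le>l. real (l choose j) * I2 (\<lambda>x z. f j r x z * g (l - j) (i - r) x z * b x z))"
      by (simp add: I2_cmult)
  qed
  finally show ?thesis .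
qed

text \<open>The velocity integral of the derivative of \<partial>_x \<phi> times h against A of the
  same derivative of h. The factor T depends on the test function too, so this is an expansion of
  its own and not an instance of \<open>nl\<close>.\<close>

definition N where "N l i t x z = (\<Sum>r\<le>i. real (i choose r) * (\<Sum>j\<le>l. real (l choose j) * (F 0 j r t x z * T (l - j) (i - r) l i t x z)))"

lemma decay_xz_N: "l \<le> m \<Longrightarrow> i \<le> 1 \<Longrightarrow> 0 \<le> t \<Longrightarrow> decay_xz (N l i t)"
  unfolding N_def[abs_def] by (intro decay_xz_sum decay_xz_cmult decay_xz_mult decay_xz_F decay_xz_T) auto

lemma energy_identity:
  assumes "l \<le> m" "i \<le> 1" "0 \<le> t"
  shows "\<epsilon> * \<delta> * I2 (E' l i t) + \<delta> * I2 (N l i t) + \<delta> * I2 (\<lambda>x z. F 0 l i t x z * U 0 l i t x z) + I2 (B l i t) = 0"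
proof -
  have pt: "\<epsilon> * \<delta> * E' l i t x z + \<epsilon> * X l i t x z + \<delta> * N l i t x z
      + \<delta> * (F 0 l i t x z * U 0 l i t x z) + B l i t x z = 0" if z: "z \<in> I" for x z
  proof -
    have u: "(LINT v|lborel. (v * sqrtM v) * H 0 0 l i t x v z) = U 0 l i t x z"
      unfolding moment_def by (simp add: mult.commute)
    \<comment> \<open>The factor \<open>\<partial>\<^sub>v - v/2\<close> moves to the test function
      as -A, so the nonlinear term enters with a plus sign.\<close>
    have q: "(LINT v|lborel. Q (l - j) (i - r) t x v z * H 0 0 l i t x v z) = - T (l - j) (i - r) l i t x z" for j r
      unfolding T_def by (rule Q_integrals(3)) (use assms z in auto)
    have "decay (\<lambda>v. H 0 0 l i t x v z)" by (rule decay_H) (use assms z in auto)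
    from kinetic_tested[OF assms z this, of x] show ?thesis
      unfolding u q FP_H(1)[OF assms z] by (simp add: E'_def X_def N_def B_def sum_negf algebra_simps)
  qed
  have d: "decay_xz (\<lambda>x z. F 0 l i t x z * U 0 l i t x z)" by (intro decay_xz_mult decay_xz_F decay_xz_U) (use assms in auto)
  note ds = decay_xz_E'[OF assms] decay_xz_X[OF assms] decay_xz_N[OF assms] d decay_xz_B[OF assms]
  have "I2 (\<lambda>x z. \<epsilon> * \<delta> * E' l i t x z + \<epsilon> * X l i t x z + \<delta> * N l i t x z
      + \<delta> * (F 0 l i t x z * U 0 l i t x z) + B l i t x z) = I2 (\<lambda>x z. 0)"
    by (rule I2_cong) (rule pt)
  moreover have "I2 (\<lambda>x z. \<epsilon> * \<delta> * E' l i t x z + \<epsilon> * X l i t x z + \<delta> * N l i t x z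
      + \<delta> * (F 0 l i t x z * U 0 l i t x z) + B l i t x z)
    = \<epsilon> * \<delta> * I2 (E' l i t) + \<epsilon> * I2 (X l i t) + \<delta> * I2 (N l i t) + \<delta> * I2 (\<lambda>x z. F 0 l i t x z * U 0 l i t x z) + I2 (B l i t)"
    by (simp only: I2_add I2_cmult decay_xz_add decay_xz_cmult ds)
  ultimately show ?thesis by (simp add: I2_X[OF assms] I2_zero)
qed

lemma micro:
  assumes "l \<le> m" "i \<le> 1" "0 \<le> t" "z \<in> I"
  shows "1 / 7 * G l i t x z + (U 0 l i t x z)\<^sup>2 \<le> B l i t x z" "B l i t x z \<le> 2 * G l i t x z + (U 0 l i t x z)\<^sup>2"
    "(V 0 l i t x z - S 0 l i t x z)\<^sup>2 \<le> G l i t x z"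
    "\<And>v. ((\<lambda>v. H 0 0 l i t x v z - S 0 l i t x z * sqrtM v - U 0 l i t x z * (v * sqrtM v)) has_real_derivative
      H 0 1 l i t x v z + S 0 l i t x z * (v / 2 * sqrtM v) - U 0 l i t x z * (sqrtM v - v\<^sup>2 / 2 * sqrtM v)) (at v)"
proof -
  have D: "((\<lambda>v. H 0 0 l i t x v z) has_real_derivative H 0 1 l i t x v z) (at v)" for v
    using kin_family_DERIV(2)[OF H _ assms(3) inJ[OF assms(4)], of 0 0 l i x v] assms by simp
  have d: "decay (\<lambda>v. H 0 0 l i t x v z)" "decay (\<lambda>v. H 0 1 l i t x v z)"
    by (intro decay_H; use assms in simp)+
  note * = micro_bounds[OF D d]
  show "1 / 7 * G l i t x z + (U 0 l i t x z)\<^sup>2 \<le> B l i t x z"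
    unfolding G_def B_def A_def moment_def by (rule *(1))
  show "B l i t x z \<le> 2 * G l i t x z + (U 0 l i t x z)\<^sup>2"
    unfolding G_def B_def A_def moment_def by (rule *(2))
  show "(V 0 l i t x z - S 0 l i t x z)\<^sup>2 \<le> G l i t x z"
    unfolding G_def moment_def by (rule *(3))
  show "((\<lambda>v. H 0 0 l i t x v z - S 0 l i t x z * sqrtM v - U 0 l i t x z * (v * sqrtM v)) has_real_derivative
      H 0 1 l i t x v z + S 0 l i t x z * (v / 2 * sqrtM v) - U 0 l i t x z * (sqrtM v - v\<^sup>2 / 2 * sqrtM v)) (at v)" for v
    unfolding moment_def by (rule *(4))
qed

lemma decay_xz_mult_v:
  assumes "decay_xz f" "decay g" shows "decay_xvz (\<lambda>x v z. f x z * g v)"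
proof -
  obtain K where K: "0 \<le> K" "\<And>x z. z \<in> I \<Longrightarrow> \<bar>f x z\<bar> \<le> K / (1 + x\<^sup>2)" by (rule decay_xzE[OF assms(1)]) (rule that)
  obtain L where L: "0 \<le> L" "\<And>v. \<bar>g v\<bar> \<le> L / (1 + v\<^sup>2)" by (rule decayE[OF assms(2)]) (rule that)
  have "\<bar>f x z * g v\<bar> \<le> (K * L) * (1 / (1 + x\<^sup>2)) * (1 / (1 + v\<^sup>2))" if "z \<in> I" for x v z
  proof -
    have "\<bar>f x z * g v\<bar> \<le> (K / (1 + x\<^sup>2)) * (L / (1 + v\<^sup>2))"
      unfolding abs_mult using K(1) that by (intro mult_mono K L) auto
    then show ?thesis by simp
  qed
  moreover have "(\<lambda>(x, v, z). f x z * g v) \<in> borel_measurable (lborel \<Otimes>\<^sub>M (lborel \<Otimes>\<^sub>M P))"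
  proof -
    have "(\<lambda>p. (fst p, snd (snd p))) \<in> measurable ((lborel :: real measure) \<Otimes>\<^sub>M ((lborel :: real measure) \<Otimes>\<^sub>M P)) (lborel \<Otimes>\<^sub>M P)"
      by (intro measurable_Pair measurable_fst measurable_compose[OF measurable_snd measurable_snd])
    from measurable_compose[OF this conjunct1[OF assms(1)[unfolded decay_xz_def]]]
    have 1: "(\<lambda>p. f (fst p) (snd (snd p))) \<in> borel_measurable ((lborel :: real measure) \<Otimes>\<^sub>M ((lborel :: real measure) \<Otimes>\<^sub>M P))"
      by (simp add: case_prod_beta')
    have "(\<lambda>p. fst (snd p)) \<in> borel_measurable ((lborel :: real measure) \<Otimes>\<^sub>M ((lborel :: real measure) \<Otimes>\<^sub>M P))"
      by (rule measurable_compose[OF measurable_snd fst_borel_measurable_lborel])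
    from measurable_compose[OF this borel_measurable_continuous_onI[OF decay_continuous[OF assms(2)]]]
    have 2: "(\<lambda>p. g (fst (snd p))) \<in> borel_measurable ((lborel :: real measure) \<Otimes>\<^sub>M ((lborel :: real measure) \<Otimes>\<^sub>M P))" .
    show ?thesis using borel_measurable_times[OF 1 2] by (simp add: case_prod_beta')
  qed
  ultimately show ?thesis unfolding decay_xvz_def by blast
qed

lemma decay_xvz_G:
  assumes "l \<le> m" "i \<le> 1" "0 \<le> t"
  shows "decay_xvz (\<lambda>x v z. (1 + v\<^sup>2) * (H 0 0 l i t x v z - S 0 l i t x z * sqrtM v - U 0 l i t x z * (v * sqrtM v))\<^sup>2 +
    (H 0 1 l i t x v z + S 0 l i t x z * (v / 2 * sqrtM v) - U 0 l i t x z * (sqrtM v - v\<^sup>2 / 2 * sqrtM v))\<^sup>2)"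
proof -
  let ?g = "\<lambda>x v z. H 0 0 l i t x v z - S 0 l i t x z * sqrtM v - U 0 l i t x z * (v * sqrtM v)"
  let ?g' = "\<lambda>x v z. H 0 1 l i t x v z + S 0 l i t x z * (v / 2 * sqrtM v) - U 0 l i t x z * (sqrtM v - v\<^sup>2 / 2 * sqrtM v)"
  have sub: "decay_xvz (\<lambda>x v z. f x v z - g x v z)" "decay_xvz (\<lambda>x v z. f x v z + g x v z)" if fg: "decay_xvz f" "decay_xvz g" for f g
  proof -
    have add: "decay_xvz (\<lambda>x v z. f x v z + c * g x v z)" for c
    proof -
      obtain K where K: "0 \<le> K" "\<And>x v z. z \<in> I \<Longrightarrow> \<bar>f x v z\<bar> \<le> K * (1 / (1 + x\<^sup>2)) * (1 / (1 + v\<^sup>2))"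
        by (rule decay_xvzE[OF fg(1)]) (rule that)
      obtain L where L: "0 \<le> L" "\<And>x v z. z \<in> I \<Longrightarrow> \<bar>g x v z\<bar> \<le> L * (1 / (1 + x\<^sup>2)) * (1 / (1 + v\<^sup>2))"
        by (rule decay_xvzE[OF fg(2)]) (rule that)
      have "\<bar>f x v z + c * g x v z\<bar> \<le> (K + \<bar>c\<bar> * L) * (1 / (1 + x\<^sup>2)) * (1 / (1 + v\<^sup>2))" if "z \<in> I" for x v z
        unfolding distrib_right
        by (rule order_trans[OF abs_triangle_ineq add_mono[OF K(2)[OF that]]])
           (unfold abs_mult mult.assoc, rule mult_left_mono[OF L(2)[OF that, unfolded mult.assoc]], simp)
      moreover have "(\<lambda>(x, v, z). f x v z + c * g x v z) \<in> borel_measurable (lborel \<Otimes>\<^sub>M (lborel \<Otimes>\<^sub>M P))"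
        using fg by (auto simp: decay_xvz_def case_prod_beta' intro!: borel_measurable_add borel_measurable_times)
      ultimately show ?thesis unfolding decay_xvz_def by blast
    qed
    show "decay_xvz (\<lambda>x v z. f x v z - g x v z)" "decay_xvz (\<lambda>x v z. f x v z + g x v z)" using add[of "-1"] add[of 1] by simp_all
  qed
  have dv2: "decay (\<lambda>v. v / 2 * sqrtM v)" "decay (\<lambda>v. v\<^sup>2 / 2 * sqrtM v)"
    using decay_cmult[OF decay_v_sqrtM, of "1/2"] decay_cmult[OF decay_v2_sqrtM, of "1/2"] by simp_all
  have g: "decay_xvz ?g" by (intro sub decay_xvz_H decay_xz_mult_v decay_xz_S decay_xz_U decay_sqrtM decay_v_sqrtM) (use assms in auto)
  have g': "decay_xvz ?g'" by (intro sub decay_xvz_H decay_xz_mult_v decay_xz_S decay_xz_U decay_diff decay_sqrtM dv2) (use assms in auto)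
  have "decay_xvz (\<lambda>x v z. ((?g x v z)\<^sup>2 + (v * ?g x v z)\<^sup>2) + (?g' x v z)\<^sup>2)"
    by (intro sub decay1_xvz_power2 decay_xvz_imp_v_decay1_xvz decay_xvz_imp_decay1_xvz g g')
  \<comment> \<open>The weight 1 + v^2 is distributed over two squares of functions of class
    \<open>decay1_xvz\<close>.\<close>
  moreover have "(a\<^sup>2 + (v * a)\<^sup>2) + b = (1 + v\<^sup>2) * a\<^sup>2 + b" for a b v :: real
    by (simp add: power_mult_distrib distrib_right)
  ultimately show ?thesis by (simp only:)
qed

lemma decay_xz_G: "l \<le> m \<Longrightarrow> i \<le> 1 \<Longrightarrow> 0 \<le> t \<Longrightarrow> decay_xz (G l i t)"
  unfolding G_def[abs_def] by (intro decay_xz_integral_v decay_xvz_G)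

section \<open>Summed energies and bounds of the nonlinear terms\<close>

definition EH where "EH t = (\<Sum>l\<le>m. \<Sum>i\<le>1. I2 (E l i t))"
text \<open>\<open>E_phi\<close> and \<open>D_phi\<close> have the same defining formula, so this
  one quantity represents both.\<close>

definition EF where "EF t = (\<Sum>l\<le>m. \<Sum>i\<le>1. I2 (\<lambda>x z. (F 0 l i t x z)\<^sup>2))"
definition DG where "DG t = (\<Sum>l\<le>m. \<Sum>i\<le>1. I2 (G l i t))"
definition DU where "DU t = (\<Sum>l\<le>m. \<Sum>i\<le>1. I2 (\<lambda>x z. (U 0 l i t x z)\<^sup>2))"
definition DS where "DS t = (\<Sum>l\<le>m. \<Sum>i\<le>1. I2 (\<lambda>x z. (S 0 l i t x z)\<^sup>2))"
definition DB where "DB t = (\<Sum>l\<le>m. \<Sum>i\<le>1. I2 (B l i t))"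

lemma nonneg: "0 \<le> EH t" "0 \<le> EF t" "0 \<le> DU t" "0 \<le> DS t" "0 \<le> DB t"
  unfolding EH_def EF_def DU_def DS_def DB_def
  by (intro sum_nonneg I2_nonneg; simp add: E_nonneg B_nonneg)+

lemma DG_nonneg: "0 \<le> DG t"
  unfolding DG_def G_def by (intro sum_nonneg I2_nonneg Bochner_Integration.integral_nonneg) simp

lemma DB_bounds:
  assumes t: "0 \<le> t" shows "1 / 7 * DG t + DU t \<le> DB t" "DB t \<le> 2 * DG t + DU t"
proof -
  have d: "decay_xz (\<lambda>x z. (U 0 l i t x z)\<^sup>2)" if "l \<le> m" "i \<le> 1" for l i
    using that t by (intro decay_xz_power2 decay_xz_U) auto
  have "1 / 7 * I2 (G l i t) + I2 (\<lambda>x z. (U 0 l i t x z)\<^sup>2) \<le> I2 (B l i t)" if "l \<le> m" "i \<le> 1" for l i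
  proof -
    have "I2 (\<lambda>x z. 1 / 7 * G l i t x z + (U 0 l i t x z)\<^sup>2) \<le> I2 (B l i t)"
      by (intro I2_mono decay_xz_add decay_xz_cmult decay_xz_G decay_xz_B d that t micro(1))
    also have "I2 (\<lambda>x z. 1 / 7 * G l i t x z + (U 0 l i t x z)\<^sup>2) = 1 / 7 * I2 (G l i t) + I2 (\<lambda>x z. (U 0 l i t x z)\<^sup>2)"
      unfolding I2_cmult[symmetric] by (intro I2_add decay_xz_cmult decay_xz_G d that t)
    finally show ?thesis .
  qed
  then have "(\<Sum>l\<le>m. \<Sum>i\<le>1. 1 / 7 * I2 (G l i t) + I2 (\<lambda>x z. (U 0 l i t x z)\<^sup>2)) \<le> DB t"
    unfolding DB_def by (intro sum_mono) auto
  then show "1 / 7 * DG t + DU t \<le> DB t"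
    unfolding DG_def DU_def sum_distrib_left sum.distrib[symmetric] by simp
  have "I2 (B l i t) \<le> 2 * I2 (G l i t) + I2 (\<lambda>x z. (U 0 l i t x z)\<^sup>2)" if "l \<le> m" "i \<le> 1" for l i
  proof -
    have "I2 (B l i t) \<le> I2 (\<lambda>x z. 2 * G l i t x z + (U 0 l i t x z)\<^sup>2)"
      by (intro I2_mono decay_xz_add decay_xz_cmult decay_xz_G decay_xz_B d that t micro(2))
    also have "\<dots> = 2 * I2 (G l i t) + I2 (\<lambda>x z. (U 0 l i t x z)\<^sup>2)"
      unfolding I2_cmult[symmetric] by (intro I2_add decay_xz_cmult decay_xz_G d that t)
    finally show ?thesis .
  qed
  then have "DB t \<le> (\<Sum>l\<le>m. \<Sum>i\<le>1. 2 * I2 (G l i t) + I2 (\<lambda>x z. (U 0 l i t x z)\<^sup>2))"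
    unfolding DB_def by (intro sum_mono) auto
  then show "DB t \<le> 2 * DG t + DU t"
    unfolding DG_def DU_def sum_distrib_left sum.distrib[symmetric] by simp
qed

lemma F_x_sup:
  assumes "l \<le> m" "0 \<le> t" "z \<in> I"
  shows "(F 0 l 0 t x z)\<^sup>2 \<le> (LINT x|lborel. (F 0 l 0 t x z)\<^sup>2) + (LINT x|lborel. (F 0 l 1 t x z)\<^sup>2)"
  using mac_family_DERIV(3)[OF F _ assms(2) inJ[OF assms(3)], of 0 l 0] assms
  by (intro sup_le_H1 mac_family_decay_x[OF F] inJ) auto

lemma S_x_sup:
  assumes "l \<le> m" "0 \<le> t" "z \<in> I"
  shows "(S 0 l 0 t x z)\<^sup>2 \<le> (LINT x|lborel. (S 0 l 0 t x z)\<^sup>2) + (LINT x|lborel. (S 0 l 1 t x z)\<^sup>2)"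
  using mac_family_DERIV(3)[OF S _ assms(2) inJ[OF assms(3)], of 0 l 0] assms
  by (intro sup_le_H1 mac_family_decay_x[OF S] inJ) auto

lemma C0: "0 \<le> C" using emb by simp

text \<open>Cauchy-Schwarz in v bounds T by the product of the roots of E and B. The trilinear
  estimate then applies to |F|, the root of E and the root of B; the last factor takes no supremum,
  which matters since B contains the v-derivative and the weight v.\<close>

lemma N_bound:
  assumes t: "0 \<le> t"
  shows "- (\<Sum>l\<le>m. \<Sum>i\<le>1. I2 (N l i t)) \<le> 2 * A_const m * C * sqrt (EF t) * sqrt (EH t) * sqrt (DB t)"
proof -
  let ?f = "\<lambda>l i x z. \<bar>F 0 l i t x z\<bar>" and ?k = "\<lambda>l i x z. sqrt (E l i t x z)" and ?b = "\<lambda>l i x z. sqrt (B l i t x z)"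
  have mF: "decay_xz (\<lambda>x z. F 0 l i t x z)" if "l \<le> m" "i \<le> 1" for l i using that t by (intro decay_xz_F) auto
  have mk: "decay_xz (?k l i)" if "l \<le> m" "i \<le> 1" for l i
    unfolding E_def using that t by (intro decay_xz_sqrt_integral_v decay_xvz_imp_decay1_xvz decay_xvz_H) auto
  have mb: "decay_xz (?b l i)" if "l \<le> m" "i \<le> 1" for l i
    unfolding B_def using that t by (intro decay_xz_sqrt_integral_v decay1_xvz_A) auto
  have T: "\<bar>T j r l i t x z\<bar> \<le> ?k j r x z * ?b l i x z" if "j \<le> m" "r \<le> 1" "l \<le> m" "i \<le> 1" "z \<in> I" for j r l i x z
    unfolding T_def E_def B_def
    by (rule integral_le_sqrt_mult; intro decay_xvz_v_integrable[OF _ that(5)] decay1_xvz_mult decay1_xvz_power2 decay1_xvz_A decay_xvz_imp_decay1_xvz decay_xvz_H) (use that t in auto)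
  have "- (\<Sum>l\<le>m. \<Sum>i\<le>1. I2 (N l i t)) = (\<Sum>l\<le>m. \<Sum>i\<le>1. I2 (\<lambda>x z. - N l i t x z))"
    by (simp only: I2_minus sum_negf)
  also have "\<dots> \<le> (\<Sum>l\<le>m. \<Sum>i\<le>1. I2 (\<lambda>x z. nl ?f ?k l i x z * ?b l i x z))"
  proof (intro sum_mono I2_mono decay_xz_minus decay_xz_N decay_xz_mult decay_xz_nl decay_xz_abs)
    fix l i x z assume li: "l \<in> {..m}" "i \<in> {..1::nat}" and z: "z \<in> I"
    have "- N l i t x z = (\<Sum>r\<le>i. real (i choose r) * (\<Sum>j\<le>l. real (l choose j) * (- (F 0 j r t x z * T (l - j) (i - r) l i t x z))))"
      by (simp add: N_def sum_negf)
    also have "\<dots> \<le> (\<Sum>r\<le>i. real (i choose r) * (\<Sum>j\<le>l. real (l choose j) * (?f j r x z * (?k (l - j) (i - r) x z * ?b l i x z))))"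
    proof (intro sum_mono mult_left_mono)
      fix r j assume "r \<in> {..i}" "j \<in> {..l}"
      have "- (F 0 j r t x z * T (l - j) (i - r) l i t x z) \<le> \<bar>F 0 j r t x z\<bar> * \<bar>T (l - j) (i - r) l i t x z\<bar>"
        unfolding abs_mult[symmetric] by (rule abs_ge_minus_self)
      also have "\<dots> \<le> ?f j r x z * (?k (l - j) (i - r) x z * ?b l i x z)"
        by (intro mult_left_mono T z) (use li in auto)
      finally show "- (F 0 j r t x z * T (l - j) (i - r) l i t x z) \<le> ?f j r x z * (?k (l - j) (i - r) x z * ?b l i x z)" .
    qed auto
    also have "\<dots> = nl ?f ?k l i x z * ?b l i x z" by (simp add: nl_def sum_distrib_right mult.assoc)
    finally show "- N l i t x z \<le> nl ?f ?k l i x z * ?b l i x z" .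
  qed (use t in \<open>auto intro!: mF mk mb\<close>)
  also have "\<dots> = (\<Sum>l\<le>m. \<Sum>i\<le>1. \<Sum>r\<le>i. real (i choose r) * (\<Sum>j\<le>l. real (l choose j) *
      I2 (\<lambda>x z. ?f j r x z * ?k (l - j) (i - r) x z * ?b l i x z)))"
    by (intro sum.cong refl I2_nl_mult decay_xz_abs mF mk mb) auto
  also have "\<dots> \<le> 2 * A_const m * C * sqrt (\<Sum>l\<le>m. \<Sum>i\<le>1. I2 (\<lambda>x z. (?f l i x z)\<^sup>2))
        * sqrt (\<Sum>l\<le>m. \<Sum>i\<le>1. I2 (\<lambda>x z. (?k l i x z)\<^sup>2)) * sqrt (\<Sum>l\<le>m. \<Sum>i\<le>1. I2 (\<lambda>x z. (?b l i x z)\<^sup>2))"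
  proof (rule xz_trilinear[OF m C0])
    show "(?k l 0 x z)\<^sup>2 \<le> (LINT x|lborel. (?k l 0 x z)\<^sup>2) + (LINT x|lborel. (?k l 1 x z)\<^sup>2)" if "l \<le> m" "z \<in> I" for l x z
      using kin_family_x_sup[OF H J _ t that(2), of l x] that(1) by (simp add: E_def)
    show "(LINT x|lborel. (?k l i x z)\<^sup>2) \<le> C\<^sup>2 * (I2 (\<lambda>x z. (?k l i x z)\<^sup>2) + I2 (\<lambda>x z. (?k (Suc l) i x z)\<^sup>2))"
      if "l < m" "i \<le> 1" "z \<in> I" for l i z
      using kin_family_z_sup[OF H J emb(1) C0 _ t that(3), of l i] that by (simp add: E_def)
    show "(?f l 0 x z)\<^sup>2 \<le> (LINT x|lborel. (?f l 0 x z)\<^sup>2) + (LINT x|lborel. (?f l 1 x z)\<^sup>2)" if "l \<le> m" "z \<in> I" for l x z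
      using F_x_sup[OF that(1) t that(2)] by simp
    show "(LINT x|lborel. (?f l i x z)\<^sup>2) \<le> C\<^sup>2 * (I2 (\<lambda>x z. (?f l i x z)\<^sup>2) + I2 (\<lambda>x z. (?f (Suc l) i x z)\<^sup>2))"
      if "l < m" "i \<le> 1" "z \<in> I" for l i z
      using mac_family_z_sup[OF F J emb(1) C0 _ t that(3), of l i] that by simp
  qed (auto intro!: decay_xz_abs mF mk mb simp: E_nonneg B_nonneg)
  finally show ?thesis by (simp add: EF_def EH_def DB_def E_nonneg B_nonneg)
qed

text \<open>In the momentum equation tested with the field the three factors are field, density and
  field again, so suprema fall on field or density only.\<close>

lemma FS_bound:
  assumes t: "0 \<le> t"
  shows "- (\<Sum>l\<le>m. \<Sum>i\<le>1. I2 (\<lambda>x z. nl (\<lambda>j r. F 0 j r t) (\<lambda>j r. S 0 j r t) l i x z * F 0 l i t x z))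
    \<le> 2 * A_const m * C * sqrt (EF t) * sqrt (DS t) * sqrt (EF t)"
proof -
  let ?f = "\<lambda>l i x z. \<bar>F 0 l i t x z\<bar>" and ?k = "\<lambda>l i x z. \<bar>S 0 l i t x z\<bar>"
  have mF: "decay_xz (\<lambda>x z. F 0 l i t x z)" if "l \<le> m" "i \<le> 1" for l i using that t by (intro decay_xz_F) auto
  have mS: "decay_xz (\<lambda>x z. S 0 l i t x z)" if "l \<le> m" "i \<le> 1" for l i using that t by (intro decay_xz_S) auto
  have "- (\<Sum>l\<le>m. \<Sum>i\<le>1. I2 (\<lambda>x z. nl (\<lambda>j r. F 0 j r t) (\<lambda>j r. S 0 j r t) l i x z * F 0 l i t x z))
      = (\<Sum>l\<le>m. \<Sum>i\<le>1. \<Sum>r\<le>i. real (i choose r) * (\<Sum>j\<le>l. real (l choose j) *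
      - I2 (\<lambda>x z. F 0 j r t x z * S 0 (l - j) (i - r) t x z * F 0 l i t x z)))"
    unfolding sum_negf[symmetric]
  proof (intro sum.cong refl)
    fix l i assume "l \<in> {..m}" "i \<in> {..1::nat}"
    then show "- I2 (\<lambda>x z. nl (\<lambda>j r. F 0 j r t) (\<lambda>j r. S 0 j r t) l i x z * F 0 l i t x z)
      = (\<Sum>r\<le>i. real (i choose r) * (\<Sum>j\<le>l. real (l choose j) *
      - I2 (\<lambda>x z. F 0 j r t x z * S 0 (l - j) (i - r) t x z * F 0 l i t x z)))"
      by (subst I2_nl_mult) (auto intro: mF mS simp: sum_negf)
  qed
  also have "\<dots> \<le> (\<Sum>l\<le>m. \<Sum>i\<le>1. \<Sum>r\<le>i. real (i choose r) * (\<Sum>j\<le>l. real (l choose j) *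
      I2 (\<lambda>x z. ?f j r x z * ?k (l - j) (i - r) x z * ?f l i x z)))"
  proof (intro sum_mono mult_left_mono)
    fix l i r j assume a: "l \<in> {..m}" "i \<in> {..1::nat}" "r \<in> {..i}" "j \<in> {..l}"
    have "decay_xz (\<lambda>x z. F 0 j r t x z * S 0 (l - j) (i - r) t x z * F 0 l i t x z)"
      using a by (intro decay_xz_mult mF mS) auto
    then have "\<bar>I2 (\<lambda>x z. F 0 j r t x z * S 0 (l - j) (i - r) t x z * F 0 l i t x z)\<bar>
      \<le> I2 (\<lambda>x z. \<bar>F 0 j r t x z * S 0 (l - j) (i - r) t x z * F 0 l i t x z\<bar>)" by (rule I2_abs_le)
    then show "- I2 (\<lambda>x z. F 0 j r t x z * S 0 (l - j) (i - r) t x z * F 0 l i t x z)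
      \<le> I2 (\<lambda>x z. ?f j r x z * ?k (l - j) (i - r) x z * ?f l i x z)" by (simp add: abs_mult)
  qed auto
  also have "\<dots> \<le> 2 * A_const m * C * sqrt (\<Sum>l\<le>m. \<Sum>i\<le>1. I2 (\<lambda>x z. (?f l i x z)\<^sup>2))
        * sqrt (\<Sum>l\<le>m. \<Sum>i\<le>1. I2 (\<lambda>x z. (?k l i x z)\<^sup>2)) * sqrt (\<Sum>l\<le>m. \<Sum>i\<le>1. I2 (\<lambda>x z. (?f l i x z)\<^sup>2))"
  proof (rule xz_trilinear[OF m C0])
    show "(?k l 0 x z)\<^sup>2 \<le> (LINT x|lborel. (?k l 0 x z)\<^sup>2) + (LINT x|lborel. (?k l 1 x z)\<^sup>2)" if "l \<le> m" "z \<in> I" for l x z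
      using S_x_sup[OF that(1) t that(2)] by simp
    show "(LINT x|lborel. (?k l i x z)\<^sup>2) \<le> C\<^sup>2 * (I2 (\<lambda>x z. (?k l i x z)\<^sup>2) + I2 (\<lambda>x z. (?k (Suc l) i x z)\<^sup>2))"
      if "l < m" "i \<le> 1" "z \<in> I" for l i z
      using mac_family_z_sup[OF S J emb(1) C0 _ t that(3), of l i] that by simp
    show "(?f l 0 x z)\<^sup>2 \<le> (LINT x|lborel. (?f l 0 x z)\<^sup>2) + (LINT x|lborel. (?f l 1 x z)\<^sup>2)" if "l \<le> m" "z \<in> I" for l x z
      using F_x_sup[OF that(1) t that(2)] by simp
    show "(LINT x|lborel. (?f l i x z)\<^sup>2) \<le> C\<^sup>2 * (I2 (\<lambda>x z. (?f l i x z)\<^sup>2) + I2 (\<lambda>x z. (?f (Suc l) i x z)\<^sup>2))"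
      if "l < m" "i \<le> 1" "z \<in> I" for l i z
      using mac_family_z_sup[OF F J emb(1) C0 _ t that(3), of l i] that by simp
  qed (auto intro!: decay_xz_abs mF mS)
  finally show ?thesis by (simp add: EF_def DS_def)
qed

end

section \<open>Evolution of the energies\<close>

context vfp begin

lemma I2_weight_decay_xz: "decay_xz (\<lambda>x z. K / (1 + x\<^sup>2))"
  unfolding decay_xz_def
proof (intro conjI exI allI ballI)
  show "(\<lambda>(x, z). K / (1 + x\<^sup>2)) \<in> borel_measurable (lborel \<Otimes>\<^sub>M P)"
    by (rule borel_measurable_mu2[of UNIV "\<lambda>x z. K / (1 + x\<^sup>2)"])
       (auto intro!: continuous_intros simp: case_prod_beta' add_nonneg_eq_0_iff)
  show "\<bar>K / (1 + x\<^sup>2)\<bar> \<le> \<bar>K\<bar> / (1 + x\<^sup>2)" for x :: real by simp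
qed

text \<open>Two orders \<open>Nf\<close> and \<open>Ng\<close> are allowed, because velocity moments
  have m + 3 derivatives and the field has m + 2.\<close>

lemma I2_has_derivative:
  assumes f: "mac_family Nf J f" and g: "mac_family Ng J g" and "l + i < Nf" "l' + i' < Ng" and t: "0 \<le> t"
  shows "((\<lambda>s. I2 (\<lambda>x z. f 0 l i s x z * g 0 l' i' s x z)) has_real_derivative
    I2 (\<lambda>x z. f 1 l i t x z * g 0 l' i' t x z) + I2 (\<lambda>x z. f 0 l i t x z * g 1 l' i' t x z)) (at t within {0..})"
proof -
  obtain K where K: "0 \<le> K" "\<And>k l i t' x z. k + l + i \<le> Nf \<Longrightarrow> 0 \<le> t' \<Longrightarrow> t' \<le> t + 1 \<Longrightarrow> z \<in> J \<Longrightarrow>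
      \<bar>f k l i t' x z\<bar> \<le> K / (1 + x\<^sup>2)"
    by (rule mac_family_bound[OF f, where T="t + 1"]) (rule that)
  obtain L where L: "0 \<le> L" "\<And>k l i t' x z. k + l + i \<le> Ng \<Longrightarrow> 0 \<le> t' \<Longrightarrow> t' \<le> t + 1 \<Longrightarrow> z \<in> J \<Longrightarrow>
      \<bar>g k l i t' x z\<bar> \<le> L / (1 + x\<^sup>2)"
    by (rule mac_family_bound[OF g, where T="t + 1"]) (rule that)
  have decay_xz: "decay_xz (\<lambda>x z. f k l i s x z * g k' l' i' s x z)" if "k \<le> 1" "k' \<le> 1" "0 \<le> s" for k k' s
    using that assms by (intro decay_xz_mult mac_family_decay_xz[OF f J] mac_family_decay_xz[OF g J]) auto
  have sp: "snd p \<in> I" if "p \<in> space (mu2 P)" for p using that by (auto simp: mu2_def space_pair_measure)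
  have L1: "L / (1 + x\<^sup>2) \<le> L" for x
    using divide_left_mono[of 1 "1 + x\<^sup>2" L] L(1) by simp
  have bb: "\<bar>a * b\<bar> \<le> K / (1 + x\<^sup>2) * L" if "\<bar>a\<bar> \<le> K / (1 + x\<^sup>2)" "\<bar>b\<bar> \<le> L / (1 + x\<^sup>2)" for a b x :: real
    unfolding abs_mult using that K(1) by (intro mult_mono) (auto intro: order_trans[OF _ L1])
  let ?D = "\<lambda>s p. case p of (x, z) \<Rightarrow> f 1 l i s x z * g 0 l' i' s x z + f 0 l i s x z * g 1 l' i' s x z"
  have "((\<lambda>s. LINT p|mu2 P. (case p of (x, z) \<Rightarrow> f 0 l i s x z * g 0 l' i' s x z)) has_real_derivative
      (LINT p|mu2 P. ?D t p)) (at t within {0..})"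
  proof (rule integral_has_time_derivative[OF t, where w="\<lambda>p. case p of (x, z) \<Rightarrow> 2 * K * L / (1 + x\<^sup>2)"])
    fix s :: real and p :: "real \<times> real" assume s: "0 \<le> s" and p: "p \<in> space (mu2 P)"
    obtain x z where xz: "p = (x, z)" by (cases p)
    have z: "z \<in> J" using sp[OF p] J by (auto simp: xz)
    have "((\<lambda>s. f 0 l i s x z) has_real_derivative f 1 l i s x z) (at s within {0..})"
      "((\<lambda>s. g 0 l' i' s x z) has_real_derivative g 1 l' i' s x z) (at s within {0..})"
      using mac_family_DERIV(1)[OF f _ s z, of 0 l i x] mac_family_DERIV(1)[OF g _ s z, of 0 l' i' x] assms by auto
    then show "((\<lambda>s. case p of (x, z) \<Rightarrow> f 0 l i s x z * g 0 l' i' s x z) has_real_derivative ?D s p) (at s within {0..})"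
      unfolding xz by (auto intro!: derivative_eq_intros)
    assume s1: "s \<le> t + 1"
    have "\<bar>f 1 l i s x z * g 0 l' i' s x z\<bar> \<le> K / (1 + x\<^sup>2) * L" "\<bar>f 0 l i s x z * g 1 l' i' s x z\<bar> \<le> K / (1 + x\<^sup>2) * L"
      by (intro bb K(2) L(2); use assms s s1 z in simp)+
    then have "\<bar>?D s p\<bar> \<le> K / (1 + x\<^sup>2) * L + K / (1 + x\<^sup>2) * L"
      unfolding xz prod.case by (intro order_trans[OF abs_triangle_ineq] add_mono)
    then show "\<bar>?D s p\<bar> \<le> (case p of (x, z) \<Rightarrow> 2 * K * L / (1 + x\<^sup>2))" by (simp add: xz)
  next
    show "integrable (mu2 P) (\<lambda>p. case p of (x, z) \<Rightarrow> 2 * K * L / (1 + x\<^sup>2))"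
      by (rule mu2_integral(1)[OF I2_weight_decay_xz])
    show "integrable (mu2 P) (\<lambda>p. case p of (x, z) \<Rightarrow> f 0 l i s x z * g 0 l' i' s x z)" if "0 \<le> s" for s
      by (rule mu2_integral(1)[OF decay_xz]) (use that in auto)
    show "?D t \<in> borel_measurable (mu2 P)"
      by (rule borel_measurable_integrable, rule mu2_integral(1), intro decay_xz_add decay_xz) (use t in auto)
  qed
  moreover have "(LINT p|mu2 P. ?D t p) = I2 (\<lambda>x z. f 1 l i t x z * g 0 l' i' t x z) + I2 (\<lambda>x z. f 0 l i t x z * g 1 l' i' t x z)"
    unfolding I2_def[of "\<lambda>x z. f 1 l i t x z * g 0 l' i' t x z + f 0 l i t x z * g 1 l' i' t x z", symmetric]
    by (intro I2_add decay_xz) (use t in auto)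
  ultimately show ?thesis unfolding I2_def[symmetric] by simp
qed

lemma I2_E: "l \<le> m \<Longrightarrow> i \<le> 1 \<Longrightarrow> 0 \<le> t \<Longrightarrow>
    I2 (E l i t) = (LINT p|mu3 P. (case p of (x, v, z) \<Rightarrow> (H 0 0 l i t x v z)\<^sup>2))"
  using mu3_integral(2)[of "\<lambda>x v z. (H 0 0 l i t x v z)\<^sup>2"] I2_iterated[OF decay_xz_E, of l i t] decay1_xvz_power2[OF decay_xvz_imp_decay1_xvz[OF decay_xvz_H], of 0 0 l i t]
  by (simp add: E_def)

lemma I2_G: "l \<le> m \<Longrightarrow> i \<le> 1 \<Longrightarrow> 0 \<le> t \<Longrightarrow>
    I2 (G l i t) = (LINT p|mu3 P. (case p of (x, v, z) \<Rightarrow>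
      (1 + v\<^sup>2) * (H 0 0 l i t x v z - S 0 l i t x z * sqrtM v - U 0 l i t x z * (v * sqrtM v))\<^sup>2 +
      (H 0 1 l i t x v z + S 0 l i t x z * (v / 2 * sqrtM v) - U 0 l i t x z * (sqrtM v - v\<^sup>2 / 2 * sqrtM v))\<^sup>2))"
  using mu3_integral(2)[OF decay_xvz_G, of l i t] I2_iterated[OF decay_xz_G, of l i t] by (simp add: G_def)

lemma E_has_derivative:
  assumes li: "l \<le> m" "i \<le> 1" and t: "0 \<le> t"
  shows "((\<lambda>s. I2 (E l i s)) has_real_derivative 2 * I2 (E' l i t)) (at t within {0..})"
proof -
  obtain K where K: "0 \<le> K" "\<And>k j l i t' x v z. k + j + l + i \<le> m + 3 \<Longrightarrow> 0 \<le> t' \<Longrightarrow> t' \<le> t + 1 \<Longrightarrow> z \<in> J \<Longrightarrow>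
      \<bar>H k j l i t' x v z\<bar> \<le> K * (1 / (1 + x\<^sup>2)) * (1 / (1 + v\<^sup>2))"
    by (rule kin_family_bound[OF H, where T="t + 1"]) (rule that)
  have sp: "snd (snd p) \<in> J" if "p \<in> space (mu3 P)" for p using that J by (auto simp: mu3_def space_pair_measure)
  have decay_xvz: "decay_xvz (\<lambda>x v z. H 1 0 l i t x v z * H 0 0 l i t x v z)" "decay_xvz (\<lambda>x v z. (H 0 0 l i s x v z)\<^sup>2)" if "0 \<le> s" for s
    using li t that by (auto intro!: decay1_xvz_mult decay1_xvz_power2 decay_xvz_imp_decay1_xvz decay_xvz_H)
  have dw: "decay (\<lambda>v::real. 1 / (1 + v\<^sup>2))" by (intro decayI[where K=1] continuous_intros) auto
  let ?D = "\<lambda>s p. case p of (x, v, z) \<Rightarrow> 2 * (H 1 0 l i s x v z * H 0 0 l i s x v z)"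
  have "((\<lambda>s. LINT p|mu3 P. (case p of (x, v, z) \<Rightarrow> (H 0 0 l i s x v z)\<^sup>2)) has_real_derivative
      (LINT p|mu3 P. ?D t p)) (at t within {0..})"
  proof (rule integral_has_time_derivative[OF t, where w="\<lambda>p. case p of (x, v, z) \<Rightarrow> (2 * K * K) / (1 + x\<^sup>2) * (1 / (1 + v\<^sup>2))"])
    fix s :: real and p :: "real \<times> real \<times> real" assume s: "0 \<le> s" and p: "p \<in> space (mu3 P)"
    obtain x v z where xz: "p = (x, v, z)" by (cases p)
    have z: "z \<in> J" using sp[OF p] by (simp add: xz)
    have "((\<lambda>s. H 0 0 l i s x v z) has_real_derivative H 1 0 l i s x v z) (at s within {0..})"
      using kin_family_DERIV(1)[OF H _ s z, of 0 0 l i x v] li by auto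
    then show "((\<lambda>s. case p of (x, v, z) \<Rightarrow> (H 0 0 l i s x v z)\<^sup>2) has_real_derivative ?D s p) (at s within {0..})"
      unfolding xz by (auto intro!: derivative_eq_intros)
    assume s1: "s \<le> t + 1"
    have b: "\<bar>H k 0 l i s x v z\<bar> \<le> K * (1 / (1 + x\<^sup>2)) * (1 / (1 + v\<^sup>2))" if "k \<le> 1" for k
      using K(2)[of k 0 l i s z x v] li s s1 z that by auto
    have le: "a * (1 / (1 + y\<^sup>2)) \<le> a" if "0 \<le> a" for a y :: real
      using mult_left_mono[of "1 / (1 + y\<^sup>2)" 1 a] that by simp
    have "K * (1 / (1 + x\<^sup>2)) * (1 / (1 + v\<^sup>2)) \<le> K"
      using le[of "K * (1 / (1 + x\<^sup>2))" v] le[of K x] K(1) by simp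
    then have "\<bar>H 0 0 l i s x v z\<bar> \<le> K" using b[of 0] by simp
    then have "\<bar>H 1 0 l i s x v z\<bar> * \<bar>H 0 0 l i s x v z\<bar> \<le> (K * (1 / (1 + x\<^sup>2)) * (1 / (1 + v\<^sup>2))) * K"
      using K(1) b[of 1] by (intro mult_mono) auto
    then have "2 * (\<bar>H 1 0 l i s x v z\<bar> * \<bar>H 0 0 l i s x v z\<bar>) \<le> 2 * ((K * (1 / (1 + x\<^sup>2)) * (1 / (1 + v\<^sup>2))) * K)"
      by (intro mult_left_mono) auto
    then show "\<bar>?D s p\<bar> \<le> (case p of (x, v, z) \<Rightarrow> (2 * K * K) / (1 + x\<^sup>2) * (1 / (1 + v\<^sup>2)))"
      by (simp add: xz abs_mult mult_ac)
  next
    show "integrable (mu3 P) (\<lambda>p. case p of (x, v, z) \<Rightarrow> (2 * K * K) / (1 + x\<^sup>2) * (1 / (1 + v\<^sup>2)))"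
      by (rule mu3_integral(1)[OF decay_xz_mult_v[OF I2_weight_decay_xz dw]])
    show "integrable (mu3 P) (\<lambda>p. case p of (x, v, z) \<Rightarrow> (H 0 0 l i s x v z)\<^sup>2)" if "0 \<le> s" for s
      by (rule mu3_integral(1)[OF decay_xvz(2)[OF that]])
    show "?D t \<in> borel_measurable (mu3 P)"
      using integrable_mult_right[OF mu3_integral(1)[OF decay_xvz(1)[OF t]], of 2] by (auto simp: case_prod_beta')
  qed
  moreover have "(LINT p|mu3 P. ?D t p) = 2 * I2 (E' l i t)"
    using mu3_integral(2)[OF decay_xvz(1)[OF t]] I2_iterated[OF decay_xz_E'[OF li t]] by (simp add: case_prod_beta' E'_def)
  ultimately have "((\<lambda>s. LINT p|mu3 P. (case p of (x, v, z) \<Rightarrow> (H 0 0 l i s x v z)\<^sup>2)) has_real_derivative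
      2 * I2 (E' l i t)) (at t within {0..})" by simp
  then show ?thesis
    by (rule has_field_derivative_transform_within[where d=1]) (use li t in \<open>auto simp: I2_E\<close>)
qed

text \<open>Both identities insert \<open>dt_field\<close>. The first turns the linear field term of
  the energy identity into half a time derivative of the field energy, the second produces the
  squared norm of u in the second inequality.\<close>

lemma I2_F1_F:
  assumes "l \<le> m" "i \<le> 1" "0 \<le> t"
  shows "\<delta> * I2 (\<lambda>x z. F 1 l i t x z * F 0 l i t x z) = I2 (\<lambda>x z. F 0 l i t x z * U 0 l i t x z)"
    and "\<delta> * I2 (\<lambda>x z. U 0 l i t x z * F 1 l i t x z) = I2 (\<lambda>x z. (U 0 l i t x z)\<^sup>2)"
proof -
  have f: "\<delta> * F 1 l i t x z = U 0 l i t x z" if "z \<in> I" for x z by (rule dt_field[OF assms that])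
  show "\<delta> * I2 (\<lambda>x z. F 1 l i t x z * F 0 l i t x z) = I2 (\<lambda>x z. F 0 l i t x z * U 0 l i t x z)"
    unfolding I2_cmult[symmetric] by (rule I2_cong) (simp add: f[symmetric])
  show "\<delta> * I2 (\<lambda>x z. U 0 l i t x z * F 1 l i t x z) = I2 (\<lambda>x z. (U 0 l i t x z)\<^sup>2)"
    unfolding I2_cmult[symmetric] by (rule I2_cong) (simp add: f[symmetric] power2_eq_square)
qed

section \<open>The two differential inequalities for the derivative families\<close>

lemma A_const_nonneg: "0 \<le> A_const m"
  by (simp add: A_const_def)

text \<open>The trilinear estimates are linear in C, whereas the inequalities are stated with its
  square.\<close>

lemma C_le: "C \<le> C\<^sup>2"
  using emb(2) by (simp add: power2_eq_square)

text \<open>The energy identity divided by \<epsilon> \<delta> is an equality with full dissipation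
  \<open>DB\<close>. The lower bound of \<open>DB\<close> supplies the dissipation on the left, the
  upper bound absorbs the \<open>DB\<close> that the nonlinear term leaves on the right.\<close>

lemma first_inequality:
  assumes t: "0 \<le> t" and a: "0 < a"
  shows "(\<Sum>l\<le>m. \<Sum>i\<le>1. I2 (E' l i t) + \<delta> / \<epsilon> * I2 (\<lambda>x z. F 1 l i t x z * F 0 l i t x z))
      + 1 / 7 / (\<delta> * \<epsilon>) * DG t + 1 / (\<delta> * \<epsilon>) * DU t
    \<le> A_const m * C\<^sup>2 / (a * \<epsilon>) * sqrt (EH t) * (3 * DU t + 2 * DG t) + a * A_const m * C\<^sup>2 / \<epsilon> * sqrt (EH t) * EF t"
proof -
  have e: "I2 (E' l i t) + \<delta> / \<epsilon> * I2 (\<lambda>x z. F 1 l i t x z * F 0 l i t x z) = 1 / \<epsilon> * - I2 (N l i t) - 1 / (\<delta> * \<epsilon>) * I2 (B l i t)"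
    if "l \<le> m" "i \<le> 1" for l i
  proof -
    have gen: "e + \<delta> / \<epsilon> * f1 = 1 / \<epsilon> * - n - 1 / (\<delta> * \<epsilon>) * b"
      if "\<epsilon> * \<delta> * e + \<delta> * n + \<delta> * fu + b = 0" "\<delta> * f1 = fu" for e n fu b f1 :: real
    proof -
      have b: "b = - (\<epsilon> * \<delta> * e + \<delta> * n + \<delta> * (\<delta> * f1))" unfolding that(2) using that(1) by linarith
      show ?thesis unfolding b using eps del by (simp add: field_simps)
    qed
    show ?thesis by (rule gen[OF energy_identity[OF that t] I2_F1_F(1)[OF that t]])
  qed
  have "(\<Sum>l\<le>m. \<Sum>i\<le>1. I2 (E' l i t) + \<delta> / \<epsilon> * I2 (\<lambda>x z. F 1 l i t x z * F 0 l i t x z))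
      = (\<Sum>l\<le>m. \<Sum>i\<le>1. 1 / \<epsilon> * - I2 (N l i t) - 1 / (\<delta> * \<epsilon>) * I2 (B l i t))"
    by (intro sum.cong refl e) auto
  also have "\<dots> = 1 / \<epsilon> * - (\<Sum>l\<le>m. \<Sum>i\<le>1. I2 (N l i t)) - 1 / (\<delta> * \<epsilon>) * DB t"
    unfolding DB_def by (simp only: sum_subtractf sum_distrib_left sum_negf[symmetric])
  finally have 1: "(\<Sum>l\<le>m. \<Sum>i\<le>1. I2 (E' l i t) + \<delta> / \<epsilon> * I2 (\<lambda>x z. F 1 l i t x z * F 0 l i t x z))
      = 1 / \<epsilon> * - (\<Sum>l\<le>m. \<Sum>i\<le>1. I2 (N l i t)) - 1 / (\<delta> * \<epsilon>) * DB t" .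
  \<comment> \<open>Young's inequality with weight a; the free parameter of the statement originates
    here.\<close>
  have am: "2 * (sqrt (EF t) * sqrt (DB t)) \<le> a * EF t + 1 / a * DB t"
  proof -
    have "0 \<le> (sqrt a * sqrt (EF t) - sqrt (1 / a) * sqrt (DB t))\<^sup>2" by simp
    also have "\<dots> = a * EF t + 1 / a * DB t - 2 * (sqrt a * sqrt (1 / a)) * (sqrt (EF t) * sqrt (DB t))"
      using a nonneg by (simp add: power2_diff power_mult_distrib algebra_simps)
    also have "sqrt a * sqrt (1 / a) = 1" using a by (simp flip: real_sqrt_mult)
    finally show ?thesis by simp
  qed
  have "- (\<Sum>l\<le>m. \<Sum>i\<le>1. I2 (N l i t)) \<le> A_const m * C * sqrt (EH t) * (2 * (sqrt (EF t) * sqrt (DB t)))"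
    using N_bound[OF t] by (simp only: mult_ac)
  also have "\<dots> \<le> A_const m * C\<^sup>2 * sqrt (EH t) * (a * EF t + 1 / a * (3 * DU t + 2 * DG t))"
  proof (intro mult_mono)
    \<comment> \<open>\<open>DB_bounds\<close> gives DU with the factor 1, which is enlarged to 3 to
      meet the stated form.\<close>
    have "DB t \<le> 3 * DU t + 2 * DG t" using DB_bounds(2)[OF t] nonneg(3)[of t] by linarith
    then have "1 / a * DB t \<le> 1 / a * (3 * DU t + 2 * DG t)" using a by (intro mult_left_mono) auto
    then show "2 * (sqrt (EF t) * sqrt (DB t)) \<le> a * EF t + 1 / a * (3 * DU t + 2 * DG t)" using am by linarith
  qed (use A_const_nonneg C0 C_le nonneg in auto)
  finally have 2: "1 / \<epsilon> * - (\<Sum>l\<le>m. \<Sum>i\<le>1. I2 (N l i t)) \<le>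
      1 / \<epsilon> * (A_const m * C\<^sup>2 * sqrt (EH t) * (a * EF t + 1 / a * (3 * DU t + 2 * DG t)))"
    using eps by (intro mult_left_mono) auto
  have "1 / (\<delta> * \<epsilon>) * (1 / 7 * DG t + DU t) \<le> 1 / (\<delta> * \<epsilon>) * DB t"
    using DB_bounds(1)[OF t] eps del by (intro mult_left_mono) auto
  then have 3: "1 / 7 / (\<delta> * \<epsilon>) * DG t + 1 / (\<delta> * \<epsilon>) * DU t \<le> 1 / (\<delta> * \<epsilon>) * DB t" by (simp add: algebra_simps)
  have 4: "1 / \<epsilon> * (A_const m * C\<^sup>2 * sqrt (EH t) * (a * EF t + 1 / a * (3 * DU t + 2 * DG t))) =
    A_const m * C\<^sup>2 / (a * \<epsilon>) * sqrt (EH t) * (3 * DU t + 2 * DG t) + a * A_const m * C\<^sup>2 / \<epsilon> * sqrt (EH t) * EF t"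
    using a eps by (simp add: field_simps)
  show ?thesis using 1 2 3 4 by linarith
qed

text \<open>Integration by parts in x. By the Poisson equation the x-derivative of the field is
  minus the density, and the two minus signs cancel.\<close>

lemma I2_V_F:
  assumes "l \<le> m" "i \<le> 1" "0 \<le> t"
  shows "I2 (\<lambda>x z. V 0 l (Suc i) t x z * F 0 l i t x z) = I2 (\<lambda>x z. V 0 l i t x z * S 0 l i t x z)"
proof -
  have decay_xz: "decay_xz (\<lambda>x z. V 0 l (Suc i) t x z * F 0 l i t x z)" "decay_xz (\<lambda>x z. V 0 l i t x z * S 0 l i t x z)"
    using assms by (auto intro!: decay_xz_mult decay_xz_V decay_xz_F decay_xz_S)
  have eq: "(LINT x|lborel. V 0 l (Suc i) t x z * F 0 l i t x z) = (LINT x|lborel. V 0 l i t x z * S 0 l i t x z)" if z: "z \<in> I" for z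
  proof -
    note zJ = inJ[OF z]
    have D: "((\<lambda>x. V 0 l i t x z) has_real_derivative V 0 l (Suc i) t x z) (at x)"
      "((\<lambda>x. F 0 l i t x z) has_real_derivative - S 0 l i t x z) (at x)" for x
      using mac_family_DERIV(3)[OF V _ assms(3) zJ, of 0 l i] mac_family_DERIV(3)[OF F _ assms(3) zJ, of 0 l i x]
        poisson_derivs[OF assms z, of x] assms by auto
    have d: "decay (\<lambda>x. V 0 l i t x z)" "decay (\<lambda>x. V 0 l (Suc i) t x z)" "decay (\<lambda>x. F 0 l i t x z)" "decay (\<lambda>x. S 0 l i t x z)"
      by (rule mac_family_decay_x[OF V _ _ zJ] mac_family_decay_x[OF F _ _ zJ] mac_family_decay_x[OF S _ _ zJ]; use assms in simp)+
    have p: "decay (\<lambda>x. V 0 l (Suc i) t x z * F 0 l i t x z)" "decay (\<lambda>x. V 0 l i t x z * S 0 l i t x z)" "decay (\<lambda>x. V 0 l i t x z * F 0 l i t x z)"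
      by (intro decay1_mult decay_imp_decay1 d)+
    have "(LINT x|lborel. V 0 l (Suc i) t x z * F 0 l i t x z - V 0 l i t x z * S 0 l i t x z) = 0"
      by (rule lborel_FTC(1)[OF _ p(3) decay_diff[OF p(1,2)]]) (auto intro!: derivative_eq_intros D)
    then show ?thesis using decay_integrable[OF p(1)] decay_integrable[OF p(2)] by simp
  qed
  show ?thesis
    unfolding I2_iterated[OF decay_xz(1)] I2_iterated[OF decay_xz(2)]
    by (rule Bochner_Integration.integral_cong[OF refl]) (simp add: eq)
qed

text \<open>The momentum equation is tested with the field. The linear field term damps the field,
  and the second moment V damps the density, because V - S is microscopic and therefore controlled
  by G.\<close>

lemma second_inequality:
  assumes t: "0 \<le> t"
  shows "(\<Sum>l\<le>m. \<Sum>i\<le>1. I2 (\<lambda>x z. U 1 l i t x z * F 0 l i t x z) + I2 (\<lambda>x z. U 0 l i t x z * F 1 l i t x z)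
        + 1 / \<epsilon> * I2 (\<lambda>x z. F 1 l i t x z * F 0 l i t x z))
      + 1 / (2 * \<delta>) * DS t + 1 / \<epsilon> * EF t
    \<le> 1 / \<delta> * DU t + 1 / (2 * \<delta>) * DG t + A_const m * C\<^sup>2 / \<epsilon> * sqrt (EF t) * (3 * DS t + 2 * EF t)"
proof -
  let ?nl = "nl (\<lambda>j r. F 0 j r t) (\<lambda>j r. S 0 j r t)"
  define n where "n l i = I2 (\<lambda>x z. ?nl l i x z * F 0 l i t x z)" for l i
  have e: "I2 (\<lambda>x z. U 1 l i t x z * F 0 l i t x z) + I2 (\<lambda>x z. U 0 l i t x z * F 1 l i t x z)
        + 1 / \<epsilon> * I2 (\<lambda>x z. F 1 l i t x z * F 0 l i t x z)
      \<le> 1 / \<epsilon> * - n l i + 1 / (2 * \<delta>) * I2 (G l i t) + 1 / \<delta> * I2 (\<lambda>x z. (U 0 l i t x z)\<^sup>2)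
        - 1 / (2 * \<delta>) * I2 (\<lambda>x z. (S 0 l i t x z)\<^sup>2) - 1 / \<epsilon> * I2 (\<lambda>x z. (F 0 l i t x z)\<^sup>2)"
    if li: "l \<le> m" "i \<le> 1" for l i
  proof -
    have decay_xz: "decay_xz (\<lambda>x z. U 1 l i t x z * F 0 l i t x z)" "decay_xz (\<lambda>x z. V 0 l (Suc i) t x z * F 0 l i t x z)"
      "decay_xz (\<lambda>x z. ?nl l i x z * F 0 l i t x z)"
      "decay_xz (\<lambda>x z. (F 0 l i t x z)\<^sup>2)" "decay_xz (\<lambda>x z. F 0 l i t x z * U 0 l i t x z)"
      "decay_xz (\<lambda>x z. V 0 l i t x z * S 0 l i t x z)" "decay_xz (\<lambda>x z. (S 0 l i t x z)\<^sup>2)"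
      using li t by (auto intro!: decay_xz_mult decay_xz_power2 decay_xz_nl decay_xz_U decay_xz_F decay_xz_S decay_xz_V)
    have "I2 (\<lambda>x z. \<epsilon> * \<delta> * (U 1 l i t x z * F 0 l i t x z) + \<epsilon> * (V 0 l (Suc i) t x z * F 0 l i t x z)
      + \<delta> * (?nl l i x z * F 0 l i t x z)
      + \<delta> * (F 0 l i t x z)\<^sup>2 + F 0 l i t x z * U 0 l i t x z) = I2 (\<lambda>x z. 0)"
    proof (rule I2_cong)
      fix x z assume z: "z \<in> I"
      have "(\<epsilon> * \<delta> * U 1 l i t x z + \<epsilon> * V 0 l (Suc i) t x z + \<delta> * ?nl l i x z
        + \<delta> * F 0 l i t x z + U 0 l i t x z) * F 0 l i t x z = 0"
        unfolding nl_def using momentum[OF li t z, of x] by simp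
      then show "\<epsilon> * \<delta> * (U 1 l i t x z * F 0 l i t x z) + \<epsilon> * (V 0 l (Suc i) t x z * F 0 l i t x z)
        + \<delta> * (?nl l i x z * F 0 l i t x z)
        + \<delta> * (F 0 l i t x z)\<^sup>2 + F 0 l i t x z * U 0 l i t x z = 0"
        by (simp add: power2_eq_square algebra_simps)
    qed
    moreover have "I2 (\<lambda>x z. \<epsilon> * \<delta> * (U 1 l i t x z * F 0 l i t x z) + \<epsilon> * (V 0 l (Suc i) t x z * F 0 l i t x z)
      + \<delta> * (?nl l i x z * F 0 l i t x z)
      + \<delta> * (F 0 l i t x z)\<^sup>2 + F 0 l i t x z * U 0 l i t x z)
      = \<epsilon> * \<delta> * I2 (\<lambda>x z. U 1 l i t x z * F 0 l i t x z) + \<epsilon> * I2 (\<lambda>x z. V 0 l (Suc i) t x z * F 0 l i t x z)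
      + \<delta> * n l i + \<delta> * I2 (\<lambda>x z. (F 0 l i t x z)\<^sup>2) + I2 (\<lambda>x z. F 0 l i t x z * U 0 l i t x z)"
      unfolding n_def by (simp only: I2_add I2_cmult decay_xz_add decay_xz_cmult decay_xz)
    ultimately have M: "\<epsilon> * \<delta> * I2 (\<lambda>x z. U 1 l i t x z * F 0 l i t x z) + \<epsilon> * I2 (\<lambda>x z. V 0 l i t x z * S 0 l i t x z)
      + \<delta> * n l i + \<delta> * I2 (\<lambda>x z. (F 0 l i t x z)\<^sup>2) + I2 (\<lambda>x z. F 0 l i t x z * U 0 l i t x z) = 0"
      by (simp add: I2_zero I2_V_F[OF li t])
    have "I2 (\<lambda>x z. 1 / 2 * (S 0 l i t x z)\<^sup>2 - 1 / 2 * G l i t x z) \<le> I2 (\<lambda>x z. V 0 l i t x z * S 0 l i t x z)"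
    proof (intro I2_mono decay_xz_diff decay_xz_cmult decay_xz decay_xz_G li t)
      fix x z assume z: "z \<in> I"
      \<comment> \<open>Writing 2 V S as S^2 + V^2 - (V - S)^2 and dropping V^2 keeps half of S^2 at
        the price of half of G. Both constants 1 / (2 \<delta>) come from here.\<close>
      have "(V 0 l i t x z - S 0 l i t x z)\<^sup>2 = (V 0 l i t x z)\<^sup>2 - 2 * (V 0 l i t x z * S 0 l i t x z) + (S 0 l i t x z)\<^sup>2"
        by (simp add: power2_diff)
      moreover have "0 \<le> (V 0 l i t x z)\<^sup>2" by simp
      ultimately show "1 / 2 * (S 0 l i t x z)\<^sup>2 - 1 / 2 * G l i t x z \<le> V 0 l i t x z * S 0 l i t x z"
        using micro(3)[OF li t z, of x] by linarith
    qed
    also have "I2 (\<lambda>x z. 1 / 2 * (S 0 l i t x z)\<^sup>2 - 1 / 2 * G l i t x z) = 1 / 2 * I2 (\<lambda>x z. (S 0 l i t x z)\<^sup>2) - 1 / 2 * I2 (G l i t)"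
      unfolding I2_cmult[symmetric] by (intro I2_diff decay_xz_cmult decay_xz decay_xz_G li t)
    finally have VS: "1 / 2 * I2 (\<lambda>x z. (S 0 l i t x z)\<^sup>2) - 1 / 2 * I2 (G l i t) \<le> I2 (\<lambda>x z. V 0 l i t x z * S 0 l i t x z)" .
    define u1 vs f2 fu ff uf1 where q: "u1 = I2 (\<lambda>x z. U 1 l i t x z * F 0 l i t x z)" "vs = I2 (\<lambda>x z. V 0 l i t x z * S 0 l i t x z)"
      "f2 = I2 (\<lambda>x z. (F 0 l i t x z)\<^sup>2)" "fu = I2 (\<lambda>x z. F 0 l i t x z * U 0 l i t x z)"
      "ff = I2 (\<lambda>x z. F 1 l i t x z * F 0 l i t x z)" "uf1 = I2 (\<lambda>x z. U 0 l i t x z * F 1 l i t x z)"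
    have fu: "fu = - (\<epsilon> * \<delta> * u1 + \<epsilon> * vs + \<delta> * n l i + \<delta> * f2)"
      using M unfolding q[symmetric] by linarith
    have "u1 = - (1 / \<delta>) * vs - 1 / \<epsilon> * n l i - 1 / \<epsilon> * f2 - 1 / (\<epsilon> * \<delta>) * fu"
      unfolding fu using eps del by (simp add: field_simps)
    \<comment> \<open>This is the time derivative of the field energy times 1 / (2 \<epsilon>),
      order by order. It cancels the friction term of the previous identity, which is why the
      functional contains that multiple of the field energy.\<close>
    moreover have "1 / \<epsilon> * ff = 1 / (\<epsilon> * \<delta>) * fu"
      using I2_F1_F(1)[OF li t] eps del unfolding q[symmetric] by (simp add: field_simps)
    \<comment> \<open>The time derivative that falls on the field yields u; hence the term with
      \<open>D_u\<close> on the right.\<close>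
    moreover have "uf1 = 1 / \<delta> * I2 (\<lambda>x z. (U 0 l i t x z)\<^sup>2)"
      using I2_F1_F(2)[OF li t] del unfolding q[symmetric] by (simp add: field_simps)
    moreover have "1 / \<delta> * (1 / 2 * I2 (\<lambda>x z. (S 0 l i t x z)\<^sup>2) - 1 / 2 * I2 (G l i t)) \<le> 1 / \<delta> * vs"
      using VS del unfolding q[symmetric] by (intro mult_left_mono) auto
    then have "1 / (2 * \<delta>) * I2 (\<lambda>x z. (S 0 l i t x z)\<^sup>2) - 1 / (2 * \<delta>) * I2 (G l i t) \<le> 1 / \<delta> * vs"
      by (simp add: algebra_simps)
    ultimately show ?thesis unfolding q[symmetric] by simp
  qed
  have "(\<Sum>l\<le>m. \<Sum>i\<le>1. I2 (\<lambda>x z. U 1 l i t x z * F 0 l i t x z) + I2 (\<lambda>x z. U 0 l i t x z * F 1 l i t x z)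
        + 1 / \<epsilon> * I2 (\<lambda>x z. F 1 l i t x z * F 0 l i t x z))
    \<le> (\<Sum>l\<le>m. \<Sum>i\<le>1. 1 / \<epsilon> * - n l i + 1 / (2 * \<delta>) * I2 (G l i t) + 1 / \<delta> * I2 (\<lambda>x z. (U 0 l i t x z)\<^sup>2)
        - 1 / (2 * \<delta>) * I2 (\<lambda>x z. (S 0 l i t x z)\<^sup>2) - 1 / \<epsilon> * I2 (\<lambda>x z. (F 0 l i t x z)\<^sup>2))"
    by (intro sum_mono e) auto
  also have "\<dots> = 1 / \<epsilon> * - (\<Sum>l\<le>m. \<Sum>i\<le>1. n l i) + 1 / (2 * \<delta>) * DG t + 1 / \<delta> * DU t - 1 / (2 * \<delta>) * DS t - 1 / \<epsilon> * EF t"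
    unfolding DG_def DU_def DS_def EF_def by (simp only: sum_subtractf sum.distrib sum_distrib_left sum_negf[symmetric])
  finally have 1: "(\<Sum>l\<le>m. \<Sum>i\<le>1. I2 (\<lambda>x z. U 1 l i t x z * F 0 l i t x z) + I2 (\<lambda>x z. U 0 l i t x z * F 1 l i t x z)
        + 1 / \<epsilon> * I2 (\<lambda>x z. F 1 l i t x z * F 0 l i t x z))
    \<le> 1 / \<epsilon> * - (\<Sum>l\<le>m. \<Sum>i\<le>1. n l i) + 1 / (2 * \<delta>) * DG t + 1 / \<delta> * DU t - 1 / (2 * \<delta>) * DS t - 1 / \<epsilon> * EF t" .
  \<comment> \<open>One root of EF stays outside; the other is combined with the root of DS, and DS
    + EF is enlarged to the stated multiples.\<close>
  have am: "2 * (sqrt (DS t) * sqrt (EF t)) \<le> 3 * DS t + 2 * EF t"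
    using sum_squares_bound[of "sqrt (DS t)" "sqrt (EF t)"] nonneg[of t] by simp
  have "- (\<Sum>l\<le>m. \<Sum>i\<le>1. n l i) \<le> A_const m * C * sqrt (EF t) * (2 * (sqrt (DS t) * sqrt (EF t)))"
    using FS_bound[OF t] unfolding n_def by (simp only: mult_ac)
  also have "\<dots> \<le> A_const m * C\<^sup>2 * sqrt (EF t) * (3 * DS t + 2 * EF t)"
    by (intro mult_mono am) (use A_const_nonneg C0 C_le nonneg in auto)
  finally have "1 / \<epsilon> * - (\<Sum>l\<le>m. \<Sum>i\<le>1. n l i) \<le> 1 / \<epsilon> * (A_const m * C\<^sup>2 * sqrt (EF t) * (3 * DS t + 2 * EF t))"
    using eps by (intro mult_left_mono) auto
  also have "\<dots> = A_const m * C\<^sup>2 / \<epsilon> * sqrt (EF t) * (3 * DS t + 2 * EF t)" by simp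
  finally show ?thesis using 1 by linarith
qed

end

section \<open>The energies in terms of derivative families\<close>

lemma pds_append: "pds (as @ bs) f = pds as (pds bs f)"
  by (simp add: pds_def)

lemma pd_slice: "pd (0, e) (\<lambda>(t, p). f t p) = (\<lambda>(t, p). pd e (f t) p)"
  by (rule ext) (auto simp: pd_def)

lemma pds_replicate_slice: "pds (replicate n (0, e)) (\<lambda>(t, p). f t p) = (\<lambda>(t, p). (pd e ^^ n) (f t) p)"
proof (induction n)
  case (Suc n)
  show ?case
    unfolding replicate_Suc pds_Cons Suc by (simp add: pd_slice[of e "\<lambda>t. (pd e ^^ n) (f t)"])
qed simp

lemma kin_derivs_slice: "kin_derivs h 0 0 l i t x v z = (pd ez3 ^^ l) ((pd ex3 ^^ i) (h t)) (x, v, z)"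
  by (simp add: kin_derivs_def pds_append pds_replicate_slice)

lemma mac_derivs_slice: "mac_derivs f 0 l i t x z = (pd ez2 ^^ l) ((pd ex2 ^^ i) (f t)) (x, z)"
  by (simp add: mac_derivs_def pds_append pds_replicate_slice)

lemma kin_derivs_time: "kin_derivs h 1 0 0 0 t x v z = deriv (\<lambda>s. h s (x, v, z)) t"
proof -
  \<comment> \<open>\<open>deriv\<close> chooses among the numbers that satisfy the derivative
    relation, so equal relations give equal values, whether or not a derivative exists.\<close>
  have "(\<lambda>D. ((\<lambda>s. h (t + s) (x, v, z)) has_real_derivative D) (at 0)) = (\<lambda>D. ((\<lambda>s. h s (x, v, z)) has_real_derivative D) (at t))"
    using DERIV_shift[of "\<lambda>s. h s (x, v, z)" _ 0 t] by (simp add: add.commute)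
  then show ?thesis by (simp add: kin_derivs_def pds_Cons pd_def deriv_def)
qed

lemma kin_derivs_v: "kin_derivs h 0 1 0 0 t x v z = pd ev3 (h t) (x, v, z)"
  by (simp add: kin_derivs_def pds_Cons pd_def)

lemma shift_DERIV: "(f has_real_derivative D) (at x) \<Longrightarrow> ((\<lambda>s. f (x + s)) has_real_derivative D) (at 0)"
  using DERIV_shift[of f D 0 x] by (simp add: add.commute)

text \<open>The densities in the energies are defined by velocity integrals, whose derivatives are
  known only as members of a family. Agreement on the open set J lets iterated \<open>pd\<close> be
  computed from that family, first in x and then in z.\<close>

lemma mac_family_pd:
  assumes F: "mac_family N J F" and J: "open J" and t: "0 \<le> t" and f: "\<And>x z. z \<in> J \<Longrightarrow> f (x, z) = F 0 0 0 t x z"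
    and N: "l + i \<le> N" and z: "z \<in> J"
  shows "(pd ez2 ^^ l) ((pd ex2 ^^ i) f) (x, z) = F 0 l i t x z"
proof -
  have U: "open ((UNIV :: real set) \<times> J)" using J by (intro open_Times) auto
  have x: "(pd ex2 ^^ i) f p = (\<lambda>(x, z). F 0 0 i t x z) p" if "p \<in> UNIV \<times> J" for p
  proof (rule pd_iterate[OF U, of i "\<lambda>i (x, z). F 0 0 i t x z"])
    fix n p assume n: "n < i" "p \<in> (UNIV :: real set) \<times> J"
    then obtain x z where p: "p = (x, z)" "z \<in> J" by (cases p) auto
    show "((\<lambda>s. case p + s *\<^sub>R ex2 of (x, z) \<Rightarrow> F 0 0 n t x z) has_real_derivative (case p of (x, z) \<Rightarrow> F 0 0 (Suc n) t x z)) (at 0)"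
      using shift_DERIV[OF mac_family_DERIV(3)[OF F _ t p(2), of 0 0 n x]] n N by (simp add: p)
  qed (use f that in auto)
  have "(pd ez2 ^^ l) ((pd ex2 ^^ i) f) (x, z) = (\<lambda>(x, z). F 0 l i t x z) (x, z)"
  proof (rule pd_iterate[OF U, of l "\<lambda>l (x, z). F 0 l i t x z"])
    fix n p assume n: "n < l" "p \<in> (UNIV :: real set) \<times> J"
    then obtain x z where p: "p = (x, z)" "z \<in> J" by (cases p) auto
    show "((\<lambda>s. case p + s *\<^sub>R ez2 of (x, z) \<Rightarrow> F 0 n i t x z) has_real_derivative (case p of (x, z) \<Rightarrow> F 0 (Suc n) i t x z)) (at 0)"
      using shift_DERIV[OF mac_family_DERIV(2)[OF F _ t p(2), of 0 n i x]] n N by (simp add: p)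
  qed (use x z in auto)
  then show ?thesis by simp
qed

lemma micro_pd:
  fixes W :: "nat \<Rightarrow> nat \<Rightarrow> real \<Rightarrow> real \<Rightarrow> real \<Rightarrow> real"
  assumes J: "open J" and f: "\<And>x v z. z \<in> J \<Longrightarrow> f (x, v, z) = W 0 0 x v z"
    and D: "\<And>l i x v z. l + i < N \<Longrightarrow> z \<in> J \<Longrightarrow> ((\<lambda>x. W l i x v z) has_real_derivative W l (Suc i) x v z) (at x)"
      "\<And>l i x v z. l + i < N \<Longrightarrow> z \<in> J \<Longrightarrow> ((\<lambda>z. W l i x v z) has_real_derivative W (Suc l) i x v z) (at z)"
    and N: "l + i \<le> N" and z: "z \<in> J"
  shows "(pd ez3 ^^ l) ((pd ex3 ^^ i) f) (x, v, z) = W l i x v z"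
proof -
  have U: "open ((UNIV :: real set) \<times> (UNIV :: real set) \<times> J)" using J by (intro open_Times) auto
  have x: "(pd ex3 ^^ i) f p = (\<lambda>(x, v, z). W 0 i x v z) p" if "p \<in> UNIV \<times> UNIV \<times> J" for p
  proof (rule pd_iterate[OF U, of i "\<lambda>i (x, v, z). W 0 i x v z"])
    fix n p assume n: "n < i" "p \<in> (UNIV :: real set) \<times> (UNIV :: real set) \<times> J"
    then obtain x v z where p: "p = (x, v, z)" "z \<in> J" by (cases p) auto
    show "((\<lambda>s. case p + s *\<^sub>R ex3 of (x, v, z) \<Rightarrow> W 0 n x v z) has_real_derivative (case p of (x, v, z) \<Rightarrow> W 0 (Suc n) x v z)) (at 0)"
      using shift_DERIV[OF D(1)[OF _ p(2), of 0 n v x]] n N by (simp add: p)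
  qed (use f that in auto)
  have "(pd ez3 ^^ l) ((pd ex3 ^^ i) f) (x, v, z) = (\<lambda>(x, v, z). W l i x v z) (x, v, z)"
  proof (rule pd_iterate[OF U, of l "\<lambda>l (x, v, z). W l i x v z"])
    fix n p assume n: "n < l" "p \<in> (UNIV :: real set) \<times> (UNIV :: real set) \<times> J"
    then obtain x v z where p: "p = (x, v, z)" "z \<in> J" by (cases p) auto
    show "((\<lambda>s. case p + s *\<^sub>R ez3 of (x, v, z) \<Rightarrow> W n i x v z) has_real_derivative (case p of (x, v, z) \<Rightarrow> W (Suc n) i x v z)) (at 0)"
      using shift_DERIV[OF D(2)[OF _ p(2), of n i x v]] n N by (simp add: p)
  qed (use x z in auto)
  then show ?thesis by simp
qed

lemma sob_norm_power2: "(sob_norm M e m g)\<^sup>2 = (\<Sum>l\<le>m. LINT p|M. ((pd e ^^ l) g p)\<^sup>2)"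
  by (simp add: sob_norm_def l2_norm_def l2_inner_def power2_eq_square[symmetric] sum_nonneg)

lemma sigma_of_moment: "sigma_of (h t) (x, z) = moment sqrtM (kin_derivs h) 0 0 0 t x z"
  and u_of_moment: "u_of (h t) (x, z) = moment (\<lambda>v. v * sqrtM v) (kin_derivs h) 0 0 0 t x z"
  by (simp_all add: sigma_of_def u_of_def moment_def sqrtM_def kin_derivs_def mult.assoc)

context zspace begin

lemma LINT_mu2_cong: "(\<And>x z. z \<in> I \<Longrightarrow> f (x, z) = g x z) \<Longrightarrow> (LINT p|mu2 P. f p) = I2 g"
  unfolding I2_def by (rule Bochner_Integration.integral_cong) (auto simp: mu2_def space_pair_measure)

lemma LINT_mu3_cong: "(\<And>x v z. z \<in> I \<Longrightarrow> f (x, v, z) = g x v z) \<Longrightarrow>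
    (LINT p|mu3 P. f p) = (LINT p|mu3 P. (case p of (x, v, z) \<Rightarrow> g x v z))"
  by (rule Bochner_Integration.integral_cong) (auto simp: mu3_def space_pair_measure)

lemma sum_sob_norm_mac:
  assumes F: "mac_family N J F" and J: "open J" "I \<subseteq> J" and t: "0 \<le> t" and f: "\<And>x z. z \<in> J \<Longrightarrow> f (x, z) = F 0 0 0 t x z"
    and N: "m + 1 \<le> N"
  shows "(\<Sum>i\<le>1. (sob_norm (mu2 P) ez2 m ((pd ex2 ^^ i) f))\<^sup>2) = (\<Sum>l\<le>m. \<Sum>i\<le>1. I2 (\<lambda>x z. (F 0 l i t x z)\<^sup>2))"
proof -
  have "(LINT p|mu2 P. ((pd ez2 ^^ l) ((pd ex2 ^^ i) f) p)\<^sup>2) = I2 (\<lambda>x z. (F 0 l i t x z)\<^sup>2)" if "l \<le> m" "i \<le> 1" for l i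
    by (rule LINT_mu2_cong, subst mac_family_pd[OF F J(1) t f]) (use that N J(2) in auto)
  then show ?thesis
    unfolding sob_norm_power2 by (subst sum.swap) (intro sum.cong refl, auto)
qed

end

section \<open>The stated energies and their time derivatives\<close>

context vfp begin

text \<open>The projection commutes with derivatives in x and z, since its coefficients are moments.
  The differentiated microscopic part is therefore the microscopic part of the differentiated h, to
  which \<open>micro_bounds\<close> refers.\<close>

lemma D_h_eq:
  assumes h: "H = kin_derivs h" and t: "0 \<le> t"
  shows "D_h P m (h t) = DG t"
proof -
  define W where "W l i x v z = H 0 0 l i t x v z - S 0 l i t x z * sqrtM v - U 0 l i t x z * (v * sqrtM v)" for l i x v z
  have f: "micro_part (h t) (x, v, z) = W 0 0 x v z" for x v z
    unfolding micro_part_def fluid_proj_def W_def h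
    by (simp add: sigma_of_moment u_of_moment sqrtM_def kin_derivs_slice mult.assoc)
  have D: "((\<lambda>x. W l i x v z) has_real_derivative W l (Suc i) x v z) (at x)"
    "((\<lambda>z. W l i x v z) has_real_derivative W (Suc l) i x v z) (at z)" if "l + i < m + 3" "z \<in> J" for l i x v z
    unfolding W_def
    using that kin_family_DERIV(3,4)[OF H _ t that(2), of 0 0 l i] mac_family_DERIV(2,3)[OF S _ t that(2), of 0 l i]
      mac_family_DERIV(2,3)[OF U _ t that(2), of 0 l i]
    by (auto intro!: DERIV_diff DERIV_cmult_right)
  have pd: "(pd ez3 ^^ l) ((pd ex3 ^^ i) (micro_part (h t))) (x, v, z) = W l i x v z" if "l \<le> m" "i \<le> 1" "z \<in> J" for l i x v z
    by (rule micro_pd[OF J(1) f D]) (use that in auto)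
  have n: "(nu_norm P ((pd ez3 ^^ l) ((pd ex3 ^^ i) (micro_part (h t)))))\<^sup>2 = I2 (G l i t)" if li: "l \<le> m" "i \<le> 1" for l i
  proof -
    let ?g = "(pd ez3 ^^ l) ((pd ex3 ^^ i) (micro_part (h t)))"
    let ?g' = "\<lambda>x v z. H 0 1 l i t x v z + S 0 l i t x z * (v / 2 * sqrtM v) - U 0 l i t x z * (sqrtM v - v\<^sup>2 / 2 * sqrtM v)"
    have v: "pd ev3 ?g (x, v, z) = ?g' x v z" if z: "z \<in> I" for x v z
    proof -
      have "pd ev3 ?g (x, v, z) = pd ev3 (\<lambda>(x, v, z). W l i x v z) (x, v, z)"
        by (rule pd_cong_open[of "UNIV \<times> UNIV \<times> J"]) (use J inJ[OF z] pd[OF li] in \<open>auto intro!: open_Times\<close>)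
      also have "\<dots> = ?g' x v z"
        unfolding pd_def
        by (rule DERIV_imp_deriv) (use shift_DERIV[OF micro(4)[OF li t z, of x v]] in \<open>simp add: W_def\<close>)
      finally show ?thesis .
    qed
    have "(LINT p|mu3 P. (case p of (x, v, z) \<Rightarrow> (1 + v\<^sup>2) * (?g (x, v, z))\<^sup>2 + (pd ev3 ?g (x, v, z))\<^sup>2)) = I2 (G l i t)"
      unfolding I2_G[OF li t]
      by (rule LINT_mu3_cong) (simp only: prod.case v pd[OF li inJ] W_def)
    moreover have "0 \<le> I2 (G l i t)"
      by (rule I2_nonneg) (simp add: G_def)
    ultimately show ?thesis unfolding nu_norm_def by simp
  qed
  show ?thesis
    unfolding D_h_def DG_def by (subst sum.swap, intro sum.cong refl, rule n) auto
qed

lemma E_h_eq: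
  assumes h: "H = kin_derivs h" and t: "0 \<le> t"
  shows "E_h P m (h t) = EH t"
proof -
  have "(LINT p|mu3 P. ((pd ez3 ^^ l) ((pd ex3 ^^ i) (h t)) p)\<^sup>2) = I2 (E l i t)" if "l \<le> m" "i \<le> 1" for l i
    unfolding I2_E[OF that t] by (rule LINT_mu3_cong) (simp add: h kin_derivs_slice)
  then show ?thesis
    unfolding E_h_def EH_def sob_norm_power2 by (subst sum.swap) (intro sum.cong refl, auto)
qed

lemma macro_eq:
  assumes h: "H = kin_derivs h" and F': "F = mac_derivs (\<lambda>t. pd ex2 (\<phi> t))" and t: "0 \<le> t"
  shows "E_phi P m (\<phi> t) = EF t" "D_phi P m (\<phi> t) = EF t" "D_u P m (h t) = DU t" "D_sigma P m (h t) = DS t"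
proof -
  show E: "E_phi P m (\<phi> t) = EF t"
    unfolding E_phi_def EF_def
    by (rule sum_sob_norm_mac[OF F J t]) (simp_all add: F' mac_derivs_slice)
  then show "D_phi P m (\<phi> t) = EF t" by (simp add: D_phi_def E_phi_def)
  show "D_u P m (h t) = DU t"
    unfolding D_u_def DU_def by (rule sum_sob_norm_mac[OF U J t]) (simp_all add: u_of_moment h)
  show "D_sigma P m (h t) = DS t"
    unfolding D_sigma_def DS_def by (rule sum_sob_norm_mac[OF S J t]) (simp_all add: sigma_of_moment h)
qed

text \<open>The two sums are the terms i = 0 and i = 1 of a single double sum, since the second
  x-derivative of \<phi> is the first of the field.\<close>

lemma cross_eq:
  assumes h: "H = kin_derivs h" and F': "F = mac_derivs (\<lambda>t. pd ex2 (\<phi> t))" and t: "0 \<le> t"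
  shows "(\<Sum>l\<le>m. l2_inner (mu2 P) ((pd ez2 ^^ l) (u_of (h t))) ((pd ez2 ^^ l) (pd ex2 (\<phi> t))))
        + (\<Sum>l\<le>m. l2_inner (mu2 P) ((pd ez2 ^^ l) (pd ex2 (u_of (h t)))) ((pd ez2 ^^ l) ((pd ex2 ^^ 2) (\<phi> t))))
      = (\<Sum>l\<le>m. \<Sum>i\<le>1. I2 (\<lambda>x z. U 0 l i t x z * F 0 l i t x z))"
proof -
  have u: "(pd ez2 ^^ l) ((pd ex2 ^^ i) (u_of (h t))) (x, z) = U 0 l i t x z" if "l \<le> m" "i \<le> 1" "z \<in> I" for l i x z
    by (rule mac_family_pd[OF U J(1) t]) (use that J(2) in \<open>auto simp: u_of_moment h\<close>)
  have f: "(pd ez2 ^^ l) ((pd ex2 ^^ i) (pd ex2 (\<phi> t))) (x, z) = F 0 l i t x z" for l i x z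
    by (simp add: F' mac_derivs_slice)
  have "l2_inner (mu2 P) ((pd ez2 ^^ l) ((pd ex2 ^^ i) (u_of (h t)))) ((pd ez2 ^^ l) ((pd ex2 ^^ i) (pd ex2 (\<phi> t))))
      = I2 (\<lambda>x z. U 0 l i t x z * F 0 l i t x z)" if "l \<le> m" "i \<le> 1" for l i
    unfolding l2_inner_def by (rule LINT_mu2_cong) (simp only: u[OF that] f)
  from this[of _ 0] this[of _ 1] show ?thesis
    by (simp add: sum.distrib numeral_2_eq_2)
qed

lemma EH_has_derivative:
  assumes "0 \<le> t" shows "(EH has_real_derivative (\<Sum>l\<le>m. \<Sum>i\<le>1. 2 * I2 (E' l i t))) (at t within {0..})"
  unfolding EH_def[abs_def] by (intro DERIV_sum E_has_derivative) (use assms in auto)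

lemma EF_has_derivative:
  assumes "0 \<le> t"
  shows "(EF has_real_derivative (\<Sum>l\<le>m. \<Sum>i\<le>1. 2 * I2 (\<lambda>x z. F 1 l i t x z * F 0 l i t x z))) (at t within {0..})"
proof -
  have "((\<lambda>s. I2 (\<lambda>x z. (F 0 l i s x z)\<^sup>2)) has_real_derivative 2 * I2 (\<lambda>x z. F 1 l i t x z * F 0 l i t x z)) (at t within {0..})"
    if "l \<le> m" "i \<le> 1" for l i
    using I2_has_derivative[OF F F, of l i l i t] that assms by (simp add: power2_eq_square mult.commute)
  then show ?thesis unfolding EF_def[abs_def] by (intro DERIV_sum) auto
qed

lemma cross_has_derivative:
  assumes "0 \<le> t"
  shows "((\<lambda>s. \<Sum>l\<le>m. \<Sum>i\<le>1. I2 (\<lambda>x z. U 0 l i s x z * F 0 l i s x z)) has_real_derivative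
    (\<Sum>l\<le>m. \<Sum>i\<le>1. I2 (\<lambda>x z. U 1 l i t x z * F 0 l i t x z) + I2 (\<lambda>x z. U 0 l i t x z * F 1 l i t x z))) (at t within {0..})"
  by (intro DERIV_sum I2_has_derivative[OF U F]) (use assms in auto)

end

theorem lemma3p2:
  fixes \<epsilon> \<delta> a C\<^sub>1 :: real and m :: nat
    and I :: "real set" and \<rho> :: "real \<Rightarrow> real"
    and h :: "real \<Rightarrow> real \<times> real \<times> real \<Rightarrow> real"
    and \<phi> :: "real \<Rightarrow> real \<times> real \<Rightarrow> real"
    and P :: "real measure"
  assumes eps: "0 < \<epsilon>" "\<epsilon> < 1" and delta: "0 < \<delta>"
    and density: "is_prob_density_on I \<rho>" and law: "P = zlaw I \<rho>"
    and sobolev: "1 \<le> C\<^sub>1" "sobolev_constant I P C\<^sub>1"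
    and m: "1 \<le> m" and a: "0 < a"
    and regular: "regular_pair m I h \<phi>"
    and kinetic: "\<And>t x v z. 0 \<le> t \<Longrightarrow> z \<in> I \<Longrightarrow>
      \<epsilon> * \<delta> * deriv (\<lambda>s. h s (x, v, z)) t + \<epsilon> * v * pd ex3 (h t) (x, v, z)
        - \<delta> * pd ex2 (\<phi> t) (x, z) * pd ev3 (h t) (x, v, z)
        + \<delta> * (v / 2) * pd ex2 (\<phi> t) (x, z) * h t (x, v, z)
        + \<delta> * v * sqrt (Maxw v) * pd ex2 (\<phi> t) (x, z)
      = FP_op (\<lambda>w. h t (x, w, z)) v"
    and poisson: "\<And>t x z. 0 \<le> t \<Longrightarrow> z \<in> I \<Longrightarrow>
      (pd ex2 ^^ 2) (\<phi> t) (x, z) = - sigma_of (h t) (x, z)"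
  shows "\<forall>t\<ge>0.
    (\<exists>d. ((\<lambda>s. E_h P m (h s) + \<delta> / \<epsilon> * E_phi P m (\<phi> s)) has_real_derivative d) (at t within {0..}) \<and>
      1 / 2 * d + lambda0 / (\<delta> * \<epsilon>) * D_h P m (h t) + 1 / (\<delta> * \<epsilon>) * D_u P m (h t)
      \<le> A_const m * C\<^sub>1\<^sup>2 / (a * \<epsilon>) * sqrt (E_h P m (h t)) * (3 * D_u P m (h t) + 2 * D_h P m (h t))
        + 2 * A_const m * C\<^sub>1\<^sup>2 / \<epsilon> * sqrt (E_phi P m (\<phi> t))
            * ((4 + 1 / a) * D_u P m (h t) + 4 * D_h P m (h t))
        + a * A_const m * C\<^sub>1\<^sup>2 / \<epsilon> * sqrt (E_h P m (h t)) * D_phi P m (\<phi> t)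
        + a * A_const m * C\<^sub>1\<^sup>2 / \<epsilon> * sqrt (E_phi P m (\<phi> t)) * D_sigma P m (h t)) \<and>
    (\<exists>d. ((\<lambda>s.
          (\<Sum>l\<le>m. l2_inner (mu2 P) ((pd ez2 ^^ l) (u_of (h s))) ((pd ez2 ^^ l) (pd ex2 (\<phi> s))))
        + (\<Sum>l\<le>m. l2_inner (mu2 P) ((pd ez2 ^^ l) (pd ex2 (u_of (h s))))
                                       ((pd ez2 ^^ l) ((pd ex2 ^^ 2) (\<phi> s))))
        + 1 / (2 * \<epsilon>) * E_phi P m (\<phi> s)) has_real_derivative d) (at t within {0..}) \<and>
      d + 1 / (2 * \<delta>) * D_sigma P m (h t) + 1 / \<epsilon> * D_phi P m (\<phi> t)
      \<le> 1 / \<delta> * D_u P m (h t) + 1 / (2 * \<delta>) * D_h P m (h t)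
        + A_const m * C\<^sub>1\<^sup>2 / \<epsilon> * sqrt (E_phi P m (\<phi> t))
            * (3 * D_sigma P m (h t) + 2 * D_phi P m (\<phi> t)))"
proof (intro allI impI, goal_cases)
  case (1 t)
  note t = this
  have emb: "z_embedding I P C\<^sub>1" using sobolev(2) by (rule sobolev_constant_imp_z_embedding)
  obtain J where J: "open J" "I \<subseteq> J" and H: "kin_family (m + 3) J (kin_derivs h)"
    and F: "mac_family (m + 2) J (mac_derivs (\<lambda>t. pd ex2 (\<phi> t)))"
    using regular by (rule regular_pair_families)
  let ?H = "kin_derivs h" and ?F = "mac_derivs (\<lambda>t. pd ex2 (\<phi> t))"
  have "prob_space P" using density law by (simp add: is_prob_density_on_def)
  then interpret zspace P I
    by (intro zspace.intro zspace_axioms.intro) (simp_all add: law)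
  interpret vfp P I J ?H ?F \<epsilon> \<delta> C\<^sub>1 m
  proof unfold_locales
    show "z islimpt I" if "z \<in> I" for z
      by (rule z_embedding_imp_islimpt[OF emb density law that])
    fix t x v z :: real assume t: "0 \<le> t" and z: "z \<in> I"
    have zJ: "z \<in> J" using J z by auto
    have "FP_op (\<lambda>w. h t (x, w, z)) v = ?H 0 2 0 0 t x v z + (1 / 2 - v\<^sup>2 / 4) * ?H 0 0 0 0 t x v z"
    proof -
      have D: "((\<lambda>v. ?H 0 0 0 0 t x v z) has_real_derivative ?H 0 1 0 0 t x v z) (at v)"
        "((\<lambda>v. ?H 0 1 0 0 t x v z) has_real_derivative ?H 0 2 0 0 t x v z) (at v)" for v
        using kin_family_DERIV(2)[OF H _ t zJ, of 0 0 0 0 x v] kin_family_DERIV(2)[OF H _ t zJ, of 0 1 0 0 x v]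
        by (simp_all add: numeral_2_eq_2)
      have "(\<lambda>w. h t (x, w, z)) = (\<lambda>v. ?H 0 0 0 0 t x v z)" by (simp add: kin_derivs_slice)
      then show ?thesis using FP_op_eq[OF D, of v] by simp
    qed
    with kinetic[OF t z, of x v]
    show "\<epsilon> * \<delta> * ?H 1 0 0 0 t x v z + \<epsilon> * v * ?H 0 0 0 1 t x v z
        - \<delta> * ?F 0 0 0 t x z * (?H 0 1 0 0 t x v z - v / 2 * ?H 0 0 0 0 t x v z)
        + \<delta> * v * sqrtM v * ?F 0 0 0 t x z
      = ?H 0 2 0 0 t x v z + (1 / 2 - v\<^sup>2 / 4) * ?H 0 0 0 0 t x v z"
      unfolding kin_derivs_time kin_derivs_v kin_derivs_slice mac_derivs_slice sqrtM_def
      by (simp add: algebra_simps)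
    show "?F 0 0 1 t x z = - moment sqrtM ?H 0 0 0 t x z"
      using poisson[OF t z, of x] by (simp add: mac_derivs_slice sigma_of_moment numeral_2_eq_2)
  qed (use J H F emb sobolev m eps delta in auto)
  note eqs = E_h_eq[OF refl] macro_eq[OF refl refl] D_h_eq[OF refl] cross_eq[OF refl refl]
  \<comment> \<open>The energies agree with their family versions for nonnegative times only, so
    derivatives are transferred within \<open>{0..}\<close>.\<close>
  have tr: "(f has_real_derivative d) (at t within {0..})"
    if "(g has_real_derivative d) (at t within {0..})" "\<And>s. 0 \<le> s \<Longrightarrow> f s = g s" for f g d
    by (rule has_field_derivative_transform_within[OF that(1), where d=1]) (use t that(2) in auto)
  let ?e = "\<Sum>l\<le>m. \<Sum>i\<le>1. I2 (E' l i t)" and ?f = "\<Sum>l\<le>m. \<Sum>i\<le>1. I2 (\<lambda>x z. ?F 1 l i t x z * ?F 0 l i t x z)"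
  let ?c = "\<Sum>l\<le>m. \<Sum>i\<le>1. I2 (\<lambda>x z. U 1 l i t x z * ?F 0 l i t x z) + I2 (\<lambda>x z. U 0 l i t x z * ?F 1 l i t x z)"
  have EH': "(EH has_real_derivative 2 * ?e) (at t within {0..})" and EF': "(EF has_real_derivative 2 * ?f) (at t within {0..})"
    using EH_has_derivative[OF t] EF_has_derivative[OF t] by (simp_all only: sum_distrib_left)
  have d1: "((\<lambda>s. E_h P m (h s) + \<delta> / \<epsilon> * E_phi P m (\<phi> s)) has_real_derivative 2 * ?e + \<delta> / \<epsilon> * (2 * ?f)) (at t within {0..})"
    by (rule tr[OF DERIV_add[OF EH' DERIV_cmult[OF EF']]]) (simp add: eqs)
  have d2: "((\<lambda>s. (\<Sum>l\<le>m. l2_inner (mu2 P) ((pd ez2 ^^ l) (u_of (h s))) ((pd ez2 ^^ l) (pd ex2 (\<phi> s))))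
        + (\<Sum>l\<le>m. l2_inner (mu2 P) ((pd ez2 ^^ l) (pd ex2 (u_of (h s)))) ((pd ez2 ^^ l) ((pd ex2 ^^ 2) (\<phi> s))))
        + 1 / (2 * \<epsilon>) * E_phi P m (\<phi> s)) has_real_derivative ?c + 1 / (2 * \<epsilon>) * (2 * ?f)) (at t within {0..})"
    by (rule tr[OF DERIV_add[OF cross_has_derivative[OF t] DERIV_cmult[OF EF']]]) (simp only: eqs)
  have "1 / 2 * (2 * ?e + \<delta> / \<epsilon> * (2 * ?f)) = (\<Sum>l\<le>m. \<Sum>i\<le>1. I2 (E' l i t) + \<delta> / \<epsilon> * I2 (\<lambda>x z. ?F 1 l i t x z * ?F 0 l i t x z))"
    by (simp only: sum.distrib sum_distrib_left[symmetric]) simp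
  \<comment> \<open>The terms of the right-hand side with the root of the field energy are
    nonnegative and are added to the bound from \<open>first_inequality\<close>.\<close>
  moreover have "0 \<le> 2 * A_const m * C\<^sub>1\<^sup>2 / \<epsilon> * sqrt (EF t) * ((4 + 1 / a) * DU t + 4 * DG t)"
    "0 \<le> a * A_const m * C\<^sub>1\<^sup>2 / \<epsilon> * sqrt (EF t) * DS t"
    using a eps A_const_nonneg nonneg[of t] DG_nonneg[of t] by simp_all
  ultimately have i1: "1 / 2 * (2 * ?e + \<delta> / \<epsilon> * (2 * ?f)) + lambda0 / (\<delta> * \<epsilon>) * DG t + 1 / (\<delta> * \<epsilon>) * DU t
      \<le> A_const m * C\<^sub>1\<^sup>2 / (a * \<epsilon>) * sqrt (EH t) * (3 * DU t + 2 * DG t)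
        + 2 * A_const m * C\<^sub>1\<^sup>2 / \<epsilon> * sqrt (EF t) * ((4 + 1 / a) * DU t + 4 * DG t)
        + a * A_const m * C\<^sub>1\<^sup>2 / \<epsilon> * sqrt (EH t) * EF t
        + a * A_const m * C\<^sub>1\<^sup>2 / \<epsilon> * sqrt (EF t) * DS t"
    using first_inequality[OF t a] unfolding lambda0_def by linarith
  have "?c + 1 / (2 * \<epsilon>) * (2 * ?f) = (\<Sum>l\<le>m. \<Sum>i\<le>1. I2 (\<lambda>x z. U 1 l i t x z * ?F 0 l i t x z)
      + I2 (\<lambda>x z. U 0 l i t x z * ?F 1 l i t x z) + 1 / \<epsilon> * I2 (\<lambda>x z. ?F 1 l i t x z * ?F 0 l i t x z))"
    by (simp only: sum.distrib sum_distrib_left[symmetric])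
  then have i2: "?c + 1 / (2 * \<epsilon>) * (2 * ?f) + 1 / (2 * \<delta>) * DS t + 1 / \<epsilon> * EF t
      \<le> 1 / \<delta> * DU t + 1 / (2 * \<delta>) * DG t + A_const m * C\<^sub>1\<^sup>2 / \<epsilon> * sqrt (EF t) * (3 * DS t + 2 * EF t)"
    using second_inequality[OF t] by simp
  show ?case
    by (intro conjI exI[of _ "2 * ?e + \<delta> / \<epsilon> * (2 * ?f)"] exI[of _ "?c + 1 / (2 * \<epsilon>) * (2 * ?f)"] d1 d2)
       (use i1 i2 in \<open>simp_all only: eqs t\<close>)
qed

end
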